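(* Let $A$ and $f$ satisfy the standing assumptions listed in the context. Assume in addition that for every $x\in\mathbb{R}^n$ the function $s\mapsto f(x,s)/s$ is decreasing in $s>0$; that there is a constant $M>0$ with $f(x,s)\le 0$ for all $x\in\mathbb{R}^n$ and $s\ge M$; that $\mu_1>0$; and that $\bar\mu_1<0$. Let $c\ge c^*$, let $w(x,x_1+ct)$ be a spatially periodic traveling wavefront with speed $c$, and let $\lambda\in[\lambda_1(c),\lambda_2(c)]$. Then there is $\bar\varepsilon_0>0$ such that the following holds for every $\bar\varepsilon\in(0,\bar\varepsilon_0)$ and every $\xi_0\in\mathbb{R}$ with $|w(x,\xi)-p(x)|<\bar\varepsilon$ for all $\xi\ge\xi_0$ and $x\in\mathbb{R}^n$. Let $W$ be the weight function $$W(\xi)=e^{-\lambda(\xi-\xi_0)}\ \ (\xi\le\xi_0),\qquad W(\xi)=1\ \ (\xi>\xi_0).$$ Let $u_0:\mathbb{R}^n\to\mathbb{R}$ have at most finitely many points of discontinuity and satisfy $0\le u_0(x)\le p(x)$ for all $x\in\mathbb{R}^n$ and $$W(x_1)\,\bigl(u_0(x)-w(x,x_1)\bigr)\in L^1(\mathbb{R}^n),$$ and let $u(t,x)$ be the solution of $u_t-\nabla\cdot(A(x)\nabla u)=f(x,u)$ with $u(0,x)=u_0(x)$. Then there is a constant $C>0$, independent of $t$ and $x$, such that for all $t\ge 0$ and $x\in\mathbb{R}^n$: (1) if $x_1+ct\le\xi_0$, then $$|u(t,x)-w(x,x_1+ct)|<C(1+t)^{-\frac n2}e^{-\mu_c(\lambda)t};$$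 (2) if $x_1+ct\ge\xi_0$, then $$|u(t,x)-w(x,x_1+ct)|<C(1+t)^{-\frac n2}e^{-\min\{\mu_c(\lambda),\,-\bar\mu_1/2\}\,t}.$$
   Context: Setting. $n\ge1$, $x=(x_1,\dots,x_n)\in\mathbb{R}^n$, $\mathbf e_i$ is the $i$-th standard basis vector, $\mathbf e=\mathbf e_1=(1,0,\dots,0)$, and $L_1,\dots,L_n>0$ are fixed. A function $h$ of $x$ is called $L$-periodic if $h(x+L_i\mathbf e_i)=h(x)$ for all $x$ and $1\le i\le n$. The equation is $$u_t-\nabla\cdot(A(x)\nabla u)=f(x,u),\qquad x\in\mathbb{R}^n.\qquad( * )$$ Standing assumptions. $A(x)=(a_{i,j}(x))$ is a bounded symmetric matrix field, $L$-periodic in $x$, of class $C^{1,\alpha}(\mathbb{R}^n)$ for some $\alpha\in(0,1)$, and uniformly elliptic: $\sum_{i,j}a_{i,j}(x)\xi_i\xi_j\ge\alpha_0|\xi|^2$ for all $x,\xi\in\mathbb{R}^n$, with some $\alpha_0>0$. The function $f(x,u)$ is $L$-periodic in $x$, continuous, of class $C^{0,\alpha}$ in $x$ locally uniformly in $u\in\mathbb{R}$; the derivative $f_u=\partial f/\partial u$ exists and is continuous in $u\in\mathbb{R}$ uniformly for $x\in\mathbb{R}^n$; and $f(x,0)=0$ for all $x$. Eigenvalues. A principal eigenvalue (among $L$-periodic functions) is the one having a positive $L$-periodic eigenfunction. $\mu_1$ is the principal eigenvalue of $\phi\mapsto\nabla\cdot(A(x)\nabla\phi)+f_u(x,0)\phi$,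 i.e. $\nabla\cdot(A\nabla\phi)+f_u(x,0)\phi=\mu_1\phi$. When $\mu_1>0$ and $f$ satisfies the conditions of the statement, it is known that there is a unique positive $L$-periodic steady state $p(x)$ of class $C^{2,\alpha}$, i.e. $\nabla\cdot(A\nabla p)+f(x,p)=0$. $\bar\mu_1$ is the principal eigenvalue of $\phi\mapsto\nabla\cdot(A(x)\nabla\phi)+f_u(x,p(x))\phi$. For $c\in\mathbb{R}$ and $\lambda\in\mathbb{R}$, $\mu_c(\lambda)$ is the principal eigenvalue of the operator $-L_{c,\lambda}$ on $L$-periodic functions, i.e. $-L_{c,\lambda}\psi=\mu_c(\lambda)\psi$ with $\psi>0$ $L$-periodic, where $$-L_{c,\lambda}\psi=-\nabla\cdot(A\nabla\psi)-2\lambda\,\mathbf e\cdot(A\nabla\psi)-\bigl[\lambda\nabla\cdot(A\mathbf e)+\lambda^2\,\mathbf e\cdot(A\mathbf e)-\lambda c+f_u(x,0)\bigr]\psi .$$ The minimal speed is $c^*=\min\{c:\ \exists\,\lambda>0\text{ such that }\mu_c(\lambda)=0\}$. It is known that for $c>c^*$ there are $0<\lambda_1(c)<\lambda_2(c)$ with $\mu_c(\lambda_1(c))=\mu_c(\lambda_2(c))=0$ and $\mu_c(\lambda)>0$ for $\lambda\in(\lambda_1(c),\lambda_2(c))$; for $c=c^*$ one has $\mu_{c^*}(\lambda)\le0$, with $\mu_{c^*}(\lambda^* )=0$ for $\lambda^*=\lambda_1(c^* )=\lambda_2(c^* )$. Traveling wavefront. A (spatially periodic) traveling wavefront with speed $c$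 is a nonnegative function $w(x,\xi)$, $(x,\xi)\in\mathbb{R}^n\times\mathbb{R}$, $L$-periodic in $x$, such that $u(t,x)=w(x,x_1+ct)$ solves $( * )$ and $\lim_{\xi\to-\infty}w(x,\xi)=0$, $\lim_{\xi\to\infty}w(x,\xi)=p(x)$ uniformly in $x\in\mathbb{R}^n$. Solutions of the initial value problem for $( * )$ are understood as bounded solutions. *)

theory Defs
  imports "HOL-Analysis.Analysis"
begin

text \<open>Space is \<open>real ^ 'n\<close>. The direction \<open>\<bold>e\<close> of propagation is the unit vector
  \<open>axis k 1\<close> of a distinguished index \<open>k :: 'n\<close> (the index type carries no order, so ``first
  coordinate'' is the name given to that index); thus \<open>x\<^sub>1\<close> is \<open>x $ k\<close>.\<close>

section \<open>Function spaces and differential operators\<close>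

definition periodic :: "real ^ 'n \<Rightarrow> (real ^ 'n \<Rightarrow> 'b) \<Rightarrow> bool" where
  "periodic L h \<longleftrightarrow> (\<forall>x i. h (x + axis i (L $ i)) = h x)"

definition grad :: "(real ^ 'n \<Rightarrow> real) \<Rightarrow> real ^ 'n \<Rightarrow> real ^ 'n" where
  "grad g x = (\<chi> i. frechet_derivative g (at x) (axis i 1))"

definition divergence :: "(real ^ 'n \<Rightarrow> real ^ 'n) \<Rightarrow> real ^ 'n \<Rightarrow> real" where
  "divergence V x = (\<Sum>i\<in>UNIV. grad (\<lambda>y. V y $ i) x $ i)"

definition C1 :: "(real ^ 'n \<Rightarrow> real) \<Rightarrow> bool" where
  "C1 g \<longleftrightarrow> (\<forall>x. g differentiable (at x)) \<and> continuous_on UNIV (grad g)"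

definition C2 :: "(real ^ 'n \<Rightarrow> real) \<Rightarrow> bool" where
  "C2 g \<longleftrightarrow> C1 g \<and> (\<forall>i. C1 (\<lambda>x. grad g x $ i))"

text \<open>The Hoelder condition is global; it is only used for periodic functions, where it
  agrees with the local one (and boundedness is automatic).\<close>

definition holder :: "real \<Rightarrow> (real ^ 'n \<Rightarrow> real) \<Rightarrow> bool" where
  "holder \<alpha> g \<longleftrightarrow> (\<exists>K. \<forall>x y. \<bar>g x - g y\<bar> \<le> K * norm (x - y) powr \<alpha>)"

definition C1_holder :: "real \<Rightarrow> (real ^ 'n \<Rightarrow> real) \<Rightarrow> bool" where
  "C1_holder \<alpha> g \<longleftrightarrow> C1 g \<and> (\<forall>i. holder \<alpha> (\<lambda>x. grad g x $ i))"

definition C2_holder :: "real \<Rightarrow> (real ^ 'n \<Rightarrow> real) \<Rightarrow> bool" where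
  "C2_holder \<alpha> g \<longleftrightarrow> C2 g \<and> (\<forall>i j. holder \<alpha> (\<lambda>x. grad (\<lambda>y. grad g y $ i) x $ j))"

definition div_A_grad :: "(real ^ 'n \<Rightarrow> real ^ 'n ^ 'n) \<Rightarrow> (real ^ 'n \<Rightarrow> real) \<Rightarrow> real ^ 'n \<Rightarrow> real" where
  "div_A_grad A \<phi> x = divergence (\<lambda>y. A y *v grad \<phi> y) x"

definition f_u :: "(real ^ 'n \<Rightarrow> real \<Rightarrow> real) \<Rightarrow> real ^ 'n \<Rightarrow> real \<Rightarrow> real" where
  "f_u f x s = deriv (f x) s"


section \<open>Standing assumptions\<close>

definition diffusion_matrix :: "real ^ 'n \<Rightarrow> real \<Rightarrow> (real ^ 'n \<Rightarrow> real ^ 'n ^ 'n) \<Rightarrow> bool" where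
  "diffusion_matrix L \<alpha> A \<longleftrightarrow>
     bounded (range A) \<and> (\<forall>x. transpose (A x) = A x) \<and> periodic L A \<and>
     (\<forall>i j. C1_holder \<alpha> (\<lambda>x. A x $ i $ j)) \<and>
     (\<exists>\<alpha>\<^sub>0>0. \<forall>x \<xi>. \<alpha>\<^sub>0 * (norm \<xi>)\<^sup>2 \<le> (\<Sum>i\<in>UNIV. \<Sum>j\<in>UNIV. A x $ i $ j * \<xi> $ i * \<xi> $ j))"

definition reaction_term :: "real ^ 'n \<Rightarrow> real \<Rightarrow> (real ^ 'n \<Rightarrow> real \<Rightarrow> real) \<Rightarrow> bool" where
  "reaction_term L \<alpha> f \<longleftrightarrow>
     periodic L f \<and>
     continuous_on UNIV (\<lambda>(x, s). f x s) \<and>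
     (\<forall>R. \<exists>K. \<forall>s x y. \<bar>s\<bar> \<le> R \<longrightarrow> \<bar>f x s - f y s\<bar> \<le> K * norm (x - y) powr \<alpha>) \<and>
     (\<forall>x s. f x field_differentiable (at s)) \<and>
     (\<forall>s. \<forall>\<epsilon>>0. \<exists>\<delta>>0. \<forall>r. \<bar>r - s\<bar> < \<delta> \<longrightarrow> (\<forall>x. \<bar>f_u f x r - f_u f x s\<bar> < \<epsilon>)) \<and>
     (\<forall>x. f x 0 = 0)"


section \<open>Principal eigenvalues\<close>

text \<open>The zeroth order coefficients \<open>f\<^sub>u(x,0)\<close> and \<open>f\<^sub>u(x,p(x))\<close> are continuous in \<open>x\<close>, but the
  standing assumptions do not make them Hoelder continuous, so eigenfunctions lie in \<open>W\<^sup>2\<^sup>,\<^sup>q\<close> for all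
  finite \<open>q\<close>, hence in \<open>C\<^sup>1\<close>, but need not be \<open>C\<^sup>2\<close>. Therefore the outer divergence in
  \<open>\<nabla>\<cdot>(A\<nabla>\<phi>)\<close> is taken in the sense of distributions; for \<open>C\<^sup>2\<close> functions \<open>\<phi>\<close> it is the
  classical one.\<close>

definition test_function :: "(real ^ 'n \<Rightarrow> real) \<Rightarrow> bool" where
  "test_function \<eta> \<longleftrightarrow> C1 \<eta> \<and> bounded {x. \<eta> x \<noteq> 0}"

definition has_weak_divergence :: "(real ^ 'n \<Rightarrow> real ^ 'n) \<Rightarrow> (real ^ 'n \<Rightarrow> real) \<Rightarrow> bool" where
  "has_weak_divergence V D \<longleftrightarrow> continuous_on UNIV V \<and> continuous_on UNIV D \<and>
     (\<forall>\<eta>. test_function \<eta> \<longrightarrow>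
        (LINT x|lborel. V x \<bullet> grad \<eta> x) = - (LINT x|lborel. D x * \<eta> x))"

definition principal_eigenvalue ::
  "real ^ 'n \<Rightarrow> (real ^ 'n \<Rightarrow> real ^ 'n ^ 'n) \<Rightarrow> (real ^ 'n \<Rightarrow> real) \<Rightarrow> real \<Rightarrow> bool" where
  "principal_eigenvalue L A q \<mu> \<longleftrightarrow>
     (\<exists>\<phi> D. C1 \<phi> \<and> periodic L \<phi> \<and> (\<forall>x. \<phi> x > 0) \<and>
        has_weak_divergence (\<lambda>x. A x *v grad \<phi> x) D \<and>
        (\<forall>x. D x + q x * \<phi> x = \<mu> * \<phi> x))"

definition principal_eigenvalue_L ::
  "real ^ 'n \<Rightarrow> (real ^ 'n \<Rightarrow> real ^ 'n ^ 'n) \<Rightarrow> (real ^ 'n \<Rightarrow> real \<Rightarrow> real) \<Rightarrow> 'n \<Rightarrow>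
   real \<Rightarrow> real \<Rightarrow> real \<Rightarrow> bool" where
  "principal_eigenvalue_L L A f k c l \<mu> \<longleftrightarrow>
     (let e = axis k 1 in
      \<exists>\<psi> D. C1 \<psi> \<and> periodic L \<psi> \<and> (\<forall>x. \<psi> x > 0) \<and>
        has_weak_divergence (\<lambda>x. A x *v grad \<psi> x) D \<and>
        (\<forall>x. - D x - 2 * l * (e \<bullet> (A x *v grad \<psi> x))
              - (l * divergence (\<lambda>y. A y *v e) x + l\<^sup>2 * (e \<bullet> (A x *v e)) - l * c + f_u f x 0) * \<psi> x
             = \<mu> * \<psi> x))"

text \<open>In the next two definitions \<open>\<mu> c l\<close> stands for \<open>\<mu>\<^sub>c(l)\<close>.\<close>

definition minimal_speed :: "(real \<Rightarrow> real \<Rightarrow> real) \<Rightarrow> real \<Rightarrow> bool" where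
  "minimal_speed \<mu> cs \<longleftrightarrow>
     cs \<in> {c. \<exists>l>0. \<mu> c l = 0} \<and> (\<forall>c \<in> {c. \<exists>l>0. \<mu> c l = 0}. cs \<le> c)"

text \<open>\<open>l\<^sub>1 = \<lambda>\<^sub>1(c)\<close> and \<open>l\<^sub>2 = \<lambda>\<^sub>2(c)\<close>. Since \<open>\<mu>\<^sub>c\<close> is strictly concave, these conditions determine
  both numbers.\<close>

definition decay_rates :: "(real \<Rightarrow> real \<Rightarrow> real) \<Rightarrow> real \<Rightarrow> real \<Rightarrow> real \<Rightarrow> real \<Rightarrow> bool" where
  "decay_rates \<mu> cs c l\<^sub>1 l\<^sub>2 \<longleftrightarrow> 0 < l\<^sub>1 \<and> \<mu> c l\<^sub>1 = 0 \<and> \<mu> c l\<^sub>2 = 0 \<and>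
     (if c > cs then l\<^sub>1 < l\<^sub>2 \<and> (\<forall>l. l\<^sub>1 < l \<and> l < l\<^sub>2 \<longrightarrow> \<mu> c l > 0)
      else l\<^sub>1 = l\<^sub>2 \<and> (\<forall>l. \<mu> c l \<le> 0))"


section \<open>Solutions\<close>

text \<open>Classical solution on \<open>I \<times> \<real>\<^sup>n\<close>: \<open>u\<close>, \<open>u\<^sub>t\<close>, and the first and second space derivatives exist
  and are jointly continuous.\<close>

definition solves_equation ::
  "(real ^ 'n \<Rightarrow> real ^ 'n ^ 'n) \<Rightarrow> (real ^ 'n \<Rightarrow> real \<Rightarrow> real) \<Rightarrow> real set \<Rightarrow>
   (real \<Rightarrow> real ^ 'n \<Rightarrow> real) \<Rightarrow> bool" where
  "solves_equation A f I u \<longleftrightarrow>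
     (\<forall>t\<in>I. \<forall>x. (\<lambda>s. u s x) field_differentiable (at t)) \<and>
     (\<forall>t\<in>I. C2 (u t)) \<and>
     continuous_on (I \<times> UNIV) (\<lambda>(t, x). u t x) \<and>
     continuous_on (I \<times> UNIV) (\<lambda>(t, x). deriv (\<lambda>s. u s x) t) \<and>
     continuous_on (I \<times> UNIV) (\<lambda>(t, x). grad (u t) x) \<and>
     (\<forall>i. continuous_on (I \<times> UNIV) (\<lambda>(t, x). grad (\<lambda>y. grad (u t) y $ i) x)) \<and>
     (\<forall>t\<in>I. \<forall>x. deriv (\<lambda>s. u s x) t - div_A_grad A (u t) x = f x (u t x))"

text \<open>Bounded solution of the initial value problem. Since \<open>u\<^sub>0\<close> may be discontinuous,
  the solution is required to be continuous up to \<open>t = 0\<close> exactly at the continuity points of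
  \<open>u\<^sub>0\<close>.\<close>

definition solves_ivp ::
  "(real ^ 'n \<Rightarrow> real ^ 'n ^ 'n) \<Rightarrow> (real ^ 'n \<Rightarrow> real \<Rightarrow> real) \<Rightarrow> (real ^ 'n \<Rightarrow> real) \<Rightarrow>
   (real \<Rightarrow> real ^ 'n \<Rightarrow> real) \<Rightarrow> bool" where
  "solves_ivp A f u\<^sub>0 u \<longleftrightarrow>
     solves_equation A f {0<..} u \<and>
     (\<exists>B. \<forall>t\<ge>0. \<forall>x. \<bar>u t x\<bar> \<le> B) \<and>
     (\<forall>x. u 0 x = u\<^sub>0 x) \<and>
     (\<forall>x. isCont u\<^sub>0 x \<longrightarrow> continuous (at (0, x) within {0..} \<times> UNIV) (\<lambda>(t, y). u t y))"

definition steady_state ::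
  "real ^ 'n \<Rightarrow> real \<Rightarrow> (real ^ 'n \<Rightarrow> real ^ 'n ^ 'n) \<Rightarrow> (real ^ 'n \<Rightarrow> real \<Rightarrow> real) \<Rightarrow>
   (real ^ 'n \<Rightarrow> real) \<Rightarrow> bool" where
  "steady_state L \<alpha> A f p \<longleftrightarrow>
     (\<forall>x. p x > 0) \<and> periodic L p \<and> C2_holder \<alpha> p \<and> (\<forall>x. div_A_grad A p x + f x (p x) = 0)"

definition traveling_wavefront ::
  "real ^ 'n \<Rightarrow> (real ^ 'n \<Rightarrow> real ^ 'n ^ 'n) \<Rightarrow> (real ^ 'n \<Rightarrow> real \<Rightarrow> real) \<Rightarrow> 'n \<Rightarrow>
   (real ^ 'n \<Rightarrow> real) \<Rightarrow> real \<Rightarrow> (real ^ 'n \<Rightarrow> real \<Rightarrow> real) \<Rightarrow> bool" where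
  "traveling_wavefront L A f k p c w \<longleftrightarrow>
     (\<forall>x \<xi>. 0 \<le> w x \<xi>) \<and> periodic L w \<and>
     solves_equation A f UNIV (\<lambda>t x. w x (x $ k + c * t)) \<and>
     uniform_limit UNIV (\<lambda>\<xi> x. w x \<xi>) (\<lambda>x. 0) at_bot \<and>
     uniform_limit UNIV (\<lambda>\<xi> x. w x \<xi>) p at_top"

definition weight :: "real \<Rightarrow> real \<Rightarrow> real \<Rightarrow> real" where
  "weight l \<xi>\<^sub>0 \<xi> = (if \<xi> \<le> \<xi>\<^sub>0 then exp (- l * (\<xi> - \<xi>\<^sub>0)) else 1)"

end

theory Submission
  imports Defs "HOL-Real_Asymp.Real_Asymp"
begin

text \<open>Let \<open>v = u - W\<close> with \<open>W t x = w x (x\<^sub>1 + c t)\<close>, and let \<open>\<Phi> = e\<^bsup>l x\<^sub>1\<^esup>\<psi>\<close> with \<open>\<psi>\<close> the eigenfunction for \<open>\<mu>\<^sub>c(l)\<close>.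
  By the KPP condition \<open>\<bar>v\<bar>\<close> is a subsolution of the equation linearised at \<open>0\<close>, and \<open>\<Phi>\<close> together with the
  eigenfunction \<open>\<Psi>\<close> for \<open>- l\<close> turns that linear equation for \<open>z = v / \<Phi>\<close> into a diffusion with weight
  \<open>\<Phi>\<Psi>\<close> and bounded drift, up to an exponential factor in time. The \<open>L\<^sup>1\<close> norm of \<open>z\<close> does not grow, and
  Nash's inequality gives \<open>\<bar>v\<bar> \<le> C t\<^bsup>-n/2\<^esup> e\<^bsup>-\<mu> t\<^esup> e\<^bsup>l(x\<^sub>1 + c t)\<^esup>\<close>; this is the estimate for \<open>x\<^sub>1 + c t \<le> \<xi>\<^sub>0\<close>.
  For \<open>x\<^sub>1 + c t \<ge> \<xi>\<^sub>0\<close>, the wave is close to \<open>p\<close>, and \<open>u\<close> is so from some time on: it is close to \<open>W\<close> near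
  \<open>\<xi>\<^sub>0\<close> and far out in space, it is positive, and \<open>\<theta>(t) p\<close> with \<open>\<theta>\<close> increasing to almost \<open>1\<close> is a subsolution.
  There the equation for \<open>v\<close> is governed by the linearisation at \<open>p\<close>, and \<open>C (1 + t)\<^bsup>-n/2\<^esup> e\<^bsup>-min(\<mu>, -\<mu>'/2) t\<^esup> \<phi>\<close> is
  a supersolution, where \<open>\<phi>\<close> is the eigenfunction for \<open>\<mu>' = \<mu>bar\<^sub>1\<close>.\<close>

section \<open>Weak divergences\<close>

text \<open>Two obstacles shape the argument. The eigenfunctions are only C1, and
  \<open>v / \<Phi>\<close> may grow exponentially in space; so all computations are integrations by
  parts against compactly supported C1 weights. The weight is a Gaussian exp(-\<beta> (1 + t) |x|^2)
  times a cutoff of radius R: its decay in time dominates the terms created by its gradient, and the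
  errors left over are O(\<beta>) and O(1/R). The partner for \<open>- l\<close> is taken because
  the exponentials cancel in \<Phi>\<Psi>, which is then periodic, bounded and bounded away from 0.
  Initial values are attained only almost everywhere, since \<open>u\<^sub>0\<close> may jump. Hence
  the comparison principle is also an energy estimate, for the fourth power of the positive part.
  The rate \<open>- \<mu>bar\<^sub>1 / 2\<close> is what is left of
  \<open>- \<mu>bar\<^sub>1\<close> after one quarter has paid for the variation of
  \<open>f_u\<close> near p and another quarter for the derivative of the algebraic factor (1 +
  t)^(-n/2).\<close>

lemma C1_gderiv:
  assumes "C1 g"
  shows "GDERIV g x :> grad g x"
proof -
  have d: "(g has_derivative frechet_derivative g (at x)) (at x)"
    using assms frechet_derivative_works unfolding C1_def by blast
  interpret bounded_linear "frechet_derivative g (at x)"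
    using d by (rule has_derivative_bounded_linear)
  have "frechet_derivative g (at x) h = h \<bullet> grad g x" for h
  proof -
    have "h = (\<Sum>i\<in>UNIV. (h $ i) *\<^sub>R axis i 1)"
      using basis_expansion[of h] by (simp add: scalar_mult_eq_scaleR)
    hence "frechet_derivative g (at x) h = (\<Sum>i\<in>UNIV. h $ i * frechet_derivative g (at x) (axis i 1))"
      by (metis (mono_tags, lifting) sum sum.cong scale real_scaleR_def)
    thus ?thesis by (simp add: inner_vec_def grad_def)
  qed
  hence "frechet_derivative g (at x) = (\<lambda>h. h \<bullet> grad g x)" by auto
  with d show ?thesis unfolding gderiv_def by simp
qed

lemma grad_eqI:
  assumes "GDERIV g x :> D"
  shows "grad g x = D"
proof -
  have "(\<lambda>h. h \<bullet> D) = frechet_derivative g (at x)"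
    using assms frechet_derivative_at unfolding gderiv_def by blast
  hence "frechet_derivative g (at x) (axis i 1) = axis i 1 \<bullet> D" for i by metis
  thus ?thesis
    by (simp add: grad_def vec_eq_iff inner_axis' )
qed

lemma C1I:
  assumes "\<And>x. GDERIV g x :> g' x" "continuous_on UNIV g'"
  shows "C1 g"
proof -
  have "grad g = g'" using grad_eqI[OF assms(1)] by auto
  thus ?thesis using assms unfolding C1_def gderiv_def differentiable_def by auto
qed

lemma C1_continuous_grad: "C1 g \<Longrightarrow> continuous_on UNIV (grad g)"
  by (simp add: C1_def)

lemma C1_continuous: "C1 g \<Longrightarrow> continuous_on UNIV g"
  unfolding C1_def continuous_on_eq_continuous_within
  by (simp add: differentiable_imp_continuous_within)

lemma C1_continuous_grad_nth: "C1 g \<Longrightarrow> continuous_on UNIV (\<lambda>x. grad g x $ i)"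
  by (intro continuous_intros C1_continuous_grad)

section \<open>Algebra of continuously differentiable functions and their gradients\<close>

lemma C1_const: "C1 (\<lambda>x. a)" and grad_const: "grad (\<lambda>x. a) x = 0"
  by (auto intro!: C1I GDERIV_const grad_eqI continuous_intros)

lemma C1_add:
  assumes "C1 f" "C1 g"
  shows "C1 (\<lambda>x. f x + g x)" and "grad (\<lambda>x. f x + g x) x = grad f x + grad g x"
  by (auto intro!: C1I GDERIV_add grad_eqI continuous_intros C1_gderiv C1_continuous_grad assms)

lemma C1_diff:
  assumes "C1 f" "C1 g"
  shows "C1 (\<lambda>x. f x - g x)" and "grad (\<lambda>x. f x - g x) x = grad f x - grad g x"
  by (auto intro!: C1I GDERIV_diff grad_eqI continuous_intros C1_gderiv C1_continuous_grad assms)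

lemma C1_mult:
  assumes "C1 f" "C1 g"
  shows "C1 (\<lambda>x. f x * g x)" and "grad (\<lambda>x. f x * g x) x = f x *\<^sub>R grad g x + g x *\<^sub>R grad f x"
  by (auto intro!: C1I[OF GDERIV_mult] GDERIV_mult grad_eqI continuous_intros C1_gderiv C1_continuous_grad
      C1_continuous assms)

lemma C1_cmult:
  assumes "C1 g"
  shows "C1 (\<lambda>x. a * g x)" and "grad (\<lambda>x. a * g x) x = a *\<^sub>R grad g x"
  using C1_mult[OF C1_const assms, of a] by (auto simp: grad_const)

lemma C1_compose:
  assumes "C1 g" "\<And>s. (h has_real_derivative h' s) (at s)" "continuous_on UNIV h'"
  shows "C1 (\<lambda>x. h (g x))" and "grad (\<lambda>x. h (g x)) x = h' (g x) *\<^sub>R grad g x"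
proof -
  have c: "continuous_on UNIV (\<lambda>x. h' (g x))"
    by (rule continuous_on_compose2[OF assms(3) C1_continuous[OF assms(1)]]) auto
  show "C1 (\<lambda>x. h (g x))"
    by (rule C1I[OF GDERIV_DERIV_compose[OF C1_gderiv[OF assms(1)] assms(2)]])
       (intro continuous_intros c C1_continuous_grad assms)
  show "grad (\<lambda>x. h (g x)) x = h' (g x) *\<^sub>R grad g x"
    by (rule grad_eqI[OF GDERIV_DERIV_compose[OF C1_gderiv[OF assms(1)] assms(2)]])
qed

lemma C1_inverse:
  assumes "C1 g" "\<And>x. g x \<noteq> 0"
  shows "C1 (\<lambda>x. inverse (g x))" and "grad (\<lambda>x. inverse (g x)) x = - ((inverse (g x))\<^sup>2 *\<^sub>R grad g x)"
proof -
  show "C1 (\<lambda>x. inverse (g x))"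
    by (rule C1I[OF GDERIV_inverse[OF C1_gderiv[OF assms(1)] assms(2)]])
       (intro continuous_intros assms C1_continuous_grad ballI C1_continuous)+
  show "grad (\<lambda>x. inverse (g x)) x = - ((inverse (g x))\<^sup>2 *\<^sub>R grad g x)"
    using grad_eqI[OF GDERIV_inverse[OF C1_gderiv[OF assms(1)] assms(2)]] by simp
qed

lemma C1_divide:
  assumes "C1 f" "C1 g" "\<And>x. g x \<noteq> 0"
  shows "C1 (\<lambda>x. f x / g x)"
    and "grad (\<lambda>x. f x / g x) x = inverse (g x) *\<^sub>R grad f x - (f x / (g x)\<^sup>2) *\<^sub>R grad g x"
proof -
  show "C1 (\<lambda>x. f x / g x)"
    using C1_mult(1)[OF assms(1) C1_inverse(1)[OF assms(2,3)]] by (simp add: divide_inverse)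
  show "grad (\<lambda>x. f x / g x) x = inverse (g x) *\<^sub>R grad f x - (f x / (g x)\<^sup>2) *\<^sub>R grad g x"
    using C1_mult(2)[OF assms(1) C1_inverse(1)[OF assms(2,3)], of x] C1_inverse(2)[OF assms(2,3)]
    by (simp add: divide_inverse power_inverse)
qed

lemma C1_sum:
  assumes "\<And>i. i \<in> I \<Longrightarrow> C1 (f i)"
  shows "C1 (\<lambda>x. \<Sum>i\<in>I. f i x)" and "grad (\<lambda>x. \<Sum>i\<in>I. f i x) x = (\<Sum>i\<in>I. grad (f i) x)"
proof -
  have "C1 (\<lambda>x. \<Sum>i\<in>I. f i x) \<and> grad (\<lambda>x. \<Sum>i\<in>I. f i x) x = (\<Sum>i\<in>I. grad (f i) x)"
    using assms by (induction I rule: infinite_finite_induct) (auto simp: C1_const grad_const C1_add)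
  thus "C1 (\<lambda>x. \<Sum>i\<in>I. f i x)" "grad (\<lambda>x. \<Sum>i\<in>I. f i x) x = (\<Sum>i\<in>I. grad (f i) x)" by auto
qed

lemma fixes k :: "'n::finite" shows C1_nth: "C1 (\<lambda>x. x $ k)" and grad_nth: "grad (\<lambda>x. x $ k) x = axis k 1"
proof -
  have g: "GDERIV (\<lambda>x. x $ k) x :> axis k 1" for x :: "real ^ 'n"
    unfolding gderiv_def inner_axis
    by (simp add: bounded_linear_vec_nth bounded_linear_imp_has_derivative)
  show "C1 (\<lambda>x. x $ k)" by (rule C1I[OF g]) (intro continuous_intros)
  show "grad (\<lambda>x. x $ k) x = axis k 1" by (rule grad_eqI[OF g])
qed

lemma fixes a :: "real ^ 'n::finite" shows C1_sqnorm: "C1 (\<lambda>x. (x - a) \<bullet> (x - a))"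
  and grad_sqnorm: "grad (\<lambda>x. (x - a) \<bullet> (x - a)) x = 2 *\<^sub>R (x - a)"
proof -
  have g: "GDERIV (\<lambda>x. (x - a) \<bullet> (x - a)) x :> 2 *\<^sub>R (x - a)" for x :: "real ^ 'n"
    unfolding gderiv_def by (auto intro!: derivative_eq_intros simp: inner_commute algebra_simps)
  show "C1 (\<lambda>x. (x - a) \<bullet> (x - a))" by (rule C1I[OF g]) (intro continuous_intros)
  show "grad (\<lambda>x. (x - a) \<bullet> (x - a)) x = 2 *\<^sub>R (x - a)" by (rule grad_eqI[OF g])
qed

text \<open>The class is stable under multiplication by arbitrary continuous functions, which
  settles integrability in all later identities; \<open>test_function\<close> adds the C1
  condition.\<close>

definition csupp :: "('a::real_normed_vector \<Rightarrow> real) \<Rightarrow> bool" where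
  "csupp g \<longleftrightarrow> continuous_on UNIV g \<and> bounded {x. g x \<noteq> 0}"

lemma csupp_integrable:
  fixes g :: "'a::euclidean_space \<Rightarrow> real"
  assumes "csupp g"
  shows "integrable lborel g"
proof -
  obtain a where a: "{x. g x \<noteq> 0} \<subseteq> cbox (-a) a"
    using assms bounded_subset_cbox_symmetric unfolding csupp_def by metis
  have "integrable lborel (\<lambda>x. indicator (cbox (-a) a) x *\<^sub>R g x)"
    using assms by (intro borel_integrable_compact) (auto simp: csupp_def intro: continuous_on_subset)
  also have "(\<lambda>x. indicator (cbox (-a) a) x *\<^sub>R g x) = g"
    using a by (auto simp: indicator_def fun_eq_iff)
  finally show ?thesis .
qed

lemma csuppI: 
  assumes "csupp g" "continuous_on UNIV h" "\<And>x. g x = 0 \<Longrightarrow> h x = 0"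
  shows "csupp h"
  using assms unfolding csupp_def by (auto elim!: bounded_subset)

lemma continuous_on_vecI:
  fixes V :: "'a::topological_space \<Rightarrow> real ^ 'n"
  assumes "\<And>i. continuous_on S (\<lambda>x. V x $ i)"
  shows "continuous_on S V"
  using continuous_on_vec_lambda[of S "\<lambda>i x. V x $ i"] assms by simp

lemma csupp_grad:
  assumes "test_function \<eta>"
  shows "csupp \<eta>" "bounded {x. grad \<eta> x \<noteq> 0}"
proof -
  show 1: "csupp \<eta>" using assms C1_continuous unfolding test_function_def csupp_def by blast
  \<comment> \<open>Off the closure \<open>\<eta>\<close> vanishes on an open set, so there the zero
    function has gradient \<open>grad \<eta> x\<close>.\<close>
  have "{x. grad \<eta> x \<noteq> 0} \<subseteq> closure {x. \<eta> x \<noteq> 0}"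
  proof (rule ccontr)
    assume "\<not> ?thesis"
    then obtain x where x: "grad \<eta> x \<noteq> 0" "x \<in> - closure {x. \<eta> x \<noteq> 0}" by auto
    have "GDERIV \<eta> x :> grad \<eta> x" using assms C1_gderiv unfolding test_function_def by blast
    hence "((\<lambda>x. 0) has_derivative (\<lambda>h. h \<bullet> grad \<eta> x)) (at x)"
      unfolding gderiv_def
      by (rule has_derivative_transform_within_open[of _ _ _ _ "- closure {x. \<eta> x \<noteq> 0}"])
         (use x closure_subset[of "{x. \<eta> x \<noteq> 0}"] in auto)
    hence "grad (\<lambda>x. 0) x = grad \<eta> x" by (intro grad_eqI) (simp add: gderiv_def)
    thus False using x by (simp add: grad_const)
  qed
  thus "bounded {x. grad \<eta> x \<noteq> 0}"
    using assms unfolding test_function_def by (meson bounded_closure bounded_subset)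
qed

lemma csupp_inner_grad:
  assumes "test_function \<eta>" "continuous_on UNIV V"
  shows "csupp (\<lambda>x. V x \<bullet> grad \<eta> x)"
  using assms csupp_grad(2)[OF assms(1)] unfolding csupp_def test_function_def C1_def
  by (auto intro!: continuous_intros elim!: bounded_subset)

lemma csupp_mult:
  assumes "csupp g" "continuous_on UNIV h"
  shows "csupp (\<lambda>x. h x * g x)"
  using assms unfolding csupp_def by (auto intro!: continuous_intros elim!: bounded_subset)

lemma test_mult:
  assumes "test_function \<eta>" "C1 h"
  shows "test_function (\<lambda>x. h x * \<eta> x)"
  using assms C1_mult(1) unfolding test_function_def by (auto elim!: bounded_subset)

text \<open>All \<open>f s\<close> vanish off one box, so the integral over the space is an integral
  over that box, where the Leibniz rule for compact boxes applies. The vanishing passes to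
  \<open>f'\<close> by uniqueness of derivatives, because \<open>I\<close> is open.\<close>

lemma leibniz_lborel:
  fixes f :: "real \<Rightarrow> 'a::euclidean_space \<Rightarrow> real"
  assumes I: "open I" "convex I" "t \<in> I"
    and d: "\<And>s x. s \<in> I \<Longrightarrow> ((\<lambda>s. f s x) has_real_derivative f' s x) (at s)"
    and c: "continuous_on (I \<times> UNIV) (\<lambda>(s, x). f s x)" "continuous_on (I \<times> UNIV) (\<lambda>(s, x). f' s x)"
    and supp: "\<And>s x. s \<in> I \<Longrightarrow> x \<notin> cbox a b \<Longrightarrow> f s x = 0"
  shows "((\<lambda>s. LINT x|lborel. f s x) has_real_derivative (LINT x|lborel. f' t x)) (at t)"
proof -
  have supp': "f' s x = 0" if "s \<in> I" "x \<notin> cbox a b" for s x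
  proof -
    have "((\<lambda>s. 0) has_real_derivative f' s x) (at s)"
      by (rule has_field_derivative_transform_within_open[OF d[OF that(1)] I(1) that(1)])
         (simp add: supp that)
    thus ?thesis using DERIV_unique DERIV_const by blast
  qed
  have cs: "continuous_on S (f s)" "continuous_on S (f' s)" if "s \<in> I" for s S
  proof -
    have "continuous_on S (\<lambda>x. (s, x))" by (intro continuous_intros)
    thus "continuous_on S (f s)" "continuous_on S (f' s)"
      using continuous_on_compose2[OF c(1), of S "\<lambda>x. (s, x)"]
          continuous_on_compose2[OF c(2), of S "\<lambda>x. (s, x)"] that by auto
  qed
  have eq: "(LINT x|lborel. g x) = integral (cbox a b) g"
    if "continuous_on UNIV g" "\<And>x. x \<notin> cbox a b \<Longrightarrow> g x = 0" for g :: "'a \<Rightarrow> real"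
  proof -
    have "{x. g x \<noteq> 0} \<subseteq> cbox a b" using that(2) by auto
    hence "bounded {x. g x \<noteq> 0}" by (rule bounded_subset[OF bounded_cbox])
    hence "csupp g" unfolding csupp_def using that(1) by simp
    hence "(LINT x|lborel. g x) = integral UNIV g"
      by (simp add: integral_lborel[OF csupp_integrable])
    also have "\<dots> = integral (cbox a b) g"
      by (rule integral_spike_set) (auto intro: negligible_subset[of "{}"] simp: that)
    finally show ?thesis .
  qed
  have "((\<lambda>s. integral (cbox a b) (f s)) has_field_derivative integral (cbox a b) (f' t)) (at t within I)"
  proof (rule leibniz_rule_field_derivative)
    show "continuous_on (I \<times> cbox a b) (\<lambda>(x, t). f' x t)"
      by (rule continuous_on_subset[OF c(2)]) auto
  qed (use I d cs in \<open>auto intro: has_field_derivative_at_within integrable_continuous\<close>)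
  hence "((\<lambda>s. integral (cbox a b) (f s)) has_field_derivative integral (cbox a b) (f' t)) (at t)"
    using at_within_open[OF I(3) I(1)] by simp
  hence "((\<lambda>s. LINT x|lborel. f s x) has_field_derivative integral (cbox a b) (f' t)) (at t)"
    by (rule has_field_derivative_transform_within_open[OF _ I(1) I(3)])
       (use eq cs supp in auto)
  thus ?thesis using eq[of "f' t"] cs(2) supp' I(3) by simp
qed

lemma integral_lborel_shift:
  fixes g :: "'a::euclidean_space \<Rightarrow> real"
  assumes "g \<in> borel_measurable borel"
  shows "(LINT x|lborel. g (x + a)) = (LINT x|lborel. g x)"
proof -
  have "(LINT x|lborel. g x) = (LINT x|distr lborel borel ((+) a). g x)"
    by (simp add: lborel_distr_plus)
  also have "\<dots> = (LINT x|lborel. g (a + x))"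
    using assms by (intro integral_distr) auto
  finally show ?thesis by (simp add: add.commute)
qed

text \<open>Supplies the common box that \<open>leibniz_lborel\<close> asks for when the parameter
  is a translation.\<close>

lemma csupp_shift_bound:
  assumes "bounded {x. (g :: 'a::euclidean_space \<Rightarrow> real) x \<noteq> 0}"
  obtains a where "\<And>s x. \<bar>s\<bar> < T \<Longrightarrow> x \<notin> cbox (-a) a \<Longrightarrow> g (x + s *\<^sub>R h) = 0"
proof -
  obtain M where M: "\<And>x. g x \<noteq> 0 \<Longrightarrow> norm x \<le> M"
    using assms unfolding bounded_iff by auto
  have "bounded (cball (0::'a) (M + T * norm h))" by simp
  then obtain a where a: "cball (0::'a) (M + T * norm h) \<subseteq> cbox (-a) a"
    by (rule bounded_subset_cbox_symmetric)
  show ?thesis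
  proof (rule that[of a])
    fix s :: real and x assume s: "\<bar>s\<bar> < T" "x \<notin> cbox (-a) a"
    show "g (x + s *\<^sub>R h) = 0"
    proof (rule ccontr)
      assume "g (x + s *\<^sub>R h) \<noteq> 0"
      hence "norm (x + s *\<^sub>R h) \<le> M" by (rule M)
      moreover have "norm (s *\<^sub>R h) \<le> T * norm h" using s by (simp add: mult_right_mono)
      moreover have "norm x \<le> norm (x + s *\<^sub>R h) + norm (s *\<^sub>R h)"
        by (metis add_diff_cancel_right' norm_triangle_ineq4)
      ultimately have "x \<in> cball 0 (M + T * norm h)" by simp
      thus False using a s by auto
    qed
  qed
qed

text \<open>The integral of a translate does not depend on the translation, so its derivative with
  respect to the shift is 0. Integration by parts for C1 fields rests on this.\<close>

lemma integral_grad_0: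
  assumes "test_function \<eta>"
  shows "(LINT x|lborel. grad \<eta> x $ i) = 0"
proof -
  have C: "C1 \<eta>" "bounded {x. \<eta> x \<noteq> 0}" using assms by (auto simp: test_function_def)
  obtain a where a: "\<And>s x. \<bar>s\<bar> < 1 \<Longrightarrow> x \<notin> cbox (-a) a \<Longrightarrow> \<eta> (x + s *\<^sub>R axis i 1) = 0"
    using csupp_shift_bound[OF C(2)] by metis
  have "((\<lambda>s. LINT x|lborel. \<eta> (x + s *\<^sub>R axis i 1)) has_real_derivative
     (LINT x|lborel. grad \<eta> (x + 0 *\<^sub>R axis i 1) $ i)) (at 0)"
  proof (rule leibniz_lborel[where f = "\<lambda>s x. \<eta> (x + s *\<^sub>R axis i 1)" and f' = "\<lambda>s x. grad \<eta> (x + s *\<^sub>R axis i 1) $ i" and I="{-1<..<1}" and a="-a" and b=a])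
    fix s :: real and x
    have "((\<lambda>s. \<eta> (x + s *\<^sub>R axis i 1)) has_derivative (\<lambda>h. (h *\<^sub>R axis i 1) \<bullet> grad \<eta> (x + s *\<^sub>R axis i 1))) (at s)"
      by (rule has_derivative_compose[OF _ C1_gderiv[OF C(1), unfolded gderiv_def]])
         (auto intro!: derivative_eq_intros)
    thus "((\<lambda>s. \<eta> (x + s *\<^sub>R axis i 1)) has_real_derivative grad \<eta> (x + s *\<^sub>R axis i 1) $ i) (at s)"
      unfolding has_field_derivative_def by (simp add: inner_axis' mult_commute_abs)
  next
    show "continuous_on ({- 1<..<1} \<times> UNIV) (\<lambda>(s, x). \<eta> (x + s *\<^sub>R axis i 1))"
      unfolding split_beta by (rule continuous_on_compose2[OF C1_continuous[OF C(1)]]) (auto intro!: continuous_intros)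
    show "continuous_on ({- 1<..<1} \<times> UNIV) (\<lambda>(s, x). grad \<eta> (x + s *\<^sub>R axis i 1) $ i)"
      unfolding split_beta by (rule continuous_on_compose2[OF C1_continuous_grad_nth[OF C(1)]]) (auto intro!: continuous_intros)
  qed (use a in auto)
  moreover have "(\<lambda>s. LINT x|lborel. \<eta> (x + s *\<^sub>R axis i 1)) = (\<lambda>s. LINT x|lborel. \<eta> x)"
    using C1_continuous[OF C(1)] by (auto intro!: integral_lborel_shift borel_measurable_continuous_onI)
  ultimately show ?thesis using DERIV_unique[OF _ DERIV_const] by fastforce
qed

lemma integral_inner_grad_C1:
  assumes V: "\<And>i. C1 (\<lambda>x. V x $ i)" and \<eta>: "test_function \<eta>"
  shows "(LINT x|lborel. V x \<bullet> grad \<eta> x) = - (LINT x|lborel. divergence V x * \<eta> x)"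
proof -
  have C: "C1 \<eta>" using \<eta> by (simp add: test_function_def)
  have i0: "(LINT x|lborel. grad (\<lambda>x. V x $ i * \<eta> x) x $ i) = 0" for i
    by (rule integral_grad_0[OF test_mult[OF \<eta> V]])
  have csg: "csupp (\<lambda>x. grad (\<lambda>y. V y $ i * \<eta> y) x $ i)" for i
    using csupp_inner_grad[OF test_mult[OF \<eta> V[of i]], of "\<lambda>_. axis i 1"] by (simp add: inner_axis')
  have cs1: "csupp (\<lambda>x. V x \<bullet> grad \<eta> x)"
    by (rule csupp_inner_grad[OF \<eta>])
       (intro continuous_on_vecI C1_continuous V)
  have cs2: "csupp (\<lambda>x. divergence V x * \<eta> x)"
    by (rule csupp_mult[OF csupp_grad(1)[OF \<eta>]])
       (auto simp: divergence_def intro!: continuous_intros C1_continuous_grad V)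
  have "V x \<bullet> grad \<eta> x + divergence V x * \<eta> x = (\<Sum>i\<in>UNIV. grad (\<lambda>x. V x $ i * \<eta> x) x $ i)" for x
    unfolding C1_mult(2)[OF V C] inner_vec_def divergence_def sum_distrib_right sum.distrib[symmetric]
    by (rule sum.cong) simp_all
  hence "(LINT x|lborel. V x \<bullet> grad \<eta> x + divergence V x * \<eta> x) = 0"
    using i0 csg by (simp add: csupp_integrable)
  thus ?thesis using cs1 cs2 by (simp add: csupp_integrable)
qed

lemma weak_div_C1:
  assumes "\<And>i. C1 (\<lambda>x. V x $ i)"
  shows "has_weak_divergence V (divergence V)"
  unfolding has_weak_divergence_def
proof (intro conjI allI impI)
  show "continuous_on UNIV V"
    by (intro continuous_on_vecI C1_continuous assms)
  show "continuous_on UNIV (divergence V)"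
    unfolding divergence_def by (intro continuous_intros C1_continuous_grad assms)
qed (rule integral_inner_grad_C1[OF assms])

lemma weak_div_cong: "has_weak_divergence V D \<Longrightarrow> (\<And>x. V x = V' x) \<Longrightarrow> (\<And>x. D x = D' x) \<Longrightarrow> has_weak_divergence V' D'"
  by (metis ext)

lemma weak_div_test:
  assumes "has_weak_divergence V D" "test_function \<eta>"
  shows "(LINT x|lborel. V x \<bullet> grad \<eta> x) = - (LINT x|lborel. D x * \<eta> x)"
    "integrable lborel (\<lambda>x. V x \<bullet> grad \<eta> x)" "integrable lborel (\<lambda>x. D x * \<eta> x)"
  using assms csupp_grad csupp_inner_grad csupp_mult csupp_integrable
  unfolding has_weak_divergence_def by blast+

lemma weak_div_add:
  assumes "has_weak_divergence V D" "has_weak_divergence V' D'"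
  shows "has_weak_divergence (\<lambda>x. V x + V' x) (\<lambda>x. D x + D' x)"
  unfolding has_weak_divergence_def
proof (intro conjI allI impI)
  fix \<eta> :: "real ^ 'a \<Rightarrow> real" assume "test_function \<eta>"
  note w = weak_div_test[OF assms(1) this] weak_div_test[OF assms(2) this]
  show "(LINT x|lborel. (V x + V' x) \<bullet> grad \<eta> x) = - (LINT x|lborel. (D x + D' x) * \<eta> x)"
    using w by (simp add: inner_add_left distrib_right)
qed (use assms in \<open>auto simp: has_weak_divergence_def intro!: continuous_intros\<close>)

text \<open>A C1 function times a test function is again a test function; testing the divergence of
  \<open>V\<close> with that product gives the product rule.\<close>

lemma weak_div_mult:
  assumes "has_weak_divergence V D" "C1 h"
  shows "has_weak_divergence (\<lambda>x. h x *\<^sub>R V x) (\<lambda>x. h x * D x + V x \<bullet> grad h x)"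
  unfolding has_weak_divergence_def
proof (intro conjI allI impI)
  fix \<eta> :: "real ^ 'a \<Rightarrow> real" assume \<eta>: "test_function \<eta>"
  note w = weak_div_test[OF assms(1) test_mult[OF \<eta> assms(2)]]
  have V: "continuous_on UNIV V" "continuous_on UNIV D" using assms by (auto simp: has_weak_divergence_def)
  have g: "V x \<bullet> grad (\<lambda>x. h x * \<eta> x) x = h x *\<^sub>R V x \<bullet> grad \<eta> x + (V x \<bullet> grad h x) * \<eta> x" for x
    using \<eta> C1_mult(2)[OF assms(2), of \<eta>] by (simp add: test_function_def inner_add_right)
  have i: "integrable lborel (\<lambda>x. (V x \<bullet> grad h x) * \<eta> x)"
    by (rule csupp_integrable[OF csupp_mult[OF csupp_grad(1)[OF \<eta>]]])
       (intro continuous_intros V C1_continuous_grad assms)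
  have i': "integrable lborel (\<lambda>x. h x *\<^sub>R V x \<bullet> grad \<eta> x)"
    by (rule csupp_integrable[OF csupp_inner_grad[OF \<eta>]])
       (intro continuous_intros V C1_continuous assms)
  have "(LINT x|lborel. h x *\<^sub>R V x \<bullet> grad \<eta> x) + (LINT x|lborel. (V x \<bullet> grad h x) * \<eta> x)
    = - (LINT x|lborel. D x * (h x * \<eta> x))"
    using w(1) i i' unfolding g by simp
  moreover have "(LINT x|lborel. (h x * D x + V x \<bullet> grad h x) * \<eta> x) =
     (LINT x|lborel. D x * (h x * \<eta> x)) + (LINT x|lborel. (V x \<bullet> grad h x) * \<eta> x)"
    using w(3) i by (subst Bochner_Integration.integral_add[symmetric]) (auto simp: algebra_simps)
  ultimately show "(LINT x|lborel. (h x *\<^sub>R V x) \<bullet> grad \<eta> x) = - (LINT x|lborel. (h x * D x + V x \<bullet> grad h x) * \<eta> x)"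
    by linarith
qed (use assms(1) in \<open>auto simp: has_weak_divergence_def intro!: continuous_intros C1_continuous_grad[OF assms(2)] C1_continuous[OF assms(2)]\<close>)

lemma weak_div_cmult:
  assumes "has_weak_divergence V D"
  shows "has_weak_divergence (\<lambda>x. a *\<^sub>R V x) (\<lambda>x. a * D x)"
  using weak_div_mult[OF assms C1_const[of a]] by (simp add: grad_const)

lemma weak_div_diff:
  assumes "has_weak_divergence V D" "has_weak_divergence V' D'"
  shows "has_weak_divergence (\<lambda>x. V x - V' x) (\<lambda>x. D x - D' x)"
  using weak_div_add[OF assms(1) weak_div_cmult[OF assms(2), of "-1"]] by simp

section \<open>The energy identity\<close>

lemma inner_symmetric_matrix:
  fixes M :: "real ^ 'n ^ 'n"
  assumes "transpose M = M"
  shows "(M *v x) \<bullet> y = (M *v y) \<bullet> x"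
  by (metis assms dot_lmul_matrix inner_commute transpose_matrix_vector)

definition flux :: "(real ^ 'n \<Rightarrow> real ^ 'n ^ 'n) \<Rightarrow> (real ^ 'n \<Rightarrow> real) \<Rightarrow> real ^ 'n \<Rightarrow> real ^ 'n" where
  "flux A g x = A x *v grad g x"

definition weak_sol :: "(real ^ 'n \<Rightarrow> real ^ 'n ^ 'n) \<Rightarrow> (real ^ 'n \<Rightarrow> real) \<Rightarrow> (real ^ 'n \<Rightarrow> real) \<Rightarrow> bool" where
  "weak_sol A g D \<longleftrightarrow> C1 g \<and> has_weak_divergence (flux A g) D"

text \<open>For v = \<Phi> z one has, formally, \<Psi> div(A grad v) = div(\<Phi>\<Psi> A grad z) +
  B . grad z + z \<Psi> div(A grad \<Phi>), where B is this field. Its divergence is \<Psi> div(A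
  grad \<Phi>) - \<Phi> div(A grad \<Psi>), hence 0 if both functions solve the same linear
  equation.\<close>

definition drift :: "(real ^ 'n \<Rightarrow> real ^ 'n ^ 'n) \<Rightarrow> (real ^ 'n \<Rightarrow> real) \<Rightarrow> (real ^ 'n \<Rightarrow> real) \<Rightarrow> real ^ 'n \<Rightarrow> real ^ 'n" where
  "drift A \<Phi> \<Psi> x = \<Psi> x *\<^sub>R flux A \<Phi> x - \<Phi> x *\<^sub>R flux A \<Psi> x"

text \<open>Formally, the equation of z is multiplied by H(z) \<sigma> and the term B . grad G(z) is
  integrated by parts. As all three functions have their divergence only in the weak sense, the
  identity is assembled from tested ones: that of \<open>v\<close> against \<open>\<eta>0\<close>,
  of \<open>\<Phi>\<close> against \<open>\<eta>1\<close>, of \<open>\<Psi>\<close> against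
  \<open>\<eta>2\<close>.\<close>

lemma energy_identity:
  fixes v \<Phi> \<Psi> \<sigma> :: "real ^ 'n \<Rightarrow> real"
  assumes sym: "\<And>x. transpose (A x) = A x"
    and v: "weak_sol A v D" and \<Phi>: "weak_sol A \<Phi> D\<^sub>\<Phi>" "\<And>x. \<Phi> x > 0" and \<Psi>: "weak_sol A \<Psi> D\<^sub>\<Psi>"
    and \<sigma>: "test_function \<sigma>"
    and G: "\<And>s. (G has_real_derivative H s) (at s)" "\<And>s. (H has_real_derivative H' s) (at s)" "continuous_on UNIV H'"
    and z_def: "z = (\<lambda>x. v x / \<Phi> x)"
  shows "(LINT x|lborel. \<Psi> x * \<sigma> x * H (z x) * D x) =
      (LINT x|lborel. \<sigma> x * (\<Psi> x * D\<^sub>\<Phi> x * (z x * H (z x)) - G (z x) * (\<Psi> x * D\<^sub>\<Phi> x - \<Phi> x * D\<^sub>\<Psi> x)))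
    - (LINT x|lborel. \<Phi> x * \<Psi> x * \<sigma> x * H' (z x) * (flux A z x \<bullet> grad z x)
         + \<Phi> x * \<Psi> x * H (z x) * (flux A z x \<bullet> grad \<sigma> x) + G (z x) * (drift A \<Phi> \<Psi> x \<bullet> grad \<sigma> x))"
    (is "?L = ?R1 - ?R2")
    and "csupp (\<lambda>x. \<sigma> x * (\<Psi> x * D\<^sub>\<Phi> x * (z x * H (z x)) - G (z x) * (\<Psi> x * D\<^sub>\<Phi> x - \<Phi> x * D\<^sub>\<Psi> x)))"
    and "csupp (\<lambda>x. \<Psi> x * \<sigma> x * H (z x) * D x)"
proof -
  have C: "C1 v" "C1 \<Phi>" "C1 \<Psi>" "C1 \<sigma>"
    and w: "has_weak_divergence (flux A v) D" "has_weak_divergence (flux A \<Phi>) D\<^sub>\<Phi>" "has_weak_divergence (flux A \<Psi>) D\<^sub>\<Psi>"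
    using v \<Phi> \<Psi> \<sigma> by (auto simp: weak_sol_def test_function_def)
  have \<Phi>0: "\<Phi> x \<noteq> 0" for x using \<Phi>(2)[of x] by simp
  have Cz: "C1 z" unfolding z_def by (rule C1_divide[OF C(1,2) \<Phi>0])
  have vz: "v = (\<lambda>x. \<Phi> x * z x)" using \<Phi>0 by (auto simp: z_def)
  have gv: "grad v x = \<Phi> x *\<^sub>R grad z x + z x *\<^sub>R grad \<Phi> x" for x
    unfolding vz by (rule C1_mult(2)[OF C(2) Cz])
  have cH: "continuous_on UNIV H" using G(2) DERIV_continuous_on by (metis has_field_derivative_at_within)
  note CG = C1_compose[OF Cz G(1) cH] and CH = C1_compose[OF Cz G(2,3)]
  \<comment> \<open>The derivative of s H(s) - G(s) is s H'(s), so \<open>grad K\<close> carries no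
    term with \<open>H\<close>.\<close>
  define K where "K = (\<lambda>x. z x * H (z x) - G (z x))"
  have CK: "C1 K" unfolding K_def by (intro C1_diff C1_mult Cz CG CH)
  have gK: "grad K x = (z x * H' (z x)) *\<^sub>R grad z x" for x
    unfolding K_def C1_diff(2)[OF C1_mult(1)[OF Cz CH(1)] CG(1)] C1_mult(2)[OF Cz CH(1)] CG(2) CH(2)
    by (simp add: scaleR_scaleR)
  define \<eta>0 where "\<eta>0 = (\<lambda>x. \<Psi> x * (H (z x) * \<sigma> x))"
  define \<eta>1 where "\<eta>1 = (\<lambda>x. \<Psi> x * (K x * \<sigma> x))"
  define \<eta>2 where "\<eta>2 = (\<lambda>x. \<Phi> x * (G (z x) * \<sigma> x))"
  have t: "test_function \<eta>0" "test_function \<eta>1" "test_function \<eta>2"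
    unfolding \<eta>0_def \<eta>1_def \<eta>2_def by (intro test_mult \<sigma> C CG CH CK)+
  have g0: "grad \<eta>0 x = (\<Psi> x * H (z x)) *\<^sub>R grad \<sigma> x + (\<Psi> x * \<sigma> x * H' (z x)) *\<^sub>R grad z x + (H (z x) * \<sigma> x) *\<^sub>R grad \<Psi> x" for x
    unfolding \<eta>0_def C1_mult(2)[OF C(3) C1_mult(1)[OF CH(1) C(4)]] C1_mult(2)[OF CH(1) C(4)] CH(2)
    by (simp add: scaleR_add_right mult.assoc)
  have g1: "grad \<eta>1 x = (\<Psi> x * K x) *\<^sub>R grad \<sigma> x + (\<Psi> x * \<sigma> x * (z x * H' (z x))) *\<^sub>R grad z x + (K x * \<sigma> x) *\<^sub>R grad \<Psi> x" for x
    unfolding \<eta>1_def C1_mult(2)[OF C(3) C1_mult(1)[OF CK C(4)]] C1_mult(2)[OF CK C(4)] gK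
    by (simp add: scaleR_add_right mult.assoc)
  have g2: "grad \<eta>2 x = (\<Phi> x * G (z x)) *\<^sub>R grad \<sigma> x + (\<Phi> x * \<sigma> x * H (z x)) *\<^sub>R grad z x + (G (z x) * \<sigma> x) *\<^sub>R grad \<Phi> x" for x
    unfolding \<eta>2_def C1_mult(2)[OF C(2) C1_mult(1)[OF CG(1) C(4)]] C1_mult(2)[OF CG(1) C(4)] CG(2)
    by (simp add: scaleR_add_right mult.assoc)
  have fv: "flux A v x = \<Phi> x *\<^sub>R flux A z x + z x *\<^sub>R flux A \<Phi> x" for x
    unfolding flux_def gv by (simp add: matrix_vector_right_distrib matrix_vector_mult_scaleR)
  \<comment> \<open>By symmetry of \<open>A\<close>, every term with \<open>grad \<Phi>\<close> or
    \<open>grad \<Psi>\<close> cancels, except those that make up the drift.\<close>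
  have pt: "flux A v x \<bullet> grad \<eta>0 x - flux A \<Phi> x \<bullet> grad \<eta>1 x - flux A \<Psi> x \<bullet> grad \<eta>2 x
    = \<Phi> x * \<Psi> x * \<sigma> x * H' (z x) * (flux A z x \<bullet> grad z x)
         + \<Phi> x * \<Psi> x * H (z x) * (flux A z x \<bullet> grad \<sigma> x) + G (z x) * (drift A \<Phi> \<Psi> x \<bullet> grad \<sigma> x)" for x
  proof -
    have s: "flux A \<Psi> x \<bullet> grad \<Phi> x = flux A \<Phi> x \<bullet> grad \<Psi> x" "flux A \<Psi> x \<bullet> grad z x = flux A z x \<bullet> grad \<Psi> x"
      unfolding flux_def by (rule inner_symmetric_matrix[OF sym])+
    show ?thesis unfolding fv g0 g1 g2 drift_def
      by (simp add: inner_add_left inner_add_right inner_diff_left s K_def) (simp add: algebra_simps)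
  qed
  note w0 = weak_div_test[OF w(1) t(1)] and w1 = weak_div_test[OF w(2) t(2)] and w2 = weak_div_test[OF w(3) t(3)]
  have "?R2 = (LINT x|lborel. flux A v x \<bullet> grad \<eta>0 x - flux A \<Phi> x \<bullet> grad \<eta>1 x - flux A \<Psi> x \<bullet> grad \<eta>2 x)"
    unfolding pt by simp
  also have "\<dots> = - (LINT x|lborel. D x * \<eta>0 x) + (LINT x|lborel. D\<^sub>\<Phi> x * \<eta>1 x) + (LINT x|lborel. D\<^sub>\<Psi> x * \<eta>2 x)"
    using w0 w1 w2 by simp
  also have "\<dots> = - ?L + ?R1"
  proof -
    have "(LINT x|lborel. D\<^sub>\<Phi> x * \<eta>1 x) + (LINT x|lborel. D\<^sub>\<Psi> x * \<eta>2 x) = ?R1"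
      by (subst Bochner_Integration.integral_add[symmetric, OF w1(3) w2(3)])
         (auto simp: \<eta>1_def \<eta>2_def K_def algebra_simps intro!: Bochner_Integration.integral_cong)
    moreover have "(LINT x|lborel. D x * \<eta>0 x) = ?L"
      by (auto simp: \<eta>0_def mult_ac intro!: Bochner_Integration.integral_cong)
    ultimately show ?thesis by simp
  qed
  finally show "?L = ?R1 - ?R2" by simp
  have cont: "continuous_on UNIV D" "continuous_on UNIV D\<^sub>\<Phi>" "continuous_on UNIV D\<^sub>\<Psi>"
    using w by (auto simp: has_weak_divergence_def)
  have cs: "csupp \<sigma>" using csupp_grad(1)[OF \<sigma>] .
  show "csupp (\<lambda>x. \<sigma> x * (\<Psi> x * D\<^sub>\<Phi> x * (z x * H (z x)) - G (z x) * (\<Psi> x * D\<^sub>\<Phi> x - \<Phi> x * D\<^sub>\<Psi> x)))"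
    by (rule csuppI[OF cs]) (auto intro!: continuous_intros cont C[THEN C1_continuous] CG(1)[THEN C1_continuous] CH(1)[THEN C1_continuous] Cz[THEN C1_continuous])
  show "csupp (\<lambda>x. \<Psi> x * \<sigma> x * H (z x) * D x)"
    by (rule csuppI[OF cs]) (auto intro!: continuous_intros cont C[THEN C1_continuous] CG(1)[THEN C1_continuous] CH(1)[THEN C1_continuous] Cz[THEN C1_continuous])
qed

text \<open>Regularity only: the time derivative and the weak divergence are recorded as data. The
  differential inequality between \<open>v'\<close> and \<open>D\<close> is stated separately each
  time, since it may hold only where \<open>v\<close> has a sign.\<close>

definition parabolic :: "(real ^ 'n \<Rightarrow> real ^ 'n ^ 'n) \<Rightarrow> (real \<Rightarrow> real ^ 'n \<Rightarrow> real) \<Rightarrow>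
    (real \<Rightarrow> real ^ 'n \<Rightarrow> real) \<Rightarrow> (real \<Rightarrow> real ^ 'n \<Rightarrow> real) \<Rightarrow> bool" where
  "parabolic A v v' D \<longleftrightarrow>
     (\<forall>t>0. \<forall>x. ((\<lambda>s. v s x) has_real_derivative v' t x) (at t)) \<and>
     continuous_on ({0<..} \<times> UNIV) (\<lambda>(t, x). v t x) \<and>
     continuous_on ({0<..} \<times> UNIV) (\<lambda>(t, x). v' t x) \<and>
     (\<forall>t>0. weak_sol A (v t) (D t))"

section \<open>The time derivative of a weighted energy\<close>

lemma continuous_on_slice:
  assumes "continuous_on ({0<..} \<times> UNIV) (\<lambda>(t::real, x). v t x)" "t > 0"
  shows "continuous_on S (v t)"
proof -
  have "continuous_on S (\<lambda>x. (t, x))" by (intro continuous_intros)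
  thus ?thesis using continuous_on_compose2[OF assms(1), of S "\<lambda>x. (t, x)"] assms(2) by auto
qed

text \<open>Once the inequality for \<open>v\<close> is inserted, the terms of order zero are at
  most (z H - G) \<Psi> (div(A grad \<Phi>) + q \<Phi>) + G \<Phi> (div(A grad \<Psi>) + q \<Psi>),
  times \<sigma>. Both summands are nonpositive because \<Phi> and \<Psi> are supersolutions and 0
  \<le> G \<le> s H; this is the origin of the conditions on \<open>G\<close>.\<close>

lemma energy_derivative:
  fixes \<Phi> \<Psi> q :: "real ^ 'n \<Rightarrow> real"
  assumes sym: "\<And>x. transpose (A x) = A x"
    and v: "parabolic A v v' D"
    and \<Phi>: "weak_sol A \<Phi> D\<^sub>\<Phi>" "\<And>x. \<Phi> x > 0" "\<And>x. D\<^sub>\<Phi> x \<le> - q x * \<Phi> x"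
    and \<Psi>: "weak_sol A \<Psi> D\<^sub>\<Psi>" "\<And>x. \<Psi> x > 0" "\<And>x. D\<^sub>\<Psi> x \<le> - q x * \<Psi> x"
    and \<sigma>: "\<And>t x. t > 0 \<Longrightarrow> ((\<lambda>s. \<sigma> s x) has_real_derivative \<sigma>' t x) (at t)"
      "continuous_on ({0<..} \<times> UNIV) (\<lambda>(t, x). \<sigma> t x)" "continuous_on ({0<..} \<times> UNIV) (\<lambda>(t, x). \<sigma>' t x)"
      "\<And>t. t > 0 \<Longrightarrow> C1 (\<sigma> t)" "\<And>t x. t > 0 \<Longrightarrow> 0 \<le> \<sigma> t x"
      "\<And>t x. t > 0 \<Longrightarrow> x \<notin> cbox a b \<Longrightarrow> \<sigma> t x = 0"
    and G: "\<And>s. (G has_real_derivative H s) (at s)" "\<And>s. (H has_real_derivative H' s) (at s)" "continuous_on UNIV H'"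
      "\<And>s. 0 \<le> G s" "\<And>s. G s \<le> s * H s"
    and ineq: "\<And>t x. t > 0 \<Longrightarrow> H (v t x / \<Phi> x) * (v' t x - D t x - q x * v t x) \<le> 0"
    and z_def: "z = (\<lambda>t x. v t x / \<Phi> x)"
    and t: "t > 0"
  shows "\<exists>e. ((\<lambda>t. LINT x|lborel. \<Phi> x * \<Psi> x * \<sigma> t x * G (z t x)) has_real_derivative e) (at t) \<and>
     e \<le> (LINT x|lborel. \<Phi> x * \<Psi> x * \<sigma>' t x * G (z t x))
       - (LINT x|lborel. \<Phi> x * \<Psi> x * \<sigma> t x * H' (z t x) * (flux A (z t) x \<bullet> grad (z t) x)
         + \<Phi> x * \<Psi> x * H (z t x) * (flux A (z t) x \<bullet> grad (\<sigma> t) x) + G (z t x) * (drift A \<Phi> \<Psi> x \<bullet> grad (\<sigma> t) x))"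
proof -
  have C: "C1 \<Phi>" "C1 \<Psi>" using \<Phi> \<Psi> by (auto simp: weak_sol_def)
  have \<Phi>0: "\<Phi> x \<noteq> 0" for x using \<Phi>(2)[of x] by simp
  have vd: "((\<lambda>s. v s x) has_real_derivative v' t x) (at t)" if "t > 0" for t x
    using v that by (simp add: parabolic_def)
  have vc: "continuous_on ({0<..} \<times> UNIV) (\<lambda>(t, x). v t x)" "continuous_on ({0<..} \<times> UNIV) (\<lambda>(t, x). v' t x)"
    using v by (auto simp: parabolic_def)
  have wv: "weak_sol A (v t) (D t)" using v t by (simp add: parabolic_def)
  have cG: "continuous_on UNIV G" and cH: "continuous_on UNIV H"
    using G(1,2) DERIV_continuous_on by (metis has_field_derivative_at_within)+
  have c2: "continuous_on ({0<..} \<times> UNIV) (\<lambda>p. g (snd p))" if "continuous_on UNIV g" for g :: "real ^ 'n \<Rightarrow> real"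
    by (rule continuous_on_compose2[OF that]) (auto intro!: continuous_intros)
  note cc = vc[unfolded split_beta] \<sigma>(2,3)[unfolded split_beta] c2[OF C1_continuous[OF C(1)]] c2[OF C1_continuous[OF C(2)]]
  have cz: "continuous_on ({0<..} \<times> UNIV) (\<lambda>p. z (fst p) (snd p))"
    unfolding z_def using \<Phi>0 by (intro continuous_intros cc) auto
  have cGz: "continuous_on ({0<..} \<times> UNIV) (\<lambda>p. G (z (fst p) (snd p)))"
       "continuous_on ({0<..} \<times> UNIV) (\<lambda>p. H (z (fst p) (snd p)))"
    using continuous_on_compose2[OF cG cz] continuous_on_compose2[OF cH cz] by auto
  let ?f = "\<lambda>t x. \<Phi> x * \<Psi> x * \<sigma> t x * G (z t x)"
  let ?f' = "\<lambda>t x. \<Phi> x * \<Psi> x * \<sigma>' t x * G (z t x) + \<Psi> x * \<sigma> t x * H (z t x) * v' t x"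
  have der: "((\<lambda>t. LINT x|lborel. ?f t x) has_real_derivative (LINT x|lborel. ?f' t x)) (at t)"
  proof (rule leibniz_lborel[where I = "{0<..}" and a = a and b = b])
    fix s :: real and x assume "s \<in> {0<..}"
    hence s: "s > 0" by simp
    have "((\<lambda>s. z s x) has_real_derivative v' s x / \<Phi> x) (at s)"
      unfolding z_def by (rule DERIV_cdivide[OF vd[OF s]])
    hence "((\<lambda>s. G (z s x)) has_real_derivative H (z s x) * (v' s x / \<Phi> x)) (at s)"
      by (rule DERIV_chain2[OF G(1)])
    from DERIV_mult[OF DERIV_cmult[OF \<sigma>(1)[OF s], of "\<Phi> x * \<Psi> x"] this]
    show "((\<lambda>s. ?f s x) has_real_derivative ?f' s x) (at s)"
      by (rule DERIV_cong) (use \<Phi>0[of x] in \<open>simp add: field_simps\<close>)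
  next
    show "continuous_on ({0<..} \<times> UNIV) (\<lambda>(s, x). ?f s x)" "continuous_on ({0<..} \<times> UNIV) (\<lambda>(s, x). ?f' s x)"
      unfolding split_beta by (intro continuous_intros cc cGz)+
  qed (use \<sigma> t in auto)
  have T: "test_function (\<sigma> t)" 
  proof -
    have "{x. \<sigma> t x \<noteq> 0} \<subseteq> cbox a b" using \<sigma>(6)[OF t] by auto
    hence "bounded {x. \<sigma> t x \<noteq> 0}" by (rule bounded_subset[OF bounded_cbox])
    thus ?thesis using \<sigma>(4)[OF t] by (simp add: test_function_def)
  qed
  have zt: "z t = (\<lambda>x. v t x / \<Phi> x)" by (simp add: z_def)
  note id = energy_identity[OF sym wv \<Phi>(1,2) \<Psi>(1) T G(1,2,3) zt]
  note sl = continuous_on_slice[of _ t UNIV, OF _ t]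
  have cs: "csupp (\<sigma> t)" by (rule csupp_grad(1)[OF T])
  have s0: "\<sigma>' t x = 0" if "x \<notin> cbox a b" for x
  proof -
    have "((\<lambda>s. 0) has_real_derivative \<sigma>' t x) (at t)"
      by (rule has_field_derivative_transform_within_open[OF \<sigma>(1)[OF t], of "{0<..}"]) (use \<sigma>(6) that t in auto)
    thus ?thesis using DERIV_unique DERIV_const by blast
  qed
  have cs': "csupp (\<sigma>' t)"
  proof -
    have "{x. \<sigma>' t x \<noteq> 0} \<subseteq> cbox a b" using s0 by auto
    hence "bounded {x. \<sigma>' t x \<noteq> 0}" by (rule bounded_subset[OF bounded_cbox])
    thus ?thesis unfolding csupp_def using sl[OF \<sigma>(3)] by simp
  qed
  have Gz: "continuous_on UNIV (\<lambda>x. G (z t x))" "continuous_on UNIV (\<lambda>x. H (z t x))"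
    using sl[of "\<lambda>t x. G (z t x)"] sl[of "\<lambda>t x. H (z t x)"] cGz by (auto simp: split_beta)
  have i1: "integrable lborel (\<lambda>x. \<Phi> x * \<Psi> x * \<sigma>' t x * G (z t x))"
    by (rule csupp_integrable[OF csuppI[OF cs']]) (auto intro!: continuous_intros sl[OF \<sigma>(3)] C[THEN C1_continuous] Gz)
  have i2: "integrable lborel (\<lambda>x. \<Psi> x * \<sigma> t x * H (z t x) * v' t x)"
    by (rule csupp_integrable[OF csuppI[OF cs]]) (auto intro!: continuous_intros sl[OF \<sigma>(2)] sl[OF vc(2)] C[THEN C1_continuous] Gz)
  note i3 = csupp_integrable[OF id(2)] csupp_integrable[OF id(3)]
  let ?P = "\<lambda>x. \<sigma> t x * (\<Psi> x * D\<^sub>\<Phi> x * (z t x * H (z t x)) - G (z t x) * (\<Psi> x * D\<^sub>\<Phi> x - \<Phi> x * D\<^sub>\<Psi> x))"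
  have "(LINT x|lborel. \<Psi> x * \<sigma> t x * H (z t x) * v' t x) - (LINT x|lborel. \<Psi> x * \<sigma> t x * H (z t x) * D t x) + (LINT x|lborel. ?P x)
    = (LINT x|lborel. (\<Psi> x * \<sigma> t x * H (z t x) * v' t x - \<Psi> x * \<sigma> t x * H (z t x) * D t x) + ?P x)"
    using i2 i3 by simp
  also have "\<dots> \<le> (LINT x|(lborel :: (real ^ 'n) measure). 0)"
  proof (rule Bochner_Integration.integral_mono)
    fix x
    have 1: "H (z t x) * (v' t x - D t x) \<le> H (z t x) * (q x * (\<Phi> x * z t x))"
      using ineq[OF t, of x] \<Phi>0[of x] by (simp add: z_def algebra_simps)
    have X: "D\<^sub>\<Phi> x + q x * \<Phi> x \<le> 0" "D\<^sub>\<Psi> x + q x * \<Psi> x \<le> 0" using \<Phi>(3)[of x] \<Psi>(3)[of x] by auto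
    have 2: "(z t x * H (z t x) - G (z t x)) * (\<Psi> x * (D\<^sub>\<Phi> x + q x * \<Phi> x)) \<le> 0"
      "G (z t x) * (\<Phi> x * (D\<^sub>\<Psi> x + q x * \<Psi> x)) \<le> 0"
      using X G(4)[of "z t x"] G(5)[of "z t x"] \<Phi>(2)[of x] \<Psi>(2)[of x]
      by (auto intro!: mult_nonneg_nonpos simp: mult_pos_neg)
    have "(\<Psi> x * \<sigma> t x * H (z t x) * v' t x - \<Psi> x * \<sigma> t x * H (z t x) * D t x) + ?P x
      = \<sigma> t x * (\<Psi> x * (H (z t x) * (v' t x - D t x)) + (\<Psi> x * D\<^sub>\<Phi> x * (z t x * H (z t x)) - G (z t x) * (\<Psi> x * D\<^sub>\<Phi> x - \<Phi> x * D\<^sub>\<Psi> x)))"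
      by (simp add: algebra_simps)
    also have "\<dots> \<le> \<sigma> t x * (\<Psi> x * (H (z t x) * (q x * (\<Phi> x * z t x))) + (\<Psi> x * D\<^sub>\<Phi> x * (z t x * H (z t x)) - G (z t x) * (\<Psi> x * D\<^sub>\<Phi> x - \<Phi> x * D\<^sub>\<Psi> x)))"
      by (intro mult_left_mono[OF add_right_mono[OF mult_left_mono[OF 1]]] less_imp_le[OF \<Psi>(2)] \<sigma>(5)[OF t])
    also have "\<dots> = \<sigma> t x * ((z t x * H (z t x) - G (z t x)) * (\<Psi> x * (D\<^sub>\<Phi> x + q x * \<Phi> x)) + G (z t x) * (\<Phi> x * (D\<^sub>\<Psi> x + q x * \<Psi> x)))"
      by (simp add: algebra_simps)
    also have "\<dots> \<le> 0" using 2 \<sigma>(5)[OF t, of x] by (intro mult_nonneg_nonpos) auto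
    finally show "(\<Psi> x * \<sigma> t x * H (z t x) * v' t x - \<Psi> x * \<sigma> t x * H (z t x) * D t x) + ?P x \<le> 0" .
  qed (use i2 i3 in auto)
  finally have le: "(LINT x|lborel. \<Psi> x * \<sigma> t x * H (z t x) * v' t x) \<le> (LINT x|lborel. \<Psi> x * \<sigma> t x * H (z t x) * D t x) - (LINT x|lborel. ?P x)"
    by simp
  have "(LINT x|lborel. ?f' t x) = (LINT x|lborel. \<Phi> x * \<Psi> x * \<sigma>' t x * G (z t x)) + (LINT x|lborel. \<Psi> x * \<sigma> t x * H (z t x) * v' t x)"
    using i1 i2 by simp
  with le id(1) der show ?thesis by (intro exI[of _ "LINT x|lborel. ?f' t x"]) auto
qed

section \<open>Nash's inequality\<close>

lemma csupp_shift:
  fixes g :: "'a::euclidean_space \<Rightarrow> real"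
  assumes "csupp g"
  shows "csupp (\<lambda>x. g (x + a))"
proof -
  have "{x. g (x + a) \<noteq> 0} = (\<lambda>x. x - a) ` {x. g x \<noteq> 0}"
    by (auto simp: image_iff) (metis add_diff_cancel)
  moreover have "bounded ((\<lambda>x. x - a) ` {x. g x \<noteq> 0})"
    using assms bounded_translation_minus unfolding csupp_def by blast
  moreover have "continuous_on UNIV (\<lambda>x. g (x + a))"
    using assms unfolding csupp_def by (auto intro!: continuous_on_compose2[of UNIV g] continuous_intros)
  ultimately show ?thesis unfolding csupp_def by simp
qed

lemma csupp_measurable: "csupp g \<Longrightarrow> g \<in> borel_measurable borel"
  by (auto simp: csupp_def intro: borel_measurable_continuous_onI)

text \<open>The function \<psi>(s), the integral of f(x) f(x + s h), has \<psi>'(0) = 0 and \<psi>''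
  \<ge> -M, with M the integral of (grad f . h)^2; integrating twice up to s = 1 gives the bound.
  This takes the place of the Fourier transform in the proof of Nash's inequality.\<close>

lemma autocorrelation_lower_bound:
  fixes f :: "real ^ 'n \<Rightarrow> real"
  assumes f: "test_function f"
  shows "(LINT x|lborel. (f x)\<^sup>2) - (LINT x|lborel. (grad f x \<bullet> h)\<^sup>2) / 2 \<le> (LINT x|lborel. f x * f (x + h))"
proof -
  define g where "g = (\<lambda>x. grad f x \<bullet> h)"
  have C: "C1 f" using f by (simp add: test_function_def)
  have cf: "csupp f" by (rule csupp_grad(1)[OF f])
  have cg: "csupp g" unfolding g_def using csupp_inner_grad[OF f, of "\<lambda>_. h"] by (simp add: inner_commute)
  have contf: "continuous_on UNIV f" "continuous_on UNIV g" using cf cg by (auto simp: csupp_def)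
  have dirf: "((\<lambda>s. f (x + s *\<^sub>R k)) has_real_derivative grad f (x + s *\<^sub>R k) \<bullet> k) (at s)" for x s k
  proof -
    have "((\<lambda>s. f (x + s *\<^sub>R k)) has_derivative (\<lambda>r. (r *\<^sub>R k) \<bullet> grad f (x + s *\<^sub>R k))) (at s)"
      by (rule has_derivative_compose[OF _ C1_gderiv[OF C, unfolded gderiv_def]])
         (auto intro!: derivative_eq_intros)
    thus ?thesis unfolding has_field_derivative_def by (simp add: inner_commute mult_commute_abs)
  qed
  let ?I = "{-2<..<2::real}"
  obtain b where b: "\<And>x. x \<notin> cbox (-b) b \<Longrightarrow> f x = 0"
    using csupp_shift_bound[of f 1 0] cf unfolding csupp_def by (metis abs_zero add.right_neutral scaleR_zero_right zero_less_one)
  obtain b' where b': "\<And>x. x \<notin> cbox (-b') b' \<Longrightarrow> g x = 0"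
    using csupp_shift_bound[of g 1 0] cg unfolding csupp_def by (metis abs_zero add.right_neutral scaleR_zero_right zero_less_one)
  define \<psi> where "\<psi> = (\<lambda>s. LINT x|lborel. f x * f (x + s *\<^sub>R h))"
  \<comment> \<open>The translation is moved to the undifferentiated factor, so that the second
    derivative falls on that one and C1 regularity of \<open>f\<close> suffices.\<close>
  define \<psi>' where "\<psi>' = (\<lambda>s. LINT x|lborel. f (x + s *\<^sub>R (-h)) * g x)"
  define M where "M = (LINT x|lborel. (g x)\<^sup>2)"
  have c2: "continuous_on (?I \<times> UNIV) (\<lambda>p. u (snd p + fst p *\<^sub>R k))" if "continuous_on UNIV u" for u :: "real ^ 'n \<Rightarrow> real" and k
    by (rule continuous_on_compose2[OF that]) (auto intro!: continuous_intros)
  have c1: "continuous_on (?I \<times> UNIV) (\<lambda>p. u (snd p))" if "continuous_on UNIV u" for u :: "real ^ 'n \<Rightarrow> real"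
    by (rule continuous_on_compose2[OF that]) (auto intro!: continuous_intros)
  have d1: "(\<psi> has_real_derivative \<psi>' s) (at s)" if "s \<in> ?I" for s
  proof -
    have "(\<psi> has_real_derivative (LINT x|lborel. f x * g (x + s *\<^sub>R h))) (at s)"
      unfolding \<psi>_def
    proof (rule leibniz_lborel[where I = ?I and a = "-b" and b = b])
      show "continuous_on (?I \<times> UNIV) (\<lambda>(s, x). f x * f (x + s *\<^sub>R h))"
        "continuous_on (?I \<times> UNIV) (\<lambda>(s, x). f x * g (x + s *\<^sub>R h))"
        unfolding split_beta by (intro continuous_intros c1 c2 contf)+
      show "((\<lambda>s. f x * f (x + s *\<^sub>R h)) has_real_derivative f x * g (x + s *\<^sub>R h)) (at s)" for s x
        unfolding g_def by (rule DERIV_cmult[OF dirf])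
    qed (use that b in auto)
    also have "(LINT x|lborel. f x * g (x + s *\<^sub>R h)) = \<psi>' s"
    proof -
      have "(\<lambda>x. f (x + s *\<^sub>R (-h)) * g x) \<in> borel_measurable borel"
        by (intro borel_measurable_times csupp_measurable csupp_shift cf cg)
      from integral_lborel_shift[OF this, of "s *\<^sub>R h"] show ?thesis unfolding \<psi>'_def by simp
    qed
    finally show ?thesis .
  qed
  have d2: "\<exists>e. (\<psi>' has_real_derivative e) (at s) \<and> - M \<le> e" if "s \<in> ?I" for s
  proof (intro exI conjI)
    have dirf': "((\<lambda>s. f (x + s *\<^sub>R (-h))) has_real_derivative - g (x + s *\<^sub>R (-h))) (at s)" for x s
      using dirf[of x "-h" s] by (simp add: g_def)
    show "(\<psi>' has_real_derivative (LINT x|lborel. - g (x + s *\<^sub>R (-h)) * g x)) (at s)"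
      unfolding \<psi>'_def
    proof (rule leibniz_lborel[where I = ?I and a = "-b'" and b = b'])
      show "continuous_on (?I \<times> UNIV) (\<lambda>(s, x). f (x + s *\<^sub>R (-h)) * g x)"
        "continuous_on (?I \<times> UNIV) (\<lambda>(s, x). - g (x + s *\<^sub>R (-h)) * g x)"
        unfolding split_beta by (intro continuous_intros c1 c2 contf)+
      show "((\<lambda>s. f (x + s *\<^sub>R (-h)) * g x) has_real_derivative - g (x + s *\<^sub>R (-h)) * g x) (at s)" for s x
        using DERIV_cmult_right[OF dirf'] by blast
    qed (use that b' in auto)
    have cg': "csupp (\<lambda>x. g (x + s *\<^sub>R (-h)))" by (rule csupp_shift[OF cg])
    have sq: "csupp (\<lambda>x. (u x)\<^sup>2)" if "csupp u" for u :: "real ^ 'n \<Rightarrow> real"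
      by (rule csuppI[OF that]) (use that in \<open>auto simp: csupp_def intro!: continuous_intros\<close>)
    have i: "integrable lborel (\<lambda>x. (g x)\<^sup>2)" "integrable lborel (\<lambda>x. (g (x + s *\<^sub>R (-h)))\<^sup>2)"
      by (rule csupp_integrable sq cg cg')+
    have i': "integrable lborel (\<lambda>x. - g (x + s *\<^sub>R (-h)) * g x)"
      by (rule csupp_integrable[OF csupp_mult[OF cg]]) (use cg' in \<open>auto simp: csupp_def intro!: continuous_intros\<close>)
    have "(LINT x|lborel. - (1/2) * (g (x + s *\<^sub>R (-h)))\<^sup>2 - (1/2) * (g x)\<^sup>2) \<le> (LINT x|lborel. - g (x + s *\<^sub>R (-h)) * g x)"
    proof (rule Bochner_Integration.integral_mono)
      show "- (1/2) * (g (x + s *\<^sub>R (-h)))\<^sup>2 - (1/2) * (g x)\<^sup>2 \<le> - g (x + s *\<^sub>R (-h)) * g x" for x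
        using zero_le_power2[of "g (x + s *\<^sub>R (-h)) - g x"] by (simp add: power2_eq_square algebra_simps)
    qed (use i i' in auto)
    also have "(LINT x|lborel. - (1/2) * (g (x + s *\<^sub>R (-h)))\<^sup>2 - (1/2) * (g x)\<^sup>2)
       = - (1/2) * (LINT x|lborel. (g (x + s *\<^sub>R (-h)))\<^sup>2) - (1/2) * M"
      using i by (simp add: M_def)
    also have "(LINT x|lborel. (g (x + s *\<^sub>R (-h)))\<^sup>2) = M"
      unfolding M_def by (rule integral_lborel_shift) (use csupp_measurable[OF cg] in auto)
    finally show "- M \<le> (LINT x|lborel. - g (x + s *\<^sub>R (-h)) * g x)" by simp
  qed
  \<comment> \<open>\<open>\<psi>' 0\<close> is half the integral of the derivative of f^2 in
    direction \<open>h\<close>.\<close>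
  have \<psi>'0: "\<psi>' 0 = 0"
  proof -
    have "(LINT x|lborel. h \<bullet> grad (\<lambda>x. f x * f x) x) = - (LINT x|lborel. 0 * (f x * f x))"
      using weak_div_test(1)[OF weak_div_C1[of "\<lambda>_. h", OF C1_const] test_mult[OF f C]]
      by (simp add: divergence_def grad_const)
    moreover have "h \<bullet> grad (\<lambda>x. f x * f x) x = 2 * (f x * g x)" for x
      unfolding C1_mult(2)[OF C C] g_def inner_add_right inner_scaleR_right inner_commute[of h] by simp
    ultimately show ?thesis by (simp add: \<psi>'_def)
  qed
  have p1: "0 \<le> \<psi>' s + M * s" if "0 \<le> s" "s \<le> 1" for s
  proof -
    have "\<psi>' 0 + M * 0 \<le> \<psi>' s + M * s"
    proof (rule DERIV_nonneg_imp_nondecreasing[OF that(1)])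
      fix r assume r: "0 \<le> r" "r \<le> s"
      hence "r \<in> ?I" using that by simp
      then obtain e where e: "(\<psi>' has_real_derivative e) (at r)" "- M \<le> e" using d2 by blast
      have "((\<lambda>s. \<psi>' s + M * s) has_real_derivative e + M) (at r)"
        by (auto intro!: derivative_eq_intros e)
      thus "\<exists>y. ((\<lambda>s. \<psi>' s + M * s) has_real_derivative y) (at r) \<and> 0 \<le> y" using e(2) by (intro exI[of _ "e + M"]) simp
    qed
    thus ?thesis using \<psi>'0 by simp
  qed
  have "\<psi> 0 + M * 0\<^sup>2 / 2 \<le> \<psi> 1 + M * 1\<^sup>2 / 2"
  proof (rule DERIV_nonneg_imp_nondecreasing[where f = "\<lambda>s. \<psi> s + M * s\<^sup>2 / 2"])
    fix r :: real assume r: "0 \<le> r" "r \<le> 1"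
    have "((\<lambda>s. \<psi> s + M * s\<^sup>2 / 2) has_real_derivative \<psi>' r + M * r) (at r)"
      using r by (auto intro!: derivative_eq_intros d1)
    thus "\<exists>y. ((\<lambda>s. \<psi> s + M * s\<^sup>2 / 2) has_real_derivative y) (at r) \<and> 0 \<le> y" using p1[OF r] by blast
  qed simp
  thus ?thesis by (simp add: \<psi>_def M_def g_def power2_eq_square)
qed

text \<open>The autocorrelation bound is integrated over all \<open>h\<close> in a cube of side
  \<open>r\<close>, where |h|^2 is at most the dimension times r^2; on the other side Tonelli's
  theorem produces the square of the L^1 norm. The scale \<open>r\<close> stays free, so that it can
  be matched to the dissipation in \<open>smoothing_step\<close>.\<close>

lemma nash_inequality:
  fixes f :: "real ^ 'n \<Rightarrow> real"
  assumes f: "test_function f" and r: "r > 0"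
  shows "r ^ CARD('n) * ((LINT x|lborel. (f x)\<^sup>2) - real CARD('n) * r\<^sup>2 / 2 * (LINT x|lborel. (norm (grad f x))\<^sup>2))
     \<le> (LINT x|lborel. \<bar>f x\<bar>)\<^sup>2" (is "_ * ?c \<le> _")
proof -
  define Q where "Q = cbox (0 :: real ^ 'n) (\<chi> i. r)"
  have cf: "csupp f" by (rule csupp_grad(1)[OF f])
  have mf[measurable]: "f \<in> borel_measurable borel" by (rule csupp_measurable[OF cf])
  have iabs: "integrable lborel (\<lambda>x. \<bar>f x\<bar>)" using csupp_integrable[OF cf] by simp
  have ig: "integrable lborel (\<lambda>x. (norm (grad f x))\<^sup>2)" "integrable lborel (\<lambda>x. (grad f x \<bullet> h)\<^sup>2)" for h
    using csupp_grad(2)[OF f] C1_continuous_grad[of f] f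
    by (auto intro!: csupp_integrable continuous_intros simp: csupp_def test_function_def elim!: bounded_subset)
  have low: "?c \<le> (LINT x|lborel. f x * f (x + h))" if "h \<in> Q" for h
  proof -
    have "(norm h)\<^sup>2 = (\<Sum>i\<in>UNIV. (h $ i)\<^sup>2)"
      by (simp add: norm_vec_def L2_set_def sum_nonneg)
    also have "\<dots> \<le> (\<Sum>i\<in>(UNIV::'n set). r\<^sup>2)"
      using that by (intro sum_mono power_mono) (auto simp: Q_def mem_box_cart)
    finally have h: "(norm h)\<^sup>2 \<le> real CARD('n) * r\<^sup>2" by simp
    have "(LINT x|lborel. (grad f x \<bullet> h)\<^sup>2) \<le> (LINT x|lborel. real CARD('n) * r\<^sup>2 * (norm (grad f x))\<^sup>2)"
    proof (rule Bochner_Integration.integral_mono)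
      fix x
      have "(grad f x \<bullet> h)\<^sup>2 \<le> (norm (grad f x) * norm h)\<^sup>2"
        using Cauchy_Schwarz_ineq2 by (metis abs_ge_zero power2_abs power_mono)
      also have "\<dots> \<le> real CARD('n) * r\<^sup>2 * (norm (grad f x))\<^sup>2"
        using mult_right_mono[OF h zero_le_power2[of "norm (grad f x)"]] by (simp add: power_mult_distrib mult.commute)
      finally show "(grad f x \<bullet> h)\<^sup>2 \<le> real CARD('n) * r\<^sup>2 * (norm (grad f x))\<^sup>2" .
    qed (use ig in auto)
    thus ?thesis using autocorrelation_lower_bound[OF f, of h] by simp
  qed
  \<comment> \<open>\<open>ennreal\<close> sends a negative \<open>?c\<close> to 0, which covers the
    trivial case silently.\<close>
  have "ennreal ?c * emeasure lborel Q = (\<integral>\<^sup>+h. ennreal ?c * indicator Q h \<partial>lborel)"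
    by (simp add: Q_def nn_integral_cmult_indicator)
  also have "\<dots> \<le> (\<integral>\<^sup>+h. (\<integral>\<^sup>+x. ennreal (\<bar>f x\<bar> * \<bar>f (x + h)\<bar>) \<partial>lborel) \<partial>lborel)"
  proof (rule nn_integral_mono)
    fix h :: "real ^ 'n"
    have i: "integrable lborel (\<lambda>x. f x * f (x + h))"
      by (rule csupp_integrable[OF csuppI[OF cf]]) (use cf csupp_shift[OF cf, of h] in \<open>auto simp: csupp_def intro!: continuous_intros\<close>)
    have "ennreal ?c \<le> (\<integral>\<^sup>+x. ennreal (\<bar>f x\<bar> * \<bar>f (x + h)\<bar>) \<partial>lborel)" if "h \<in> Q"
    proof -
      have "?c \<le> (LINT x|lborel. \<bar>f x * f (x + h)\<bar>)"
        using low[OF that] integral_abs_bound[of lborel "\<lambda>x. f x * f (x + h)"] by linarith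
      also have "ennreal \<dots> = (\<integral>\<^sup>+x. ennreal \<bar>f x * f (x + h)\<bar> \<partial>lborel)"
        by (rule nn_integral_eq_integral[symmetric]) (use i in auto)
      finally show ?thesis by (simp add: abs_mult ennreal_leI)
    qed
    thus "ennreal ?c * indicator Q h \<le> (\<integral>\<^sup>+x. ennreal (\<bar>f x\<bar> * \<bar>f (x + h)\<bar>) \<partial>lborel)"
      by (auto simp: indicator_def)
  qed
  also have "\<dots> = (\<integral>\<^sup>+x. (\<integral>\<^sup>+h. ennreal (\<bar>f x\<bar> * \<bar>f (x + h)\<bar>) \<partial>lborel) \<partial>lborel)"
    by (rule lborel_pair.Fubini') measurable
  also have "\<dots> = (\<integral>\<^sup>+x. ennreal \<bar>f x\<bar> * ennreal (LINT y|lborel. \<bar>f y\<bar>) \<partial>lborel)"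
  proof (rule nn_integral_cong)
    fix x :: "real ^ 'n"
    have "(\<integral>\<^sup>+h. ennreal (\<bar>f x\<bar> * \<bar>f (x + h)\<bar>) \<partial>lborel) = ennreal \<bar>f x\<bar> * (\<integral>\<^sup>+h. ennreal \<bar>f (x + h)\<bar> \<partial>lborel)"
      by (simp add: ennreal_mult nn_integral_cmult)
    also have "(\<integral>\<^sup>+h. ennreal \<bar>f (x + h)\<bar> \<partial>lborel) = ennreal (LINT h|lborel. \<bar>f (h + x)\<bar>)"
      using csupp_integrable[OF csupp_shift[OF cf, of x]] by (subst nn_integral_eq_integral) (auto simp: add.commute)
    also have "(LINT h|lborel. \<bar>f (h + x)\<bar>) = (LINT y|lborel. \<bar>f y\<bar>)"
      by (rule integral_lborel_shift) measurable
    finally show "(\<integral>\<^sup>+h. ennreal (\<bar>f x\<bar> * \<bar>f (x + h)\<bar>) \<partial>lborel) = ennreal \<bar>f x\<bar> * ennreal (LINT y|lborel. \<bar>f y\<bar>)" .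
  qed
  also have "\<dots> = ennreal (LINT y|lborel. \<bar>f y\<bar>) * ennreal (LINT y|lborel. \<bar>f y\<bar>)"
    by (simp add: nn_integral_multc nn_integral_eq_integral[OF iabs])
  also have "emeasure lborel Q = ennreal (r ^ CARD('n))"
  proof -
    have "measure lborel Q = (\<Prod>i\<in>(UNIV::'n set). r)"
      unfolding Q_def using r by (subst content_cbox_cart) (auto simp: interval_ne_empty_cart)
    thus ?thesis using emeasure_eq_ennreal_measure[of lborel Q] emeasure_lborel_cbox_finite[of "0 :: real ^ 'n" "\<chi> i. r"]
      by (simp add: Q_def top.not_eq_extremum)
  qed
  finally have "ennreal (?c * r ^ CARD('n)) \<le> ennreal ((LINT y|lborel. \<bar>f y\<bar>)\<^sup>2)"
    using r by (simp add: ennreal_mult'' power2_eq_square integral_nonneg)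
  thus ?thesis by (simp add: mult.commute)
qed

lemma integrable_gaussian:
  fixes a b :: real
  assumes b: "b > 0"
  shows "integrable lborel (\<lambda>x :: real ^ 'n. exp (a * norm x - b * (x \<bullet> x)))" (is "integrable _ ?g")
proof -
  let ?n = "CARD('n)"
  define V where "V = unit_ball_vol (real ?n)"
  have V: "V > 0" by (simp add: V_def)
  define C where "C = V * exp ((\<bar>a\<bar> + ?n + 1)\<^sup>2 / (4 * b))"
  \<comment> \<open>Chosen so that the k-th term of the majorant, \<open>c k\<close> on the ball of
    radius k + 1, has integral C / 2^k.\<close>
  define c where "c k = C / (V * 2 ^ k * (real k + 1) ^ ?n)" for k :: nat
  have C: "C > 0" using V by (simp add: C_def)
  have mg: "?g \<in> borel_measurable lborel" by measurable
  have pt: "ennreal (?g x) \<le> (\<Sum>k. ennreal (c k) * indicator (cball 0 (real k + 1)) x)" for x :: "real ^ 'n"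
  proof -
    define k where "k = nat \<lfloor>norm x\<rfloor>"
    have "0 \<le> \<lfloor>norm x\<rfloor>" by simp
    hence "real k = of_int \<lfloor>norm x\<rfloor>" by (simp add: k_def)
    hence k: "real k \<le> norm x" "norm x \<le> real k + 1" by linarith+
    have "2 ^ k * (real k + 1) ^ ?n \<le> exp (real k) * exp (real k) ^ ?n"
    proof (intro mult_mono power_mono)
      have "(2::real) ^ k \<le> exp 1 ^ k" by (intro power_mono exp_ge_add_one_self[of 1, simplified]) (auto intro: order_trans[OF _ exp_ge_add_one_self[of 1]])
      thus "2 ^ k \<le> exp (real k)" by (simp add: exp_of_nat_mult[symmetric])
    qed (auto simp: add.commute)
    also have "\<dots> = exp ((?n + 1) * real k)" by (simp add: exp_of_nat_mult[symmetric] exp_add[symmetric] algebra_simps)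
    also have "\<dots> \<le> exp ((?n + 1) * norm x)" using k by simp
    finally have 1: "2 ^ k * (real k + 1) ^ ?n \<le> exp ((?n + 1) * norm x)" .
    \<comment> \<open>Completion of the square in \<open>norm x\<close>; the summand
      \<open>(?n + 1) * norm x\<close> pays for the growth of the denominator of
      \<open>c k\<close>.\<close>
    have 2: "(?n + 1) * norm x + (a * norm x - b * (x \<bullet> x)) \<le> (\<bar>a\<bar> + ?n + 1)\<^sup>2 / (4 * b)"
    proof -
      define s where "s = \<bar>a\<bar> + ?n + 1"
      have "(?n + 1) * norm x + a * norm x \<le> s * norm x"
        using mult_right_mono[OF abs_ge_self[of a] norm_ge_zero[of x]] by (simp add: s_def algebra_simps)
      moreover have "s * norm x - b * (norm x)\<^sup>2 \<le> s\<^sup>2 / (4 * b)"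
        using zero_le_power2[of "s - 2 * b * norm x"] b by (simp add: field_simps power2_eq_square)
      ultimately show ?thesis by (simp add: s_def power2_norm_eq_inner)
    qed
    have "?g x * (V * (2 ^ k * (real k + 1) ^ ?n)) \<le> ?g x * (V * exp ((?n + 1) * norm x))"
      using 1 V by (intro mult_left_mono) auto
    also have "\<dots> = V * exp ((?n + 1) * norm x + (a * norm x - b * (x \<bullet> x)))"
      unfolding exp_add[of "(?n + 1) * norm x"] by simp
    also have "\<dots> \<le> C" using 2 V by (simp add: C_def)
    finally have "?g x \<le> c k" using V by (simp add: c_def field_simps)
    define u :: "nat \<Rightarrow> ennreal" where "u = (\<lambda>i. ennreal (c i) * indicator (cball 0 (real i + 1)) x)"
    have "ennreal (?g x) \<le> u k"
      using k \<open>?g x \<le> c k\<close> by (auto simp: indicator_def u_def intro: ennreal_leI)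
    also have "\<dots> = sum u {k}" by simp
    also have "\<dots> \<le> (\<Sum>i. u i)"
      by (intro sum_le_suminf) auto
    finally show ?thesis by (simp add: u_def)
  qed
  have "(\<integral>\<^sup>+x. ennreal (?g x) \<partial>lborel) \<le> (\<integral>\<^sup>+x. (\<Sum>k. ennreal (c k) * indicator (cball (0::real^'n) (real k + 1)) x) \<partial>lborel)"
    by (rule nn_integral_mono) (rule pt)
  also have "\<dots> = (\<Sum>k. (\<integral>\<^sup>+x. ennreal (c k) * indicator (cball (0::real^'n) (real k + 1)) x \<partial>lborel))"
    by (rule nn_integral_suminf) (intro borel_measurable_times_ennreal borel_measurable_const borel_measurable_indicator, simp)
  also have "\<dots> = (\<Sum>k. ennreal (C * (1/2) ^ k))"
  proof (rule suminf_cong)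
    fix k
    have "(\<integral>\<^sup>+x. ennreal (c k) * indicator (cball (0::real^'n) (real k + 1)) x \<partial>lborel) = ennreal (c k) * ennreal (V * (real k + 1) ^ ?n)"
      by (subst nn_integral_cmult_indicator) (auto simp: emeasure_cball V_def)
    also have "\<dots> = ennreal (c k * (V * (real k + 1) ^ ?n))" 
      by (rule ennreal_mult[symmetric]) (use V C in \<open>auto simp: c_def\<close>)
    also have "c k * (V * (real k + 1) ^ ?n) = C * (1/2) ^ k"
      using V by (simp add: c_def field_simps)
    finally show "(\<integral>\<^sup>+x. ennreal (c k) * indicator (cball (0::real^'n) (real k + 1)) x \<partial>lborel) = ennreal (C * (1/2) ^ k)" .
  qed
  also have "\<dots> = ennreal (\<Sum>k. C * (1/2) ^ k)"
    using C by (intro suminf_ennreal2) (auto intro!: summable_mult summable_geometric)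
  also have "\<dots> < \<infinity>" by simp
  finally show ?thesis using mg by (intro integrableI_bounded) auto
qed

section \<open>Weighted energy estimates\<close>

lemma DERIV_pos_part_power:
  "((\<lambda>s :: real. (max 0 s) ^ Suc (Suc n)) has_real_derivative real (n + 2) * (max 0 s) ^ Suc n) (at s)"
proof -
  consider "s > 0" | "s < 0" | "s = 0" by linarith
  thus ?thesis
  proof cases
    case 1
    have "((\<lambda>s :: real. s ^ Suc (Suc n)) has_real_derivative real (n + 2) * s ^ Suc n) (at s)"
      using DERIV_pow[of "Suc (Suc n)" s UNIV] by simp
    hence "((\<lambda>s :: real. (max 0 s) ^ Suc (Suc n)) has_real_derivative real (n + 2) * s ^ Suc n) (at s)"
      by (rule has_field_derivative_transform_within_open[of _ _ _ "{0<..}"]) (use 1 in auto)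
    thus ?thesis using 1 by simp
  next
    case 2
    have "((\<lambda>s :: real. 0) has_real_derivative 0) (at s)" by simp
    hence "((\<lambda>s :: real. (max 0 s) ^ Suc (Suc n)) has_real_derivative 0) (at s)"
      by (rule has_field_derivative_transform_within_open[of _ _ _ "{..<0}"]) (use 2 in \<open>auto simp: max_def\<close>)
    thus ?thesis using 2 by simp
  next
    case 3
    have "((\<lambda>h :: real. (max 0 h) ^ Suc (Suc n) / h) \<longlongrightarrow> 0) (at 0)"
    proof (rule Lim_null_comparison)
      show "\<forall>\<^sub>F h :: real in at 0. norm ((max 0 h) ^ Suc (Suc n) / h) \<le> (max 0 h) ^ Suc n"
        by (auto intro!: always_eventually simp: max_def)
      have "((\<lambda>h :: real. (max 0 h) ^ Suc n) \<longlongrightarrow> (max 0 0) ^ Suc n) (at 0)"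
        by (intro tendsto_intros)
      thus "((\<lambda>h :: real. (max 0 h) ^ Suc n) \<longlongrightarrow> 0) (at 0)" by simp
    qed
    thus ?thesis using 3 by (simp add: has_field_derivative_iff)
  qed
qed

text \<open>The square makes the truncated parabola continuously differentiable across the sphere of
  radius R.\<close>

definition cutoff :: "real \<Rightarrow> real ^ 'n \<Rightarrow> real" where
  "cutoff R x = (max 0 (1 - (x \<bullet> x) / R\<^sup>2))\<^sup>2"

lemma cutoff_bounds: "0 \<le> cutoff R x" "cutoff R x \<le> 1"
proof -
  show "0 \<le> cutoff R x" by (simp add: cutoff_def)
  have "max 0 (1 - (x \<bullet> x) / R\<^sup>2) \<le> 1" by simp
  thus "cutoff R x \<le> 1" unfolding cutoff_def by (intro power_le_one) auto
qed

lemma C1_cutoff: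
  fixes R :: real
  assumes R: "R > 0"
  shows "C1 (cutoff R :: real ^ 'n \<Rightarrow> real)"
    and "grad (cutoff R) x = - (4 * max 0 (1 - (x \<bullet> x) / R\<^sup>2) / R\<^sup>2) *\<^sub>R (x :: real ^ 'n)"
proof -
  have d: "((\<lambda>s. (max 0 (1 - s / R\<^sup>2))\<^sup>2) has_real_derivative - (2 / R\<^sup>2) * max 0 (1 - s / R\<^sup>2)) (at s)" for s
  proof -
    have 1: "((\<lambda>s. 1 - s / R\<^sup>2) has_real_derivative - (1 / R\<^sup>2)) (at s)"
      using DERIV_diff[OF DERIV_const DERIV_cdivide[OF DERIV_ident]] by simp
    show ?thesis using DERIV_chain2[OF DERIV_pos_part_power[of 0] 1] by (simp add: numeral_2_eq_2 mult.commute)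
  qed
  have c: "continuous_on UNIV (\<lambda>s. - (2 / R\<^sup>2) * max 0 (1 - s / R\<^sup>2))"
    using R by (intro continuous_intros) auto
  have e: "cutoff R = (\<lambda>x :: real ^ 'n. (max 0 (1 - ((x - 0) \<bullet> (x - 0)) / R\<^sup>2))\<^sup>2)"
    by (simp add: cutoff_def fun_eq_iff)
  note * = C1_compose[OF C1_sqnorm d c, of 0]
  show "C1 (cutoff R :: real ^ 'n \<Rightarrow> real)" unfolding e by (rule *(1))
  show "grad (cutoff R) x = - (4 * max 0 (1 - (x \<bullet> x) / R\<^sup>2) / R\<^sup>2) *\<^sub>R x"
    unfolding e *(2) grad_sqnorm by simp
qed

lemma cutoff_outside:
  assumes "R > 0" "norm x \<ge> R"
  shows "cutoff R x = 0"
proof -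
  have "R\<^sup>2 \<le> x \<bullet> x" using assms by (metis less_imp_le power2_norm_eq_inner power_mono)
  thus ?thesis using assms by (simp add: cutoff_def)
qed

lemma norm_grad_cutoff:
  assumes R: "R > 0"
  shows "norm (grad (cutoff R) x) \<le> 4 / R"
proof (cases "norm x \<le> R")
  case True
  have "max 0 (1 - (x \<bullet> x) / R\<^sup>2) * norm x \<le> 1 * R" using True R by (intro mult_mono) auto
  hence "4 / R\<^sup>2 * (max 0 (1 - (x \<bullet> x) / R\<^sup>2) * norm x) \<le> 4 / R\<^sup>2 * (1 * R)" by (intro mult_left_mono) auto
  also have "\<dots> = 4 / R" using R by (simp add: power2_eq_square)
  finally show ?thesis using C1_cutoff(2)[OF R, of x] by (simp add: mult_ac)
next
  case False
  hence "R\<^sup>2 \<le> x \<bullet> x" using R by (metis less_imp_le power2_norm_eq_inner power_mono linear)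
  thus ?thesis using R C1_cutoff(2)[OF R, of x] by simp
qed

text \<open>The rate of the Gaussian grows with time: differentiation in \<open>t\<close> yields
  -\<beta> |x|^2 times the weight, and against this term the gradient of the weight, of size \<beta>
  |x| times the weight, is played off. The cutoff only provides compact support.\<close>

definition gwt :: "real \<Rightarrow> real \<Rightarrow> real \<Rightarrow> real ^ 'n \<Rightarrow> real" where
  "gwt \<beta> R t x = exp (- (\<beta> * (1 + t)) * (x \<bullet> x)) * cutoff R x"

lemma gwt_bounds:
  assumes "\<beta> > 0" "t \<ge> 0"
  shows "0 \<le> gwt \<beta> R t x" "gwt \<beta> R t x \<le> exp (- \<beta> * (x \<bullet> x))"
proof -
  show "0 \<le> gwt \<beta> R t x" by (simp add: gwt_def cutoff_bounds)
  have "\<beta> * (x \<bullet> x) * 1 \<le> \<beta> * (x \<bullet> x) * (1 + t)" using assms by (intro mult_left_mono) auto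
  hence "gwt \<beta> R t x \<le> exp (- \<beta> * (x \<bullet> x)) * 1"
    unfolding gwt_def by (intro mult_mono) (auto simp: cutoff_bounds algebra_simps)
  thus "gwt \<beta> R t x \<le> exp (- \<beta> * (x \<bullet> x))" by simp
qed

lemma C1_gwt:
  assumes R: "R > 0"
  shows "C1 (gwt \<beta> R t :: real ^ 'n \<Rightarrow> real)"
    and "grad (gwt \<beta> R t) x = exp (- (\<beta> * (1 + t)) * (x \<bullet> x)) *\<^sub>R grad (cutoff R) x
           - (2 * \<beta> * (1 + t) * gwt \<beta> R t x) *\<^sub>R (x :: real ^ 'n)"
proof -
  have d: "((\<lambda>s. exp (- (\<beta> * (1 + t)) * s)) has_real_derivative - (\<beta> * (1 + t)) * exp (- (\<beta> * (1 + t)) * s)) (at s)" for s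
    by (auto intro!: derivative_eq_intros)
  have c: "continuous_on UNIV (\<lambda>s. - (\<beta> * (1 + t)) * exp (- (\<beta> * (1 + t)) * s))"
    by (intro continuous_intros)
  have e: "gwt \<beta> R t = (\<lambda>x :: real ^ 'n. exp (- (\<beta> * (1 + t)) * ((x - 0) \<bullet> (x - 0))) * cutoff R x)"
    by (simp add: gwt_def fun_eq_iff)
  note * = C1_compose[OF C1_sqnorm d c, of 0]
  show "C1 (gwt \<beta> R t :: real ^ 'n \<Rightarrow> real)" unfolding e by (rule C1_mult(1)[OF *(1) C1_cutoff(1)[OF R]])
  show "grad (gwt \<beta> R t) x = exp (- (\<beta> * (1 + t)) * (x \<bullet> x)) *\<^sub>R grad (cutoff R) x
           - (2 * \<beta> * (1 + t) * gwt \<beta> R t x) *\<^sub>R x"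
    unfolding e C1_mult(2)[OF *(1) C1_cutoff(1)[OF R]] *(2) grad_sqnorm by (simp add: mult_ac)
qed

lemma norm_grad_gwt:
  assumes "R > 0" "\<beta> > 0" "t \<ge> 0"
  shows "norm (grad (gwt \<beta> R t) x) \<le> 2 * \<beta> * (1 + t) * norm x * gwt \<beta> R t x + 4 / R * exp (- \<beta> * (x \<bullet> x))"
proof -
  have "\<beta> * (x \<bullet> x) * 1 \<le> \<beta> * (x \<bullet> x) * (1 + t)" using assms by (intro mult_left_mono) auto
  hence 1: "exp (- (\<beta> * (1 + t)) * (x \<bullet> x)) \<le> exp (- \<beta> * (x \<bullet> x))" by (simp add: algebra_simps)
  have "norm (grad (gwt \<beta> R t) x) \<le> norm (exp (- (\<beta> * (1 + t)) * (x \<bullet> x)) *\<^sub>R grad (cutoff R) x) + norm ((2 * \<beta> * (1 + t) * gwt \<beta> R t x) *\<^sub>R x)"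
    unfolding C1_gwt(2)[OF assms(1)] by (rule norm_triangle_ineq4)
  also have "\<dots> \<le> exp (- \<beta> * (x \<bullet> x)) * (4 / R) + 2 * \<beta> * (1 + t) * gwt \<beta> R t x * norm x"
  proof (intro add_mono)
    show "norm (exp (- (\<beta> * (1 + t)) * (x \<bullet> x)) *\<^sub>R grad (cutoff R) x) \<le> exp (- \<beta> * (x \<bullet> x)) * (4 / R)"
      unfolding norm_scaleR abs_exp_cancel using 1 norm_grad_cutoff[OF assms(1)] by (intro mult_mono) auto
  qed (use assms in \<open>auto simp: abs_mult abs_of_nonneg[OF gwt_bounds(1)[OF assms(2,3)]]\<close>)
  finally show ?thesis by (simp add: mult_ac)
qed

lemma continuous_on_gwt:
  fixes R :: real
  assumes "R > 0"
  shows "continuous_on S (\<lambda>p :: real \<times> (real ^ 'n). gwt \<beta> R (fst p) (snd p))"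
  unfolding gwt_def cutoff_def using assms by (intro continuous_intros) auto

lemma gwt_deriv:
  "((\<lambda>s. gwt \<beta> R s x) has_real_derivative - (\<beta> * (x \<bullet> x)) * gwt \<beta> R t x) (at t)"
  unfolding gwt_def by (auto intro!: derivative_eq_intros simp: algebra_simps)

text \<open>Read \<open>y\<close> as grad z, \<open>\<rho>\<close> as the weight and
  \<open>s\<close> as its gradient, \<open>X\<close> as |x|, \<open>\<tau>\<close> as 1 + T,
  \<open>E\<close> as the Gaussian without cutoff. The time derivative of the weight gives the good
  term -2 m \<beta> X^2 \<rho>^2 G; one half of it absorbs the square of \<open>s\<close>, the other
  the drift. The negative term with G |s|^2 is retained because \<open>smoothing_step\<close> has to
  control the gradient of z^N \<rho>.\<close>

lemma weight_pointwise:
  fixes M :: "real ^ 'n ^ 'n" and y s B :: "real ^ 'n"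
  assumes sym: "transpose M = M" and ell: "\<And>y. \<alpha> * (norm y)\<^sup>2 \<le> (M *v y) \<bullet> y" "\<alpha> > 0"
    and bd: "\<And>y. norm (M *v y) \<le> \<Lambda> * norm y" "0 \<le> \<Lambda>"
    and m: "0 < m0" "m0 \<le> m" "m \<le> m1" and B: "norm B \<le> b"
    and G: "0 \<le> G" "0 \<le> H'" "H\<^sup>2 \<le> 2 * G * H'"
    and s: "norm s \<le> 2 * \<beta> * \<tau> * X * \<rho> + 4 / R * E" and \<rho>: "0 \<le> \<rho>" "\<rho> \<le> E"
    and \<beta>: "0 < \<beta>" "8 * \<beta> * (4 * m1 * \<Lambda> + \<alpha> * m0) * \<tau>\<^sup>2 \<le> m0" and R: "R \<ge> 1" and X: "0 \<le> X" "0 \<le> \<tau>"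
    and K: "K = 4 * b\<^sup>2 * \<tau>\<^sup>2 / m0 + 128 * m1 * \<Lambda> + 32 * \<alpha> * m0 + 8 * b"
  shows "m * (2 * \<rho> * (- (\<beta> * X\<^sup>2) * \<rho>)) * G
      - (m * \<rho>\<^sup>2 * H' * ((M *v y) \<bullet> y) + m * H * ((M *v y) \<bullet> ((2 * \<rho>) *\<^sub>R s)) + G * (B \<bullet> ((2 * \<rho>) *\<^sub>R s)))
    \<le> - (\<alpha> * m0 / 2) * (\<rho>\<^sup>2 * H' * (norm y)\<^sup>2) - \<alpha> * m0 * (G * (norm s)\<^sup>2) + K * \<beta> * (\<rho>\<^sup>2 * G) + K / R * (E\<^sup>2 * G)"
proof -
  have E: "0 \<le> E" using \<rho> by linarith
  have b: "0 \<le> b" using B norm_ge_zero order_trans by blast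
  have m1: "0 \<le> m1" "0 \<le> m" using m by linarith+
  define P Q S where "P = (M *v y) \<bullet> y" "Q = (M *v y) \<bullet> s" "S = (M *v s) \<bullet> s"
  have psd: "0 \<le> (M *v u) \<bullet> u" for u
    using ell by (meson mult_nonneg_nonneg order_trans less_imp_le zero_le_power2)
  have P: "0 \<le> P" "0 \<le> S" unfolding P_Q_S_def by (rule psd)+
  \<comment> \<open>Nonnegativity of the quadratic form of \<open>M\<close> at \<rho> H' y + 2 H s,
    combined with H^2 \<le> 2 G H'.\<close>
  have cross: "- (\<rho>\<^sup>2 * H' * P) - 2 * \<rho> * H * Q \<le> - (\<rho>\<^sup>2 * H' * P) / 2 + 4 * G * S"
  proof (cases "H' = 0")
    case True
    hence "H = 0" using G by simp
    thus ?thesis using True G P by simp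
  next
    case False
    hence H': "H' > 0" using G by simp
    have "0 \<le> (M *v ((\<rho> * H') *\<^sub>R y + (2 * H) *\<^sub>R s)) \<bullet> ((\<rho> * H') *\<^sub>R y + (2 * H) *\<^sub>R s)" by (rule psd)
    also have "\<dots> = \<rho>\<^sup>2 * H'\<^sup>2 * P + 4 * \<rho> * H * H' * Q + 4 * H\<^sup>2 * S"
      unfolding P_Q_S_def
      using inner_symmetric_matrix[OF sym, of s y]
      by (simp add: matrix_vector_right_distrib matrix_vector_mult_scaleR inner_add_left inner_add_right power2_eq_square algebra_simps)
    also have "\<dots> \<le> \<rho>\<^sup>2 * H'\<^sup>2 * P + 4 * \<rho> * H * H' * Q + 4 * (2 * G * H') * S"
      using G P by (intro add_left_mono mult_right_mono mult_left_mono) auto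
    also have "\<dots> = (2 * H') * (\<rho>\<^sup>2 * H' * P / 2 + 2 * \<rho> * H * Q + 4 * G * S)"
      by (simp add: algebra_simps power2_eq_square)
    finally have "0 \<le> \<rho>\<^sup>2 * H' * P / 2 + 2 * \<rho> * H * Q + 4 * G * S"
      using H' by (simp add: zero_le_mult_iff)
    thus ?thesis by simp
  qed
  define n where "n = norm s"
  have n: "0 \<le> n" by (simp add: n_def)
  have Pn: "\<alpha> * (norm y)\<^sup>2 \<le> P" using ell by (simp add: P_Q_S_def)
  have Sn: "S \<le> \<Lambda> * n\<^sup>2"
  proof -
    have "S \<le> norm (M *v s) * norm s" unfolding P_Q_S_def by (rule norm_cauchy_schwarz)
    also have "\<dots> \<le> \<Lambda> * norm s * norm s" using bd by (intro mult_right_mono) auto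
    finally show ?thesis by (simp add: n_def power2_eq_square mult.assoc)
  qed
  have Bn: "- (B \<bullet> s) \<le> b * n"
  proof -
    have "- (B \<bullet> s) \<le> norm B * norm s" using Cauchy_Schwarz_ineq2[of B s] by linarith
    also have "\<dots> \<le> b * n" unfolding n_def using B by (intro mult_right_mono) auto
    finally show ?thesis .
  qed
  have nn: "n \<le> 2 * \<beta> * \<tau> * X * \<rho> + 4 / R * E" using s by (simp add: n_def)
  have R': "1 / R \<le> 1" "0 < 1 / R" using R by auto
  have sq: "(a + b)\<^sup>2 \<le> 2 * a\<^sup>2 + 2 * b\<^sup>2" for a b :: real
    using sum_squares_bound[of a b] by (simp add: power2_sum)
  have n2: "n\<^sup>2 \<le> 8 * \<beta>\<^sup>2 * \<tau>\<^sup>2 * X\<^sup>2 * \<rho>\<^sup>2 + 32 / R * E\<^sup>2"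
  proof -
    have "n\<^sup>2 \<le> (2 * \<beta> * \<tau> * X * \<rho> + 4 / R * E)\<^sup>2" using nn n by (intro power_mono)
    also have "\<dots> \<le> 2 * (2 * \<beta> * \<tau> * X * \<rho>)\<^sup>2 + 2 * (4 / R * E)\<^sup>2"
      by (rule sq)
    also have "(4 / R * E)\<^sup>2 = 16 * (1 / R) * (1 / R) * E\<^sup>2" by (simp add: power2_eq_square)
    also have "\<dots> \<le> 16 * (1 / R) * 1 * E\<^sup>2"
      by (rule mult_right_mono[OF mult_left_mono[OF R'(1)]]) (use R in auto)
    finally show ?thesis by (simp add: power_mult_distrib)
  qed
  have rn: "2 * b * \<rho> * n \<le> \<beta> * \<rho>\<^sup>2 * (m0 * X\<^sup>2 + 4 * b\<^sup>2 * \<tau>\<^sup>2 / m0) + 8 * b / R * E\<^sup>2"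
  proof -
    have "2 * b * \<rho> * n \<le> 2 * b * \<rho> * (2 * \<beta> * \<tau> * X * \<rho> + 4 / R * E)"
      using nn b \<rho> by (intro mult_left_mono) auto
    also have "\<dots> = \<beta> * \<rho>\<^sup>2 * (4 * b * \<tau> * X) + 8 * b / R * (\<rho> * E)" by (simp add: power2_eq_square algebra_simps)
    also have "\<dots> \<le> \<beta> * \<rho>\<^sup>2 * (m0 * X\<^sup>2 + 4 * b\<^sup>2 * \<tau>\<^sup>2 / m0) + 8 * b / R * E\<^sup>2"
    proof (intro add_mono mult_left_mono)
      have "0 \<le> (m0 * X - 2 * b * \<tau>)\<^sup>2 / m0" using m by simp
      also have "\<dots> = m0 * X\<^sup>2 + 4 * b\<^sup>2 * \<tau>\<^sup>2 / m0 - 4 * b * \<tau> * X" using m by (simp add: power2_eq_square field_simps)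
      finally show "4 * b * \<tau> * X \<le> m0 * X\<^sup>2 + 4 * b\<^sup>2 * \<tau>\<^sup>2 / m0" by simp
      show "\<rho> * E \<le> E\<^sup>2" using \<rho> E by (simp add: power2_eq_square mult_right_mono)
    qed (use \<beta> b R in auto)
    finally show ?thesis .
  qed
  \<comment> \<open>The part 4 m1 \<Lambda> comes from the cross term, \<alpha> m0 from the term
    with |s|^2 that is to be gained. The smallness of \<beta> is exactly what puts C |s|^2 below m0
    \<beta> X^2 \<rho>^2, up to an error O(1/R).\<close>
  define C where "C = 4 * m1 * \<Lambda> + \<alpha> * m0"
  have C: "0 \<le> C" using m1 bd ell m by (simp add: C_def)
  have cn: "C * n\<^sup>2 \<le> \<beta> * \<rho>\<^sup>2 * (m0 * X\<^sup>2) + 32 * C / R * E\<^sup>2"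
  proof -
    have "C * n\<^sup>2 \<le> C * (8 * \<beta>\<^sup>2 * \<tau>\<^sup>2 * X\<^sup>2 * \<rho>\<^sup>2 + 32 / R * E\<^sup>2)" using n2 C by (rule mult_left_mono)
    also have "\<dots> = (8 * \<beta> * C * \<tau>\<^sup>2) * (\<beta> * X\<^sup>2 * \<rho>\<^sup>2) + 32 * C / R * E\<^sup>2" by (simp add: power2_eq_square algebra_simps)
    also have "\<dots> \<le> m0 * (\<beta> * X\<^sup>2 * \<rho>\<^sup>2) + 32 * C / R * E\<^sup>2"
      using \<beta> unfolding C_def by (intro add_right_mono mult_right_mono) auto
    finally show ?thesis by (simp add: mult_ac)
  qed
  have bracket: "- 2 * m * \<beta> * X\<^sup>2 * \<rho>\<^sup>2 + C * n\<^sup>2 + 2 * b * \<rho> * n \<le> K * \<beta> * \<rho>\<^sup>2 + K / R * E\<^sup>2"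
  proof -
    have "2 * m0 * (\<beta> * X\<^sup>2 * \<rho>\<^sup>2) \<le> 2 * m * (\<beta> * X\<^sup>2 * \<rho>\<^sup>2)" using m \<beta> by (intro mult_right_mono) auto
    moreover have "4 * b\<^sup>2 * \<tau>\<^sup>2 / m0 * (\<beta> * \<rho>\<^sup>2) \<le> K * (\<beta> * \<rho>\<^sup>2)"
      using K m1 bd ell m b \<beta> by (intro mult_right_mono) auto
    moreover have "(32 * C + 8 * b) * (E\<^sup>2 / R) \<le> K * (E\<^sup>2 / R)"
      using K C_def m R by (intro mult_right_mono) (auto simp: algebra_simps)
    ultimately show ?thesis using cn rn by (simp add: algebra_simps add_divide_distrib)
  qed
  have 1: "m * (- (\<rho>\<^sup>2 * H' * P) - 2 * \<rho> * H * Q) \<le> m * (- (\<rho>\<^sup>2 * H' * P) / 2 + 4 * G * S)"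
    using cross m1 by (intro mult_left_mono)
  have 2: "m0 * (\<rho>\<^sup>2 * H' * (\<alpha> * (norm y)\<^sup>2)) \<le> m * (\<rho>\<^sup>2 * H' * P)"
    using m G Pn P ell(2) by (intro mult_mono mult_left_mono) auto
  have 3: "4 * m * G * S \<le> 4 * m1 * G * (\<Lambda> * n\<^sup>2)"
    using m m1 G Sn P by (intro mult_mono) auto
  have 4: "2 * \<rho> * G * (- (B \<bullet> s)) \<le> 2 * \<rho> * G * (b * n)"
    using Bn \<rho> G by (intro mult_left_mono) auto
  have 5: "G * (- 2 * m * \<beta> * X\<^sup>2 * \<rho>\<^sup>2 + C * n\<^sup>2 + 2 * b * \<rho> * n) \<le> G * (K * \<beta> * \<rho>\<^sup>2 + K / R * E\<^sup>2)"
    using bracket G by (intro mult_left_mono)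
  have "m * (2 * \<rho> * (- (\<beta> * X\<^sup>2) * \<rho>)) * G
      - (m * \<rho>\<^sup>2 * H' * P + m * H * (2 * \<rho> * Q) + G * (2 * \<rho> * (B \<bullet> s)))
    = - 2 * m * \<beta> * X\<^sup>2 * \<rho>\<^sup>2 * G + m * (- (\<rho>\<^sup>2 * H' * P) - 2 * \<rho> * H * Q) + 2 * \<rho> * G * (- (B \<bullet> s))"
    by (simp add: power2_eq_square algebra_simps)
  also have "\<dots> \<le> - 2 * m * \<beta> * X\<^sup>2 * \<rho>\<^sup>2 * G - m0 * (\<rho>\<^sup>2 * H' * (\<alpha> * (norm y)\<^sup>2)) / 2 + 4 * m1 * G * (\<Lambda> * n\<^sup>2) + 2 * \<rho> * G * (b * n)"
    using 1 2 3 4 by (simp add: algebra_simps)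
  also have "\<dots> = - (\<alpha> * m0 / 2) * (\<rho>\<^sup>2 * H' * (norm y)\<^sup>2) - \<alpha> * m0 * (G * n\<^sup>2) + G * (- 2 * m * \<beta> * X\<^sup>2 * \<rho>\<^sup>2 + C * n\<^sup>2 + 2 * b * \<rho> * n)"
    by (simp add: C_def algebra_simps)
  also have "\<dots> \<le> - (\<alpha> * m0 / 2) * (\<rho>\<^sup>2 * H' * (norm y)\<^sup>2) - \<alpha> * m0 * (G * n\<^sup>2) + G * (K * \<beta> * \<rho>\<^sup>2 + K / R * E\<^sup>2)"
    using 5 by simp
  also have "\<dots> = - (\<alpha> * m0 / 2) * (\<rho>\<^sup>2 * H' * (norm y)\<^sup>2) - \<alpha> * m0 * (G * n\<^sup>2) + K * \<beta> * (\<rho>\<^sup>2 * G) + K / R * (E\<^sup>2 * G)"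
    by (simp add: algebra_simps)
  finally show ?thesis by (simp add: P_Q_S_def n_def)
qed

text \<open>The two bounds on \<Phi>\<Psi> make the measure with this density comparable with
  Lebesgue measure, although \<Phi> and \<Psi> may be unbounded separately. Both functions are
  positive stationary supersolutions of the same linear equation with potential q.\<close>

locale weighted_flow =
  fixes A :: "real ^ 'n \<Rightarrow> real ^ 'n ^ 'n" and \<Phi> \<Psi> q D\<^sub>\<Phi> D\<^sub>\<Psi> :: "real ^ 'n \<Rightarrow> real"
    and v v' D :: "real \<Rightarrow> real ^ 'n \<Rightarrow> real" and \<alpha> \<Lambda> m0 m1 b :: real
  assumes sym: "\<And>x. transpose (A x) = A x"
    and ell: "\<And>x y. \<alpha> * (norm y)\<^sup>2 \<le> (A x *v y) \<bullet> y" "\<alpha> > 0"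
    and bd: "\<And>x y. norm (A x *v y) \<le> \<Lambda> * norm y" "0 \<le> \<Lambda>"
    and \<Phi>: "weak_sol A \<Phi> D\<^sub>\<Phi>" "\<And>x. \<Phi> x > 0" "\<And>x. D\<^sub>\<Phi> x \<le> - q x * \<Phi> x"
    and \<Psi>: "weak_sol A \<Psi> D\<^sub>\<Psi>" "\<And>x. \<Psi> x > 0" "\<And>x. D\<^sub>\<Psi> x \<le> - q x * \<Psi> x"
    and m: "0 < m0" "\<And>x. m0 \<le> \<Phi> x * \<Psi> x" "\<And>x. \<Phi> x * \<Psi> x \<le> m1"
    and drift_bd: "\<And>x. norm (drift A \<Phi> \<Psi> x) \<le> b"
    and flow: "parabolic A v v' D"
begin

abbreviation z :: "real \<Rightarrow> real ^ 'n \<Rightarrow> real" where "z t x \<equiv> v t x / \<Phi> x"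

lemma C1_z: "t > 0 \<Longrightarrow> C1 (z t)"
proof -
  assume "t > 0"
  hence "C1 (v t)" "C1 \<Phi>" using \<Phi>(1) flow by (auto simp: parabolic_def weak_sol_def)
  thus ?thesis by (rule C1_divide(1)) (use \<Phi>(2) in \<open>simp add: less_imp_neq[symmetric]\<close>)
qed

lemma gwt_support:
  assumes R: "R > 0"
  obtains c where "\<And>\<beta> t x. x \<notin> cbox (-c) c \<Longrightarrow> gwt \<beta> R t (x :: real ^ 'n) = 0"
proof -
  have "bounded (cball (0 :: real ^ 'n) R)" by simp
  then obtain c where c: "cball (0 :: real ^ 'n) R \<subseteq> cbox (-c) c" by (rule bounded_subset_cbox_symmetric)
  have "gwt \<beta> R t x = 0" if "x \<notin> cbox (-c) c" for \<beta> t and x :: "real ^ 'n"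
  proof -
    have "\<not> norm x \<le> R" using that c by (auto simp: subset_iff)
    thus ?thesis using cutoff_outside[OF R, of x] by (simp add: gwt_def)
  qed
  thus ?thesis using that by blast
qed

lemma test_gwt: "R > 0 \<Longrightarrow> test_function (gwt \<beta> R t :: real ^ 'n \<Rightarrow> real)"
proof -
  assume R: "R > 0"
  obtain c where c: "\<And>\<beta> t x. x \<notin> cbox (-c) c \<Longrightarrow> gwt \<beta> R t (x :: real ^ 'n) = 0" using gwt_support[OF R] by blast
  have "{x :: real ^ 'n. gwt \<beta> R t x \<noteq> 0} \<subseteq> cbox (-c) c" using c by auto
  hence "bounded {x :: real ^ 'n. gwt \<beta> R t x \<noteq> 0}" by (rule bounded_subset[OF bounded_cbox])
  thus ?thesis using C1_gwt(1)[OF R] by (simp add: test_function_def)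
qed

text \<open>Integrating \<open>weight_pointwise\<close> leaves two errors: one proportional to
  \<beta>, left to a Gronwall argument, and one proportional to 1/R, finite by the growth bound on
  G(z). The constant \<open>K\<close> depends on neither \<beta> nor R.\<close>

lemma energy_estimate:
  fixes G H H' :: "real \<Rightarrow> real"
  assumes G: "\<And>s. (G has_real_derivative H s) (at s)" "\<And>s. (H has_real_derivative H' s) (at s)" "continuous_on UNIV H'"
      "\<And>s. 0 \<le> G s" "\<And>s. G s \<le> s * H s" "\<And>s. 0 \<le> H' s" "\<And>s. (H s)\<^sup>2 \<le> 2 * G s * H' s"
    and ineq: "\<And>t x. t > 0 \<Longrightarrow> H (z t x) * (v' t x - D t x - q x * v t x) \<le> 0"
    and grow: "\<And>x. G (z t x) \<le> Z * exp (a * norm x)"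
    and t: "0 < t" "t \<le> T" and R: "R \<ge> 1"
    and \<beta>: "0 < \<beta>" "8 * \<beta> * (4 * m1 * \<Lambda> + \<alpha> * m0) * (1 + T)\<^sup>2 \<le> m0"
    and K: "K = 4 * b\<^sup>2 * (1 + T)\<^sup>2 / m0 + 128 * m1 * \<Lambda> + 32 * \<alpha> * m0 + 8 * b"
  shows "\<exists>e. ((\<lambda>t. LINT x|lborel. \<Phi> x * \<Psi> x * (gwt \<beta> R t x)\<^sup>2 * G (z t x)) has_real_derivative e) (at t) \<and>
    e \<le> - (\<alpha> * m0 / 2) * (LINT x|lborel. (gwt \<beta> R t x)\<^sup>2 * H' (z t x) * (norm (grad (z t) x))\<^sup>2)
       - \<alpha> * m0 * (LINT x|lborel. G (z t x) * (norm (grad (gwt \<beta> R t) x))\<^sup>2)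
       + K * \<beta> * (LINT x|lborel. (gwt \<beta> R t x)\<^sup>2 * G (z t x))
       + K / R * (LINT x|lborel. Z * exp (a * norm (x :: real ^ 'n) - 2 * \<beta> * (x \<bullet> x)))"
proof -
  have R0: "R > 0" using R by simp
  obtain c where c: "\<And>\<beta> t x. x \<notin> cbox (-c) c \<Longrightarrow> gwt \<beta> R t (x :: real ^ 'n) = 0" using gwt_support[OF R0] by blast
  define \<rho> :: "real \<Rightarrow> real ^ 'n \<Rightarrow> real" where "\<rho> = gwt \<beta> R"
  have \<rho>t: "test_function (\<rho> t)" for t unfolding \<rho>_def by (rule test_gwt[OF R0])
  have C\<rho>: "C1 (\<rho> t)" for t using \<rho>t by (simp add: test_function_def)
  have C: "C1 \<Phi>" "C1 \<Psi>" "C1 (z t)" using \<Phi> \<Psi> C1_z[OF t(1)] by (auto simp: weak_sol_def)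
  have gs: "grad (\<lambda>x. (\<rho> t x)\<^sup>2) x = (2 * \<rho> t x) *\<^sub>R grad (\<rho> t) x" for t x
    unfolding power2_eq_square C1_mult(2)[OF C\<rho> C\<rho>] scaleR_add_left[symmetric] by simp
  have cg: "continuous_on ({0<..} \<times> UNIV) (\<lambda>p. \<rho> (fst p) (snd p))"
    unfolding \<rho>_def by (rule continuous_on_gwt[OF R0])
  let ?d = "\<lambda>t x. 2 * \<rho> t x * (- (\<beta> * (x \<bullet> x)) * \<rho> t x)"
  have der: "\<exists>e. ((\<lambda>t. LINT x|lborel. \<Phi> x * \<Psi> x * (\<rho> t x)\<^sup>2 * G (z t x)) has_real_derivative e) (at t) \<and>
     e \<le> (LINT x|lborel. \<Phi> x * \<Psi> x * ?d t x * G (z t x))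
       - (LINT x|lborel. \<Phi> x * \<Psi> x * (\<rho> t x)\<^sup>2 * H' (z t x) * (flux A (z t) x \<bullet> grad (z t) x)
         + \<Phi> x * \<Psi> x * H (z t x) * (flux A (z t) x \<bullet> grad (\<lambda>x. (\<rho> t x)\<^sup>2) x) + G (z t x) * (drift A \<Phi> \<Psi> x \<bullet> grad (\<lambda>x. (\<rho> t x)\<^sup>2) x))"
  proof (rule energy_derivative[OF sym flow \<Phi> \<Psi> _ _ _ _ _ _ G(1-5) ineq refl t(1), where a="-c" and b=c])
    show "((\<lambda>s. (\<rho> s x)\<^sup>2) has_real_derivative ?d t x) (at t)" for t x
      using DERIV_power[OF gwt_deriv[of \<beta> R x t], of 2] unfolding \<rho>_def by (simp add: mult_ac)
    show "continuous_on ({0<..} \<times> UNIV) (\<lambda>(t, x). (\<rho> t x)\<^sup>2)" "continuous_on ({0<..} \<times> UNIV) (\<lambda>(t, x). ?d t x)"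
      unfolding split_beta by (intro continuous_intros cg)+
    show "C1 (\<lambda>x. (\<rho> t x)\<^sup>2)" for t unfolding power2_eq_square by (intro C1_mult C\<rho>)
  qed (use c in \<open>auto simp: \<rho>_def\<close>)
  have cs: "csupp (\<rho> t)" by (rule csupp_grad(1)[OF \<rho>t])
  have cH: "continuous_on UNIV G" "continuous_on UNIV H" using G(1,2) DERIV_continuous_on by (metis has_field_derivative_at_within)+
  have cz: "continuous_on UNIV (z t)" by (rule C1_continuous[OF C(3)])
  have cGz: "continuous_on UNIV (\<lambda>x. G (z t x))" "continuous_on UNIV (\<lambda>x. H (z t x))" "continuous_on UNIV (\<lambda>x. H' (z t x))"
    using continuous_on_compose2[OF cH(1) cz] continuous_on_compose2[OF cH(2) cz] continuous_on_compose2[OF G(3) cz] by auto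
  have cA: "continuous_on UNIV (flux A \<Phi>)" "continuous_on UNIV (flux A \<Psi>)" "continuous_on UNIV (flux A (z t))"
  proof -
    show f: "continuous_on UNIV (flux A \<Phi>)" "continuous_on UNIV (flux A \<Psi>)"
      using \<Phi> \<Psi> by (auto simp: weak_sol_def has_weak_divergence_def)
    have f': "continuous_on UNIV (flux A (v t))" using flow t by (auto simp: parabolic_def weak_sol_def has_weak_divergence_def)
    have Cv: "C1 (v t)" using flow t by (simp add: parabolic_def weak_sol_def)
    have \<Phi>0: "\<Phi> x \<noteq> 0" for x using \<Phi>(2)[of x] by simp
    \<comment> \<open>Continuity of \<open>A\<close> is not part of the locale, so the flux of z is
      expressed through the continuous fluxes of \<open>v\<close> and \<open>\<Phi>\<close>.\<close>
    have e: "flux A (z t) x = inverse (\<Phi> x) *\<^sub>R flux A (v t) x - (v t x / (\<Phi> x)\<^sup>2) *\<^sub>R flux A \<Phi> x" for x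
      unfolding flux_def C1_divide(2)[OF Cv C(1) \<Phi>0] matrix_vector_mult_diff_distrib matrix_vector_mult_scaleR by (rule refl)
    have "continuous_on UNIV (\<lambda>x. inverse (\<Phi> x) *\<^sub>R flux A (v t) x - (v t x / (\<Phi> x)\<^sup>2) *\<^sub>R flux A \<Phi> x)"
      by (intro continuous_intros f f' C1_continuous[OF C(1)] C1_continuous[OF Cv]) (simp_all add: \<Phi>0)
    thus "continuous_on UNIV (flux A (z t))" unfolding e[symmetric] .
  qed
  have cD: "continuous_on UNIV (drift A \<Phi> \<Psi>)" unfolding drift_def by (intro continuous_intros cA C[THEN C1_continuous])
  have cgr: "continuous_on UNIV (grad (\<rho> t))" "continuous_on UNIV (grad (z t))" by (intro C1_continuous_grad C C\<rho>)+
  note co = cGz cA cD cgr C[THEN C1_continuous] C1_continuous[OF C\<rho>]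
  have i1: "integrable lborel (\<lambda>x. \<Phi> x * \<Psi> x * ?d t x * G (z t x))"
    by (rule csupp_integrable[OF csuppI[OF cs]]) (auto intro!: continuous_intros co)
  have i2: "integrable lborel (\<lambda>x. \<Phi> x * \<Psi> x * (\<rho> t x)\<^sup>2 * H' (z t x) * (flux A (z t) x \<bullet> grad (z t) x)
         + \<Phi> x * \<Psi> x * H (z t x) * (flux A (z t) x \<bullet> grad (\<lambda>x. (\<rho> t x)\<^sup>2) x) + G (z t x) * (drift A \<Phi> \<Psi> x \<bullet> grad (\<lambda>x. (\<rho> t x)\<^sup>2) x))"
    unfolding gs by (rule csupp_integrable[OF csuppI[OF cs]]) (auto intro!: continuous_intros co)
  have i3: "integrable lborel (\<lambda>x. (\<rho> t x)\<^sup>2 * H' (z t x) * (norm (grad (z t) x))\<^sup>2)"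
    by (rule csupp_integrable[OF csuppI[OF cs]]) (auto intro!: continuous_intros co)
  have i4: "integrable lborel (\<lambda>x. G (z t x) * (norm (grad (\<rho> t) x))\<^sup>2)"
    using csupp_grad(2)[OF \<rho>t, of t]
    by (intro csupp_integrable) (auto simp: csupp_def intro!: continuous_intros co elim!: bounded_subset)
  have i5: "integrable lborel (\<lambda>x. (\<rho> t x)\<^sup>2 * G (z t x))"
    by (rule csupp_integrable[OF csuppI[OF cs]]) (auto intro!: continuous_intros co)
  have i6: "integrable lborel (\<lambda>x :: real ^ 'n. Z * exp (a * norm x - 2 * \<beta> * (x \<bullet> x)))"
    by (intro integrable_mult_right integrable_gaussian) (use \<beta> in simp)
  have "(LINT x|lborel. \<Phi> x * \<Psi> x * ?d t x * G (z t x))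
       - (LINT x|lborel. \<Phi> x * \<Psi> x * (\<rho> t x)\<^sup>2 * H' (z t x) * (flux A (z t) x \<bullet> grad (z t) x)
         + \<Phi> x * \<Psi> x * H (z t x) * (flux A (z t) x \<bullet> grad (\<lambda>x. (\<rho> t x)\<^sup>2) x) + G (z t x) * (drift A \<Phi> \<Psi> x \<bullet> grad (\<lambda>x. (\<rho> t x)\<^sup>2) x))
    = (LINT x|lborel. \<Phi> x * \<Psi> x * ?d t x * G (z t x)
       - (\<Phi> x * \<Psi> x * (\<rho> t x)\<^sup>2 * H' (z t x) * (flux A (z t) x \<bullet> grad (z t) x)
         + \<Phi> x * \<Psi> x * H (z t x) * (flux A (z t) x \<bullet> grad (\<lambda>x. (\<rho> t x)\<^sup>2) x) + G (z t x) * (drift A \<Phi> \<Psi> x \<bullet> grad (\<lambda>x. (\<rho> t x)\<^sup>2) x)))"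
    by (rule Bochner_Integration.integral_diff[OF i1 i2, symmetric])
  also have "\<dots> \<le> (LINT x|lborel. - (\<alpha> * m0 / 2) * ((\<rho> t x)\<^sup>2 * H' (z t x) * (norm (grad (z t) x))\<^sup>2)
     - \<alpha> * m0 * (G (z t x) * (norm (grad (\<rho> t) x))\<^sup>2) + K * \<beta> * ((\<rho> t x)\<^sup>2 * G (z t x))
     + K / R * (Z * exp (a * norm x - 2 * \<beta> * (x \<bullet> x))))"
  proof (rule Bochner_Integration.integral_mono)
    fix x :: "real ^ 'n"
    let ?E = "exp (- \<beta> * (x \<bullet> x))"
    have b0: "0 \<le> b" using drift_bd norm_ge_zero order_trans by blast
    have "0 \<le> m1" using m(1) m(2,3)[of 0] by linarith
    hence "0 \<le> K" using K b0 m(1) bd(2) ell(2) by simp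
    hence K0: "0 \<le> K / R" using R by simp
    have "norm (grad (\<rho> t) x) \<le> 2 * \<beta> * (1 + t) * norm x * \<rho> t x + 4 / R * ?E"
      unfolding \<rho>_def by (rule norm_grad_gwt) (use R0 \<beta> t in auto)
    also have "2 * \<beta> * (1 + t) * norm x * \<rho> t x \<le> 2 * \<beta> * (1 + T) * norm x * \<rho> t x"
      using t \<beta> gwt_bounds(1)[OF \<beta>(1), of t R x] unfolding \<rho>_def by (intro mult_right_mono mult_left_mono) auto
    finally have s: "norm (grad (\<rho> t) x) \<le> 2 * \<beta> * (1 + T) * norm x * \<rho> t x + 4 / R * ?E" by simp
    have "\<Phi> x * \<Psi> x * (2 * \<rho> t x * (- (\<beta> * (norm x)\<^sup>2) * \<rho> t x)) * G (z t x)
      - (\<Phi> x * \<Psi> x * (\<rho> t x)\<^sup>2 * H' (z t x) * ((A x *v grad (z t) x) \<bullet> grad (z t) x)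
         + \<Phi> x * \<Psi> x * H (z t x) * ((A x *v grad (z t) x) \<bullet> ((2 * \<rho> t x) *\<^sub>R grad (\<rho> t) x)) + G (z t x) * (drift A \<Phi> \<Psi> x \<bullet> ((2 * \<rho> t x) *\<^sub>R grad (\<rho> t) x)))
      \<le> - (\<alpha> * m0 / 2) * ((\<rho> t x)\<^sup>2 * H' (z t x) * (norm (grad (z t) x))\<^sup>2)
     - \<alpha> * m0 * (G (z t x) * (norm (grad (\<rho> t) x))\<^sup>2) + K * \<beta> * ((\<rho> t x)\<^sup>2 * G (z t x)) + K / R * (?E\<^sup>2 * G (z t x))"
      by (rule weight_pointwise[OF sym ell bd m(1) m(2,3) drift_bd G(4,6,7) s _ _ \<beta> R norm_ge_zero _ K])
         (use gwt_bounds[OF \<beta>(1), of t] t in \<open>auto simp: \<rho>_def\<close>)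
    moreover have "K / R * (?E\<^sup>2 * G (z t x)) \<le> K / R * (Z * exp (a * norm x - 2 * \<beta> * (x \<bullet> x)))"
    proof (rule mult_left_mono[OF _ K0])
      have "?E\<^sup>2 * G (z t x) \<le> ?E\<^sup>2 * (Z * exp (a * norm x))" using grow by (intro mult_left_mono) auto
      also have "\<dots> = Z * exp (a * norm x - 2 * \<beta> * (x \<bullet> x))"
        unfolding exp_diff by (simp add: exp_minus field_simps power2_eq_square exp_add[symmetric])
      finally show "?E\<^sup>2 * G (z t x) \<le> Z * exp (a * norm x - 2 * \<beta> * (x \<bullet> x))" .
    qed
    ultimately show "\<Phi> x * \<Psi> x * ?d t x * G (z t x)
       - (\<Phi> x * \<Psi> x * (\<rho> t x)\<^sup>2 * H' (z t x) * (flux A (z t) x \<bullet> grad (z t) x)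
         + \<Phi> x * \<Psi> x * H (z t x) * (flux A (z t) x \<bullet> grad (\<lambda>x. (\<rho> t x)\<^sup>2) x) + G (z t x) * (drift A \<Phi> \<Psi> x \<bullet> grad (\<lambda>x. (\<rho> t x)\<^sup>2) x))
      \<le> - (\<alpha> * m0 / 2) * ((\<rho> t x)\<^sup>2 * H' (z t x) * (norm (grad (z t) x))\<^sup>2)
     - \<alpha> * m0 * (G (z t x) * (norm (grad (\<rho> t) x))\<^sup>2) + K * \<beta> * ((\<rho> t x)\<^sup>2 * G (z t x))
     + K / R * (Z * exp (a * norm x - 2 * \<beta> * (x \<bullet> x)))"
      unfolding gs power2_norm_eq_inner[of x] flux_def by linarith
  qed (use i1 i2 i3 i4 i5 i6 in auto)
  also have "\<dots> = - (\<alpha> * m0 / 2) * (LINT x|lborel. (\<rho> t x)\<^sup>2 * H' (z t x) * (norm (grad (z t) x))\<^sup>2)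
       - \<alpha> * m0 * (LINT x|lborel. G (z t x) * (norm (grad (\<rho> t) x))\<^sup>2)
       + K * \<beta> * (LINT x|lborel. (\<rho> t x)\<^sup>2 * G (z t x))
       + K / R * (LINT x|lborel. Z * exp (a * norm (x :: real ^ 'n) - 2 * \<beta> * (x \<bullet> x)))"
    using i3 i4 i5 i6 by simp
  finally show ?thesis using der unfolding \<rho>_def by (meson order_trans)
qed

end

section \<open>Differential inequalities in time, and removal of the weight\<close>

lemma gronwall_from_limit:
  fixes E :: "real \<Rightarrow> real"
  assumes T: "0 < T" and \<kappa>: "0 \<le> \<kappa>" and \<epsilon>: "0 \<le> \<epsilon>"
    and d: "\<And>t. 0 < t \<Longrightarrow> t \<le> T \<Longrightarrow> \<exists>e. (E has_real_derivative e) (at t) \<and> e \<le> \<kappa> * E t + \<epsilon>"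
    and lim: "(E \<longlongrightarrow> E0) (at_right 0)"
  shows "E T \<le> exp (\<kappa> * T) * (E0 + \<epsilon> * T)"
proof -
  define y where "y = (\<lambda>t. exp (- \<kappa> * t) * E t - \<epsilon> * t)"
  have mono: "y T \<le> y s" if s: "0 < s" "s \<le> T" for s
  proof (rule DERIV_nonpos_imp_nonincreasing[OF s(2)])
    fix t assume "s \<le> t" "t \<le> T"
    hence t: "0 < t" "t \<le> T" using s by auto
    obtain e where e: "(E has_real_derivative e) (at t)" "e \<le> \<kappa> * E t + \<epsilon>" using d[OF t] by blast
    have "(y has_real_derivative exp (- \<kappa> * t) * (e - \<kappa> * E t) - \<epsilon>) (at t)"
      unfolding y_def by (auto intro!: derivative_eq_intros e(1) simp: algebra_simps)
    moreover have "exp (- \<kappa> * t) * (e - \<kappa> * E t) \<le> 1 * \<epsilon>"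
    proof -
      have "exp (- \<kappa> * t) * (e - \<kappa> * E t) \<le> exp (- \<kappa> * t) * \<epsilon>" using e(2) by (intro mult_left_mono) auto
      also have "\<dots> \<le> 1 * \<epsilon>" using \<kappa> t \<epsilon> by (intro mult_right_mono) auto
      finally show ?thesis .
    qed
    ultimately show "\<exists>d. (y has_real_derivative d) (at t) \<and> d \<le> 0"
      by (intro exI[of _ "exp (- \<kappa> * t) * (e - \<kappa> * E t) - \<epsilon>"]) simp
  qed
  have "(y \<longlongrightarrow> exp (- \<kappa> * 0) * E0 - \<epsilon> * 0) (at_right 0)"
    unfolding y_def by (intro tendsto_intros lim)
  moreover have "\<forall>\<^sub>F s in at_right 0. y T \<le> y s"
    unfolding eventually_at_right_field using T mono by (intro exI[of _ T]) auto
  ultimately have "y T \<le> E0"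
    using tendsto_lowerbound[of y E0 "at_right 0" "y T"] by simp
  hence "exp (- \<kappa> * T) * E T \<le> E0 + \<epsilon> * T" by (simp add: y_def)
  hence "exp (\<kappa> * T) * (exp (- \<kappa> * T) * E T) \<le> exp (\<kappa> * T) * (E0 + \<epsilon> * T)" by (intro mult_left_mono) auto
  thus ?thesis by (simp add: mult.assoc[symmetric] exp_add[symmetric])
qed

text \<open>After multiplication by t^(2A) the inequality says that the derivative of t^(2A) E is at
  most 2 A K t^(A - 1), apart from the terms with \<open>\<kappa>\<close> and
  \<open>\<epsilon>\<close>. As E is bounded, t^(2A) E tends to 0 with t; hence no initial value
  enters and \<open>B\<close> disappears from the conclusion.\<close>

lemma smoothing_ode:
  fixes E :: "real \<Rightarrow> real"
  assumes T: "0 < T" and \<kappa>: "0 \<le> \<kappa>" and \<epsilon>: "0 \<le> \<epsilon>" and A: "0 < A" and K: "0 \<le> K"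
    and d: "\<And>t. 0 < t \<Longrightarrow> t \<le> T \<Longrightarrow> \<exists>e. (E has_real_derivative e) (at t) \<and>
         e \<le> - (2 * A / t) * E t + 2 * A * K * t powr (- 1 - A) + \<kappa> * E t + \<epsilon>"
    and E: "\<And>t. 0 < t \<Longrightarrow> t \<le> T \<Longrightarrow> 0 \<le> E t" "\<And>t. 0 < t \<Longrightarrow> t \<le> T \<Longrightarrow> E t \<le> B"
  shows "E T \<le> exp (\<kappa> * T) * (2 * K * T powr (- A) + \<epsilon> * T)"
proof -
  define b where "b = 2 * A"
  define y where "y = (\<lambda>t. exp (- \<kappa> * t) * t powr b * E t - 2 * K * t powr A - \<epsilon> * t powr (b + 1))"
  have mono: "y T \<le> y s" if s: "0 < s" "s \<le> T" for s
  proof (rule DERIV_nonpos_imp_nonincreasing[OF s(2)])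
    fix t assume "s \<le> t" "t \<le> T"
    hence t: "0 < t" "t \<le> T" using s by auto
    obtain e where e: "(E has_real_derivative e) (at t)" "e \<le> - (b / t) * E t + b * K * t powr (- 1 - A) + \<kappa> * E t + \<epsilon>"
      using d[OF t] by (auto simp: b_def)
    let ?d = "exp (- \<kappa> * t) * t powr b * (e + b / t * E t - \<kappa> * E t) - 2 * K * (A * t powr (A - 1)) - \<epsilon> * ((b + 1) * t powr b)"
    have "(y has_real_derivative ?d) (at t)"
      unfolding y_def using t
      by (auto intro!: derivative_eq_intros e(1) simp: powr_diff algebra_simps)
    moreover have "?d \<le> 0"
    proof -
      have nn: "0 \<le> b * K * t powr (- 1 - A) + \<epsilon>" using A K \<epsilon> by (simp add: b_def)
      have "exp (- \<kappa> * t) * t powr b * (e + b / t * E t - \<kappa> * E t) \<le> exp (- \<kappa> * t) * t powr b * (b * K * t powr (- 1 - A) + \<epsilon>)"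
        using e(2) by (intro mult_left_mono) auto
      also have "\<dots> \<le> 1 * t powr b * (b * K * t powr (- 1 - A) + \<epsilon>)"
        using \<kappa> t nn by (intro mult_right_mono) auto
      also have "\<dots> = b * K * t powr (A - 1) + \<epsilon> * t powr b"
      proof -
        have "t powr b * t powr (- 1 - A) = t powr (A - 1)" unfolding powr_add[symmetric] b_def by (simp add: algebra_simps)
        thus ?thesis by (simp add: algebra_simps)
      qed
      finally have "exp (- \<kappa> * t) * t powr b * (e + b / t * E t - \<kappa> * E t) \<le> b * K * t powr (A - 1) + \<epsilon> * t powr b" .
      moreover have "0 \<le> \<epsilon> * (b * t powr b)" using \<epsilon> A by (simp add: b_def)
      moreover have "b * K * t powr (A - 1) = 2 * K * (A * t powr (A - 1))" by (simp add: b_def)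
      ultimately show ?thesis by (simp add: distrib_right distrib_left)
    qed
    ultimately show "\<exists>d. (y has_real_derivative d) (at t) \<and> d \<le> 0" by blast
  qed
  have "y T \<le> 0"
  proof (rule tendsto_lowerbound)
    show "((\<lambda>s. s powr b * B) \<longlongrightarrow> 0) (at_right 0)"
    proof -
      have "((\<lambda>s. s powr b) \<longlongrightarrow> 0) (at_right 0)"
        by (rule tendsto_eq_rhs[OF tendsto_powr'[OF tendsto_ident_at tendsto_const]])
           (use A in \<open>auto simp: b_def eventually_at_right_field intro!: exI[of _ 1]\<close>)
      thus ?thesis by (rule tendsto_mult_left_zero)
    qed
    show "\<forall>\<^sub>F s in at_right 0. y T \<le> s powr b * B"
      unfolding eventually_at_right_field
    proof (intro exI[of _ T] conjI allI impI T)
      fix s assume "0 < s" "s < T"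
      hence s: "0 < s" "s \<le> T" by auto
      have "y T \<le> y s" by (rule mono[OF s])
      also have "\<dots> \<le> exp (- \<kappa> * s) * (s powr b * E s)"
      proof -
        have "0 \<le> 2 * K * s powr A" "0 \<le> \<epsilon> * s powr (b + 1)" using K \<epsilon> by auto
        thus ?thesis unfolding y_def by (simp only: mult.assoc)
      qed
      also have "\<dots> \<le> 1 * (s powr b * E s)" using \<kappa> s E(1)[OF s] by (intro mult_right_mono) auto
      also have "\<dots> \<le> s powr b * B" using E(2)[OF s] by (simp add: mult_left_mono)
      finally show "y T \<le> s powr b * B" .
    qed
  qed simp
  hence "exp (\<kappa> * T) * (exp (- \<kappa> * T) * T powr b * E T) \<le> exp (\<kappa> * T) * (2 * K * T powr A + \<epsilon> * T powr (b + 1))"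
    by (intro mult_left_mono) (auto simp: y_def)
  hence "T powr b * E T \<le> exp (\<kappa> * T) * (2 * K * T powr A + \<epsilon> * T powr (b + 1))"
    by (simp add: mult.assoc[symmetric] exp_add[symmetric])
  also have "\<dots> = T powr b * (exp (\<kappa> * T) * (2 * K * T powr (- A) + \<epsilon> * T))"
  proof -
    have "T powr A = T powr b * T powr (- A)" unfolding powr_add[symmetric] by (simp add: b_def)
    moreover have "T powr (b + 1) = T powr b * T" using T by (simp add: powr_add)
    ultimately show ?thesis by (simp add: algebra_simps)
  qed
  finally show ?thesis using T by simp
qed

text \<open>\<open>J\<close> depends on \<beta>, so R is chosen after \<beta>: along
  \<open>\<beta> k\<close> tending to 0, the radius \<open>R k\<close> is taken so large that
  \<open>J k / R k\<close> is at most 1 / (k + 1). Fatou's lemma then yields integrability and the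
  bound together; no integrable majorant is known beforehand.\<close>

lemma weight_limit:
  fixes f :: "real ^ 'n \<Rightarrow> real"
  assumes f: "continuous_on UNIV f" "\<And>x. 0 \<le> f x" and \<beta>0: "\<beta>0 > 0" and B: "0 \<le> B" and \<kappa>: "0 \<le> \<kappa>"
    and bound: "\<And>\<beta>. 0 < \<beta> \<Longrightarrow> \<beta> \<le> \<beta>0 \<Longrightarrow> \<exists>J. \<forall>R\<ge>1. (LINT x|lborel. (gwt \<beta> R T x)\<^sup>2 * f x) \<le> exp (\<kappa> * \<beta>) * (B + J / R)"
  shows "integrable lborel f" "(LINT x|lborel. f x) \<le> B"
proof -
  define \<beta> where "\<beta> k = \<beta>0 / real (k + 1)" for k
  have \<beta>: "0 < \<beta> k" "\<beta> k \<le> \<beta>0" for k using \<beta>0 by (auto simp: \<beta>_def field_simps)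
  have "\<forall>k. \<exists>J. \<forall>R\<ge>1. (LINT x|lborel. (gwt (\<beta> k) R T x)\<^sup>2 * f x) \<le> exp (\<kappa> * \<beta> k) * (B + J / R)"
    using bound[OF \<beta>] by blast
  then obtain J where J: "\<And>k R. R \<ge> 1 \<Longrightarrow> (LINT x|lborel. (gwt (\<beta> k) R T x)\<^sup>2 * f x) \<le> exp (\<kappa> * \<beta> k) * (B + J k / R)"
    by metis
  define R where "R k = real (k + 1) * (1 + \<bar>J k\<bar>)" for k
  have R: "R k \<ge> real (k + 1)" for k using mult_left_mono[of 1 "1 + \<bar>J k\<bar>" "real (k + 1)"] by (simp add: R_def)
  have R1: "R k \<ge> 1" "R k > 0" for k using R[of k] by auto
  have JR: "J k / R k \<le> 1 / real (k + 1)" for k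
  proof -
    have "J k \<le> 1 + \<bar>J k\<bar>" by simp
    hence "J k * real (k + 1) \<le> R k" unfolding R_def by (simp add: mult.commute mult_right_mono)
    thus ?thesis using R1[of k] by (simp add: field_simps)
  qed
  define g where "g k x = (gwt (\<beta> k) (R k) T x)\<^sup>2 * f x" for k and x :: "real ^ 'n"
  have g0: "0 \<le> g k x" for k x using f by (simp add: g_def)
  have gi: "integrable lborel (g k)" for k
  proof (rule csupp_integrable)
    have "{x. g k x \<noteq> 0} \<subseteq> cball 0 (R k)"
      using cutoff_outside[OF R1(2)] by (force simp: g_def gwt_def)
    hence "bounded {x. g k x \<noteq> 0}" by (rule bounded_subset[OF bounded_cball])
    thus "csupp (g k)" unfolding csupp_def g_def
      by (auto intro!: continuous_intros f C1_continuous[OF C1_gwt(1)[OF R1(2)]])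
  qed
  have lim: "(\<lambda>k. g k x) \<longlonglongrightarrow> f x" for x
  proof -
    have inv: "(\<lambda>k. 1 / real (k + 1)) \<longlonglongrightarrow> 0"
      using LIMSEQ_inverse_real_of_nat by (simp add: inverse_eq_divide)
    hence "(\<lambda>k. \<beta>0 * (1 / real (k + 1))) \<longlonglongrightarrow> 0" by (rule tendsto_mult_right_zero)
    hence b: "\<beta> \<longlonglongrightarrow> 0" by (simp add: \<beta>_def[abs_def])
    have r: "(\<lambda>k. 1 / (R k)\<^sup>2) \<longlonglongrightarrow> 0"
    proof (rule Lim_null_comparison[OF _ inv])
      show "\<forall>\<^sub>F k in sequentially. norm (1 / (R k)\<^sup>2) \<le> 1 / real (k + 1)"
      proof (intro always_eventually allI)
        fix k
        have "real (k + 1) * 1 \<le> R k * R k" using R[of k] R1[of k] by (intro mult_mono) auto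
        thus "norm (1 / (R k)\<^sup>2) \<le> 1 / real (k + 1)" by (auto simp: power2_eq_square intro!: divide_left_mono)
      qed
    qed
    have "(\<lambda>k. (exp (- (\<beta> k * (1 + T)) * (x \<bullet> x)) * (max 0 (1 - (x \<bullet> x) * (1 / (R k)\<^sup>2)))\<^sup>2)\<^sup>2 * f x)
       \<longlonglongrightarrow> (exp (- (0 * (1 + T)) * (x \<bullet> x)) * (max 0 (1 - (x \<bullet> x) * 0))\<^sup>2)\<^sup>2 * f x"
      by (intro tendsto_intros b r)
    thus ?thesis by (simp add: g_def gwt_def cutoff_def)
  qed
  have up: "(LINT x|lborel. g k x) \<le> exp (\<kappa> * \<beta> k) * (B + 1 / real (k + 1))" for k
    using J[OF R1(1), of k k] JR[of k] unfolding g_def by (elim order_trans) (intro mult_left_mono, auto)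
  have ulim: "(\<lambda>k. exp (\<kappa> * \<beta> k) * (B + 1 / real (k + 1))) \<longlonglongrightarrow> B"
  proof -
    have inv: "(\<lambda>k. 1 / real (k + 1)) \<longlonglongrightarrow> 0"
      using LIMSEQ_inverse_real_of_nat by (simp add: inverse_eq_divide)
    hence "(\<lambda>k. \<beta>0 * (1 / real (k + 1))) \<longlonglongrightarrow> 0" by (rule tendsto_mult_right_zero)
    hence b: "\<beta> \<longlonglongrightarrow> 0" by (simp add: \<beta>_def[abs_def])
    have "(\<lambda>k. exp (\<kappa> * \<beta> k) * (B + 1 / real (k + 1))) \<longlonglongrightarrow> exp (\<kappa> * 0) * (B + 0)"
      by (intro tendsto_intros b inv)
    thus ?thesis by simp
  qed
  have mf: "f \<in> borel_measurable borel" by (rule borel_measurable_continuous_onI[OF f(1)])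
  have "(\<integral>\<^sup>+x. ennreal (f x) \<partial>lborel) = (\<integral>\<^sup>+x. liminf (\<lambda>k. ennreal (g k x)) \<partial>lborel)"
  proof (rule nn_integral_cong)
    fix x
    have "(\<lambda>k. ennreal (g k x)) \<longlonglongrightarrow> ennreal (f x)" by (intro tendsto_ennrealI lim)
    thus "ennreal (f x) = liminf (\<lambda>k. ennreal (g k x))" using lim_imp_Liminf by force
  qed
  also have "\<dots> \<le> liminf (\<lambda>k. \<integral>\<^sup>+x. ennreal (g k x) \<partial>lborel)"
    by (rule nn_integral_liminf) (use gi in measurable)
  also have "\<dots> = liminf (\<lambda>k. ennreal (LINT x|lborel. g k x))"
    by (simp add: nn_integral_eq_integral[OF gi] g0)
  also have "\<dots> \<le> liminf (\<lambda>k. ennreal (exp (\<kappa> * \<beta> k) * (B + 1 / real (k + 1))))"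
    by (intro Liminf_mono always_eventually allI ennreal_leI up)
  also have "\<dots> = ennreal B"
    by (rule lim_imp_Liminf[OF _ tendsto_ennrealI[OF ulim]]) simp
  finally have le: "(\<integral>\<^sup>+x. ennreal (f x) \<partial>lborel) \<le> ennreal B" .
  show i: "integrable lborel f"
    using le mf f(2) by (intro integrableI_bounded) (auto simp: abs_of_nonneg intro: le_less_trans)
  show "(LINT x|lborel. f x) \<le> B"
    using le nn_integral_eq_integral[OF i] f(2) B by (simp add: ennreal_le_iff)
qed

section \<open>From the L^N norm to the L^2N norm\<close>

context weighted_flow
begin

lemma m1_pos: "0 < m1" using m(1) m(2,3)[of 0] by linarith

lemma csupp_gwt_mult:
  fixes g :: "real ^ 'n \<Rightarrow> real"
  assumes "R > 0" "continuous_on UNIV g"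
  shows "csupp (\<lambda>x. (gwt \<beta> R t x)\<^sup>2 * g x)"
  by (rule csuppI[OF csupp_grad(1)[OF test_gwt[OF assms(1), of \<beta> t]]])
     (auto intro!: continuous_intros assms C1_continuous[OF C1_gwt(1)[OF assms(1)]])

lemma continuous_m: "continuous_on UNIV (\<lambda>x. \<Phi> x * \<Psi> x)"
  using \<Phi>(1) \<Psi>(1) by (intro continuous_intros C1_continuous) (auto simp: weak_sol_def)

text \<open>The energy with G = s^(2N) dissipates the gradient of f = z^N \<rho>, and Nash's
  inequality bounds this dissipation from below by the energy and the L^1 norm of f, which the
  hypothesis controls. \<open>C0\<close> is the same for all N, and the iteration can afford the
  loss N^n. Here \<open>n\<close> is half the dimension.\<close>

lemma smoothing_step:
  assumes ineq: "\<And>t x. t > 0 \<Longrightarrow> v t x * (v' t x - D t x - q x * v t x) \<le> 0"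
    and grow: "\<And>T. \<exists>Z\<ge>0. \<forall>t x. 0 < t \<longrightarrow> t \<le> T \<longrightarrow> \<bar>z t x\<bar> \<le> Z * exp (a * norm x)"
    and N: "N \<ge> 1" and n: "n = real CARD('n) / 2" and M: "0 \<le> M"
    and hyp: "\<And>t. t > 0 \<Longrightarrow> integrable lborel (\<lambda>x. \<Phi> x * \<Psi> x * \<bar>z t x\<bar> ^ N)"
      "\<And>t. t > 0 \<Longrightarrow> (LINT x|lborel. \<Phi> x * \<Psi> x * \<bar>z t x\<bar> ^ N) \<le> M * t powr (- (n * (real N - 1)))"
    and T: "T > 0"
    and C0: "C0 = 2 * m1 / m0\<^sup>2 * (8 * n\<^sup>2 * m1 / (\<alpha> * m0)) powr n"
  shows "integrable lborel (\<lambda>x. \<Phi> x * \<Psi> x * \<bar>z T x\<bar> ^ (2 * N))"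
    "(LINT x|lborel. \<Phi> x * \<Psi> x * \<bar>z T x\<bar> ^ (2 * N)) \<le> C0 * real N powr n * M\<^sup>2 * T powr (- (n * (real (2 * N) - 1)))"
proof -
  \<comment> \<open>Decay exponent of the integral of |z|^(2N): Nash's inequality with r^2
    proportional to t contributes t^(-n), the square of the hypothesis t^(-2n(N - 1)).\<close>
  define Aexp where "Aexp = n * (2 * real N - 1)"
  have "0 < CARD('n)" by simp
  hence n0: "n > 0" unfolding n by simp
  have Ae: "Aexp > 0" unfolding Aexp_def using n0 N by simp
  define c where "c = \<alpha> * m0 / (2 * n * m1)"
  have c: "c > 0" using ell m m1_pos n0 by (simp add: c_def)
  define K3 where "K3 = m1 / m0\<^sup>2 * (2 * Aexp / c) powr n * M\<^sup>2"
  have K3: "K3 \<ge> 0" using m1_pos m by (simp add: K3_def)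
  define K where "K = 4 * b\<^sup>2 * (1 + T)\<^sup>2 / m0 + 128 * m1 * \<Lambda> + 32 * \<alpha> * m0 + 8 * b"
  have b0: "0 \<le> b" using drift_bd norm_ge_zero order_trans by blast
  have K: "K \<ge> 0" using b0 m1_pos m bd ell by (simp add: K_def)
  obtain Z where Z: "Z \<ge> 0" "\<And>t x. 0 < t \<Longrightarrow> t \<le> T \<Longrightarrow> \<bar>z t x\<bar> \<le> Z * exp (a * norm x)" using grow[of T] by blast
  define G H H' where "G = (\<lambda>s :: real. s ^ (2 * N))" and "H = (\<lambda>s :: real. real (2 * N) * s ^ (2 * N - 1))"
     and "H' = (\<lambda>s :: real. real (2 * N) * real (2 * N - 1) * s ^ (2 * N - 2))"
  have ev: "even (2 * N - 2)" "even (2 * N)" by auto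
  have N2: "2 * N = Suc (Suc (2 * N - 2))" "2 * N - 1 = Suc (2 * N - 2)" using N by auto
  have Gd: "(G has_real_derivative H s) (at s)" for s
    unfolding G_def H_def using DERIV_pow[of "2 * N" s UNIV] by simp
  have Hd: "(H has_real_derivative H' s) (at s)" for s
    unfolding H_def H'_def using DERIV_cmult[OF DERIV_pow[of "2 * N - 1" s UNIV], of "real (2 * N)"] N2 by (simp add: mult.assoc diff_diff_eq numeral_2_eq_2)
  have cH': "continuous_on UNIV H'" unfolding H'_def by (intro continuous_intros)
  have cG: "continuous_on UNIV G" unfolding G_def by (intro continuous_intros)
  have G0: "0 \<le> G s" for s unfolding G_def by (simp add: zero_le_even_power)
  have Gs: "s ^ (2 * N) = s * s ^ (2 * N - 1)" for s :: real by (metis N2 power_Suc)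
  have Gs2: "s ^ (2 * N) = s\<^sup>2 * s ^ (2 * N - 2)" "s ^ (2 * N - 1) = s * s ^ (2 * N - 2)" for s :: real
    by (metis N2 power_Suc power2_eq_square mult.assoc)+
  have ge0: "0 \<le> s ^ (2 * N - 2)" for s :: real by (rule zero_le_even_power[OF ev(1)])
  have GH: "G s \<le> s * H s" for s
  proof -
    have "1 * s ^ (2 * N) \<le> real (2 * N) * s ^ (2 * N)" using N G0[of s] unfolding G_def by (intro mult_right_mono) auto
    thus ?thesis unfolding G_def H_def using Gs[of s] by (simp add: mult_ac)
  qed
  have H'0: "0 \<le> H' s" for s unfolding H'_def using ge0 by simp
  have HH: "(H s)\<^sup>2 \<le> 2 * G s * H' s" for s
  proof -
    have "2 * N \<le> 2 * (2 * N - 1)" using N by simp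
    hence "real (2 * N) \<le> 2 * real (2 * N - 1)" by (metis of_nat_le_iff of_nat_mult of_nat_numeral)
    hence "real (2 * N) * (real (2 * N) * (s * s ^ (2 * N - 2))\<^sup>2) \<le> 2 * real (2 * N - 1) * (real (2 * N) * (s * s ^ (2 * N - 2))\<^sup>2)"
      by (intro mult_right_mono) auto
    thus ?thesis unfolding G_def H_def H'_def Gs2[of s] by (simp add: power2_eq_square mult_ac)
  qed
  have Hin: "H (z t x) * (v' t x - D t x - q x * v t x) \<le> 0" if "t > 0" for t x
  proof -
    have "H (z t x) * (v' t x - D t x - q x * v t x) = real (2 * N) * z t x ^ (2 * N - 2) / \<Phi> x * (v t x * (v' t x - D t x - q x * v t x))"
      unfolding H_def Gs2 by (simp add: mult_ac)
    also have "\<dots> \<le> 0"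
      by (rule mult_nonneg_nonpos[OF _ ineq[OF that]]) (use ge0[of "z t x"] \<Phi>(2)[of x] in simp)
    finally show ?thesis .
  qed
  have Gg: "G (z t x) \<le> Z ^ (2 * N) * exp (real (2 * N) * a * norm x)" if "0 < t" "t \<le> T" for t x
  proof -
    have "G (z t x) = \<bar>z t x\<bar> ^ (2 * N)" unfolding G_def by (rule power_even_abs[OF ev(2), symmetric])
    also have "\<dots> \<le> (Z * exp (a * norm x)) ^ (2 * N)" using Z(2)[OF that] by (intro power_mono) auto
    also have "\<dots> = Z ^ (2 * N) * exp (real (2 * N) * a * norm x)"
      by (simp add: power_mult_distrib exp_of_nat_mult[symmetric] mult_ac)
    finally show ?thesis .
  qed
  \<comment> \<open>The smallness condition of \<open>energy_estimate\<close>, solved for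
    \<beta>.\<close>
  define \<beta>0 where "\<beta>0 = m0 / (8 * (4 * m1 * \<Lambda> + \<alpha> * m0) * (1 + T)\<^sup>2)"
  have den: "0 < 8 * (4 * m1 * \<Lambda> + \<alpha> * m0) * (1 + T)\<^sup>2"
    using m1_pos bd ell m T by (intro mult_pos_pos add_nonneg_pos) auto
  have \<beta>0: "\<beta>0 > 0" unfolding \<beta>0_def using m den by simp
  have cz: "continuous_on UNIV (z t)" if "t > 0" for t using C1_continuous[OF C1_z[OF that]] .
  have cGz: "continuous_on UNIV (\<lambda>x. G (z t x))" if "t > 0" for t
    using continuous_on_compose2[OF cG cz[OF that]] by auto
  have main: "\<exists>J. \<forall>R\<ge>1. (LINT x|lborel. (gwt \<beta> R T x)\<^sup>2 * (\<Phi> x * \<Psi> x * G (z T x))) \<le> exp (K * T / m0 * \<beta>) * (2 * K3 * T powr (- Aexp) + J / R)"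
    if \<beta>: "0 < \<beta>" "\<beta> \<le> \<beta>0" for \<beta>
  proof (intro exI allI impI)
    fix R :: real assume R: "R \<ge> 1"
    hence R0: "R > 0" by simp
    define J where "J = (LINT x|lborel. Z ^ (2 * N) * exp (real (2 * N) * a * norm (x :: real ^ 'n) - 2 * \<beta> * (x \<bullet> x)))"
    have J: "J \<ge> 0" unfolding J_def using Z by (intro Bochner_Integration.integral_nonneg) auto
    have Ji: "integrable lborel (\<lambda>x :: real ^ 'n. Z ^ (2 * N) * exp (real (2 * N) * a * norm x - 2 * \<beta> * (x \<bullet> x)))"
      by (intro integrable_mult_right integrable_gaussian) (use \<beta> in simp)
    have \<beta>': "8 * \<beta> * (4 * m1 * \<Lambda> + \<alpha> * m0) * (1 + T)\<^sup>2 \<le> m0"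
      using \<beta>(2) unfolding \<beta>0_def pos_le_divide_eq[OF den] by (simp add: mult_ac)
    define \<rho> :: "real \<Rightarrow> real ^ 'n \<Rightarrow> real" where "\<rho> = gwt \<beta> R"
    define E where "E = (\<lambda>t. LINT x|lborel. \<Phi> x * \<Psi> x * (\<rho> t x)\<^sup>2 * G (z t x))"
    have Ei: "integrable lborel (\<lambda>x. \<Phi> x * \<Psi> x * (\<rho> t x)\<^sup>2 * G (z t x))" if "t > 0" for t
      using csupp_integrable[OF csupp_gwt_mult[OF R0 continuous_on_mult[OF continuous_m cGz[OF that]], of \<beta> t]]
      by (simp add: \<rho>_def mult_ac)
    have Ei': "integrable lborel (\<lambda>x. (\<rho> t x)\<^sup>2 * G (z t x))" if "t > 0" for t
      using csupp_integrable[OF csupp_gwt_mult[OF R0 cGz[OF that], of \<beta> t]] by (simp add: \<rho>_def)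
    have E0: "0 \<le> E t" for t unfolding E_def
      by (intro Bochner_Integration.integral_nonneg mult_nonneg_nonneg G0 less_imp_le[OF \<Phi>(2)] less_imp_le[OF \<Psi>(2)] zero_le_power2)
    \<comment> \<open>This bound depends on \<beta>, but \<open>smoothing_ode\<close> uses it only
      near time 0 and forgets its size.\<close>
    have EB: "E t \<le> m1 * J" if t: "0 < t" "t \<le> T" for t
    proof -
      have "E t \<le> (LINT x|lborel. m1 * (Z ^ (2 * N) * exp (real (2 * N) * a * norm (x :: real ^ 'n) - 2 * \<beta> * (x \<bullet> x))))"
        unfolding E_def
      proof (rule Bochner_Integration.integral_mono[OF Ei[OF t(1)]])
        fix x :: "real ^ 'n"
        have "(\<rho> t x)\<^sup>2 \<le> (exp (- \<beta> * (x \<bullet> x)))\<^sup>2"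
          unfolding \<rho>_def using t by (intro power_mono gwt_bounds \<beta>) auto
        hence "\<Phi> x * \<Psi> x * (\<rho> t x)\<^sup>2 * G (z t x) \<le> m1 * (exp (- \<beta> * (x \<bullet> x)))\<^sup>2 * (Z ^ (2 * N) * exp (real (2 * N) * a * norm x))"
          using m(3)[of x] m1_pos G0 Gg[OF t, of x] by (intro mult_mono) auto
        also have "\<dots> = m1 * (Z ^ (2 * N) * exp (real (2 * N) * a * norm x - 2 * \<beta> * (x \<bullet> x)))"
          unfolding exp_diff by (simp add: exp_minus field_simps power2_eq_square exp_add[symmetric])
        finally show "\<Phi> x * \<Psi> x * (\<rho> t x)\<^sup>2 * G (z t x) \<le> m1 * (Z ^ (2 * N) * exp (real (2 * N) * a * norm x - 2 * \<beta> * (x \<bullet> x)))" .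
      qed (use Ji in simp)
      thus ?thesis by (simp add: J_def)
    qed
    have "E T \<le> exp (K * \<beta> / m0 * T) * (2 * K3 * T powr (- Aexp) + K / R * J * T)"
    proof (rule smoothing_ode[OF T _ _ Ae K3 _ E0 EB])
      fix t assume t: "0 < t" "t \<le> T"
      obtain e where e: "(E has_real_derivative e) (at t)"
        "e \<le> - (\<alpha> * m0 / 2) * (LINT x|lborel. (\<rho> t x)\<^sup>2 * H' (z t x) * (norm (grad (z t) x))\<^sup>2)
           - \<alpha> * m0 * (LINT x|lborel. G (z t x) * (norm (grad (\<rho> t) x))\<^sup>2)
           + K * \<beta> * (LINT x|lborel. (\<rho> t x)\<^sup>2 * G (z t x)) + K / R * J"
        using energy_estimate[OF Gd Hd cH' G0 GH H'0 HH Hin Gg[OF t] t R \<beta>(1) \<beta>' K_def] unfolding E_def \<rho>_def J_def by blast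
      define f where "f = (\<lambda>x. z t x ^ N * \<rho> t x)"
      have tr: "test_function (\<rho> t)" unfolding \<rho>_def by (rule test_gwt[OF R0])
      have C\<rho>: "C1 (\<rho> t)" using tr by (simp add: test_function_def)
      have Cz: "C1 (z t)" by (rule C1_z[OF t(1)])
      have dp: "((\<lambda>s. s ^ N) has_real_derivative real N * s ^ (N - 1)) (at s)" for s :: real
        using DERIV_pow[of N s UNIV] by simp
      have cp: "continuous_on UNIV (\<lambda>s :: real. real N * s ^ (N - 1))" by (intro continuous_intros)
      note CzN = C1_compose[OF Cz dp cp]
      have tf: "test_function f" unfolding f_def by (rule test_mult[OF tr CzN(1)])
      have gf: "grad f x = z t x ^ N *\<^sub>R grad (\<rho> t) x + (\<rho> t x * (real N * z t x ^ (N - 1))) *\<^sub>R grad (z t) x" for x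
        unfolding f_def C1_mult(2)[OF CzN(1) C\<rho>] CzN(2) by simp
      have cGr: "continuous_on UNIV (grad (z t))" "continuous_on UNIV (grad (\<rho> t))" using Cz C\<rho> by (auto intro: C1_continuous_grad)
      have i1: "integrable lborel (\<lambda>x. (\<rho> t x)\<^sup>2 * H' (z t x) * (norm (grad (z t) x))\<^sup>2)"
      proof -
        have "continuous_on UNIV (\<lambda>x. H' (z t x) * (norm (grad (z t) x))\<^sup>2)"
          using continuous_on_compose2[OF cH' cz[OF t(1)]] by (auto intro!: continuous_intros cGr)
        from csupp_integrable[OF csupp_gwt_mult[OF R0 this, of \<beta> t]] show ?thesis by (simp add: \<rho>_def mult.assoc)
      qed
      have i2: "integrable lborel (\<lambda>x. G (z t x) * (norm (grad (\<rho> t) x))\<^sup>2)"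
        using csupp_grad(2)[OF tr]
        by (intro csupp_integrable) (auto simp: csupp_def intro!: continuous_intros cGr cGz[OF t(1)] elim!: bounded_subset)
      have i3: "integrable lborel (\<lambda>x. (norm (grad f x))\<^sup>2)"
        using csupp_grad(2)[OF tf] C1_continuous_grad[of f] tf
        by (intro csupp_integrable) (auto simp: csupp_def test_function_def intro!: continuous_intros elim!: bounded_subset)
      define F where "F = (LINT x|lborel. (norm (grad f x))\<^sup>2)"
      \<comment> \<open>Since 2 N^2 \<le> 2 N (2 N - 1), the part with the gradient of z is
        dominated by H'(z) |grad z|^2. The part falling on \<open>\<rho>\<close> is what the second
        dissipation term of \<open>energy_estimate\<close> was kept for.\<close>
      have Fle: "F \<le> (LINT x|lborel. (\<rho> t x)\<^sup>2 * H' (z t x) * (norm (grad (z t) x))\<^sup>2 + 2 * (G (z t x) * (norm (grad (\<rho> t) x))\<^sup>2))"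
        unfolding F_def
      proof (rule Bochner_Integration.integral_mono[OF i3])
        fix x
        have sq: "(a + b)\<^sup>2 \<le> 2 * a\<^sup>2 + 2 * b\<^sup>2" for a b :: real
          using sum_squares_bound[of a b] by (simp add: power2_sum)
        have "norm (grad f x) \<le> norm (z t x ^ N *\<^sub>R grad (\<rho> t) x) + norm ((\<rho> t x * (real N * z t x ^ (N - 1))) *\<^sub>R grad (z t) x)"
          unfolding gf by (rule norm_triangle_ineq)
        hence "(norm (grad f x))\<^sup>2 \<le> (norm (z t x ^ N *\<^sub>R grad (\<rho> t) x) + norm ((\<rho> t x * (real N * z t x ^ (N - 1))) *\<^sub>R grad (z t) x))\<^sup>2"
          by (rule power_mono) simp
        also have "\<dots> \<le> 2 * (norm (z t x ^ N *\<^sub>R grad (\<rho> t) x))\<^sup>2 + 2 * (norm ((\<rho> t x * (real N * z t x ^ (N - 1))) *\<^sub>R grad (z t) x))\<^sup>2"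
          by (rule sq)
        also have "(norm (z t x ^ N *\<^sub>R grad (\<rho> t) x))\<^sup>2 = G (z t x) * (norm (grad (\<rho> t) x))\<^sup>2"
          by (simp add: power_mult_distrib G_def power_mult[symmetric] mult.commute)
        also have "(norm ((\<rho> t x * (real N * z t x ^ (N - 1))) *\<^sub>R grad (z t) x))\<^sup>2 = (\<rho> t x)\<^sup>2 * ((real N)\<^sup>2 * z t x ^ (2 * N - 2)) * (norm (grad (z t) x))\<^sup>2"
        proof -
          have "(N - 1) * 2 = 2 * N - 2" by simp
          hence "(z t x ^ (N - 1))\<^sup>2 = z t x ^ (2 * N - 2)" by (simp only: power_mult[symmetric])
          thus ?thesis by (simp add: power_mult_distrib)
        qed
        also have "2 * ((\<rho> t x)\<^sup>2 * ((real N)\<^sup>2 * z t x ^ (2 * N - 2)) * (norm (grad (z t) x))\<^sup>2) \<le> (\<rho> t x)\<^sup>2 * H' (z t x) * (norm (grad (z t) x))\<^sup>2"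
        proof -
          have "N \<le> 2 * N - 1" using N by simp
          hence "real N \<le> real (2 * N - 1)" by (simp only: of_nat_le_iff)
          hence "2 * (real N * real N) \<le> 2 * (real N * real (2 * N - 1))" by (intro mult_left_mono) auto
          hence "2 * (real N)\<^sup>2 * z t x ^ (2 * N - 2) \<le> H' (z t x)"
            unfolding H'_def by (intro mult_right_mono ge0) (simp add: power2_eq_square)
          from mult_right_mono[OF mult_left_mono[OF this, of "(\<rho> t x)\<^sup>2"], of "(norm (grad (z t) x))\<^sup>2"]
          show ?thesis by (simp add: mult_ac)
        qed
        finally show "(norm (grad f x))\<^sup>2 \<le> (\<rho> t x)\<^sup>2 * H' (z t x) * (norm (grad (z t) x))\<^sup>2 + 2 * (G (z t x) * (norm (grad (\<rho> t) x))\<^sup>2)" by simp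
      qed (use i1 i2 in auto)
      hence "F \<le> (LINT x|lborel. (\<rho> t x)\<^sup>2 * H' (z t x) * (norm (grad (z t) x))\<^sup>2)
          + 2 * (LINT x|lborel. G (z t x) * (norm (grad (\<rho> t) x))\<^sup>2)"
        using i1 i2 by simp
      hence "(\<alpha> * m0 / 2) * F \<le> (\<alpha> * m0 / 2) * ((LINT x|lborel. (\<rho> t x)\<^sup>2 * H' (z t x) * (norm (grad (z t) x))\<^sup>2)
          + 2 * (LINT x|lborel. G (z t x) * (norm (grad (\<rho> t) x))\<^sup>2))"
        by (rule mult_left_mono) (use ell(2) m(1) in simp)
      hence Fle': "(\<alpha> * m0 / 2) * F \<le> (\<alpha> * m0 / 2) * (LINT x|lborel. (\<rho> t x)\<^sup>2 * H' (z t x) * (norm (grad (z t) x))\<^sup>2)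
          + \<alpha> * m0 * (LINT x|lborel. G (z t x) * (norm (grad (\<rho> t) x))\<^sup>2)"
        unfolding distrib_left by simp
      have ff: "(f x)\<^sup>2 = (\<rho> t x)\<^sup>2 * G (z t x)" for x
        by (simp add: f_def G_def power_mult_distrib power_mult[symmetric] mult.commute)
      have E1: "E t \<le> m1 * (LINT x|lborel. (f x)\<^sup>2)"
      proof -
        have "E t \<le> (LINT x|lborel. m1 * ((\<rho> t x)\<^sup>2 * G (z t x)))"
          unfolding E_def
        proof (rule Bochner_Integration.integral_mono[OF Ei[OF t(1)]])
          show "\<Phi> x * \<Psi> x * (\<rho> t x)\<^sup>2 * G (z t x) \<le> m1 * ((\<rho> t x)\<^sup>2 * G (z t x))" for x
            unfolding mult.assoc[of _ "(\<rho> t x)\<^sup>2"] using m(3)[of x] G0 by (intro mult_right_mono) auto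
        qed (use Ei'[OF t(1)] in simp)
        thus ?thesis by (simp add: ff)
      qed
      have E2: "m0 * (LINT x|lborel. (\<rho> t x)\<^sup>2 * G (z t x)) \<le> E t"
      proof -
        have "(LINT x|lborel. m0 * ((\<rho> t x)\<^sup>2 * G (z t x))) \<le> E t"
          unfolding E_def
        proof (rule Bochner_Integration.integral_mono[OF _ Ei[OF t(1)]])
          show "m0 * ((\<rho> t x)\<^sup>2 * G (z t x)) \<le> \<Phi> x * \<Psi> x * (\<rho> t x)\<^sup>2 * G (z t x)" for x
            unfolding mult.assoc[of _ "(\<rho> t x)\<^sup>2"] using m(2)[of x] G0 by (intro mult_right_mono) auto
        qed (use Ei'[OF t(1)] in simp)
        thus ?thesis by simp
      qed
      define S where "S = M * t powr (- (n * (real N - 1))) / m0"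
      have fl1: "(LINT x|lborel. \<bar>f x\<bar>) \<le> S"
      proof -
        have if': "integrable lborel (\<lambda>x. \<bar>f x\<bar>)" using csupp_integrable[OF csupp_grad(1)[OF tf]] by simp
        have "(LINT x|lborel. m0 * \<bar>f x\<bar>) \<le> (LINT x|lborel. \<Phi> x * \<Psi> x * \<bar>z t x\<bar> ^ N)"
        proof (rule Bochner_Integration.integral_mono[OF _ hyp(1)[OF t(1)]])
          fix x
          have r: "0 \<le> \<rho> t x" "\<rho> t x \<le> exp (- \<beta> * (x \<bullet> x))" unfolding \<rho>_def by (rule gwt_bounds[OF \<beta>(1)], use t in simp)+
          have "exp (- \<beta> * (x \<bullet> x)) \<le> 1" using \<beta> by simp
          hence "\<rho> t x \<le> 1" using r by linarith
          hence "\<bar>f x\<bar> \<le> \<bar>z t x\<bar> ^ N * 1" using r unfolding f_def abs_mult power_abs by (intro mult_left_mono) auto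
          thus "m0 * \<bar>f x\<bar> \<le> \<Phi> x * \<Psi> x * \<bar>z t x\<bar> ^ N" using m(1) m(2)[of x] by (intro mult_mono) auto
        qed (use if' in simp)
        hence "m0 * (LINT x|lborel. \<bar>f x\<bar>) \<le> M * t powr (- (n * (real N - 1)))" using hyp(2)[OF t(1)] by simp
        thus ?thesis using m(1) by (simp add: S_def field_simps)
      qed
      \<comment> \<open>At this scale the coefficient of \<open>F\<close> in Nash's inequality,
        times m1 and 2 Aexp / t, equals the available dissipation \<alpha> m0 / 2; the factor 2 Aexp
        / t is the one that \<open>smoothing_ode\<close> expects.\<close>
      define r where "r = sqrt (c * t / (2 * Aexp))"
      have r: "r > 0" "r\<^sup>2 = c * t / (2 * Aexp)" using c t Ae by (auto simp: r_def)
      have rn: "r ^ CARD('n) = (c * t / (2 * Aexp)) powr n"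
      proof -
        have "real CARD('n) = 2 * n" using n by simp
        hence "r ^ CARD('n) = r powr (2 * n)" using powr_realpow[OF r(1), of "CARD('n)"] by simp
        also have "\<dots> = (r powr 2) powr n" by (simp add: powr_powr)
        also have "r powr 2 = r\<^sup>2" using r(1) by simp
        finally show ?thesis using r by simp
      qed
      have nash: "r ^ CARD('n) * ((LINT x|lborel. (f x)\<^sup>2) - n * r\<^sup>2 * F) \<le> S\<^sup>2"
      proof -
        have "r ^ CARD('n) * ((LINT x|lborel. (f x)\<^sup>2) - n * r\<^sup>2 * F) \<le> (LINT x|lborel. \<bar>f x\<bar>)\<^sup>2"
          using nash_inequality[OF tf r(1)] by (simp add: n F_def)
        also have "\<dots> \<le> S\<^sup>2" using fl1 by (intro power_mono) auto
        finally show ?thesis .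
      qed
      hence nash': "(LINT x|lborel. (f x)\<^sup>2) - n * r\<^sup>2 * F \<le> S\<^sup>2 / r ^ CARD('n)"
        using r by (simp add: field_simps)
      have "m1 * (LINT x|lborel. (f x)\<^sup>2) \<le> m1 * (n * r\<^sup>2 * F + S\<^sup>2 / r ^ CARD('n))"
        using nash' m1_pos by (intro mult_left_mono) auto
      hence "E t \<le> m1 * (n * r\<^sup>2) * F + m1 * (S\<^sup>2 / r ^ CARD('n))" using E1 by (simp add: algebra_simps)
      also have "m1 * (n * r\<^sup>2) = (\<alpha> * m0 / 2) * t / (2 * Aexp)"
        unfolding r(2) c_def using n0 m1_pos by (simp add: field_simps)
      finally have "(2 * Aexp / t) * E t \<le> (2 * Aexp / t) * ((\<alpha> * m0 / 2) * t / (2 * Aexp) * F + m1 * (S\<^sup>2 / r ^ CARD('n)))"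
        using t Ae by (intro mult_left_mono) auto
      also have "\<dots> = (\<alpha> * m0 / 2) * F + (2 * Aexp / t) * (m1 * (S\<^sup>2 / r ^ CARD('n)))"
        using t Ae by (simp add: field_simps)
      also have "(2 * Aexp / t) * (m1 * (S\<^sup>2 / r ^ CARD('n))) = 2 * Aexp * K3 * t powr (- 1 - Aexp)"
      proof -
        have s1: "S\<^sup>2 = M\<^sup>2 / m0\<^sup>2 * t powr (- (2 * n * (real N - 1)))"
        proof -
          have "(t powr (- (n * (real N - 1))))\<^sup>2 = t powr (- (2 * n * (real N - 1)))"
            unfolding power2_eq_square powr_add[symmetric] by (simp add: algebra_simps)
          thus ?thesis by (simp add: S_def power_mult_distrib power_divide)
        qed
        have s2: "1 / r ^ CARD('n) = (2 * Aexp / c) powr n * t powr (- n)"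
          unfolding rn using c t Ae by (simp add: powr_mult powr_divide powr_minus field_simps)
        have s3: "1 / t * (t powr (- n) * t powr (- (2 * n * (real N - 1)))) = t powr (- 1 - Aexp)"
        proof -
          have 1: "1 / t = t powr (-1)" using t by (simp add: powr_minus divide_inverse)
          show ?thesis unfolding 1 powr_add[symmetric] Aexp_def by (rule arg_cong[where f = "\<lambda>y. t powr y"]) (simp add: algebra_simps)
        qed
        have "(1 / t) * (S\<^sup>2 * (1 / r ^ CARD('n))) = M\<^sup>2 / m0\<^sup>2 * (2 * Aexp / c) powr n * (1 / t * (t powr (- n) * t powr (- (2 * n * (real N - 1)))))"
          unfolding s1 s2 by (simp only: mult_ac)
        hence "(1 / t) * (S\<^sup>2 * (1 / r ^ CARD('n))) = M\<^sup>2 / m0\<^sup>2 * (2 * Aexp / c) powr n * t powr (- 1 - Aexp)"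
          unfolding s3 .
        hence "2 * Aexp * m1 * ((1 / t) * (S\<^sup>2 * (1 / r ^ CARD('n)))) = 2 * Aexp * m1 * (M\<^sup>2 / m0\<^sup>2 * (2 * Aexp / c) powr n * t powr (- 1 - Aexp))"
          by simp
        thus ?thesis unfolding K3_def by (simp add: mult_ac)
      qed
      finally have low: "(2 * Aexp / t) * E t - 2 * Aexp * K3 * t powr (- 1 - Aexp) \<le> (\<alpha> * m0 / 2) * F" by simp
      have "K * \<beta> * (LINT x|lborel. (\<rho> t x)\<^sup>2 * G (z t x)) \<le> K * \<beta> / m0 * E t"
        using mult_left_mono[OF E2, of "K * \<beta> / m0"] K \<beta> m(1) by simp
      hence "e \<le> - (2 * Aexp / t) * E t + 2 * Aexp * K3 * t powr (- 1 - Aexp) + K * \<beta> / m0 * E t + K / R * J"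
        using e(2) Fle' low by linarith
      thus "\<exists>e. (E has_real_derivative e) (at t) \<and> e \<le> - (2 * Aexp / t) * E t + 2 * Aexp * K3 * t powr (- 1 - Aexp) + K * \<beta> / m0 * E t + K / R * J"
        using e(1) by blast
    qed (use K \<beta> m R J in auto)
    moreover have "(LINT x|lborel. (gwt \<beta> R T x)\<^sup>2 * (\<Phi> x * \<Psi> x * G (z T x))) = E T"
      unfolding E_def \<rho>_def by (simp add: mult_ac)
    ultimately show "(LINT x|lborel. (gwt \<beta> R T x)\<^sup>2 * (\<Phi> x * \<Psi> x * G (z T x))) \<le> exp (K * T / m0 * \<beta>) * (2 * K3 * T powr (- Aexp) + (K * (LINT x|lborel. Z ^ (2 * N) * exp (real (2 * N) * a * norm (x :: real ^ 'n) - 2 * \<beta> * (x \<bullet> x))) * T) / R)"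
      unfolding J_def by (simp add: mult_ac)
  qed
  have GA: "G s = \<bar>s\<bar> ^ (2 * N)" for s unfolding G_def by (simp add: power_even_abs)
  have cf: "continuous_on UNIV (\<lambda>x. \<Phi> x * \<Psi> x * G (z T x))"
    by (rule continuous_on_mult[OF continuous_m cGz[OF T]])
  have nn: "0 \<le> \<Phi> x * \<Psi> x * G (z T x)" for x using \<Phi>(2)[of x] \<Psi>(2)[of x] G0 by simp
  have B0: "0 \<le> 2 * K3 * T powr (- Aexp)" "0 \<le> K * T / m0" using K K3 T m by auto
  note wl = weight_limit[OF cf nn \<beta>0 B0 main]
  \<comment> \<open>The dependence on N is made explicit here, by \<open>2 * Aexp\<close> \<le> 4 n
    N.\<close>
  have le: "2 * K3 * T powr (- Aexp) \<le> C0 * real N powr n * M\<^sup>2 * T powr (- (n * (real (2 * N) - 1)))"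
  proof -
    have "2 * Aexp / c \<le> (4 * n * real N) / c" using c n0 N unfolding Aexp_def by (intro divide_right_mono) (auto simp: algebra_simps)
    also have "\<dots> = 8 * n\<^sup>2 * m1 / (\<alpha> * m0) * real N" unfolding c_def using n0 ell m m1_pos by (simp add: field_simps power2_eq_square)
    finally have "(2 * Aexp / c) powr n \<le> (8 * n\<^sup>2 * m1 / (\<alpha> * m0) * real N) powr n"
      using Ae c n0 by (intro powr_mono2) auto
    also have "\<dots> = (8 * n\<^sup>2 * m1 / (\<alpha> * m0)) powr n * real N powr n" by (rule powr_mult)
    finally have "2 * (m1 / m0\<^sup>2 * (2 * Aexp / c) powr n * M\<^sup>2) * T powr (- Aexp) \<le> 2 * (m1 / m0\<^sup>2 * ((8 * n\<^sup>2 * m1 / (\<alpha> * m0)) powr n * real N powr n) * M\<^sup>2) * T powr (- Aexp)"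
      using m1_pos by (intro mult_right_mono mult_left_mono) auto
    thus ?thesis unfolding K3_def C0 Aexp_def by (simp add: mult_ac)
  qed
  show "integrable lborel (\<lambda>x. \<Phi> x * \<Psi> x * \<bar>z T x\<bar> ^ (2 * N))"
    using wl(1) unfolding GA .
  show "(LINT x|lborel. \<Phi> x * \<Psi> x * \<bar>z T x\<bar> ^ (2 * N)) \<le> C0 * real N powr n * M\<^sup>2 * T powr (- (n * (real (2 * N) - 1)))"
    using order_trans[OF wl(2) le] unfolding GA .
qed

end

lemma AE_nonpos_imp_nonpos:
  fixes f :: "'a::euclidean_space \<Rightarrow> real"
  assumes "continuous_on UNIV f" "AE x in lborel. f x \<le> 0"
  shows "f x \<le> 0"
proof (rule ccontr)
  assume x: "\<not> f x \<le> 0"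
  have "open {x. f x > 0}" using assms(1) by (intro open_Collect_less) auto
  moreover have "{x. f x > 0} \<noteq> {}" using x by (auto simp: not_le)
  ultimately have "\<not> negligible {x. f x > 0}" by (rule open_not_negligible)
  moreover have "{x. f x > 0} \<in> null_sets lborel"
  proof -
    have "AE x in lborel. x \<notin> {x. f x > 0}" using assms(2) by eventually_elim simp
    thus ?thesis using AE_iff_null_sets[of "{x. f x > 0}" lborel] \<open>open {x. f x > 0}\<close> by simp
  qed
  hence "negligible {x. f x > 0}" using negligible_iff_null_sets null_sets_completionI by blast
  ultimately show False by blast
qed

section \<open>A comparison principle with initial values almost everywhere\<close>

context weighted_flow
begin

text \<open>Dominated convergence with a Gaussian majorant, furnished by the growth bound and the
  weight; so convergence of the initial values almost everywhere is enough.\<close>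

lemma energy_initial_limit:
  assumes G: "continuous_on UNIV G" "\<And>s. 0 \<le> G s"
    and grow: "\<And>t x. 0 < t \<Longrightarrow> t \<le> T \<Longrightarrow> G (z t x) \<le> Z * exp (a * norm x)"
    and T: "0 < T" and R: "R \<ge> 1" and \<beta>: "0 < \<beta>"
    and lim: "AE x in lborel. ((\<lambda>t. G (z t x)) \<longlongrightarrow> g x) (at_right 0)" and g: "g \<in> borel_measurable borel"
  shows "((\<lambda>t. LINT x|lborel. \<Phi> x * \<Psi> x * (gwt \<beta> R t x)\<^sup>2 * G (z t x)) \<longlongrightarrow>
     (LINT x|lborel. \<Phi> x * \<Psi> x * (gwt \<beta> R 0 x)\<^sup>2 * g x)) (at_right 0)"
proof (rule tendsto_at_right_sequentially[OF T])
  fix S :: "nat \<Rightarrow> real" assume S: "\<And>n. 0 < S n" "\<And>n. S n < T" "decseq S" "S \<longlonglongrightarrow> 0"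
  have R0: "R > 0" using R by simp
  have mm[measurable]: "(\<lambda>x. \<Phi> x * \<Psi> x) \<in> borel_measurable borel" by (rule borel_measurable_continuous_onI[OF continuous_m])
  have gm[measurable]: "gwt \<beta> R t \<in> borel_measurable borel" for t
    by (rule borel_measurable_continuous_onI[OF C1_continuous[OF C1_gwt(1)[OF R0]]])
  have Gm[measurable]: "(\<lambda>x. G (z (S n) x)) \<in> borel_measurable borel" for n
    using continuous_on_compose2[OF G(1) C1_continuous[OF C1_z[OF S(1)]]] by (intro borel_measurable_continuous_onI) auto
  show "(\<lambda>n. LINT x|lborel. \<Phi> x * \<Psi> x * (gwt \<beta> R (S n) x)\<^sup>2 * G (z (S n) x)) \<longlonglongrightarrow>
      (LINT x|lborel. \<Phi> x * \<Psi> x * (gwt \<beta> R 0 x)\<^sup>2 * g x)"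
  proof (rule integral_dominated_convergence[where w = "\<lambda>x. m1 * (Z * exp (a * norm x - 2 * \<beta> * (x \<bullet> x)))"])
    show "(\<lambda>x. \<Phi> x * \<Psi> x * (gwt \<beta> R 0 x)\<^sup>2 * g x) \<in> borel_measurable lborel" using g by measurable
    show "(\<lambda>x. \<Phi> x * \<Psi> x * (gwt \<beta> R (S n) x)\<^sup>2 * G (z (S n) x)) \<in> borel_measurable lborel" for n by measurable
    show "integrable lborel (\<lambda>x :: real ^ 'n. m1 * (Z * exp (a * norm x - 2 * \<beta> * (x \<bullet> x))))"
      by (intro integrable_mult_right integrable_gaussian) (use \<beta> in simp)
    show "AE x in lborel. (\<lambda>n. \<Phi> x * \<Psi> x * (gwt \<beta> R (S n) x)\<^sup>2 * G (z (S n) x)) \<longlonglongrightarrow> \<Phi> x * \<Psi> x * (gwt \<beta> R 0 x)\<^sup>2 * g x"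
      using lim
    proof eventually_elim
      case (elim x)
      have f: "filterlim S (at_right 0) sequentially"
        using S(4) S(1) by (auto simp: filterlim_at less_imp_neq[symmetric] intro!: always_eventually)
      have 1: "(\<lambda>n. G (z (S n) x)) \<longlonglongrightarrow> g x" by (rule filterlim_compose[OF elim f])
      have 2: "(\<lambda>n. gwt \<beta> R (S n) x) \<longlonglongrightarrow> gwt \<beta> R 0 x"
        unfolding gwt_def by (intro tendsto_intros S)
      show ?case by (intro tendsto_intros 1 2)
    qed
    show "AE x in lborel. norm (\<Phi> x * \<Psi> x * (gwt \<beta> R (S n) x)\<^sup>2 * G (z (S n) x)) \<le> m1 * (Z * exp (a * norm x - 2 * \<beta> * (x \<bullet> x)))" for n
    proof (rule AE_I2)
      fix x :: "real ^ 'n"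
      have t: "0 < S n" "S n \<le> T" using S(1,2)[of n] by auto
      have "0 \<le> \<Phi> x * \<Psi> x" using \<Phi>(2)[of x] \<Psi>(2)[of x] by simp
      have "norm (\<Phi> x * \<Psi> x * (gwt \<beta> R (S n) x)\<^sup>2 * G (z (S n) x)) = \<Phi> x * \<Psi> x * (gwt \<beta> R (S n) x)\<^sup>2 * G (z (S n) x)"
        using \<Phi>(2)[of x] \<Psi>(2)[of x] G(2) by simp
      also have "\<dots> \<le> m1 * (exp (- \<beta> * (x \<bullet> x)))\<^sup>2 * (Z * exp (a * norm x))"
        using m(3)[of x] m1_pos G(2) grow[OF t, of x] gwt_bounds[OF \<beta>, of "S n" R x] t by (intro mult_mono power_mono) auto
      also have "\<dots> = m1 * (Z * exp (a * norm x - 2 * \<beta> * (x \<bullet> x)))"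
        unfolding exp_diff by (simp add: exp_minus field_simps power2_eq_square exp_add[symmetric])
      finally show "norm (\<Phi> x * \<Psi> x * (gwt \<beta> R (S n) x)\<^sup>2 * G (z (S n) x)) \<le> m1 * (Z * exp (a * norm x - 2 * \<beta> * (x \<bullet> x)))" .
    qed
  qed
qed

text \<open>The energy of the positive part of z starts from 0, so Gronwall's lemma leaves only the
  error of order 1/R. The fourth power gives a twice continuously differentiable G with H^2 \<le> 2
  G H', as \<open>energy_estimate\<close> demands, and its \<open>H\<close> vanishes where v \<le>
  0, where no inequality is assumed.\<close>

lemma comparison:
  assumes ineq: "\<And>t x. t > 0 \<Longrightarrow> v t x > 0 \<Longrightarrow> v' t x \<le> D t x + q x * v t x"
    and bdd: "\<And>T. \<exists>B. \<forall>t x. 0 < t \<longrightarrow> t \<le> T \<longrightarrow> z t x \<le> B"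
    and lim: "AE x in lborel. ((\<lambda>t. max 0 (z t x)) \<longlongrightarrow> 0) (at_right 0)"
    and T: "T > 0"
  shows "v T x \<le> 0"
proof -
  define G H H' where "G = (\<lambda>s :: real. (max 0 s) ^ 4)" and "H = (\<lambda>s :: real. 4 * (max 0 s) ^ 3)"
     and "H' = (\<lambda>s :: real. 12 * (max 0 s)\<^sup>2)"
  have Gd: "(G has_real_derivative H s) (at s)" for s
    using DERIV_pos_part_power[of 2 s] unfolding G_def H_def by (simp add: eval_nat_numeral)
  have Hd: "(H has_real_derivative H' s) (at s)" for s
    using DERIV_cmult[OF DERIV_pos_part_power[of 1 s], of 4] unfolding H_def H'_def by (simp add: eval_nat_numeral)
  have cH': "continuous_on UNIV H'" unfolding H'_def by (intro continuous_intros)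
  have cG: "continuous_on UNIV G" unfolding G_def by (intro continuous_intros)
  have G0: "0 \<le> G s" for s unfolding G_def by simp
  have GH: "G s \<le> s * H s" for s unfolding G_def H_def by (cases "s \<ge> 0") (auto simp: max_def eval_nat_numeral)
  have H'0: "0 \<le> H' s" for s unfolding H'_def by simp
  have HH: "(H s)\<^sup>2 \<le> 2 * G s * H' s" for s
    unfolding G_def H_def H'_def by (simp add: power_mult_distrib power_mult[symmetric] power_add[symmetric] mult_ac)
  have Hin: "H (z t x) * (v' t x - D t x - q x * v t x) \<le> 0" if "t > 0" for t x
  proof (cases "v t x > 0")
    case True
    thus ?thesis using ineq[OF that True] \<Phi>(2)[of x] unfolding H_def by (intro mult_nonneg_nonpos) auto
  next
    case False
    hence "z t x \<le> 0" using \<Phi>(2)[of x] by (simp add: divide_nonpos_pos)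
    thus ?thesis by (simp add: H_def max_def)
  qed
  obtain B where B: "\<And>t x. 0 < t \<Longrightarrow> t \<le> T \<Longrightarrow> z t x \<le> B" using bdd[of T] by blast
  define Z where "Z = (max 0 B) ^ 4"
  have Gg: "G (z t x) \<le> Z * exp (0 * norm x)" if "0 < t" "t \<le> T" for t x
    unfolding G_def Z_def using B[OF that, of x] by (auto intro!: power_mono)
  define K where "K = 4 * b\<^sup>2 * (1 + T)\<^sup>2 / m0 + 128 * m1 * \<Lambda> + 32 * \<alpha> * m0 + 8 * b"
  have b0: "0 \<le> b" using drift_bd norm_ge_zero order_trans by blast
  have K: "K \<ge> 0" using b0 m1_pos m bd ell by (simp add: K_def)
  have den: "0 < 8 * (4 * m1 * \<Lambda> + \<alpha> * m0) * (1 + T)\<^sup>2"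
    using m1_pos bd ell m T by (intro mult_pos_pos add_nonneg_pos) auto
  define \<beta>0 where "\<beta>0 = m0 / (8 * (4 * m1 * \<Lambda> + \<alpha> * m0) * (1 + T)\<^sup>2)"
  have \<beta>0: "\<beta>0 > 0" unfolding \<beta>0_def using m den by simp
  have cGz: "continuous_on UNIV (\<lambda>x. G (z t x))" if "t > 0" for t
    using continuous_on_compose2[OF cG C1_continuous[OF C1_z[OF that]]] by auto
  have main: "\<exists>J. \<forall>R\<ge>1. (LINT x|lborel. (gwt \<beta> R T x)\<^sup>2 * (\<Phi> x * \<Psi> x * G (z T x))) \<le> exp (K * T / m0 * \<beta>) * (0 + J / R)"
    if \<beta>: "0 < \<beta>" "\<beta> \<le> \<beta>0" for \<beta>
  proof (intro exI allI impI)
    fix R :: real assume R: "R \<ge> 1"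
    hence R0: "R > 0" by simp
    define J where "J = (LINT x|lborel. Z * exp (0 * norm (x :: real ^ 'n) - 2 * \<beta> * (x \<bullet> x)))"
    have J: "J \<ge> 0" unfolding J_def Z_def by (intro Bochner_Integration.integral_nonneg) auto
    have \<beta>': "8 * \<beta> * (4 * m1 * \<Lambda> + \<alpha> * m0) * (1 + T)\<^sup>2 \<le> m0"
      using \<beta>(2) unfolding \<beta>0_def pos_le_divide_eq[OF den] by (simp add: mult_ac)
    define E where "E = (\<lambda>t. LINT x|lborel. \<Phi> x * \<Psi> x * (gwt \<beta> R t x)\<^sup>2 * G (z t x))"
    have "E T \<le> exp (K * \<beta> / m0 * T) * (0 + K / R * J * T)"
    proof (rule gronwall_from_limit[OF T])
      fix t assume t: "0 < t" "t \<le> T"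
      obtain e where e: "(E has_real_derivative e) (at t)"
        "e \<le> - (\<alpha> * m0 / 2) * (LINT x|lborel. (gwt \<beta> R t x)\<^sup>2 * H' (z t x) * (norm (grad (z t) x))\<^sup>2)
           - \<alpha> * m0 * (LINT x|lborel. G (z t x) * (norm (grad (gwt \<beta> R t) x))\<^sup>2)
           + K * \<beta> * (LINT x|lborel. (gwt \<beta> R t x)\<^sup>2 * G (z t x)) + K / R * J"
        using energy_estimate[OF Gd Hd cH' G0 GH H'0 HH Hin Gg[OF t] t R \<beta>(1) \<beta>' K_def] unfolding E_def J_def by blast
      have p: "0 \<le> (\<alpha> * m0 / 2) * (LINT x|lborel. (gwt \<beta> R t x)\<^sup>2 * H' (z t x) * (norm (grad (z t) x))\<^sup>2)"
         "0 \<le> \<alpha> * m0 * (LINT x|lborel. G (z t x) * (norm (grad (gwt \<beta> R t) x))\<^sup>2)"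
        using ell(2) m(1) H'0 G0 by (auto intro!: mult_nonneg_nonneg Bochner_Integration.integral_nonneg)
      have "(LINT x|lborel. m0 * ((gwt \<beta> R t x)\<^sup>2 * G (z t x))) \<le> E t"
        unfolding E_def
      proof (rule Bochner_Integration.integral_mono)
        show "integrable lborel (\<lambda>x. m0 * ((gwt \<beta> R t x)\<^sup>2 * G (z t x)))"
          using csupp_integrable[OF csupp_gwt_mult[OF R0 cGz[OF t(1)], of \<beta> t]] by simp
        show "integrable lborel (\<lambda>x. \<Phi> x * \<Psi> x * (gwt \<beta> R t x)\<^sup>2 * G (z t x))"
          using csupp_integrable[OF csupp_gwt_mult[OF R0 continuous_on_mult[OF continuous_m cGz[OF t(1)]], of \<beta> t]]
          by (simp add: mult_ac)
        show "m0 * ((gwt \<beta> R t x)\<^sup>2 * G (z t x)) \<le> \<Phi> x * \<Psi> x * (gwt \<beta> R t x)\<^sup>2 * G (z t x)" for x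
          unfolding mult.assoc[of _ "(gwt \<beta> R t x)\<^sup>2"] using m(2)[of x] G0 by (intro mult_right_mono) auto
      qed
      hence "m0 * (LINT x|lborel. (gwt \<beta> R t x)\<^sup>2 * G (z t x)) \<le> E t" by simp
      from mult_left_mono[OF this, of "K * \<beta> / m0"]
      have "K * \<beta> * (LINT x|lborel. (gwt \<beta> R t x)\<^sup>2 * G (z t x)) \<le> K * \<beta> / m0 * E t" using K \<beta> m(1) by simp
      hence "e \<le> K * \<beta> / m0 * E t + K / R * J" using e(2) p by linarith
      thus "\<exists>e. (E has_real_derivative e) (at t) \<and> e \<le> K * \<beta> / m0 * E t + K / R * J" using e(1) by blast
    next
      have "AE x in lborel. ((\<lambda>t. G (z t x)) \<longlongrightarrow> 0) (at_right 0)"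
        using lim
      proof eventually_elim
        case (elim x)
        have "((\<lambda>t. (max 0 (z t x)) ^ 4) \<longlongrightarrow> 0 ^ 4) (at_right 0)" by (intro tendsto_intros elim)
        thus ?case by (simp add: G_def)
      qed
      from energy_initial_limit[OF cG G0 Gg T R \<beta>(1) this] show "(E \<longlongrightarrow> 0) (at_right 0)" by (simp add: E_def)
    qed (use K \<beta> m R J in auto)
    moreover have "(LINT x|lborel. (gwt \<beta> R T x)\<^sup>2 * (\<Phi> x * \<Psi> x * G (z T x))) = E T"
      unfolding E_def by (simp add: mult_ac)
    ultimately show "(LINT x|lborel. (gwt \<beta> R T x)\<^sup>2 * (\<Phi> x * \<Psi> x * G (z T x))) \<le> exp (K * T / m0 * \<beta>) * (0 + (K * (LINT x|lborel. Z * exp (0 * norm (x :: real ^ 'n) - 2 * \<beta> * (x \<bullet> x))) * T) / R)"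
      unfolding J_def by (simp add: mult_ac)
  qed
  have cf: "continuous_on UNIV (\<lambda>x. \<Phi> x * \<Psi> x * G (z T x))"
    by (rule continuous_on_mult[OF continuous_m cGz[OF T]])
  have nn: "0 \<le> \<Phi> x * \<Psi> x * G (z T x)" for x using \<Phi>(2)[of x] \<Psi>(2)[of x] G0 by simp
  have K': "0 \<le> K * T / m0" using K T m by simp
  note wl = weight_limit[OF cf nn \<beta>0 order_refl K' main]
  have "(LINT x|lborel. \<Phi> x * \<Psi> x * G (z T x)) = 0"
    using wl(2) Bochner_Integration.integral_nonneg[of lborel "\<lambda>x. \<Phi> x * \<Psi> x * G (z T x)"] nn by (simp add: antisym)
  hence "AE x in lborel. \<Phi> x * \<Psi> x * G (z T x) = 0"
    using integral_nonneg_eq_0_iff_AE[OF wl(1)] nn by simp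
  hence "AE x in lborel. \<Phi> x * \<Psi> x * G (z T x) \<le> 0" by eventually_elim (simp only: order_refl)
  from AE_nonpos_imp_nonpos[OF cf this, of x] have "G (z T x) = 0" using nn[of x] \<Phi>(2)[of x] \<Psi>(2)[of x] G0[of "z T x"]
    by (simp add: mult_le_0_iff)
  hence "max 0 (z T x) = 0" by (simp add: G_def)
  hence "z T x \<le> 0" by linarith
  thus ?thesis using \<Phi>(2)[of x] by (simp add: divide_le_0_iff)
qed

end

text \<open>Up to sign the radial factor in the gradient of the squared weight
  (\<open>grad_gwt_sq\<close>), as a function of s = |x|^2 and with \<gamma> = \<beta> (1 + t). The
  L^1 estimate differentiates it once more.\<close>

definition gwt_coeff :: "real \<Rightarrow> real \<Rightarrow> real \<Rightarrow> real" where
  "gwt_coeff \<gamma> R s = exp (- (2 * \<gamma>) * s) * (8 / R\<^sup>2 * (max 0 (1 - s / R\<^sup>2)) ^ 3 + 4 * \<gamma> * (max 0 (1 - s / R\<^sup>2)) ^ 4)"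

definition gwt_coeff' :: "real \<Rightarrow> real \<Rightarrow> real \<Rightarrow> real" where
  "gwt_coeff' \<gamma> R s = - (2 * \<gamma>) * gwt_coeff \<gamma> R s
     - exp (- (2 * \<gamma>) * s) * (24 / R ^ 4 * (max 0 (1 - s / R\<^sup>2)) ^ 2 + 16 * \<gamma> / R\<^sup>2 * (max 0 (1 - s / R\<^sup>2)) ^ 3)"

lemma gwt_coeff_deriv: "(gwt_coeff \<gamma> R has_real_derivative gwt_coeff' \<gamma> R s) (at s)"
proof -
  have 1: "((\<lambda>s. 1 - s / R\<^sup>2) has_real_derivative - (1 / R\<^sup>2)) (at s)"
    using DERIV_diff[OF DERIV_const DERIV_cdivide[OF DERIV_ident]] by simp
  have 3: "((\<lambda>s. (max 0 (1 - s / R\<^sup>2)) ^ 3) has_real_derivative 3 * (max 0 (1 - s / R\<^sup>2)) ^ 2 * - (1 / R\<^sup>2)) (at s)"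
    using DERIV_chain2[OF DERIV_pos_part_power[of 1] 1] by (simp add: eval_nat_numeral)
  have 4: "((\<lambda>s. (max 0 (1 - s / R\<^sup>2)) ^ 4) has_real_derivative 4 * (max 0 (1 - s / R\<^sup>2)) ^ 3 * - (1 / R\<^sup>2)) (at s)"
    using DERIV_chain2[OF DERIV_pos_part_power[of 2] 1] by (simp add: eval_nat_numeral)
  have 5: "((\<lambda>s. exp (- (2 * \<gamma>) * s)) has_real_derivative - (2 * \<gamma>) * exp (- (2 * \<gamma>) * s)) (at s)"
    by (auto intro!: derivative_eq_intros)
  have R4: "R ^ 4 = R\<^sup>2 * R\<^sup>2" by (simp add: power_add[symmetric])
  have alg: "- (2 * \<gamma>) * e * (8 / Q * c ^ 3 + 4 * \<gamma> * c ^ 4) + (8 / Q * (3 * c ^ 2 * - (1 / Q)) + 4 * \<gamma> * (4 * c ^ 3 * - (1 / Q))) * e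
    = - (2 * \<gamma>) * (e * (8 / Q * c ^ 3 + 4 * \<gamma> * c ^ 4)) - e * (24 / (Q * Q) * c ^ 2 + 16 * \<gamma> / Q * c ^ 3)" for e Q c :: real
    by (simp add: algebra_simps)
  show ?thesis
    unfolding gwt_coeff_def[abs_def]
    by (rule DERIV_cong[OF DERIV_mult[OF 5 DERIV_add[OF DERIV_cmult[OF 3] DERIV_cmult[OF 4]]]])
       (unfold gwt_coeff'_def gwt_coeff_def R4, rule alg)
qed

lemma continuous_gwt_coeff': "R > 0 \<Longrightarrow> continuous_on UNIV (gwt_coeff' \<gamma> R)"
  unfolding gwt_coeff'_def[abs_def] gwt_coeff_def by (intro continuous_intros) auto

lemma grad_gwt_sq:
  assumes R: "R > 0"
  shows "grad (\<lambda>x. (gwt \<beta> R t x)\<^sup>2) x = - gwt_coeff (\<beta> * (1 + t)) R (x \<bullet> x) *\<^sub>R (x :: real ^ 'n)"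
proof -
  let ?g = "\<beta> * (1 + t)"
  let ?c = "max 0 (1 - (x \<bullet> x) / R\<^sup>2)"
  let ?e = "exp (- ?g * (x \<bullet> x))"
  have "grad (\<lambda>x. (gwt \<beta> R t x)\<^sup>2) x = (2 * gwt \<beta> R t x) *\<^sub>R grad (gwt \<beta> R t) x"
    unfolding power2_eq_square C1_mult(2)[OF C1_gwt(1)[OF R] C1_gwt(1)[OF R]] scaleR_add_left[symmetric] by simp
  also have "\<dots> = - (2 * gwt \<beta> R t x * (?e * (4 * ?c / R\<^sup>2) + 2 * ?g * gwt \<beta> R t x)) *\<^sub>R x"
    unfolding C1_gwt(2)[OF R] C1_cutoff(2)[OF R] by (simp add: algebra_simps)
  also have "2 * gwt \<beta> R t x * (?e * (4 * ?c / R\<^sup>2) + 2 * ?g * gwt \<beta> R t x) = gwt_coeff ?g R (x \<bullet> x)"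
  proof -
    have ee: "exp (- (2 * ?g) * (x \<bullet> x)) = ?e * ?e" unfolding exp_add[symmetric] by simp
    show ?thesis unfolding gwt_coeff_def ee unfolding gwt_def cutoff_def
      by (simp add: eval_nat_numeral algebra_simps)
  qed
  finally show ?thesis .
qed

text \<open>On the support |x| \<le> R, hence |x|^2 / R^2 \<le> |x| / R: derivatives of the cutoff
  cost a factor 1/R, whereas those of the Gaussian keep the weight and bring factors
  \<beta>.\<close>

lemma gwt_coeff_bounds:
  fixes x :: "real ^ 'n"
  assumes R: "R \<ge> 1" and \<beta>: "0 < \<beta>" and t: "0 \<le> t" "t \<le> T"
  defines "\<gamma> \<equiv> \<beta> * (1 + t)" and "E \<equiv> exp (- \<beta> * (x \<bullet> x))"
  shows "0 \<le> gwt_coeff \<gamma> R (x \<bullet> x)"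
    and "gwt_coeff \<gamma> R (x \<bullet> x) \<le> 4 * \<beta> * (1 + T) * (gwt \<beta> R t x)\<^sup>2 + 8 / R * E\<^sup>2"
    and "\<bar>gwt_coeff' \<gamma> R (x \<bullet> x)\<bar> * (norm x)\<^sup>2 \<le> 8 * \<beta>\<^sup>2 * (1 + T)\<^sup>2 * (norm x)\<^sup>2 * (gwt \<beta> R t x)\<^sup>2
       + (32 * \<beta> * (1 + T) * norm x + 24) / R * E\<^sup>2"
proof -
  define X where "X = norm x"
  have X: "0 \<le> X" "x \<bullet> x = X\<^sup>2" by (simp_all add: X_def power2_norm_eq_inner)
  define c where "c = max 0 (1 - X\<^sup>2 / R\<^sup>2)"
  define e where "e = exp (- (2 * \<gamma>) * X\<^sup>2)"
  have \<gamma>: "0 < \<gamma>" "\<gamma> \<le> \<beta> * (1 + T)" unfolding \<gamma>_def using \<beta> t by auto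
  have c: "0 \<le> c" "c \<le> 1" by (auto simp: c_def)
  have c': "c ^ k \<le> 1" "0 \<le> c ^ k" for k using c by (auto intro: power_le_one)
  have e: "0 < e" "e \<le> E\<^sup>2"
  proof -
    have "\<beta> * X\<^sup>2 * 1 \<le> \<beta> * X\<^sup>2 * (1 + t)" using \<beta> t by (intro mult_left_mono) auto
    hence "- (2 * \<gamma>) * X\<^sup>2 \<le> - \<beta> * X\<^sup>2 + - \<beta> * X\<^sup>2" by (simp add: \<gamma>_def algebra_simps)
    thus "e \<le> E\<^sup>2" unfolding e_def E_def X power2_eq_square[of "exp _"] exp_add[symmetric] by (subst exp_le_cancel_iff)
  qed (simp add: e_def)
  have g2: "(gwt \<beta> R t x)\<^sup>2 = e * c ^ 4"
  proof -
    have "e = exp (- \<gamma> * X\<^sup>2) * exp (- \<gamma> * X\<^sup>2)" unfolding e_def exp_add[symmetric] by simp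
    moreover have "gwt \<beta> R t x = exp (- \<gamma> * X\<^sup>2) * c ^ 2" by (simp add: gwt_def cutoff_def X c_def \<gamma>_def)
    ultimately show ?thesis by (simp add: eval_nat_numeral)
  qed
  have h: "gwt_coeff \<gamma> R (x \<bullet> x) = 8 / R\<^sup>2 * (e * c ^ 3) + 4 * \<gamma> * (gwt \<beta> R t x)\<^sup>2"
    unfolding gwt_coeff_def X e_def[symmetric] c_def[symmetric] g2 by (simp add: algebra_simps)
  have R2: "1 / R\<^sup>2 \<le> 1 / R" using R by (auto simp: power2_eq_square intro!: divide_left_mono)
  show p: "0 \<le> gwt_coeff \<gamma> R (x \<bullet> x)" unfolding h using c e \<gamma> by auto
  have ec: "e * c ^ k \<le> E\<^sup>2" "0 \<le> e * c ^ k" for k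
    using mult_mono[OF e(2) c'(1)[of k]] e(1) c'(2)[of k] by auto
  show "gwt_coeff \<gamma> R (x \<bullet> x) \<le> 4 * \<beta> * (1 + T) * (gwt \<beta> R t x)\<^sup>2 + 8 / R * E\<^sup>2"
  proof -
    have "4 * \<gamma> * (gwt \<beta> R t x)\<^sup>2 \<le> 4 * \<beta> * (1 + T) * (gwt \<beta> R t x)\<^sup>2" using \<gamma> by (intro mult_right_mono) auto
    moreover have "(8 * (1 / R\<^sup>2)) * (e * c ^ 3) \<le> (8 * (1 / R)) * E\<^sup>2"
      using R2 ec[of 3] R by (intro mult_mono) auto
    ultimately show ?thesis unfolding h by simp
  qed
  have XR: "c ^ 2 * (X\<^sup>2 / R\<^sup>2) \<le> c ^ 2 * (X / R)" "c ^ 2 * (X\<^sup>2 / R ^ 4) \<le> c ^ 2 * (1 / R)"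
  proof -
    have R4: "R ^ 4 = R\<^sup>2 * R\<^sup>2" by (simp add: power_add[symmetric])
    have "c = 0 \<or> X\<^sup>2 \<le> R\<^sup>2" using R by (auto simp: c_def max_def field_simps split: if_splits)
    moreover have "X\<^sup>2 / R\<^sup>2 \<le> X / R" "X\<^sup>2 / R ^ 4 \<le> 1 / R" if "X\<^sup>2 \<le> R\<^sup>2"
    proof -
      have "X \<le> R" by (rule power2_le_imp_le[OF that]) (use R in simp)
      hence XR: "X / R \<le> 1" "0 \<le> X / R" using R X by auto
      have "X\<^sup>2 / R\<^sup>2 = X / R * (X / R)" by (simp add: power2_eq_square)
      also have "\<dots> \<le> X / R * 1" by (rule mult_left_mono[OF XR])
      finally show "X\<^sup>2 / R\<^sup>2 \<le> X / R" by simp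
      hence 1: "X\<^sup>2 / R\<^sup>2 \<le> 1" using XR by simp
      have "X\<^sup>2 / R ^ 4 = (X\<^sup>2 / R\<^sup>2) * (1 / R\<^sup>2)" unfolding R4 by simp
      also have "\<dots> \<le> 1 * (1 / R)" using 1 R2 R by (intro mult_mono) auto
      finally show "X\<^sup>2 / R ^ 4 \<le> 1 / R" by simp
    qed
    ultimately consider "c = 0" | "X\<^sup>2 / R\<^sup>2 \<le> X / R" "X\<^sup>2 / R ^ 4 \<le> 1 / R" by blast
    hence "c ^ 2 * (X\<^sup>2 / R\<^sup>2) \<le> c ^ 2 * (X / R) \<and> c ^ 2 * (X\<^sup>2 / R ^ 4) \<le> c ^ 2 * (1 / R)"
    proof cases
      case 2
      thus ?thesis by (intro conjI mult_left_mono zero_le_power2)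
    qed simp
    thus "c ^ 2 * (X\<^sup>2 / R\<^sup>2) \<le> c ^ 2 * (X / R)" "c ^ 2 * (X\<^sup>2 / R ^ 4) \<le> c ^ 2 * (1 / R)" by auto
  qed
  have "\<bar>gwt_coeff' \<gamma> R (x \<bullet> x)\<bar> = 2 * \<gamma> * gwt_coeff \<gamma> R (x \<bullet> x) + e * (24 / R ^ 4 * c ^ 2 + 16 * \<gamma> / R\<^sup>2 * c ^ 3)"
  proof -
    have "0 \<le> e * (24 / R ^ 4 * c ^ 2 + 16 * \<gamma> / R\<^sup>2 * c ^ 3)" 
      using e(1) c(1) \<gamma>(1) R by (intro mult_nonneg_nonneg add_nonneg_nonneg divide_nonneg_nonneg zero_le_power) auto
    moreover have "0 \<le> 2 * \<gamma> * gwt_coeff \<gamma> R (x \<bullet> x)" using p \<gamma> by auto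
    moreover have "gwt_coeff' \<gamma> R (x \<bullet> x) = - (2 * \<gamma> * gwt_coeff \<gamma> R (x \<bullet> x)) - e * (24 / R ^ 4 * c ^ 2 + 16 * \<gamma> / R\<^sup>2 * c ^ 3)"
      unfolding gwt_coeff'_def X e_def[symmetric] c_def[symmetric] by simp
    ultimately show ?thesis by linarith
  qed
  hence "\<bar>gwt_coeff' \<gamma> R (x \<bullet> x)\<bar> * X\<^sup>2 = 8 * \<gamma>\<^sup>2 * X\<^sup>2 * (gwt \<beta> R t x)\<^sup>2
      + 32 * \<gamma> * (e * c * (c ^ 2 * (X\<^sup>2 / R\<^sup>2))) + 24 * (e * (c ^ 2 * (X\<^sup>2 / R ^ 4)))"
    unfolding h by (simp add: eval_nat_numeral algebra_simps add_divide_distrib)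
  also have "\<dots> \<le> 8 * (\<beta> * (1 + T))\<^sup>2 * X\<^sup>2 * (gwt \<beta> R t x)\<^sup>2 + 32 * (\<beta> * (1 + T)) * (E\<^sup>2 * (X / R)) + 24 * (E\<^sup>2 * (1 / R))"
  proof (intro add_mono)
    show "8 * \<gamma>\<^sup>2 * X\<^sup>2 * (gwt \<beta> R t x)\<^sup>2 \<le> 8 * (\<beta> * (1 + T))\<^sup>2 * X\<^sup>2 * (gwt \<beta> R t x)\<^sup>2"
      using \<gamma> by (intro mult_right_mono mult_left_mono power_mono) auto
    have "e * c * (c ^ 2 * (X\<^sup>2 / R\<^sup>2)) \<le> e * c * (c ^ 2 * (X / R))" by (rule mult_left_mono[OF XR(1)]) (use e c in simp)
    also have "\<dots> = (e * c ^ 3) * (X / R)" by (simp add: eval_nat_numeral)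
    also have "\<dots> \<le> E\<^sup>2 * (X / R)" using ec[of 3] X R by (intro mult_right_mono) auto
    finally have f: "e * c * (c ^ 2 * (X\<^sup>2 / R\<^sup>2)) \<le> E\<^sup>2 * (X / R)" .
    show "32 * \<gamma> * (e * c * (c ^ 2 * (X\<^sup>2 / R\<^sup>2))) \<le> 32 * (\<beta> * (1 + T)) * (E\<^sup>2 * (X / R))"
      by (rule mult_mono[OF _ f]) (use \<gamma> \<beta> t e(1) c in auto)
    have "e * (c ^ 2 * (X\<^sup>2 / R ^ 4)) \<le> e * (c ^ 2 * (1 / R))" by (rule mult_left_mono[OF XR(2)]) (use e in simp)
    also have "\<dots> = (e * c ^ 2) * (1 / R)" by simp
    also have "\<dots> \<le> E\<^sup>2 * (1 / R)" using ec[of 2] R by (intro mult_right_mono) auto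
    finally show "24 * (e * (c ^ 2 * (X\<^sup>2 / R ^ 4))) \<le> 24 * (E\<^sup>2 * (1 / R))" by simp
  qed
  also have "\<dots> = 8 * \<beta>\<^sup>2 * (1 + T)\<^sup>2 * X\<^sup>2 * (gwt \<beta> R t x)\<^sup>2 + (32 * \<beta> * (1 + T) * X + 24) / R * E\<^sup>2"
    unfolding power_mult_distrib add_divide_distrib by (simp add: distrib_right)
  finally show "\<bar>gwt_coeff' \<gamma> R (x \<bullet> x)\<bar> * (norm x)\<^sup>2 \<le> 8 * \<beta>\<^sup>2 * (1 + T)\<^sup>2 * (norm x)\<^sup>2 * (gwt \<beta> R t x)\<^sup>2
       + (32 * \<beta> * (1 + T) * norm x + 24) / R * E\<^sup>2" by (simp add: X_def)
qed

section \<open>Control of the L^1 norm\<close>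

context weighted_flow
begin

text \<open>For G close to |s| the inequality H^2 \<le> 2 G H' fails, so the cross term with H(z)
  grad z cannot be absorbed as in \<open>energy_estimate\<close>. Instead it is integrated by parts,
  as grad G(z) against the field \<Phi>\<Psi> A x; the price is the divergence \<open>dY\<close> and
  a second derivative of the weight.\<close>

lemma mass_bound_regularized:
  assumes ineq: "\<And>t x. t > 0 \<Longrightarrow> v t x * (v' t x - D t x - q x * v t x) \<le> 0"
    and Z: "Z \<ge> 0" "\<And>t x. 0 < t \<Longrightarrow> t \<le> T \<Longrightarrow> \<bar>z t x\<bar> \<le> Z * exp (a * norm x)"
    and Y: "has_weak_divergence (\<lambda>x. (\<Phi> x * \<Psi> x) *\<^sub>R (A x *v x)) dY" "\<And>x. \<bar>dY x\<bar> \<le> d * (1 + norm x)"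
    and lim: "AE x in lborel. ((\<lambda>t. z t x) \<longlongrightarrow> z0 x) (at_right 0)" and z0: "z0 \<in> borel_measurable borel"
    and M: "integrable lborel (\<lambda>x. \<Phi> x * \<Psi> x * \<bar>z0 x\<bar>)" "(LINT x|lborel. \<Phi> x * \<Psi> x * \<bar>z0 x\<bar>) \<le> M"
    and T: "T > 0" and R: "R \<ge> 1" and \<beta>: "0 < \<beta>" "16 * \<beta> * m1 * \<Lambda> * (1 + T)\<^sup>2 \<le> m0" and \<epsilon>: "\<epsilon> > 0"
    and K: "K = 4 * (1 + T) * d + 4 * (1 + T)\<^sup>2 * (d + b)\<^sup>2 / m0"
    and K2: "K2 = 8 * d + 8 * b + 64 * m1 * \<Lambda> * \<beta> * (1 + T) + 48 * m1 * \<Lambda>"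
  shows "(LINT x|lborel. \<Phi> x * \<Psi> x * (gwt \<beta> R T x)\<^sup>2 * (sqrt ((z T x)\<^sup>2 + \<epsilon>\<^sup>2) - \<epsilon>))
     \<le> exp (K * \<beta> / m0 * T) * (M + K2 / R * (LINT x|lborel. Z * exp ((a + 1) * norm (x :: real ^ 'n) - 2 * \<beta> * (x \<bullet> x))) * T)"
proof -
  define r where "r s = sqrt (s\<^sup>2 + \<epsilon>\<^sup>2)" for s :: real
  \<comment> \<open>A smooth convex substitute for |s| that vanishes at 0, lies below |s| and
    satisfies G \<le> s H.\<close>
  define G H H' where "G = (\<lambda>s. r s - \<epsilon>)" and "H = (\<lambda>s. s / r s)" and "H' = (\<lambda>s. \<epsilon>\<^sup>2 / (r s) ^ 3)"
  have r: "r s > 0" "(r s)\<^sup>2 = s\<^sup>2 + \<epsilon>\<^sup>2" for s using \<epsilon> by (auto simp: r_def add_nonneg_pos)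
  have rd: "(r has_real_derivative s / r s) (at s)" for s
    unfolding r_def[abs_def] using r(1)[of s] \<epsilon> unfolding r_def
    by (auto intro!: derivative_eq_intros simp: add_nonneg_pos field_simps)
  have cr: "continuous_on UNIV r" unfolding r_def[abs_def] by (intro continuous_intros)
  have Gd: "(G has_real_derivative H s) (at s)" for s
    unfolding G_def H_def using DERIV_diff[OF rd DERIV_const] by simp
  have Hd: "(H has_real_derivative H' s) (at s)" for s
  proof -
    have "(H has_real_derivative (1 * r s - s * (s / r s)) / (r s * r s)) (at s)"
      unfolding H_def using r(1)[of s] by (intro DERIV_divide[OF DERIV_ident rd]) simp
    moreover have "(1 * r s - s * (s / r s)) / (r s * r s) = H' s"
      using r[of s] unfolding H'_def by (simp add: field_simps eval_nat_numeral)
    ultimately show ?thesis by simp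
  qed
  have cH': "continuous_on UNIV H'" unfolding H'_def by (intro continuous_intros cr) (use r in \<open>simp add: less_imp_neq[symmetric]\<close>)
  have cG: "continuous_on UNIV G" unfolding G_def by (intro continuous_intros cr)
  have cH: "continuous_on UNIV H" unfolding H_def by (intro continuous_intros cr) (use r in \<open>simp add: less_imp_neq[symmetric]\<close>)
  have r\<epsilon>: "\<epsilon> \<le> r s" for s unfolding r_def using \<epsilon> by (intro real_le_rsqrt) auto
  have G0: "0 \<le> G s" for s unfolding G_def using r\<epsilon>[of s] by simp
  have Gabs: "G s \<le> \<bar>s\<bar>" for s
  proof -
    have "r s \<le> \<bar>s\<bar> + \<epsilon>" unfolding r_def using \<epsilon> by (intro real_le_lsqrt) (auto simp: power2_eq_square algebra_simps)
    thus ?thesis by (simp add: G_def)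
  qed
  have GH: "G s \<le> s * H s" for s
  proof -
    have "s * H s - G s = (s\<^sup>2 - (r s)\<^sup>2 + \<epsilon> * r s) / r s"
      using r(1)[of s] by (simp add: G_def H_def field_simps power2_eq_square)
    also have "\<dots> = \<epsilon> * (r s - \<epsilon>) / r s" unfolding r(2) by (simp add: power2_eq_square algebra_simps)
    also have "\<dots> \<ge> 0" using r\<epsilon>[of s] \<epsilon> r(1)[of s] by simp
    finally show ?thesis by simp
  qed
  have H'0: "0 \<le> H' s" for s unfolding H'_def using r(1)[of s] by simp
  have Hin: "H (z t x) * (v' t x - D t x - q x * v t x) \<le> 0" if "t > 0" for t x
  proof -
    have "H (z t x) * (v' t x - D t x - q x * v t x) = 1 / (\<Phi> x * r (z t x)) * (v t x * (v' t x - D t x - q x * v t x))"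
      by (simp add: H_def)
    also have "\<dots> \<le> 0" by (rule mult_nonneg_nonpos[OF _ ineq[OF that]]) (use \<Phi>(2)[of x] r(1)[of "z t x"] in simp)
    finally show ?thesis .
  qed
  have R0: "R > 0" using R by simp
  have b0: "0 \<le> b" using drift_bd norm_ge_zero order_trans by blast
  have d0: "0 \<le> d" using Y(2)[of 0] by (simp add: abs_ge_zero order_trans[OF abs_ge_zero])
  have K0: "0 \<le> K" using d0 T m(1) by (simp add: K)
  have K20: "0 \<le> K2" using d0 b0 m1_pos bd(2) \<beta>(1) T by (simp add: K2)
  have Gz: "G (z t x) \<le> Z * exp (a * norm x)" if "0 < t" "t \<le> T" for t x
    using Gabs[of "z t x"] Z(2)[OF that, of x] by linarith
  define J where "J = (LINT x|lborel. Z * exp ((a + 1) * norm (x :: real ^ 'n) - 2 * \<beta> * (x \<bullet> x)))"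
  have Ji: "integrable lborel (\<lambda>x :: real ^ 'n. Z * exp ((a + 1) * norm x - 2 * \<beta> * (x \<bullet> x)))"
    by (intro integrable_mult_right integrable_gaussian) (use \<beta> in simp)
  have J0: "0 \<le> J" unfolding J_def using Z by (intro Bochner_Integration.integral_nonneg) auto
  obtain c where c: "\<And>\<beta> t x. x \<notin> cbox (-c) c \<Longrightarrow> gwt \<beta> R t (x :: real ^ 'n) = 0" using gwt_support[OF R0] by blast
  define \<rho> :: "real \<Rightarrow> real ^ 'n \<Rightarrow> real" where "\<rho> = gwt \<beta> R"
  have C\<rho>: "C1 (\<rho> t)" for t unfolding \<rho>_def by (rule C1_gwt(1)[OF R0])
  have C\<rho>2: "C1 (\<lambda>x. (\<rho> t x)\<^sup>2)" for t unfolding power2_eq_square by (intro C1_mult C\<rho>)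
  have cg: "continuous_on ({0<..} \<times> UNIV) (\<lambda>p. \<rho> (fst p) (snd p))"
    unfolding \<rho>_def by (rule continuous_on_gwt[OF R0])
  let ?d = "\<lambda>t x. 2 * \<rho> t x * (- (\<beta> * (x \<bullet> x)) * \<rho> t x)"
  define E where "E = (\<lambda>t. LINT x|lborel. \<Phi> x * \<Psi> x * (\<rho> t x)\<^sup>2 * G (z t x))"
  have "E T \<le> exp (K * \<beta> / m0 * T) * (M + K2 / R * J * T)"
  proof -
    have E0: "(E \<longlongrightarrow> (LINT x|lborel. \<Phi> x * \<Psi> x * (gwt \<beta> R 0 x)\<^sup>2 * G (z0 x))) (at_right 0)"
      unfolding E_def \<rho>_def
    proof (rule energy_initial_limit[OF cG G0 Gz T R \<beta>(1)])
      show "AE x in lborel. ((\<lambda>t. G (z t x)) \<longlongrightarrow> G (z0 x)) (at_right 0)"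
        using lim
      proof eventually_elim
        case (elim x)
        show ?case
          by (rule isCont_tendsto_compose[OF _ elim]) (use cG in \<open>simp add: continuous_on_eq_continuous_at\<close>)
      qed
      show "(\<lambda>x. G (z0 x)) \<in> borel_measurable borel"
        using measurable_compose[OF z0 borel_measurable_continuous_onI[OF cG]] .
    qed
    have der: "\<exists>e. (E has_real_derivative e) (at t) \<and> e \<le> K * \<beta> / m0 * E t + K2 / R * J" if t: "0 < t" "t \<le> T" for t
    proof -
      have der: "\<exists>e. (E has_real_derivative e) (at t) \<and>
         e \<le> (LINT x|lborel. \<Phi> x * \<Psi> x * ?d t x * G (z t x))
       - (LINT x|lborel. \<Phi> x * \<Psi> x * (\<rho> t x)\<^sup>2 * H' (z t x) * (flux A (z t) x \<bullet> grad (z t) x)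
         + \<Phi> x * \<Psi> x * H (z t x) * (flux A (z t) x \<bullet> grad (\<lambda>x. (\<rho> t x)\<^sup>2) x) + G (z t x) * (drift A \<Phi> \<Psi> x \<bullet> grad (\<lambda>x. (\<rho> t x)\<^sup>2) x))"
        unfolding E_def
      proof (rule energy_derivative[OF sym flow \<Phi> \<Psi> _ _ _ _ _ _ Gd Hd cH' G0 GH Hin refl t(1), where a="-c" and b=c])
        show "((\<lambda>s. (\<rho> s x)\<^sup>2) has_real_derivative ?d t x) (at t)" for t x
          using DERIV_power[OF gwt_deriv[of \<beta> R x t], of 2] unfolding \<rho>_def by (simp add: mult_ac)
        show "continuous_on ({0<..} \<times> UNIV) (\<lambda>(t, x). (\<rho> t x)\<^sup>2)" "continuous_on ({0<..} \<times> UNIV) (\<lambda>(t, x). ?d t x)"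
          unfolding split_beta by (intro continuous_intros cg)+
      qed (use c C\<rho>2 in \<open>auto simp: \<rho>_def\<close>)
      define h h' where "h = gwt_coeff (\<beta> * (1 + t)) R" and "h' = gwt_coeff' (\<beta> * (1 + t)) R"
      have gs: "grad (\<lambda>x. (\<rho> t x)\<^sup>2) x = - h (x \<bullet> x) *\<^sub>R x" for x
        unfolding \<rho>_def h_def by (rule grad_gwt_sq[OF R0])
      have hd: "(h has_real_derivative h' s) (at s)" for s unfolding h_def h'_def by (rule gwt_coeff_deriv)
      have ch': "continuous_on UNIV h'" unfolding h'_def by (rule continuous_gwt_coeff'[OF R0])
      note Ch = C1_compose[OF C1_sqnorm[of 0] hd ch', simplified]
      have gh: "grad (\<lambda>x. h (x \<bullet> x)) x = (2 * h' (x \<bullet> x)) *\<^sub>R x" for x :: "real ^ 'n"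
        using Ch(2)[of x] grad_sqnorm[of 0 x] by simp
      have Cz: "C1 (z t)" by (rule C1_z[OF t(1)])
      note CG = C1_compose[OF Cz Gd cH]
      have h0: "h (x \<bullet> x) = 0" if "norm x > R" for x :: "real ^ 'n"
      proof -
        have "R\<^sup>2 \<le> x \<bullet> x" using that R0 by (metis less_imp_le power2_norm_eq_inner power_mono)
        thus ?thesis using R0 by (simp add: h_def gwt_coeff_def)
      qed
      have th: "test_function (\<lambda>x :: real ^ 'n. h (x \<bullet> x))"
      proof -
        have "{x :: real ^ 'n. h (x \<bullet> x) \<noteq> 0} \<subseteq> cball 0 R" using h0 by (force simp: not_le[symmetric])
        hence "bounded {x :: real ^ 'n. h (x \<bullet> x) \<noteq> 0}" by (rule bounded_subset[OF bounded_cball])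
        thus ?thesis using Ch(1) by (simp add: test_function_def)
      qed
      \<comment> \<open>The gradient of this test function contains h H(z) grad z; tested with the
        field of \<open>Y\<close> it reproduces the cross term of \<open>P2\<close>.\<close>
      have th2: "test_function (\<lambda>x. G (z t x) * h (x \<bullet> x))" by (rule test_mult[OF th CG(1)])
      have gth: "grad (\<lambda>x. G (z t x) * h (x \<bullet> x)) x = (2 * G (z t x) * h' (x \<bullet> x)) *\<^sub>R x + (h (x \<bullet> x) * H (z t x)) *\<^sub>R grad (z t) x" for x
        unfolding C1_mult(2)[OF CG(1) Ch(1)] gh CG(2) by simp
      note wY = weak_div_test[OF Y(1) th2]
      define P1 where "P1 x = \<Phi> x * \<Psi> x * ?d t x * G (z t x)" for x
      define P2 where "P2 x = \<Phi> x * \<Psi> x * (\<rho> t x)\<^sup>2 * H' (z t x) * (flux A (z t) x \<bullet> grad (z t) x)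
         + \<Phi> x * \<Psi> x * H (z t x) * (flux A (z t) x \<bullet> grad (\<lambda>x. (\<rho> t x)\<^sup>2) x) + G (z t x) * (drift A \<Phi> \<Psi> x \<bullet> grad (\<lambda>x. (\<rho> t x)\<^sup>2) x)" for x
      define P3 where "P3 x = (\<Phi> x * \<Psi> x) *\<^sub>R (A x *v x) \<bullet> grad (\<lambda>x. G (z t x) * h (x \<bullet> x)) x" for x
      define P4 where "P4 x = dY x * (G (z t x) * h (x \<bullet> x))" for x
      have P34: "(LINT x|lborel. P3 x) = - (LINT x|lborel. P4 x)" "integrable lborel P3" "integrable lborel P4"
        using wY unfolding P3_def[abs_def] P4_def[abs_def] by auto
      have cs: "csupp (\<rho> t)" unfolding \<rho>_def by (rule csupp_grad(1)[OF test_gwt[OF R0]])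
      have cGz: "continuous_on UNIV (\<lambda>x. G (z t x))" by (rule C1_continuous[OF CG(1)])
      have C\<Phi>: "continuous_on UNIV \<Phi>" "continuous_on UNIV \<Psi>" using \<Phi>(1) \<Psi>(1) by (auto simp: weak_sol_def intro: C1_continuous)
      have i1: "integrable lborel P1" unfolding P1_def[abs_def]
        by (rule csupp_integrable[OF csuppI[OF cs]]) (auto intro!: continuous_intros C\<Phi> cGz C1_continuous[OF C\<rho>])
      have i5: "integrable lborel (\<lambda>x. (\<rho> t x)\<^sup>2 * G (z t x))"
        unfolding \<rho>_def by (rule csupp_integrable[OF csupp_gwt_mult[OF R0 cGz]])
      have iE: "integrable lborel (\<lambda>x. \<Phi> x * \<Psi> x * (\<rho> t x)\<^sup>2 * G (z t x))"
        using csupp_integrable[OF csupp_gwt_mult[OF R0 continuous_on_mult[OF continuous_m cGz], of \<beta> t]]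
        by (simp add: \<rho>_def mult_ac)
      \<comment> \<open>\<open>P3\<close> and \<open>P4\<close> together integrate to 0, so both may
        be subtracted. Then the cross terms cancel, and the dissipation with \<open>H'\<close> is
        dropped for its sign.\<close>
      have bracket: "P1 x - P2 x - P3 x - P4 x \<le> K * \<beta> * ((\<rho> t x)\<^sup>2 * G (z t x)) + K2 / R * (Z * exp ((a + 1) * norm x - 2 * \<beta> * (x \<bullet> x)))" for x
      proof -
        define X where "X = norm x"
        have X: "0 \<le> X" "x \<bullet> x = X\<^sup>2" by (simp_all add: X_def power2_norm_eq_inner)
        define e2 where "e2 = (exp (- \<beta> * (x \<bullet> x)))\<^sup>2"
        have e2: "0 \<le> e2" by (simp add: e2_def)
        define mm where "mm = \<Phi> x * \<Psi> x"
        have mm: "m0 \<le> mm" "mm \<le> m1" "0 < mm" using m by (auto simp: mm_def intro: less_le_trans)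
        note cb = gwt_coeff_bounds[OF R \<beta>(1) less_imp_le[OF t(1)] t(2), of x, folded h_def h'_def \<rho>_def e2_def X_def]
        have F0: "0 \<le> flux A (z t) x \<bullet> grad (z t) x"
          unfolding flux_def using ell by (meson mult_nonneg_nonneg order_trans less_imp_le zero_le_power2)
        have sy: "(A x *v x) \<bullet> grad (z t) x = flux A (z t) x \<bullet> x" unfolding flux_def by (rule inner_symmetric_matrix[OF sym])
        have "P1 x - P2 x - P3 x - P4 x = - (mm * (\<rho> t x)\<^sup>2 * H' (z t x) * (flux A (z t) x \<bullet> grad (z t) x))
          + G (z t x) * (- 2 * mm * \<beta> * X\<^sup>2 * (\<rho> t x)\<^sup>2 + h (x \<bullet> x) * (drift A \<Phi> \<Psi> x \<bullet> x)
             - 2 * h' (x \<bullet> x) * mm * ((A x *v x) \<bullet> x) - dY x * h (x \<bullet> x))"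
          unfolding P1_def P2_def P3_def P4_def gs gth mm_def[symmetric] X(2)
          by (simp add: inner_add_right sy power2_eq_square algebra_simps)
        also have "\<dots> \<le> G (z t x) * (- 2 * mm * \<beta> * X\<^sup>2 * (\<rho> t x)\<^sup>2 + h (x \<bullet> x) * (drift A \<Phi> \<Psi> x \<bullet> x)
             - 2 * h' (x \<bullet> x) * mm * ((A x *v x) \<bullet> x) - dY x * h (x \<bullet> x))"
          using F0 H'0 mm by simp
        also have "\<dots> \<le> G (z t x) * (K * \<beta> * (\<rho> t x)\<^sup>2 + K2 / R * ((1 + X) * e2))"
        proof (rule mult_left_mono[OF _ G0])
          have 1: "h (x \<bullet> x) * (drift A \<Phi> \<Psi> x \<bullet> x) \<le> h (x \<bullet> x) * (b * X)"
          proof (rule mult_left_mono[OF _ cb(1)])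
            have "drift A \<Phi> \<Psi> x \<bullet> x \<le> norm (drift A \<Phi> \<Psi> x) * X" unfolding X_def by (rule norm_cauchy_schwarz)
            also have "\<dots> \<le> b * X" using drift_bd X by (intro mult_right_mono) auto
            finally show "drift A \<Phi> \<Psi> x \<bullet> x \<le> b * X" .
          qed
          have 2: "- (dY x * h (x \<bullet> x)) \<le> d * (1 + X) * h (x \<bullet> x)"
            using mult_right_mono[OF Y(2)[of x] cb(1)] mult_right_mono[OF abs_ge_minus_self[of "dY x"] cb(1)] unfolding X_def by linarith
          have Ax: "0 \<le> (A x *v x) \<bullet> x" "(A x *v x) \<bullet> x \<le> \<Lambda> * X\<^sup>2"
          proof -
            show "0 \<le> (A x *v x) \<bullet> x" using ell by (meson mult_nonneg_nonneg order_trans less_imp_le zero_le_power2)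
            have "(A x *v x) \<bullet> x \<le> norm (A x *v x) * norm x" by (rule norm_cauchy_schwarz)
            also have "\<dots> \<le> \<Lambda> * norm x * norm x" using bd by (intro mult_right_mono) auto
            finally show "(A x *v x) \<bullet> x \<le> \<Lambda> * X\<^sup>2" by (simp add: X_def power2_eq_square mult.assoc)
          qed
          have 3: "- (2 * h' (x \<bullet> x) * mm * ((A x *v x) \<bullet> x)) \<le> 2 * m1 * \<Lambda> * (\<bar>h' (x \<bullet> x)\<bar> * X\<^sup>2)"
          proof -
            have "- (2 * h' (x \<bullet> x) * mm * ((A x *v x) \<bullet> x)) \<le> 2 * \<bar>h' (x \<bullet> x)\<bar> * mm * ((A x *v x) \<bullet> x)"
              using mult_right_mono[OF abs_ge_minus_self[of "h' (x \<bullet> x)"], of "2 * mm * ((A x *v x) \<bullet> x)"] mm Ax by (simp add: mult_ac)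
            also have "\<dots> \<le> 2 * \<bar>h' (x \<bullet> x)\<bar> * m1 * (\<Lambda> * X\<^sup>2)" using mm Ax m1_pos by (intro mult_mono) auto
            finally show ?thesis by (simp add: mult_ac)
          qed
          have 4: "2 * m1 * \<Lambda> * (\<bar>h' (x \<bullet> x)\<bar> * X\<^sup>2) \<le> 2 * m1 * \<Lambda> * (8 * \<beta>\<^sup>2 * (1 + T)\<^sup>2 * X\<^sup>2 * (\<rho> t x)\<^sup>2 + (32 * \<beta> * (1 + T) * X + 24) / R * e2)"
            using cb(3) m1_pos bd(2) by (intro mult_left_mono) auto
          \<comment> \<open>Fact 9 offers two units m0 \<beta> X^2 \<rho>^2: one is spent here on
            the derivative of \<open>h\<close>, the other in fact 8 on the terms linear in
            X.\<close>
          have 5: "2 * m1 * \<Lambda> * (8 * \<beta>\<^sup>2 * (1 + T)\<^sup>2 * X\<^sup>2 * (\<rho> t x)\<^sup>2) \<le> m0 * (\<beta> * X\<^sup>2 * (\<rho> t x)\<^sup>2)"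
          proof -
            have "0 \<le> \<beta> * X\<^sup>2 * (\<rho> t x)\<^sup>2" using \<beta>(1) by simp
            from mult_right_mono[OF \<beta>(2) this] show ?thesis by (simp add: power2_eq_square mult_ac)
          qed
          have 6: "2 * m1 * \<Lambda> * ((32 * \<beta> * (1 + T) * X + 24) / R * e2) \<le> (64 * m1 * \<Lambda> * \<beta> * (1 + T) + 48 * m1 * \<Lambda>) / R * ((1 + X) * e2)"
          proof -
            have "(32 * \<beta> * (1 + T) * X + 24) \<le> (32 * \<beta> * (1 + T) + 24) * (1 + X)" using \<beta> T X by (simp add: algebra_simps)
            from mult_left_mono[OF this, of "2 * m1 * \<Lambda> * e2 / R"] m1_pos bd(2) e2 R0
            show ?thesis by (simp add: algebra_simps add_divide_distrib)
          qed
          have 7: "h (x \<bullet> x) * (b * X) + d * (1 + X) * h (x \<bullet> x) \<le> (d + (d + b) * X) * (4 * \<beta> * (1 + T) * (\<rho> t x)\<^sup>2) + (8 * d + 8 * b) / R * ((1 + X) * e2)"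
          proof -
            have "(d + (d + b) * X) * h (x \<bullet> x) \<le> (d + (d + b) * X) * (4 * \<beta> * (1 + T) * (\<rho> t x)\<^sup>2 + 8 / R * e2)"
              using cb(2) d0 b0 X by (intro mult_left_mono) auto
            moreover have "(d + (d + b) * X) * (8 / R * e2) \<le> ((d + b) * (1 + X)) * (8 / R * e2)"
              using d0 b0 X R0 e2 by (intro mult_right_mono) (auto simp: algebra_simps)
            ultimately show ?thesis by (simp add: algebra_simps add_divide_distrib)
          qed
          have 8: "(d + (d + b) * X) * (4 * \<beta> * (1 + T) * (\<rho> t x)\<^sup>2) \<le> (m0 * X\<^sup>2 + K) * (\<beta> * (\<rho> t x)\<^sup>2)"
          proof -
            have "0 \<le> (m0 * X - 2 * (1 + T) * (d + b))\<^sup>2 / m0" using m by simp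
            also have "\<dots> = m0 * X\<^sup>2 - 4 * (1 + T) * (d + b) * X + 4 * (1 + T)\<^sup>2 * (d + b)\<^sup>2 / m0"
              using m(1) by (simp add: power2_eq_square field_simps)
            finally have "4 * (1 + T) * (d + (d + b) * X) \<le> m0 * X\<^sup>2 + K" by (simp add: K algebra_simps)
            from mult_right_mono[OF this, of "\<beta> * (\<rho> t x)\<^sup>2"] \<beta>(1) show ?thesis by (simp add: mult_ac)
          qed
          have 9: "- 2 * mm * \<beta> * X\<^sup>2 * (\<rho> t x)\<^sup>2 \<le> - 2 * m0 * (\<beta> * X\<^sup>2 * (\<rho> t x)\<^sup>2)"
            using mult_right_mono[OF mm(1), of "2 * \<beta> * X\<^sup>2 * (\<rho> t x)\<^sup>2"] \<beta>(1) by (simp add: mult_ac)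
          have "K2 / R * ((1 + X) * e2) = (8 * d + 8 * b) / R * ((1 + X) * e2) + (64 * m1 * \<Lambda> * \<beta> * (1 + T) + 48 * m1 * \<Lambda>) / R * ((1 + X) * e2)"
            unfolding K2 by (simp add: algebra_simps add_divide_distrib)
          thus "- 2 * mm * \<beta> * X\<^sup>2 * (\<rho> t x)\<^sup>2 + h (x \<bullet> x) * (drift A \<Phi> \<Psi> x \<bullet> x)
             - 2 * h' (x \<bullet> x) * mm * ((A x *v x) \<bullet> x) - dY x * h (x \<bullet> x) \<le> K * \<beta> * (\<rho> t x)\<^sup>2 + K2 / R * ((1 + X) * e2)"
            using 1 2 3 4 5 6 7 8 9 by (simp add: algebra_simps)
        qed
        also have "\<dots> \<le> K * \<beta> * ((\<rho> t x)\<^sup>2 * G (z t x)) + K2 / R * (Z * exp ((a + 1) * X - 2 * \<beta> * (x \<bullet> x)))"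
        proof -
          have "G (z t x) * ((1 + X) * e2) \<le> (Z * exp (a * X)) * (exp X * e2)"
            using Gz[OF t, of x] G0 exp_ge_add_one_self[of X] X e2 Z unfolding X_def by (intro mult_mono mult_right_mono) auto
          also have "\<dots> = Z * exp ((a + 1) * X - 2 * \<beta> * (x \<bullet> x))"
          proof -
            have "exp ((a + 1) * X - 2 * \<beta> * (x \<bullet> x)) = exp (a * X) * (exp X * e2)"
              unfolding e2_def power2_eq_square exp_add[symmetric] by (simp add: algebra_simps)
            thus ?thesis by simp
          qed
          finally have "K2 / R * (G (z t x) * ((1 + X) * e2)) \<le> K2 / R * (Z * exp ((a + 1) * X - 2 * \<beta> * (x \<bullet> x)))"
            using K20 R0 by (intro mult_left_mono) auto
          thus ?thesis by (simp add: algebra_simps)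
        qed
        finally show ?thesis unfolding X_def .
      qed
      have i2: "integrable lborel P2"
      proof -
        have f: "continuous_on UNIV (flux A \<Phi>)" "continuous_on UNIV (flux A \<Psi>)" "continuous_on UNIV (flux A (v t))"
          using \<Phi> \<Psi> flow t by (auto simp: weak_sol_def has_weak_divergence_def parabolic_def)
        have Cv: "C1 (v t)" using flow t by (simp add: parabolic_def weak_sol_def)
        have C\<Phi>1: "C1 \<Phi>" using \<Phi>(1) by (simp add: weak_sol_def)
        have \<Phi>0: "\<Phi> x \<noteq> 0" for x using \<Phi>(2)[of x] by simp
        have e: "flux A (z t) x = inverse (\<Phi> x) *\<^sub>R flux A (v t) x - (v t x / (\<Phi> x)\<^sup>2) *\<^sub>R flux A \<Phi> x" for x
          unfolding flux_def C1_divide(2)[OF Cv C\<Phi>1 \<Phi>0] matrix_vector_mult_diff_distrib matrix_vector_mult_scaleR by (rule refl)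
        have "continuous_on UNIV (\<lambda>x. inverse (\<Phi> x) *\<^sub>R flux A (v t) x - (v t x / (\<Phi> x)\<^sup>2) *\<^sub>R flux A \<Phi> x)"
          by (intro continuous_intros f C\<Phi> C1_continuous[OF Cv]) (simp_all add: \<Phi>0)
        hence f': "continuous_on UNIV (flux A (z t))" unfolding e[symmetric] .
        have cD: "continuous_on UNIV (drift A \<Phi> \<Psi>)" unfolding drift_def by (intro continuous_intros f C\<Phi>)
        have g2: "grad (\<lambda>x. (\<rho> t x)\<^sup>2) x = (2 * \<rho> t x) *\<^sub>R grad (\<rho> t) x" for x
          unfolding power2_eq_square C1_mult(2)[OF C\<rho> C\<rho>] scaleR_add_left[symmetric] by simp
        have cHz: "continuous_on UNIV (\<lambda>x. H (z t x))" "continuous_on UNIV (\<lambda>x. H' (z t x))"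
          using continuous_on_compose2[OF cH C1_continuous[OF Cz]] continuous_on_compose2[OF cH' C1_continuous[OF Cz]] by auto
        show ?thesis unfolding P2_def[abs_def] g2
          by (rule csupp_integrable[OF csuppI[OF cs]])
             (auto intro!: continuous_intros C\<Phi> cGz C1_continuous[OF C\<rho>] f' cD cHz C1_continuous_grad[OF C\<rho>] C1_continuous_grad[OF Cz])
      qed
      have "(LINT x|lborel. P1 x) - (LINT x|lborel. P2 x) = (LINT x|lborel. P1 x - P2 x - P3 x - P4 x)"
        using i1 i2 P34 by simp
      also have "\<dots> \<le> (LINT x|lborel. K * \<beta> * ((\<rho> t x)\<^sup>2 * G (z t x)) + K2 / R * (Z * exp ((a + 1) * norm x - 2 * \<beta> * (x \<bullet> x))))"
        by (rule Bochner_Integration.integral_mono[OF _ _ bracket]) (use i1 i2 P34 i5 Ji in auto)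
      also have "\<dots> = K * \<beta> * (LINT x|lborel. (\<rho> t x)\<^sup>2 * G (z t x)) + K2 / R * J"
        using i5 Ji by (simp add: J_def)
      also have "\<dots> \<le> K * \<beta> / m0 * E t + K2 / R * J"
      proof -
        have "(LINT x|lborel. m0 * ((\<rho> t x)\<^sup>2 * G (z t x))) \<le> E t"
          unfolding E_def
        proof (rule Bochner_Integration.integral_mono[OF _ iE])
          show "m0 * ((\<rho> t x)\<^sup>2 * G (z t x)) \<le> \<Phi> x * \<Psi> x * (\<rho> t x)\<^sup>2 * G (z t x)" for x
            unfolding mult.assoc[of _ "(\<rho> t x)\<^sup>2"] using m(2)[of x] G0 by (intro mult_right_mono) auto
        qed (use i5 in simp)
        hence "m0 * (LINT x|lborel. (\<rho> t x)\<^sup>2 * G (z t x)) \<le> E t" by simp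
        from mult_left_mono[OF this, of "K * \<beta> / m0"] show ?thesis using K0 \<beta> m(1) by simp
      qed
      finally show ?thesis using der unfolding P1_def P2_def by (meson order_trans)
    qed
    have "E T \<le> exp (K * \<beta> / m0 * T) * ((LINT x|lborel. \<Phi> x * \<Psi> x * (gwt \<beta> R 0 x)\<^sup>2 * G (z0 x)) + K2 / R * J * T)"
      by (rule gronwall_from_limit[OF T _ _ der E0]) (use K0 K20 J0 R0 \<beta> m in auto)
    also have "\<dots> \<le> exp (K * \<beta> / m0 * T) * (M + K2 / R * J * T)"
    proof (intro mult_left_mono add_right_mono)
      have mm[measurable]: "(\<lambda>x. \<Phi> x * \<Psi> x) \<in> borel_measurable borel" by (rule borel_measurable_continuous_onI[OF continuous_m])
      have gm[measurable]: "gwt \<beta> R 0 \<in> borel_measurable borel"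
        by (rule borel_measurable_continuous_onI[OF C1_continuous[OF C1_gwt(1)[OF R0]]])
      have Gm[measurable]: "(\<lambda>x. G (z0 x)) \<in> borel_measurable borel"
        using measurable_compose[OF z0 borel_measurable_continuous_onI[OF cG]] .
      have le: "\<Phi> x * \<Psi> x * (gwt \<beta> R 0 x)\<^sup>2 * G (z0 x) \<le> \<Phi> x * \<Psi> x * \<bar>z0 x\<bar>" "0 \<le> \<Phi> x * \<Psi> x * (gwt \<beta> R 0 x)\<^sup>2 * G (z0 x)" for x
      proof -
        have p: "0 \<le> \<Phi> x * \<Psi> x" using \<Phi>(2)[of x] \<Psi>(2)[of x] by simp
        have "gwt \<beta> R 0 x \<le> 1" using gwt_bounds[OF \<beta>(1), of 0 R x] \<beta>(1) by (auto elim: order_trans)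
        hence "(gwt \<beta> R 0 x)\<^sup>2 \<le> 1" using gwt_bounds[OF \<beta>(1), of 0 R x] by (intro power_le_one) auto
        hence "(gwt \<beta> R 0 x)\<^sup>2 * G (z0 x) \<le> 1 * \<bar>z0 x\<bar>" using Gabs G0 by (intro mult_mono) auto
        from mult_left_mono[OF this p] show "\<Phi> x * \<Psi> x * (gwt \<beta> R 0 x)\<^sup>2 * G (z0 x) \<le> \<Phi> x * \<Psi> x * \<bar>z0 x\<bar>" by (simp add: mult_ac)
        show "0 \<le> \<Phi> x * \<Psi> x * (gwt \<beta> R 0 x)\<^sup>2 * G (z0 x)" 
          by (rule mult_nonneg_nonneg[OF mult_nonneg_nonneg[OF p zero_le_power2] G0])
      qed
      have "integrable lborel (\<lambda>x. \<Phi> x * \<Psi> x * (gwt \<beta> R 0 x)\<^sup>2 * G (z0 x))"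
      proof (rule Bochner_Integration.integrable_bound[OF M(1)])
        show "(\<lambda>x. \<Phi> x * \<Psi> x * (gwt \<beta> R 0 x)\<^sup>2 * G (z0 x)) \<in> borel_measurable lborel" by measurable
        show "AE x in lborel. norm (\<Phi> x * \<Psi> x * (gwt \<beta> R 0 x)\<^sup>2 * G (z0 x)) \<le> norm (\<Phi> x * \<Psi> x * \<bar>z0 x\<bar>)"
          using le by (intro AE_I2) (metis abs_of_nonneg order_trans real_norm_def)
      qed
      from Bochner_Integration.integral_mono[OF this M(1) le(1)] M(2)
      show "(LINT x|lborel. \<Phi> x * \<Psi> x * (gwt \<beta> R 0 x)\<^sup>2 * G (z0 x)) \<le> M" by linarith
    qed simp
    finally show ?thesis .
  qed
  thus ?thesis unfolding E_def \<rho>_def J_def G_def r_def .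
qed

end

section \<open>The bound of the heat kernel\<close>

context weighted_flow
begin

text \<open>For fixed \<beta> and R the regularisation costs at most \<epsilon> times the finite
  integral \<open>I\<close> of the weight, and the regularised bound does not involve \<epsilon>; so
  \<epsilon> tends to 0 before the weight is removed.\<close>

lemma mass_bound:
  assumes ineq: "\<And>t x. t > 0 \<Longrightarrow> v t x * (v' t x - D t x - q x * v t x) \<le> 0"
    and grow: "\<And>T. \<exists>Z\<ge>0. \<forall>t x. 0 < t \<longrightarrow> t \<le> T \<longrightarrow> \<bar>z t x\<bar> \<le> Z * exp (a * norm x)"
    and Y: "has_weak_divergence (\<lambda>x. (\<Phi> x * \<Psi> x) *\<^sub>R (A x *v x)) dY" "\<And>x. \<bar>dY x\<bar> \<le> d * (1 + norm x)"
    and lim: "AE x in lborel. ((\<lambda>t. z t x) \<longlongrightarrow> z0 x) (at_right 0)" and z0: "z0 \<in> borel_measurable borel"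
    and M: "integrable lborel (\<lambda>x. \<Phi> x * \<Psi> x * \<bar>z0 x\<bar>)" "(LINT x|lborel. \<Phi> x * \<Psi> x * \<bar>z0 x\<bar>) \<le> M"
    and T: "T > 0"
  shows "integrable lborel (\<lambda>x. \<Phi> x * \<Psi> x * \<bar>z T x\<bar>)" "(LINT x|lborel. \<Phi> x * \<Psi> x * \<bar>z T x\<bar>) \<le> M"
proof -
  obtain Z where Z: "Z \<ge> 0" "\<And>t x. 0 < t \<Longrightarrow> t \<le> T \<Longrightarrow> \<bar>z t x\<bar> \<le> Z * exp (a * norm x)" using grow[of T] by blast
  define K where "K = 4 * (1 + T) * d + 4 * (1 + T)\<^sup>2 * (d + b)\<^sup>2 / m0"
  have d0: "0 \<le> d" using Y(2)[of 0] by (simp add: order_trans[OF abs_ge_zero])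
  have K0: "0 \<le> K" using d0 T m(1) by (simp add: K_def)
  have M0: "0 \<le> M"
  proof -
    have "0 \<le> (LINT x|lborel. \<Phi> x * \<Psi> x * \<bar>z0 x\<bar>)"
      by (intro Bochner_Integration.integral_nonneg mult_nonneg_nonneg less_imp_le[OF \<Phi>(2)] less_imp_le[OF \<Psi>(2)] abs_ge_zero)
    thus ?thesis using M(2) by linarith
  qed
  define \<beta>0 where "\<beta>0 = m0 / (16 * m1 * (\<Lambda> + 1) * (1 + T)\<^sup>2)"
  have den: "0 < 16 * m1 * (\<Lambda> + 1) * (1 + T)\<^sup>2" using m1_pos bd T by (intro mult_pos_pos) auto
  have \<beta>0: "\<beta>0 > 0" unfolding \<beta>0_def using m den by simp
  have cz: "continuous_on UNIV (z T)" by (rule C1_continuous[OF C1_z[OF T]])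
  have cf: "continuous_on UNIV (\<lambda>x. \<Phi> x * \<Psi> x * \<bar>z T x\<bar>)"
    by (intro continuous_on_mult[OF continuous_m] continuous_on_rabs cz)
  have nn: "0 \<le> \<Phi> x * \<Psi> x * \<bar>z T x\<bar>" for x using \<Phi>(2)[of x] \<Psi>(2)[of x] by simp
  have main: "\<exists>J. \<forall>R\<ge>1. (LINT x|lborel. (gwt \<beta> R T x)\<^sup>2 * (\<Phi> x * \<Psi> x * \<bar>z T x\<bar>)) \<le> exp (K * T / m0 * \<beta>) * (M + J / R)"
    if \<beta>: "0 < \<beta>" "\<beta> \<le> \<beta>0" for \<beta>
  proof -
    define K2 where "K2 = 8 * d + 8 * b + 64 * m1 * \<Lambda> * \<beta> * (1 + T) + 48 * m1 * \<Lambda>"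
    have "\<beta> * (16 * m1 * (\<Lambda> + 1) * (1 + T)\<^sup>2) \<le> m0" using \<beta>(2) unfolding \<beta>0_def pos_le_divide_eq[OF den] .
    moreover have "\<beta> * (16 * m1 * \<Lambda> * (1 + T)\<^sup>2) \<le> \<beta> * (16 * m1 * (\<Lambda> + 1) * (1 + T)\<^sup>2)"
      using \<beta> m1_pos by (intro mult_left_mono mult_right_mono) auto
    ultimately have \<beta>': "16 * \<beta> * m1 * \<Lambda> * (1 + T)\<^sup>2 \<le> m0" by (simp add: mult_ac)
    define J where "J = K2 * (LINT x|lborel. Z * exp ((a + 1) * norm (x :: real ^ 'n) - 2 * \<beta> * (x \<bullet> x))) * T"
    have "(LINT x|lborel. (gwt \<beta> R T x)\<^sup>2 * (\<Phi> x * \<Psi> x * \<bar>z T x\<bar>)) \<le> exp (K * T / m0 * \<beta>) * (M + J / R)" if R: "R \<ge> 1" for R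
    proof -
      have R0: "R > 0" using R by simp
      define I where "I = (LINT x|lborel. \<Phi> x * \<Psi> x * (gwt \<beta> R T x)\<^sup>2)"
      have i1: "integrable lborel (\<lambda>x. \<Phi> x * \<Psi> x * (gwt \<beta> R T x)\<^sup>2)"
        using csupp_integrable[OF csupp_gwt_mult[OF R0 continuous_m, of \<beta> T]] by (simp add: mult_ac)
      have "(LINT x|lborel. (gwt \<beta> R T x)\<^sup>2 * (\<Phi> x * \<Psi> x * \<bar>z T x\<bar>)) \<le> exp (K * T / m0 * \<beta>) * (M + J / R) + \<epsilon> * I" if \<epsilon>: "\<epsilon> > 0" for \<epsilon>
      proof -
        have i2: "integrable lborel (\<lambda>x. \<Phi> x * \<Psi> x * (gwt \<beta> R T x)\<^sup>2 * (sqrt ((z T x)\<^sup>2 + \<epsilon>\<^sup>2) - \<epsilon>))"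
        proof -
          have "continuous_on UNIV (\<lambda>x. \<Phi> x * \<Psi> x * (sqrt ((z T x)\<^sup>2 + \<epsilon>\<^sup>2) - \<epsilon>))"
            by (intro continuous_on_mult[OF continuous_m] continuous_on_diff continuous_on_real_sqrt continuous_on_add
                continuous_on_power cz continuous_on_const)
          from csupp_integrable[OF csupp_gwt_mult[OF R0 this, of \<beta> T]] show ?thesis by (simp add: mult_ac)
        qed
        have "(LINT x|lborel. (gwt \<beta> R T x)\<^sup>2 * (\<Phi> x * \<Psi> x * \<bar>z T x\<bar>))
          \<le> (LINT x|lborel. \<Phi> x * \<Psi> x * (gwt \<beta> R T x)\<^sup>2 * (sqrt ((z T x)\<^sup>2 + \<epsilon>\<^sup>2) - \<epsilon>) + \<epsilon> * (\<Phi> x * \<Psi> x * (gwt \<beta> R T x)\<^sup>2))"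
        proof (rule Bochner_Integration.integral_mono)
          show "integrable lborel (\<lambda>x. (gwt \<beta> R T x)\<^sup>2 * (\<Phi> x * \<Psi> x * \<bar>z T x\<bar>))"
            by (rule csupp_integrable[OF csupp_gwt_mult[OF R0 cf]])
          fix x
          have "\<bar>z T x\<bar> \<le> sqrt ((z T x)\<^sup>2 + \<epsilon>\<^sup>2)" by (rule real_le_rsqrt) (simp only: power2_abs le_add_same_cancel1 zero_le_power2)
          moreover have "0 \<le> \<Phi> x * \<Psi> x * (gwt \<beta> R T x)\<^sup>2"
            by (intro mult_nonneg_nonneg less_imp_le[OF \<Phi>(2)] less_imp_le[OF \<Psi>(2)] zero_le_power2)
          ultimately have "\<Phi> x * \<Psi> x * (gwt \<beta> R T x)\<^sup>2 * \<bar>z T x\<bar> \<le> \<Phi> x * \<Psi> x * (gwt \<beta> R T x)\<^sup>2 * sqrt ((z T x)\<^sup>2 + \<epsilon>\<^sup>2)"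
            by (rule mult_left_mono)
          thus "(gwt \<beta> R T x)\<^sup>2 * (\<Phi> x * \<Psi> x * \<bar>z T x\<bar>) \<le> \<Phi> x * \<Psi> x * (gwt \<beta> R T x)\<^sup>2 * (sqrt ((z T x)\<^sup>2 + \<epsilon>\<^sup>2) - \<epsilon>) + \<epsilon> * (\<Phi> x * \<Psi> x * (gwt \<beta> R T x)\<^sup>2)"
            by (simp add: algebra_simps)
        qed (use i1 i2 in auto)
        also have "\<dots> = (LINT x|lborel. \<Phi> x * \<Psi> x * (gwt \<beta> R T x)\<^sup>2 * (sqrt ((z T x)\<^sup>2 + \<epsilon>\<^sup>2) - \<epsilon>)) + \<epsilon> * I"
          using i1 i2 by (simp add: I_def)
        also have "(LINT x|lborel. \<Phi> x * \<Psi> x * (gwt \<beta> R T x)\<^sup>2 * (sqrt ((z T x)\<^sup>2 + \<epsilon>\<^sup>2) - \<epsilon>))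
           \<le> exp (K * \<beta> / m0 * T) * (M + K2 / R * (LINT x|lborel. Z * exp ((a + 1) * norm (x :: real ^ 'n) - 2 * \<beta> * (x \<bullet> x))) * T)"
          by (rule mass_bound_regularized[OF ineq Z Y lim z0 M T R \<beta>(1) \<beta>' \<epsilon> K_def K2_def])
        also have "\<dots> = exp (K * T / m0 * \<beta>) * (M + J / R)" by (simp add: J_def mult_ac)
        finally show ?thesis by simp
      qed
      note eps = this
      have "((\<lambda>\<epsilon>. exp (K * T / m0 * \<beta>) * (M + J / R) + \<epsilon> * I) \<longlongrightarrow> exp (K * T / m0 * \<beta>) * (M + J / R) + 0 * I) (at_right 0)"
        by (intro tendsto_intros)
      moreover have "\<forall>\<^sub>F \<epsilon> in at_right 0. (LINT x|lborel. (gwt \<beta> R T x)\<^sup>2 * (\<Phi> x * \<Psi> x * \<bar>z T x\<bar>)) \<le> exp (K * T / m0 * \<beta>) * (M + J / R) + \<epsilon> * I"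
        unfolding eventually_at_right_field by (intro exI[of _ 1] conjI allI impI eps) auto
      ultimately have "(LINT x|lborel. (gwt \<beta> R T x)\<^sup>2 * (\<Phi> x * \<Psi> x * \<bar>z T x\<bar>)) \<le> exp (K * T / m0 * \<beta>) * (M + J / R) + 0 * I"
        by (rule tendsto_lowerbound) simp
      thus ?thesis by simp
    qed
    thus ?thesis by blast
  qed
  have K': "0 \<le> K * T / m0" using K0 T m by simp
  show "integrable lborel (\<lambda>x. \<Phi> x * \<Psi> x * \<bar>z T x\<bar>)" "(LINT x|lborel. \<Phi> x * \<Psi> x * \<bar>z T x\<bar>) \<le> M"
    by (rule weight_limit[OF cf nn \<beta>0 M0 K' main]; assumption)+
qed

text \<open>Nash's iteration: the norms of \<open>z\<close> in \<open>L\<^sup>N\<close> are doubled step by step, \<open>N = 2\<^sup>j\<close>.\<close>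

lemma kernel_bound:
  assumes ineq: "\<And>t x. t > 0 \<Longrightarrow> v t x * (v' t x - D t x - q x * v t x) \<le> 0"
    and grow: "\<And>T. \<exists>Z\<ge>0. \<forall>t x. 0 < t \<longrightarrow> t \<le> T \<longrightarrow> \<bar>z t x\<bar> \<le> Z * exp (a * norm x)"
    and Y: "has_weak_divergence (\<lambda>x. (\<Phi> x * \<Psi> x) *\<^sub>R (A x *v x)) dY" "\<And>x. \<bar>dY x\<bar> \<le> d * (1 + norm x)"
    and lim: "AE x in lborel. ((\<lambda>t. z t x) \<longlongrightarrow> z0 x) (at_right 0)" and z0: "z0 \<in> borel_measurable borel"
    and M: "integrable lborel (\<lambda>x. \<Phi> x * \<Psi> x * \<bar>z0 x\<bar>)" "(LINT x|lborel. \<Phi> x * \<Psi> x * \<bar>z0 x\<bar>) \<le> M"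
    and n: "n = real CARD('n) / 2"
    and C0: "C0 = 2 * m1 / m0\<^sup>2 * (8 * n\<^sup>2 * m1 / (\<alpha> * m0)) powr n"
    and T: "T > 0"
  shows "\<bar>z T x\<bar> \<le> C0 * 2 powr n * M * T powr (- n)"
proof -
  have M0: "0 \<le> M"
  proof -
    have "0 \<le> (LINT x|lborel. \<Phi> x * \<Psi> x * \<bar>z0 x\<bar>)"
      by (intro Bochner_Integration.integral_nonneg mult_nonneg_nonneg less_imp_le[OF \<Phi>(2)] less_imp_le[OF \<Psi>(2)] abs_ge_zero)
    thus ?thesis using M(2) by linarith
  qed
  have "0 < CARD('n)" by simp
  hence n0: "n > 0" unfolding n by simp
  have C0p: "C0 > 0" unfolding C0 using m1_pos m n0 ell by simp
  define d' where "d' = C0 * 2 powr n"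
  have d': "d' > 0" using C0p by (simp add: d'_def)
  \<comment> \<open>The explicit solution of the recursion M(2N) = C0 N^n M(N)^2 with M(1) = M; the
    factor 2^n in \<open>d'\<close> accounts for passing from N^n to (2N)^n.\<close>
  define Mb where "Mb N = (d' * M) ^ N / (d' * real N powr n)" for N :: nat
  have norms: "\<forall>t>0. integrable lborel (\<lambda>x. \<Phi> x * \<Psi> x * \<bar>z t x\<bar> ^ (2 ^ j)) \<and>
      (LINT x|lborel. \<Phi> x * \<Psi> x * \<bar>z t x\<bar> ^ (2 ^ j)) \<le> Mb (2 ^ j) * t powr (- (n * (real (2 ^ j) - 1)))" for j
  proof (induction j)
    case 0
    show ?case using mass_bound[OF ineq grow Y lim z0 M] d' by (simp add: Mb_def)
  next
    case (Suc j)
    define N :: nat where "N = 2 ^ j"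
    have N: "N \<ge> 1" by (simp add: N_def)
    have Mb0: "0 \<le> Mb N" using d' M0 by (simp add: Mb_def)
    have hyp: "integrable lborel (\<lambda>x. \<Phi> x * \<Psi> x * \<bar>z t x\<bar> ^ N)"
      "(LINT x|lborel. \<Phi> x * \<Psi> x * \<bar>z t x\<bar> ^ N) \<le> Mb N * t powr (- (n * (real N - 1)))" if "t > 0" for t
      using Suc that by (auto simp: N_def)
    have eq: "C0 * real N powr n * (Mb N)\<^sup>2 = Mb (2 * N)"
    proof -
      have N0: "real N powr n > 0" using N by simp
      have alg: "(d' / W) * P * (Q / (d' * P))\<^sup>2 = Q\<^sup>2 / (d' * (W * P))" if "W > 0" "P > 0" for W P Q
        using that d' by (simp add: field_simps power2_eq_square)
      have "real (2 * N) powr n = 2 powr n * real N powr n" unfolding of_nat_mult of_nat_numeral by (rule powr_mult)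
      hence "Mb (2 * N) = ((d' * M) ^ N)\<^sup>2 / (d' * (2 powr n * real N powr n))"
        unfolding Mb_def by (simp add: power_mult[symmetric] mult.commute)
      moreover have "C0 = d' / 2 powr n" by (simp add: d'_def)
      ultimately show ?thesis unfolding Mb_def[of N] using alg[OF _ N0, of "2 powr n"] by simp
    qed
    show ?case
    proof (intro allI impI conjI)
      fix t :: real assume t: "t > 0"
      note st = smoothing_step[OF ineq grow N n Mb0 hyp t C0]
      have 2: "2 ^ Suc j = 2 * N" by (simp add: N_def)
      show "integrable lborel (\<lambda>x. \<Phi> x * \<Psi> x * \<bar>z t x\<bar> ^ (2 ^ Suc j))" unfolding 2 by (rule st(1))
      show "(LINT x|lborel. \<Phi> x * \<Psi> x * \<bar>z t x\<bar> ^ (2 ^ Suc j)) \<le> Mb (2 ^ Suc j) * t powr (- (n * (real (2 ^ Suc j) - 1)))"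
        unfolding 2 using st(2) unfolding eq .
    qed
  qed
  define k where "k = d' * M * T powr (- n)"
  have k0: "0 \<le> k" using d' M0 by (simp add: k_def)
  have "\<bar>z T x\<bar> \<le> k"
  proof (rule ccontr)
    assume "\<not> ?thesis"
    then obtain s where s: "k < s" "s < \<bar>z T x\<bar>" using dense not_le by blast
    have cz: "continuous_on UNIV (\<lambda>x. \<bar>z T x\<bar>)" by (intro continuous_on_rabs C1_continuous[OF C1_z[OF T]])
    have "open {y. s < \<bar>z T y\<bar>}" using cz by (intro open_Collect_less) auto
    then obtain e where e: "e > 0" "ball x e \<subseteq> {y. s < \<bar>z T y\<bar>}" using s(2) open_contains_ball by blast
    define V where "V = measure lborel (ball x e)"
    have V: "V > 0" using e(1) content_ball_pos[of e x] by (simp add: V_def)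
    have s0: "0 < s" using s(1) k0 by linarith
    \<comment> \<open>Chebyshev's inequality on a ball where |z| > s. Its volume would be bounded by
      (k / s)^N up to a fixed factor, which tends to 0 along N = 2^j because k < s.\<close>
    have key: "m0 * V \<le> (k / s) ^ (2 ^ j) * (T powr n / d')" for j
    proof -
      define N :: nat where "N = 2 ^ j"
      have N: "N \<ge> 1" by (simp add: N_def)
      have i: "integrable lborel (\<lambda>x. \<Phi> x * \<Psi> x * \<bar>z T x\<bar> ^ N)"
        "(LINT x|lborel. \<Phi> x * \<Psi> x * \<bar>z T x\<bar> ^ N) \<le> Mb N * T powr (- (n * (real N - 1)))"
        using norms[of j] T by (auto simp: N_def)
      have "(LINT y|lborel. m0 * s ^ N * indicator (ball x e) y) \<le> (LINT x|lborel. \<Phi> x * \<Psi> x * \<bar>z T x\<bar> ^ N)"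
      proof (rule Bochner_Integration.integral_mono[OF _ i(1)])
        show "integrable lborel (\<lambda>y. m0 * s ^ N * indicator (ball x e) y)"
          using emeasure_lborel_ball_finite[of x e] by (intro integrable_mult_right integrable_real_indicator) auto
        fix y
        have "m0 * s ^ N \<le> \<Phi> y * \<Psi> y * \<bar>z T y\<bar> ^ N" if "y \<in> ball x e"
          using that e(2) s0 m(1) m(2)[of y] by (intro mult_mono power_mono) auto
        moreover have "0 \<le> \<Phi> y * \<Psi> y * \<bar>z T y\<bar> ^ N"
          by (intro mult_nonneg_nonneg less_imp_le[OF \<Phi>(2)] less_imp_le[OF \<Psi>(2)] zero_le_power abs_ge_zero)
        ultimately show "m0 * s ^ N * indicator (ball x e) y \<le> \<Phi> y * \<Psi> y * \<bar>z T y\<bar> ^ N" by (auto simp: indicator_def)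
      qed
      hence "m0 * s ^ N * V \<le> Mb N * T powr (- (n * (real N - 1)))" using i(2) by (simp add: V_def)
      also have "\<dots> \<le> (d' * M) ^ N / d' * T powr (- (n * (real N - 1)))"
      proof (intro mult_right_mono)
        have "1 \<le> real N powr n" using N n0 by (simp add: ge_one_powr_ge_zero)
        hence "d' * 1 \<le> d' * real N powr n" using d' by (intro mult_left_mono) auto
        thus "Mb N \<le> (d' * M) ^ N / d'" unfolding Mb_def using d' M0 N by (intro divide_left_mono mult_pos_pos) auto
      qed simp
      also have "T powr (- (n * (real N - 1))) = (T powr (- n)) ^ N * T powr n"
      proof -
        have "(T powr (- n)) ^ N = T powr (- n * real N)" using T by (simp add: powr_realpow[symmetric] powr_powr)
        thus ?thesis unfolding powr_add[symmetric] by (simp add: powr_add[symmetric] algebra_simps)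
      qed
      also have "(d' * M) ^ N / d' * ((T powr (- n)) ^ N * T powr n) = k ^ N * (T powr n / d')"
        by (simp add: k_def power_mult_distrib mult_ac)
      finally have "m0 * s ^ N * V \<le> k ^ N * (T powr n / d')" .
      hence "(m0 * V) * s ^ N \<le> k ^ N * (T powr n / d')" by (simp only: mult_ac)
      hence "m0 * V \<le> k ^ N * (T powr n / d') / s ^ N" using s0 by (subst pos_le_divide_eq) auto
      thus ?thesis unfolding N_def[symmetric] power_divide by (simp add: mult.commute)
    qed
    have "(\<lambda>j :: nat. (k / s) ^ (2 ^ j)) \<longlonglongrightarrow> 0"
    proof -
      have 1: "(\<lambda>j. (k / s) ^ j) \<longlonglongrightarrow> 0" using k0 s s0 by (intro LIMSEQ_realpow_zero) auto
      have "strict_mono (\<lambda>j :: nat. 2 ^ j :: nat)" by (simp add: strict_mono_def)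
      from LIMSEQ_subseq_LIMSEQ[OF 1 this] show ?thesis by (simp add: o_def)
    qed
    from tendsto_mult_left_zero[OF this, of "T powr n / d'"]
    have "m0 * V \<le> 0" by (rule LIMSEQ_le_const) (use key in blast)
    thus False using m(1) V by (simp add: mult_le_0_iff)
  qed
  thus ?thesis by (simp add: k_def d'_def)
qed

end

section \<open>Periodic media\<close>

lemma periodic_int_shift:
  assumes "periodic L h"
  shows "h (x + axis i (of_int m * L $ i)) = h x"
proof -
  have nat: "h (x + axis i (of_nat n * L $ i)) = h x" for n :: nat and x
  proof (induction n)
    case (Suc n)
    have "x + axis i (of_nat (Suc n) * L $ i) = (x + axis i (of_nat n * L $ i)) + axis i (L $ i)"
      by (simp add: vec_eq_iff axis_def algebra_simps)
    thus ?case using Suc assms by (metis periodic_def)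
  qed (simp add: axis_def zero_vec_def[symmetric])
  show ?thesis
  proof (cases "m \<ge> 0")
    case True
    thus ?thesis using nat[of x "nat m"] by simp
  next
    case False
    have "(x + axis i (of_int m * L $ i)) + axis i (of_nat (nat (- m)) * L $ i) = x"
      using False by (simp add: vec_eq_iff axis_def)
    thus ?thesis using nat[of "x + axis i (of_int m * L $ i)" "nat (- m)"] by metis
  qed
qed

lemma periodic_lattice_shift:
  assumes "periodic L h"
  shows "h (\<chi> i. x $ i + of_int (m i) * L $ i) = h x"
proof -
  have "h (\<chi> i. x $ i + (if i \<in> S then of_int (m i) * L $ i else 0)) = h x" if "finite S" for S
    using that
  proof (induction S)
    case (insert j S)
    have e: "(\<chi> i. x $ i + (if i \<in> insert j S then of_int (m i) * L $ i else 0))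
      = (\<chi> i. x $ i + (if i \<in> S then of_int (m i) * L $ i else 0)) + axis j (of_int (m j) * L $ j)"
      using insert(2) by (auto simp: vec_eq_iff axis_def)
    show ?case unfolding e periodic_int_shift[OF assms] by (rule insert(3))
  qed simp
  from this[of UNIV] show ?thesis by simp
qed

lemma lattice_representative:
  assumes "\<forall>i. L $ i > 0"
  obtains m :: "'n::finite \<Rightarrow> int" where "\<And>i. 0 \<le> x $ i + of_int (m i) * L $ i" "\<And>i. (x :: real ^ 'n::finite) $ i + of_int (m i) * L $ i \<le> L $ i"
proof
  fix i
  let ?m = "\<lambda>i. - \<lfloor>x $ i / L $ i\<rfloor>"
  have L: "L $ i > 0" using assms by blast
  have "of_int \<lfloor>x $ i / L $ i\<rfloor> \<le> x $ i / L $ i" "x $ i / L $ i \<le> of_int \<lfloor>x $ i / L $ i\<rfloor> + 1" by linarith+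
  thus "0 \<le> x $ i + of_int (?m i) * L $ i" "x $ i + of_int (?m i) * L $ i \<le> L $ i"
    using pos_le_divide_eq[OF L] pos_divide_le_eq[OF L] by (auto simp: algebra_simps)
qed

lemma periodic_cell:
  assumes "\<forall>i. L $ i > 0" "periodic L h"
  obtains y where "y \<in> cbox 0 L" "h y = h x"
proof -
  obtain m where m: "\<And>i. 0 \<le> x $ i + of_int (m i) * L $ i" "\<And>i. x $ i + of_int (m i) * L $ i \<le> L $ i"
    using lattice_representative[OF assms(1)] by blast
  show ?thesis
    by (rule that[of "\<chi> i. x $ i + of_int (m i) * L $ i"]) (use m periodic_lattice_shift[OF assms(2)] in \<open>auto simp: mem_box_cart\<close>)
qed

lemma periodic_bounded:
  fixes h :: "real ^ 'n \<Rightarrow> 'b::real_normed_vector"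
  assumes "\<forall>i. L $ i > 0" "periodic L h" "continuous_on UNIV h"
  obtains B where "B > 0" "\<And>x. norm (h x) \<le> B"
proof -
  have "bounded (h ` cbox 0 L)"
    using assms(3) by (intro compact_imp_bounded compact_continuous_image) (auto intro: continuous_on_subset)
  then obtain B where B: "B > 0" "\<And>y. y \<in> cbox 0 L \<Longrightarrow> norm (h y) \<le> B" unfolding bounded_pos by auto
  show ?thesis by (rule that[OF B(1)]) (metis B(2) periodic_cell[OF assms(1,2)])
qed

lemma periodic_positive:
  fixes h :: "real ^ 'n \<Rightarrow> real"
  assumes "\<forall>i. L $ i > 0" "periodic L h" "continuous_on UNIV h" "\<And>x. h x > 0"
  obtains c where "c > 0" "\<And>x. c \<le> h x"
proof -
  have "compact (cbox 0 L)" "cbox 0 L \<noteq> {}"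
    using assms(1) by (auto simp: interval_ne_empty_cart less_imp_le)
  then obtain x0 where x0: "x0 \<in> cbox 0 L" "\<And>y. y \<in> cbox 0 L \<Longrightarrow> h x0 \<le> h y"
    using continuous_attains_inf[of "cbox 0 L" h] continuous_on_subset[OF assms(3)] by auto
  show ?thesis by (rule that[OF assms(4)[of x0]]) (metis x0(2) periodic_cell[OF assms(1,2)])
qed

lemma periodic_grad:
  assumes "periodic L h" "C1 h"
  shows "periodic L (grad h)"
  unfolding periodic_def
proof (intro allI)
  fix x i
  let ?a = "axis i (L $ i)"
  have "((\<lambda>y. h (y + ?a)) has_derivative (\<lambda>k. k \<bullet> grad h (x + ?a))) (at x)"
    by (rule has_derivative_compose[OF _ C1_gderiv[OF assms(2), unfolded gderiv_def]])
       (auto intro!: derivative_eq_intros)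
  moreover have "(\<lambda>y. h (y + ?a)) = h" using assms(1) by (auto simp: periodic_def)
  ultimately have "GDERIV h x :> grad h (x + ?a)" by (simp add: gderiv_def)
  thus "grad h (x + ?a) = grad h x" by (simp add: grad_eqI)
qed

lemma norm_matrix_vector_le:
  fixes M :: "real ^ 'n ^ 'n"
  shows "norm (M *v y) \<le> real CARD('n) * norm M * norm y"
proof -
  have "norm (M *v y) \<le> (\<Sum>i\<in>UNIV. \<bar>(M *v y) $ i\<bar>)" by (rule norm_le_l1_cart)
  also have "\<dots> \<le> (\<Sum>i\<in>(UNIV :: 'n set). norm M * norm y)"
  proof (rule sum_mono)
    fix i
    have "(M *v y) $ i = M $ i \<bullet> y" by (simp add: matrix_vector_mult_def inner_vec_def)
    hence "\<bar>(M *v y) $ i\<bar> \<le> norm (M $ i) * norm y" by (metis Cauchy_Schwarz_ineq2)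
    also have "\<dots> \<le> norm M * norm y" by (intro mult_right_mono Finite_Cartesian_Product.norm_nth_le) auto
    finally show "\<bar>(M *v y) $ i\<bar> \<le> norm M * norm y" .
  qed
  finally show ?thesis by (simp add: mult.assoc)
qed

section \<open>Operations on parabolic functions\<close>

lemma parabolic_diff:
  assumes "parabolic A v v' D" "parabolic A w w' E"
  shows "parabolic A (\<lambda>t x. v t x - w t x) (\<lambda>t x. v' t x - w' t x) (\<lambda>t x. D t x - E t x)"
proof -
  have "weak_sol A (\<lambda>x. v t x - w t x) (\<lambda>x. D t x - E t x)" if "t > 0" for t
  proof -
    have C: "C1 (v t)" "C1 (w t)" and d: "has_weak_divergence (flux A (v t)) (D t)" "has_weak_divergence (flux A (w t)) (E t)"
      using assms that by (auto simp: parabolic_def weak_sol_def)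
    have "flux A (\<lambda>x. v t x - w t x) = (\<lambda>x. flux A (v t) x - flux A (w t) x)"
      by (rule ext) (simp add: flux_def C1_diff(2)[OF C] matrix_vector_mult_diff_distrib)
    thus ?thesis using C1_diff(1)[OF C] weak_div_diff[OF d] by (simp add: weak_sol_def)
  qed
  thus ?thesis using assms unfolding parabolic_def split_beta
    by (auto intro!: continuous_intros derivative_intros)
qed

lemma parabolic_scale:
  assumes "parabolic A v v' D" "\<And>t. t > 0 \<Longrightarrow> (s has_real_derivative s' t) (at t)" "continuous_on {0<..} s'"
  shows "parabolic A (\<lambda>t x. s t * v t x) (\<lambda>t x. s' t * v t x + s t * v' t x) (\<lambda>t x. s t * D t x)"
proof -
  have ws: "weak_sol A (\<lambda>x. s t * v t x) (\<lambda>x. s t * D t x)" if "t > 0" for t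
  proof -
    have C: "C1 (v t)" and d: "has_weak_divergence (flux A (v t)) (D t)"
      using assms(1) that by (auto simp: parabolic_def weak_sol_def)
    have "flux A (\<lambda>x. s t * v t x) = (\<lambda>x. s t *\<^sub>R flux A (v t) x)"
      by (rule ext) (simp add: flux_def C1_cmult(2)[OF C] matrix_vector_mult_scaleR)
    thus ?thesis using C1_cmult(1)[OF C] weak_div_cmult[OF d] by (simp add: weak_sol_def)
  qed
  have cs: "continuous_on {0<..} s"
    using assms(2) by (auto intro!: DERIV_isCont continuous_at_imp_continuous_on)
  have c: "continuous_on ({0<..} \<times> UNIV) (\<lambda>p. s (fst p))" "continuous_on ({0<..} \<times> UNIV) (\<lambda>p. s' (fst p))"
    by (rule continuous_on_compose2[OF cs] continuous_on_compose2[OF assms(3)]; auto intro!: continuous_intros)+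
  have d: "((\<lambda>r. s r * v r x) has_real_derivative s' t * v t x + s t * v' t x) (at t)" if "t > 0" for t x
    using DERIV_mult[OF assms(2)[OF that], of "\<lambda>r. v r x" "v' t x"] assms(1) that unfolding parabolic_def by (simp add: mult.commute)
  show ?thesis using ws d assms(1) c unfolding parabolic_def split_beta
    by (auto intro!: continuous_intros)
qed

lemma parabolic_const:
  assumes "weak_sol A \<phi> D"
  shows "parabolic A (\<lambda>t. \<phi>) (\<lambda>t x. 0) (\<lambda>t. D)"
proof -
  have "C1 \<phi>" using assms by (simp add: weak_sol_def)
  hence "continuous_on ({0<..} \<times> UNIV) (\<lambda>p :: real \<times> _. \<phi> (snd p))"
    by (intro continuous_on_compose2[OF C1_continuous]) (auto intro!: continuous_intros)
  thus ?thesis using assms unfolding parabolic_def split_beta by auto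
qed

lemma parabolic_shift:
  assumes "parabolic A v v' D" "t0 \<ge> 0"
  shows "parabolic A (\<lambda>t. v (t0 + t)) (\<lambda>t. v' (t0 + t)) (\<lambda>t. D (t0 + t))"
proof -
  have c: "continuous_on ({0<..} \<times> UNIV) (\<lambda>(t, x). g (t0 + t) x)" if "continuous_on ({0<..} \<times> UNIV) (\<lambda>(t, x). g t x)" for g :: "real \<Rightarrow> real ^ 'a \<Rightarrow> real"
  proof -
    have c1: "continuous_on ({0<..} \<times> UNIV) (\<lambda>p :: real \<times> (real ^ 'a). (t0 + fst p, snd p))" by (intro continuous_intros)
    have c2: "(\<lambda>p :: real \<times> (real ^ 'a). (t0 + fst p, snd p)) ` ({0<..} \<times> UNIV) \<subseteq> {0<..} \<times> UNIV"
      using assms(2) by (auto intro: add_nonneg_pos)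
    show ?thesis using continuous_on_compose2[OF that c1 c2] by (simp add: split_beta)
  qed
  have d: "((\<lambda>s. v (t0 + s) x) has_real_derivative v' (t0 + t) x) (at t)" if "t > 0" for t x
  proof -
    have "((\<lambda>s. v s x) has_real_derivative v' (t0 + t) x) (at (t0 + t))" using assms that by (simp add: parabolic_def)
    moreover have "((\<lambda>s. t0 + s) has_real_derivative 1) (at t)" by (auto intro!: derivative_eq_intros)
    ultimately have "((\<lambda>s. v (t0 + s) x) has_real_derivative v' (t0 + t) x * 1) (at t)" by (rule DERIV_chain2)
    thus ?thesis by simp
  qed
  show ?thesis using assms c d unfolding parabolic_def by auto
qed

section \<open>Periodic diffusion matrices\<close>

locale periodic_medium =
  fixes L :: "real ^ 'n" and A :: "real ^ 'n \<Rightarrow> real ^ 'n ^ 'n" and \<gamma> :: real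
  assumes L_pos: "\<forall>i. L $ i > 0" and A: "diffusion_matrix L \<gamma> A"
begin

lemma sym: "transpose (A x) = A x"
  using A by (simp add: diffusion_matrix_def)

lemma C1_entry: "C1 (\<lambda>x. A x $ i $ j)"
  using A by (simp add: diffusion_matrix_def C1_holder_def)

lemma ellipticity:
  obtains \<alpha> where "\<alpha> > 0" "\<And>x y. \<alpha> * (norm y)\<^sup>2 \<le> (A x *v y) \<bullet> y"
proof -
  have "(A x *v y) \<bullet> y = (\<Sum>i\<in>UNIV. \<Sum>j\<in>UNIV. A x $ i $ j * y $ i * y $ j)" for x y
    by (simp add: inner_vec_def matrix_vector_mult_def sum_distrib_left sum_distrib_right mult_ac)
  thus ?thesis using A that unfolding diffusion_matrix_def by auto
qed

lemma A_bound:
  obtains \<Lambda> where "\<Lambda> > 0" "\<And>x y. norm (A x *v y) \<le> \<Lambda> * norm y"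
proof -
  obtain B where B: "B > 0" "\<And>x. norm (A x) \<le> B" using A unfolding diffusion_matrix_def bounded_pos by auto
  show ?thesis
  proof (rule that)
    show "norm (A x *v y) \<le> (real CARD('n) * B) * norm y" for x y
    proof -
      have "real CARD('n) * norm (A x) * norm y \<le> real CARD('n) * B * norm y"
        using B by (intro mult_right_mono mult_left_mono) auto
      thus ?thesis using norm_matrix_vector_le[of "A x" y] by linarith
    qed
  qed (use B in simp)
qed

lemma weak_sol_C2:
  assumes "C2 g"
  shows "weak_sol A g (div_A_grad A g)"
proof -
  have "C1 (\<lambda>x. flux A g x $ i)" for i
    unfolding flux_def matrix_vector_mult_def
    using C1_sum(1)[of UNIV "\<lambda>j x. A x $ i $ j * grad g x $ j"] C1_mult(1)[OF C1_entry] assms by (auto simp: C2_def)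
  from weak_div_C1[OF this] have "has_weak_divergence (flux A g) (div_A_grad A g)"
    unfolding div_A_grad_def flux_def by simp
  thus ?thesis using assms by (simp add: weak_sol_def C2_def)
qed

lemma parabolic_solution:
  assumes "solves_equation A f I u" "{0<..} \<subseteq> I"
  shows "parabolic A u (\<lambda>t x. deriv (\<lambda>s. u s x) t) (\<lambda>t. div_A_grad A (u t))"
    and "\<And>t x. t > 0 \<Longrightarrow> deriv (\<lambda>s. u s x) t = div_A_grad A (u t) x + f x (u t x)"
proof -
  have sub: "{0<..} \<times> UNIV \<subseteq> I \<times> (UNIV :: (real ^ 'n) set)" using assms(2) by auto
  show "parabolic A u (\<lambda>t x. deriv (\<lambda>s. u s x) t) (\<lambda>t. div_A_grad A (u t))"
    unfolding parabolic_def
  proof (intro conjI allI impI)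
    fix t :: real assume "t > 0"
    hence t: "t \<in> I" using assms(2) by auto
    show "((\<lambda>s. u s x) has_real_derivative deriv (\<lambda>s. u s x) t) (at t)" for x
      using assms(1) t unfolding solves_equation_def by (simp add: DERIV_deriv_iff_field_differentiable)
    show "weak_sol A (u t) (div_A_grad A (u t))"
      by (rule weak_sol_C2) (use assms(1) t in \<open>simp add: solves_equation_def\<close>)
  qed (use assms(1) in \<open>auto simp: solves_equation_def intro: continuous_on_subset[OF _ sub]\<close>)
  show "deriv (\<lambda>s. u s x) t = div_A_grad A (u t) x + f x (u t x)" if "t > 0" for t x
  proof -
    have "t \<in> I" using assms(2) that by auto
    hence "deriv (\<lambda>s. u s x) t - div_A_grad A (u t) x = f x (u t x)" using assms(1) unfolding solves_equation_def by blast
    thus ?thesis by simp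
  qed
qed

text \<open>The entries of \<open>A\<close> and their gradients are bounded, so the divergence of
  A(x)(x - x0) grows at most linearly, with one constant for all centres x0. The field is half the
  flux of |x - x0|^2; the radial weights and the Gaussian barrier are differentiated through
  it.\<close>

lemma radial_field:
  obtains d dA where "d > 0"
    "\<And>x0. has_weak_divergence (\<lambda>x. A x *v (x - x0)) (dA x0)" "\<And>x0 x. \<bar>dA x0 x\<bar> \<le> d * (1 + norm (x - x0))"
proof -
  have "\<exists>B>0. \<forall>x. norm (grad (\<lambda>x. A x $ i $ j) x) \<le> B" for i j
  proof -
    have "periodic L (\<lambda>x. A x $ i $ j)" using A by (simp add: diffusion_matrix_def periodic_def)
    from periodic_bounded[OF L_pos periodic_grad[OF this C1_entry] C1_continuous_grad[OF C1_entry]] show ?thesis by metis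
  qed
  then obtain G where G: "\<And>i j. G i j > 0" "\<And>i j x. norm (grad (\<lambda>x. A x $ i $ j) x) \<le> G i j" by metis
  obtain B where B: "B > 0" "\<And>x. norm (A x) \<le> B" using A unfolding diffusion_matrix_def bounded_pos by auto
  have AB: "\<bar>A x $ i $ j\<bar> \<le> B" for x i j
    using B(2)[of x] component_le_norm_cart[of "A x $ i" j] Finite_Cartesian_Product.norm_nth_le[of "A x" i] by linarith
  define d where "d = (\<Sum>i\<in>(UNIV::'n set). \<Sum>j\<in>(UNIV::'n set). B + G i j)"
  define dA where "dA = (\<lambda>x0. divergence (\<lambda>x. A x *v (x - x0)))"
  have nthm: "(A x *v (x - x0)) $ i = (\<Sum>j\<in>UNIV. A x $ i $ j * (x $ j - x0 $ j))" for x x0 i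
    by (simp add: matrix_vector_mult_def)
  have C: "C1 (\<lambda>x. x $ j - x0 $ j)" "grad (\<lambda>x. x $ j - x0 $ j) x = axis j 1" for j and x x0 :: "real ^ 'n"
    using C1_diff[OF C1_nth C1_const, of j "x0 $ j"] by (auto simp: grad_nth grad_const)
  have Cm: "C1 (\<lambda>x. A x $ i $ j * (x $ j - x0 $ j))"
    "grad (\<lambda>x. A x $ i $ j * (x $ j - x0 $ j)) x = A x $ i $ j *\<^sub>R axis j 1 + (x $ j - x0 $ j) *\<^sub>R grad (\<lambda>x. A x $ i $ j) x" for i j x x0
    using C1_mult[OF C1_entry C(1)] by (auto simp: C(2))
  show ?thesis
  proof (rule that[of d dA])
    show "d > 0" unfolding d_def using B G by (intro sum_pos) (auto intro: add_pos_pos)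
    fix x0
    have "C1 (\<lambda>x. (A x *v (x - x0)) $ i)" for i unfolding nthm by (intro C1_sum Cm)
    from weak_div_C1[OF this] show "has_weak_divergence (\<lambda>x. A x *v (x - x0)) (dA x0)" by (simp add: dA_def)
    fix x
    have "dA x0 x = (\<Sum>i\<in>UNIV. \<Sum>j\<in>UNIV. (A x $ i $ j *\<^sub>R axis j 1 + (x $ j - x0 $ j) *\<^sub>R grad (\<lambda>x. A x $ i $ j) x) $ i)"
      unfolding dA_def divergence_def nthm C1_sum(2)[OF Cm(1)] Cm(2) by simp
    also have "\<bar>\<dots>\<bar> \<le> (\<Sum>i\<in>UNIV. \<Sum>j\<in>UNIV. \<bar>(A x $ i $ j *\<^sub>R axis j 1 + (x $ j - x0 $ j) *\<^sub>R grad (\<lambda>x. A x $ i $ j) x) $ i\<bar>)"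
      by (rule order_trans[OF sum_abs sum_mono]) (rule sum_abs)
    also have "\<dots> \<le> (\<Sum>i\<in>(UNIV::'n set). \<Sum>j\<in>(UNIV::'n set). (B + G i j) * (1 + norm (x - x0)))"
    proof (intro sum_mono)
      fix i j
      have "\<bar>(A x $ i $ j *\<^sub>R axis j 1) $ i\<bar> \<le> B" using AB[of x i j] B(1) by (cases "i = j") (simp_all add: axis_def)
      moreover have "\<bar>(x $ j - x0 $ j) * grad (\<lambda>x. A x $ i $ j) x $ i\<bar> \<le> norm (x - x0) * G i j"
        unfolding abs_mult
      proof (rule mult_mono)
        show "\<bar>x $ j - x0 $ j\<bar> \<le> norm (x - x0)" using component_le_norm_cart[of "x - x0" j] by simp
        show "\<bar>grad (\<lambda>x. A x $ i $ j) x $ i\<bar> \<le> G i j" using component_le_norm_cart G(2) order_trans by blast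
      qed auto
      ultimately have "\<bar>(A x $ i $ j *\<^sub>R axis j 1 + (x $ j - x0 $ j) *\<^sub>R grad (\<lambda>x. A x $ i $ j) x) $ i\<bar> \<le> B + norm (x - x0) * G i j"
        using abs_triangle_ineq[of "(A x $ i $ j *\<^sub>R axis j 1) $ i" "(x $ j - x0 $ j) * grad (\<lambda>x. A x $ i $ j) x $ i"]
        unfolding vector_add_component vector_scaleR_component real_scaleR_def by linarith
      also have "\<dots> \<le> (B + G i j) * (1 + norm (x - x0))"
      proof -
        have "0 \<le> B * norm (x - x0)" "0 \<le> G i j" using B(1) less_imp_le[OF G(1)] by auto
        thus ?thesis unfolding distrib_left distrib_right mult.commute[of "norm (x - x0)"] mult_1_right by linarith
      qed
      finally show "\<bar>(A x $ i $ j *\<^sub>R axis j 1 + (x $ j - x0 $ j) *\<^sub>R grad (\<lambda>x. A x $ i $ j) x) $ i\<bar> \<le> (B + G i j) * (1 + norm (x - x0))" .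
    qed
    also have "\<dots> = d * (1 + norm (x - x0))" by (simp add: d_def sum_distrib_right)
    finally show "\<bar>dA x0 x\<bar> \<le> d * (1 + norm (x - x0))" .
  qed
qed

text \<open>The case \<Phi> = \<Psi> = 1 and q = 0 of \<open>comparison\<close>, where the factor
  exp(-K t) removes the term of order zero. The inequality is required only where V > 0, so barriers
  may violate it elsewhere.\<close>

lemma global_comparison:
  assumes V: "parabolic A V V' D" and K: "K \<ge> 0"
    and ineq: "\<And>t x. t > 0 \<Longrightarrow> V t x > 0 \<Longrightarrow> V' t x \<le> D t x + K * V t x"
    and bdd: "\<And>T. \<exists>B. \<forall>t x. 0 < t \<longrightarrow> t \<le> T \<longrightarrow> V t x \<le> B"
    and lim: "AE x in lborel. ((\<lambda>t. max 0 (V t x)) \<longlongrightarrow> 0) (at_right 0)"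
    and T: "T > 0"
  shows "V T x \<le> 0"
proof -
  obtain \<alpha> where \<alpha>: "\<alpha> > 0" "\<And>x y. \<alpha> * (norm y)\<^sup>2 \<le> (A x *v y) \<bullet> y" using ellipticity by blast
  obtain \<Lambda> where \<Lambda>: "\<Lambda> > 0" "\<And>x y. norm (A x *v y) \<le> \<Lambda> * norm y" using A_bound by blast
  define s where "s = (\<lambda>t. exp (- K * t))"
  have sd: "(s has_real_derivative - K * s t) (at t)" for t unfolding s_def by (auto intro!: derivative_eq_intros)
  have s: "s t > 0" for t by (simp add: s_def)
  have cs: "continuous_on {0<..} (\<lambda>t. - K * s t)" unfolding s_def by (intro continuous_intros)
  have one: "weak_sol A (\<lambda>x. 1) (\<lambda>x. 0)"
  proof -
    have "has_weak_divergence (\<lambda>x. 0 :: real ^ 'n) (divergence (\<lambda>x. 0))" by (rule weak_div_C1) (simp add: C1_const)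
    moreover have "divergence (\<lambda>x :: real ^ 'n. 0) = (\<lambda>x. 0)" by (simp add: divergence_def grad_const fun_eq_iff)
    moreover have "flux A (\<lambda>x. 1) = (\<lambda>x. 0)" by (simp add: flux_def grad_const fun_eq_iff)
    ultimately show ?thesis by (simp add: weak_sol_def C1_const)
  qed
  interpret W: weighted_flow A "\<lambda>x. 1" "\<lambda>x. 1" "\<lambda>x. 0" "\<lambda>x. 0" "\<lambda>x. 0" "\<lambda>t x. s t * V t x"
    "\<lambda>t x. - K * s t * V t x + s t * V' t x" "\<lambda>t x. s t * D t x" \<alpha> \<Lambda> 1 1 0
    by unfold_locales (use sym \<alpha> \<Lambda> one parabolic_scale[OF V sd cs] in \<open>auto simp: drift_def\<close>)
  have "s T * V T x \<le> 0"
  proof (rule W.comparison[OF _ _ _ T])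
    fix t x assume t: "t > 0" "s t * V t x > 0"
    have "V t x > 0" using t(2) s[of t] by (simp add: zero_less_mult_iff)
    from mult_left_mono[OF ineq[OF t(1) this], of "s t"] s[of t]
    show "- K * s t * V t x + s t * V' t x \<le> s t * D t x + 0 * (s t * V t x)" by (simp add: algebra_simps)
  next
    fix T
    obtain B where B: "\<And>t x. 0 < t \<Longrightarrow> t \<le> T \<Longrightarrow> V t x \<le> B" using bdd by blast
    have "s t * V t x / 1 \<le> \<bar>B\<bar>" if "0 < t" "t \<le> T" for t x
    proof -
      have "s t * V t x \<le> s t * \<bar>B\<bar>" using B[OF that, of x] s[of t] by (intro mult_left_mono) auto
      also have "\<dots> \<le> 1 * \<bar>B\<bar>" using K that by (intro mult_right_mono) (auto simp: s_def)
      finally show ?thesis by simp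
    qed
    thus "\<exists>B. \<forall>t x. 0 < t \<longrightarrow> t \<le> T \<longrightarrow> s t * V t x / 1 \<le> B" by blast
  next
    show "AE x in lborel. ((\<lambda>t. max 0 (s t * V t x / 1)) \<longlongrightarrow> 0) (at_right 0)"
      using lim
    proof eventually_elim
      case (elim x)
      have "(s \<longlongrightarrow> s 0) (at_right 0)" unfolding s_def by (intro tendsto_intros)
      from tendsto_mult[OF this elim] have "((\<lambda>t. s t * max 0 (V t x)) \<longlongrightarrow> 0) (at_right 0)" by simp
      moreover have "max 0 (s t * V t x / 1) = s t * max 0 (V t x)" for t
        using s[of t] by (simp add: max_def mult_le_0_iff zero_le_mult_iff)
      ultimately show ?case by simp
    qed
  qed
  thus ?thesis using s[of T] by (simp add: mult_le_0_iff)
qed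

end

section \<open>KPP nonlinearities\<close>

lemma f_u_DERIV:
  assumes "reaction_term L \<gamma> f"
  shows "(f x has_real_derivative f_u f x s) (at s)"
  using assms unfolding reaction_term_def f_u_def by (simp add: DERIV_deriv_iff_field_differentiable)

text \<open>A decreasing quotient lies below its limit at 0 from the right, which is the derivative
  at 0 because f(x, 0) = 0.\<close>

lemma kpp_ratio_le:
  assumes f: "reaction_term L \<gamma> f" and dec: "\<forall>x. strict_antimono_on {0<..} (\<lambda>s. f x s / s)" and s: "s > 0"
  shows "f x s / s \<le> f_u f x 0"
proof (rule tendsto_lowerbound)
  have "f x 0 = 0" using f by (simp add: reaction_term_def)
  hence "((\<lambda>h. f x h / h) \<longlongrightarrow> f_u f x 0) (at 0)"
    using f_u_DERIV[OF f, of x 0] by (simp add: has_field_derivative_iff)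
  thus "((\<lambda>h. f x h / h) \<longlongrightarrow> f_u f x 0) (at_right 0)"
    by (rule tendsto_mono[rotated]) (simp add: at_le)
  show "\<forall>\<^sub>F h in at_right 0. f x s / s \<le> f x h / h"
    unfolding eventually_at_right_field
  proof (intro exI[of _ s] conjI allI impI s)
    fix h assume h: "0 < h" "h < s"
    show "f x s / s \<le> f x h / h"
      using monotone_onD[OF dec[rule_format, of x], of h s] h by simp
  qed
qed simp

lemma kpp_diff_le:
  assumes f: "reaction_term L \<gamma> f" and dec: "\<forall>x. strict_antimono_on {0<..} (\<lambda>s. f x s / s)"
    and ab: "0 < b" "b \<le> a"
  shows "f x a - f x b \<le> f x b / b * (a - b)"
proof (cases "a = b")
  case False
  hence "f x a / a \<le> f x b / b" using monotone_onD[OF dec[rule_format, of x], of b a] ab by simp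
  hence "f x a \<le> f x b / b * a" using ab by (simp add: field_simps)
  moreover have "f x b / b * b = f x b" using ab by simp
  ultimately show ?thesis unfolding right_diff_distrib by linarith
qed simp

text \<open>For b \<le> a, \<open>kpp_diff_le\<close> bounds the increment by the slope f(x, b) / b,
  itself at most f_u(x, 0); the other order is symmetric. The product with a - b covers both signs
  and expresses that |u - W| is a subsolution of the equation linearised at 0.\<close>

lemma kpp_upper:
  assumes f: "reaction_term L \<gamma> f" and dec: "\<forall>x. strict_antimono_on {0<..} (\<lambda>s. f x s / s)"
    and ab: "0 \<le> a" "0 \<le> b"
  shows "(a - b) * (f x a - f x b - f_u f x 0 * (a - b)) \<le> 0"
proof -
  have f0: "f x 0 = 0" using f by (simp add: reaction_term_def)
  have le: "f x a - f x b \<le> f_u f x 0 * (a - b)" if "0 \<le> b" "b \<le> a" for a b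
  proof (cases "b = 0")
    case True
    thus ?thesis using kpp_ratio_le[OF f dec, of a x] that f0 by (cases "a = 0") (auto simp: field_simps)
  next
    case False
    hence b: "b > 0" using that by simp
    have "f x b / b * (a - b) \<le> f_u f x 0 * (a - b)"
      using kpp_ratio_le[OF f dec b] that by (intro mult_right_mono) auto
    thus ?thesis using kpp_diff_le[OF f dec b that(2), of x] by linarith
  qed
  show ?thesis
  proof (cases "b \<le> a")
    case True
    thus ?thesis using le[OF ab(2) True] by (intro mult_nonneg_nonpos) auto
  next
    case False
    hence "f x b - f x a \<le> f_u f x 0 * (b - a)" using le[OF ab(1), of b] by simp
    thus ?thesis using False by (intro mult_nonpos_nonneg) (auto simp: algebra_simps)
  qed
qed

text \<open>The continuity assumption is uniform in \<open>x\<close> but pointwise in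
  \<open>s\<close>; a Lebesgue number for the cover of [-R, R] by its moduli makes it uniform in
  \<open>s\<close> as well.\<close>

lemma f_u_uniform:
  assumes f: "reaction_term L \<gamma> f" and \<epsilon>: "\<epsilon> > 0"
  obtains \<delta> where "\<delta> > 0" "\<And>r s x. \<bar>s\<bar> \<le> R \<Longrightarrow> \<bar>r - s\<bar> < \<delta> \<Longrightarrow> \<bar>f_u f x r - f_u f x s\<bar> < \<epsilon>"
proof -
  have "\<forall>s. \<exists>\<delta>>0. \<forall>r. \<bar>r - s\<bar> < \<delta> \<longrightarrow> (\<forall>x. \<bar>f_u f x r - f_u f x s\<bar> < \<epsilon> / 2)"
    using f \<epsilon> unfolding reaction_term_def by (metis half_gt_zero)
  then obtain d where d: "\<And>s. d s > 0" "\<And>r s x. \<bar>r - s\<bar> < d s \<Longrightarrow> \<bar>f_u f x r - f_u f x s\<bar> < \<epsilon> / 2" by metis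
  have sub: "{-R..R} \<subseteq> \<Union> (range (\<lambda>s. ball s (d s)))"
  proof
    fix s show "s \<in> \<Union> (range (\<lambda>s. ball s (d s)))" using d(1)[of s] by (intro UnionI[of "ball s (d s)"]) auto
  qed
  obtain e where e: "e > 0" "\<And>s. s \<in> {-R..R} \<Longrightarrow> \<exists>G \<in> range (\<lambda>s. ball s (d s)). ball s e \<subseteq> G"
    by (rule Heine_Borel_lemma[OF compact_Icc sub]) auto
  show ?thesis
  proof (rule that[OF e(1)])
    fix r s x assume s: "\<bar>s\<bar> \<le> R" "\<bar>r - s\<bar> < e"
    hence "- R \<le> s" "s \<le> R" by linarith+
    hence "s \<in> {-R..R}" by simp
    then obtain t where t: "ball s e \<subseteq> ball t (d t)" using e(2) by blast
    have "s \<in> ball t (d t)" "r \<in> ball t (d t)" using t e(1) s(2) by (auto simp: subset_iff dist_real_def abs_minus_commute)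
    hence "\<bar>f_u f x s - f_u f x t\<bar> < \<epsilon> / 2" "\<bar>f_u f x r - f_u f x t\<bar> < \<epsilon> / 2"
      using d(2) by (auto simp: dist_real_def abs_minus_commute)
    thus "\<bar>f_u f x r - f_u f x s\<bar> < \<epsilon>" by linarith
  qed
qed

text \<open>On the way from 0 to \<open>s\<close> in steps shorter than \<delta>, each step changes
  \<open>f_u\<close> by less than 1, uniformly in \<open>x\<close>, and \<open>Q\<close> bounds the
  start.\<close>

lemma f_u_bounded:
  assumes f: "reaction_term L \<gamma> f" and Q: "\<And>x. \<bar>f_u f x 0\<bar> \<le> Q"
  obtains K where "K \<ge> 0" "\<And>s x. \<bar>s\<bar> \<le> R \<Longrightarrow> \<bar>f_u f x s\<bar> \<le> K"
proof -
  obtain \<delta> where \<delta>: "\<delta> > 0" "\<And>r s x. \<bar>s\<bar> \<le> R \<Longrightarrow> \<bar>r - s\<bar> < \<delta> \<Longrightarrow> \<bar>f_u f x r - f_u f x s\<bar> < 1"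
    using f_u_uniform[OF f, of 1 R] by auto
  have step: "\<bar>f_u f x s\<bar> \<le> Q + real n" if "\<bar>s\<bar> \<le> R" "\<bar>s\<bar> \<le> real n * (\<delta> / 2)" for n s x
    using that
  proof (induction n arbitrary: s)
    case 0
    thus ?case using Q[of x] by simp
  next
    case (Suc n)
    \<comment> \<open>Shrinking towards 0 stays in [-R, R]; the step has length |s| / (n + 1), at
      most \<delta> / 2.\<close>
    define s' where "s' = s * (real n / (real n + 1))"
    have le1: "real n / (real n + 1) \<le> 1" "0 \<le> real n / (real n + 1)" by auto
    have s': "\<bar>s'\<bar> = \<bar>s\<bar> * (real n / (real n + 1))" by (simp add: s'_def abs_mult)
    have "\<bar>s\<bar> * (real n / (real n + 1)) \<le> \<bar>s\<bar> * 1" by (rule mult_left_mono[OF le1(1)]) simp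
    hence 1: "\<bar>s'\<bar> \<le> R" using Suc.prems s' by simp
    have "\<bar>s\<bar> * (real n / (real n + 1)) \<le> (real (Suc n) * (\<delta> / 2)) * (real n / (real n + 1))"
      by (rule mult_right_mono[OF Suc.prems(2) le1(2)])
    also have "\<dots> = real n * (\<delta> / 2)" by (simp add: field_simps)
    finally have 2: "\<bar>s'\<bar> \<le> real n * (\<delta> / 2)" using s' by simp
    have "s - s' = s / (real n + 1)" by (simp add: s'_def field_simps)
    hence "\<bar>s - s'\<bar> = \<bar>s\<bar> / (real n + 1)" by simp
    also have "\<dots> \<le> \<delta> / 2" using Suc.prems(2) by (simp add: field_simps)
    finally have "\<bar>s - s'\<bar> < \<delta>" using \<delta>(1) by simp
    from \<delta>(2)[OF 1 this, of x] Suc.IH[OF 1 2] show ?case by simp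
  qed
  obtain n where "R / (\<delta> / 2) \<le> real n" using real_arch_simple by blast
  hence n: "R \<le> real n * (\<delta> / 2)" using \<delta>(1) by (simp add: field_simps)
  show ?thesis
  proof (rule that)
    show "0 \<le> Q + real n" using Q[of undefined] by (simp add: order_trans[OF abs_ge_zero])
  qed (use step n in \<open>meson order_trans\<close>)
qed

lemma f_mean_value:
  assumes f: "reaction_term L \<gamma> f" and ab: "b < a"
  obtains \<theta> where "b < \<theta>" "\<theta> < a" "f x a - f x b = f_u f x \<theta> * (a - b)"
  using MVT2[OF ab f_u_DERIV[OF f, of x]] by (metis mult.commute)

text \<open>Conjugation with exp(l x_k) turns the operator defining the eigenvalue into div(A grad)
  + q, up to sign and the constant l c - \<mu>. As \<psi> is only C1, this goes through the weak
  product rule, applied once to the flux of \<psi> and once to the C1 field A e.\<close>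

lemma (in periodic_medium) exp_eigenfunction:
  assumes "principal_eigenvalue_L L A f k c l \<mu>"
  obtains \<psi> where "C1 \<psi>" "periodic L \<psi>" "\<And>x. \<psi> x > 0"
    "weak_sol A (\<lambda>x. exp (l * x $ k) * \<psi> x) (\<lambda>x. (l * c - \<mu> - f_u f x 0) * (exp (l * x $ k) * \<psi> x))"
    "\<And>x. flux A (\<lambda>x. exp (l * x $ k) * \<psi> x) x = exp (l * x $ k) *\<^sub>R (flux A \<psi> x + (l * \<psi> x) *\<^sub>R (A x *v axis k 1))"
proof -
  define e :: "real ^ 'n" where "e = axis k 1"
  obtain \<psi> D where \<psi>: "C1 \<psi>" "periodic L \<psi>" "\<And>x. \<psi> x > 0" "has_weak_divergence (flux A \<psi>) D"
    "\<And>x. - D x - 2 * l * (e \<bullet> (A x *v grad \<psi> x)) - (l * divergence (\<lambda>y. A y *v e) x + l\<^sup>2 * (e \<bullet> (A x *v e)) - l * c + f_u f x 0) * \<psi> x = \<mu> * \<psi> x"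
    using assms unfolding principal_eigenvalue_L_def Let_def e_def flux_def[abs_def] by blast
  define E :: "real ^ 'n \<Rightarrow> real" where "E = (\<lambda>x. exp (l * x $ k))"
  have dE: "((\<lambda>s. exp (l * s)) has_real_derivative l * exp (l * s)) (at s)" for s by (auto intro!: derivative_eq_intros)
  have cE: "continuous_on UNIV (\<lambda>s. l * exp (l * s))" by (intro continuous_intros)
  have CE: "C1 E" "grad E x = (l * E x) *\<^sub>R e" for x
    unfolding E_def e_def by (rule C1_compose[OF C1_nth dE cE], simp add: C1_compose(2)[OF C1_nth dE cE] grad_nth)
  have gP: "grad (\<lambda>x. E x * \<psi> x) x = E x *\<^sub>R grad \<psi> x + (\<psi> x * (l * E x)) *\<^sub>R e" for x
    by (simp add: C1_mult(2)[OF CE(1) \<psi>(1)] CE(2))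
  have fl: "flux A (\<lambda>x. E x * \<psi> x) x = E x *\<^sub>R (flux A \<psi> x + (l * \<psi> x) *\<^sub>R (A x *v e))" for x
    unfolding flux_def gP by (simp add: matrix_vector_right_distrib matrix_vector_mult_scaleR scaleR_add_right mult_ac)
  have "C1 (\<lambda>x. (A x *v e) $ i)" for i
    unfolding matrix_vector_mult_def using C1_sum(1)[of UNIV "\<lambda>j x. A x $ i $ j * e $ j"] C1_mult(1)[OF C1_entry C1_const] by auto
  from weak_div_C1[OF this] have wA: "has_weak_divergence (\<lambda>x. A x *v e) (divergence (\<lambda>y. A y *v e))" .
  define h where "h = (\<lambda>x. l * (E x * \<psi> x))"
  have Ch: "C1 h" "grad h x = l *\<^sub>R (E x *\<^sub>R grad \<psi> x + (\<psi> x * (l * E x)) *\<^sub>R e)" for x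
    unfolding h_def by (rule C1_cmult(1)[OF C1_mult(1)[OF CE(1) \<psi>(1)]], simp add: C1_cmult(2)[OF C1_mult(1)[OF CE(1) \<psi>(1)]] gP)
  have w: "has_weak_divergence (flux A (\<lambda>x. E x * \<psi> x)) (\<lambda>x. (l * c - \<mu> - f_u f x 0) * (E x * \<psi> x))"
  proof (rule weak_div_cong[OF weak_div_add[OF weak_div_mult[OF \<psi>(4) CE(1)] weak_div_mult[OF wA Ch(1)]]])
    fix x
    show "E x *\<^sub>R flux A \<psi> x + h x *\<^sub>R (A x *v e) = flux A (\<lambda>x. E x * \<psi> x) x"
      unfolding fl h_def by (simp add: scaleR_add_right mult_ac)
    have s1: "(A x *v e) \<bullet> grad \<psi> x = e \<bullet> (A x *v grad \<psi> x)"
      using inner_symmetric_matrix[OF sym, of x e "grad \<psi> x"] by (simp add: inner_commute)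
    have eq: "D x + 2 * l * (e \<bullet> (A x *v grad \<psi> x)) + (l * divergence (\<lambda>y. A y *v e) x + l\<^sup>2 * (e \<bullet> (A x *v e))) * \<psi> x = (l * c - \<mu> - f_u f x 0) * \<psi> x"
      using \<psi>(5)[of x] by (simp add: algebra_simps)
    have "E x * D x + flux A \<psi> x \<bullet> grad E x + (h x * divergence (\<lambda>y. A y *v e) x + (A x *v e) \<bullet> grad h x)
      = E x * (D x + 2 * l * (e \<bullet> (A x *v grad \<psi> x)) + (l * divergence (\<lambda>y. A y *v e) x + l\<^sup>2 * (e \<bullet> (A x *v e))) * \<psi> x)"
      unfolding CE(2) Ch(2) unfolding h_def
      by (simp add: inner_add_right s1 flux_def inner_commute[of _ e] power2_eq_square algebra_simps)
    thus "E x * D x + flux A \<psi> x \<bullet> grad E x + (h x * divergence (\<lambda>y. A y *v e) x + (A x *v e) \<bullet> grad h x) = (l * c - \<mu> - f_u f x 0) * (E x * \<psi> x)"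
      unfolding eq by simp
  qed
  have "weak_sol A (\<lambda>x. E x * \<psi> x) (\<lambda>x. (l * c - \<mu> - f_u f x 0) * (E x * \<psi> x))"
    using w C1_mult(1)[OF CE(1) \<psi>(1)] by (simp add: weak_sol_def)
  thus ?thesis using that[OF \<psi>(1-3)] fl unfolding E_def e_def by blast
qed

text \<open>The eigenvalues for \<open>l\<close> and \<open>- l\<close> (formally adjoint problems) agree: the drift field is
  bounded while its divergence is a nonzero multiple of \<open>\<Phi> \<Psi>\<close> otherwise.\<close>

lemma (in periodic_medium) adjoint_eigenvalue_le:
  assumes \<Phi>: "weak_sol A \<Phi> (\<lambda>x. (\<kappa> - q x) * \<Phi> x)" and \<Psi>: "weak_sol A \<Psi> (\<lambda>x. (\<kappa>' - q x) * \<Psi> x)"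
    and m: "0 < m0" "\<And>x. m0 \<le> \<Phi> x * \<Psi> x" and b: "\<And>x. norm (drift A \<Phi> \<Psi> x) \<le> b"
  shows "\<kappa>' \<le> \<kappa>"
proof (rule ccontr)
  assume "\<not> ?thesis"
  hence \<delta>: "(\<kappa>' - \<kappa>) * m0 > 0" using m by simp
  define \<delta> where "\<delta> = (\<kappa>' - \<kappa>) * m0"
  have b0: "0 \<le> b" using b norm_ge_zero order_trans by blast
  have C: "C1 \<Phi>" "C1 \<Psi>" and w: "has_weak_divergence (flux A \<Phi>) (\<lambda>x. (\<kappa> - q x) * \<Phi> x)"
      "has_weak_divergence (flux A \<Psi>) (\<lambda>x. (\<kappa>' - q x) * \<Psi> x)"
    using \<Phi> \<Psi> by (auto simp: weak_sol_def)
  have wB: "has_weak_divergence (drift A \<Phi> \<Psi>) (\<lambda>x. (\<kappa> - \<kappa>') * (\<Phi> x * \<Psi> x))"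
  proof (rule weak_div_cong[OF weak_div_diff[OF weak_div_mult[OF w(1) C(2)] weak_div_mult[OF w(2) C(1)]]])
    fix x
    show "\<Psi> x *\<^sub>R flux A \<Phi> x - \<Phi> x *\<^sub>R flux A \<Psi> x = drift A \<Phi> \<Psi> x" by (simp add: drift_def)
    have "flux A \<Phi> x \<bullet> grad \<Psi> x = flux A \<Psi> x \<bullet> grad \<Phi> x" unfolding flux_def by (rule inner_symmetric_matrix[OF sym])
    thus "\<Psi> x * ((\<kappa> - q x) * \<Phi> x) + flux A \<Phi> x \<bullet> grad \<Psi> x - (\<Phi> x * ((\<kappa>' - q x) * \<Psi> x) + flux A \<Psi> x \<bullet> grad \<Phi> x) = (\<kappa> - \<kappa>') * (\<Phi> x * \<Psi> x)"
      by (simp add: algebra_simps)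
  qed
  let ?n = "DIM(real ^ 'n)"
  \<comment> \<open>Testing the drift with the cutoff compares a volume of order R^d with a term of
    order R^d / R, d being the dimension. The factor 9/16 bounds the cutoff from below on the ball
    of radius R/2.\<close>
  have key: "\<delta> * (9 / 16) \<le> 4 * b * 2 ^ ?n / R" if R: "R > 0" for R
  proof -
    have T: "test_function (cutoff R :: real ^ 'n \<Rightarrow> real)"
    proof -
      have "{x :: real ^ 'n. cutoff R x \<noteq> 0} \<subseteq> cball 0 R" using cutoff_outside[OF R] by (force simp: not_le)
      hence "bounded {x :: real ^ 'n. cutoff R x \<noteq> 0}" by (rule bounded_subset[OF bounded_cball])
      thus ?thesis using C1_cutoff(1)[OF R] by (simp add: test_function_def)
    qed
    have cs: "integrable lborel (cutoff R :: real ^ 'n \<Rightarrow> real)" by (rule csupp_integrable[OF csupp_grad(1)[OF T]])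
    note wt = weak_div_test[OF wB T]
    have ic: "integrable lborel (indicator (cball (0 :: real ^ 'n) r) :: _ \<Rightarrow> real)" for r
      using emeasure_lborel_cball_finite[of "0 :: real ^ 'n" r] by (intro integrable_real_indicator) auto
    have V: "measure lborel (cball (0 :: real ^ 'n) r) = unit_ball_vol (real ?n) * r ^ ?n" if "r \<ge> 0" for r
      using content_cball[OF that, of "0 :: real ^ 'n"] by simp
    have "\<delta> * (9 / 16 * measure lborel (cball (0 :: real ^ 'n) (R / 2))) \<le> (LINT x|lborel. \<delta> * cutoff R (x :: real ^ 'n))"
    proof -
      have "(LINT x|lborel. 9 / 16 * indicator (cball (0 :: real ^ 'n) (R / 2)) x) \<le> (LINT x|lborel. cutoff R (x :: real ^ 'n))"
      proof (rule Bochner_Integration.integral_mono)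
        fix x :: "real ^ 'n"
        have "9 / 16 \<le> cutoff R x" if "norm x \<le> R / 2"
        proof -
          have "x \<bullet> x \<le> (R / 2)\<^sup>2" using that by (metis norm_ge_zero power2_norm_eq_inner power_mono)
          hence "(x \<bullet> x) / R\<^sup>2 \<le> 1 / 4" using R by (simp add: field_simps power2_eq_square)
          hence "3 / 4 \<le> 1 - (x \<bullet> x) / R\<^sup>2" by simp
          hence "3 / 4 \<le> max 0 (1 - (x \<bullet> x) / R\<^sup>2)" by (rule max.coboundedI2)
          hence "(3 / 4)\<^sup>2 \<le> cutoff R x" unfolding cutoff_def by (rule power_mono) simp
          thus ?thesis by (simp add: power2_eq_square)
        qed
        thus "9 / 16 * indicator (cball 0 (R / 2)) x \<le> cutoff R x" using cutoff_bounds(1)[of R x] by (auto simp: indicator_def)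
      qed (use ic cs in auto)
      hence "9 / 16 * measure lborel (cball (0 :: real ^ 'n) (R / 2)) \<le> (LINT x|lborel. cutoff R (x :: real ^ 'n))" by simp
      from mult_left_mono[OF this less_imp_le[OF \<delta>]] show ?thesis by (simp add: \<delta>_def)
    qed
    also have "\<dots> \<le> (LINT x|lborel. - ((\<kappa> - \<kappa>') * (\<Phi> x * \<Psi> x) * cutoff R x))"
    proof (rule Bochner_Integration.integral_mono)
      fix x
      have "(\<kappa>' - \<kappa>) * m0 \<le> (\<kappa>' - \<kappa>) * (\<Phi> x * \<Psi> x)" using m \<delta> by (intro mult_left_mono) (auto simp: zero_less_mult_iff)
      from mult_right_mono[OF this cutoff_bounds(1)[of R x]]
      show "\<delta> * cutoff R x \<le> - ((\<kappa> - \<kappa>') * (\<Phi> x * \<Psi> x) * cutoff R x)" by (simp add: \<delta>_def algebra_simps)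
    qed (use cs wt(3) in auto)
    also have "\<dots> = (LINT x|lborel. drift A \<Phi> \<Psi> x \<bullet> grad (cutoff R) x)" using wt(1) by simp
    also have "\<dots> \<le> (LINT x|lborel. 4 * b / R * indicator (cball (0 :: real ^ 'n) R) x)"
    proof (rule Bochner_Integration.integral_mono[OF wt(2)])
      fix x :: "real ^ 'n"
      show "drift A \<Phi> \<Psi> x \<bullet> grad (cutoff R) x \<le> 4 * b / R * indicator (cball 0 R) x"
      proof (cases "norm x \<le> R")
        case True
        have "drift A \<Phi> \<Psi> x \<bullet> grad (cutoff R) x \<le> norm (drift A \<Phi> \<Psi> x) * norm (grad (cutoff R) x)" by (rule norm_cauchy_schwarz)
        also have "\<dots> \<le> b * (4 / R)" using b norm_grad_cutoff[OF R] b0 by (intro mult_mono) auto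
        finally show ?thesis using True by (simp add: mult.commute)
      next
        case False
        hence "R\<^sup>2 \<le> x \<bullet> x" using R by (metis less_imp_le power2_norm_eq_inner power_mono linear)
        thus ?thesis using False R by (simp add: C1_cutoff(2)[OF R])
      qed
    qed (use ic in auto)
    also have "\<dots> = 4 * b / R * measure lborel (cball (0 :: real ^ 'n) R)" by simp
    finally have "\<delta> * (9 / 16) * (unit_ball_vol (real ?n) * (R / 2) ^ ?n) \<le> 4 * b * 2 ^ ?n / R * (unit_ball_vol (real ?n) * (R / 2) ^ ?n)"
      using V[of R] V[of "R / 2"] R by (simp add: power_divide mult_ac)
    thus ?thesis by (rule mult_right_le_imp_le) (use R in simp)
  qed
  \<comment> \<open>With this radius the left side of \<open>key\<close> times R exceeds the right
    side times R by exactly 1.\<close>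
  define R where "R = 16 * (4 * b * 2 ^ ?n + 1) / (9 * \<delta>)"
  have R: "R > 0" unfolding R_def using \<delta> b0 by (simp add: \<delta>_def[symmetric] add_nonneg_pos)
  from key[OF R] have "\<delta> * (9 / 16) * R \<le> 4 * b * 2 ^ ?n" using R by (simp add: field_simps)
  moreover have "\<delta> * (9 / 16) * R = 4 * b * 2 ^ ?n + 1" using \<delta> by (simp add: R_def \<delta>_def[symmetric])
  ultimately show False by simp
qed

text \<open>Near either end of the \<xi> axis the limits of the front bound it. In between,
  periodicity in the other coordinates reduces x to a compact set, on which w(x, x_k + c t) is
  jointly continuous.\<close>

lemma (in periodic_medium) wave_bounded:
  assumes w: "traveling_wavefront L A f k p c w" and p: "periodic L p" "continuous_on UNIV p"
  obtains B where "B \<ge> 0" "\<And>t x. 0 \<le> t \<Longrightarrow> t \<le> T \<Longrightarrow> w x (x $ k + c * t) \<le> B"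
proof -
  obtain P where P: "P > 0" "\<And>x. norm (p x) \<le> P" using periodic_bounded[OF L_pos p] by blast
  have "uniform_limit UNIV (\<lambda>\<xi> x. w x \<xi>) (\<lambda>x. 0) at_bot" "uniform_limit UNIV (\<lambda>\<xi> x. w x \<xi>) p at_top"
    using w by (auto simp: traveling_wavefront_def)
  hence "\<forall>\<^sub>F \<xi> in at_bot. \<forall>x\<in>UNIV. dist (w x \<xi>) 0 < 1" "\<forall>\<^sub>F \<xi> in at_top. \<forall>x\<in>UNIV. dist (w x \<xi>) (p x) < 1"
    by (auto dest: uniform_limitD[where e = 1])
  then obtain K1 K2 where K: "\<And>\<xi> x. \<xi> \<le> K1 \<Longrightarrow> dist (w x \<xi>) 0 < 1" "\<And>\<xi> x. \<xi> \<ge> K2 \<Longrightarrow> dist (w x \<xi>) (p x) < 1"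
    unfolding eventually_at_bot_linorder eventually_at_top_linorder by (metis UNIV_I)
  define K where "K = \<bar>K1\<bar> + \<bar>K2\<bar> + \<bar>c\<bar> * \<bar>T\<bar>"
  define C where "C = cbox (\<chi> i. if i = k then - K else 0) (\<chi> i. if i = k then K else L $ i)"
  have cont: "continuous_on (UNIV \<times> UNIV) (\<lambda>(t, x). w x (x $ k + c * t))"
    using w by (simp add: traveling_wavefront_def solves_equation_def)
  have "compact ({0..T} \<times> C)" unfolding C_def by (intro compact_Times) auto
  hence "bounded ((\<lambda>(t, x). w x (x $ k + c * t)) ` ({0..T} \<times> C))"
    using continuous_on_subset[OF cont] by (intro compact_imp_bounded compact_continuous_image) auto
  then obtain B where B: "B > 0" "\<And>t x. t \<in> {0..T} \<Longrightarrow> x \<in> C \<Longrightarrow> norm (w x (x $ k + c * t)) \<le> B"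
    unfolding bounded_pos by fastforce
  have "w x (x $ k + c * t) \<le> B + P + 1" if t: "0 \<le> t" "t \<le> T" for t x
  proof -
    define \<xi> where "\<xi> = x $ k + c * t"
    consider "\<xi> \<le> K1" | "\<xi> \<ge> K2" | "K1 < \<xi>" "\<xi> < K2" by linarith
    thus ?thesis
    proof cases
      case 1
      thus ?thesis using K(1)[OF 1, of x] B(1) P(1) by (simp add: \<xi>_def dist_real_def)
    next
      case 2
      thus ?thesis using K(2)[OF 2, of x] B(1) P(2)[of x] by (simp add: \<xi>_def dist_real_def)
    next
      case 3
      have "\<bar>c * t\<bar> \<le> \<bar>c\<bar> * \<bar>T\<bar>" unfolding abs_mult using t by (intro mult_left_mono) auto
      hence xk: "- K \<le> x $ k" "x $ k \<le> K" using 3 unfolding \<xi>_def K_def by linarith+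
      obtain m where m: "\<And>i. 0 \<le> x $ i + of_int (m i) * L $ i" "\<And>i. x $ i + of_int (m i) * L $ i \<le> L $ i"
        using lattice_representative[OF L_pos, of x] by blast
      \<comment> \<open>The k-th coordinate is left alone, as a shift there would change \<xi>; it
        is already confined by the bounds on \<xi> and t.\<close>
      define y where "y = (\<chi> i. x $ i + of_int ((m(k := 0)) i) * L $ i)"
      have "w y = w x" unfolding y_def by (rule periodic_lattice_shift) (use w in \<open>simp add: traveling_wavefront_def\<close>)
      moreover have "y $ k = x $ k" by (simp add: y_def)
      moreover have "y \<in> C" unfolding C_def mem_box_cart using m xk by (auto simp: y_def)
      ultimately show ?thesis using B(2)[of t y] t P(1) by simp
    qed
  qed
  thus ?thesis using that[of "B + P + 1"] B(1) P(1) by simp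
qed

section \<open>Perturbations of the wavefront\<close>

lemma (in periodic_medium) radial_field_ex:
  "\<exists>d dA. d > 0 \<and> (\<forall>x0. has_weak_divergence (\<lambda>x. A x *v (x - x0)) (dA x0)) \<and> (\<forall>x0 x. \<bar>dA x0 x\<bar> \<le> d * (1 + norm (x - x0)))"
proof (rule radial_field)
  fix d dA
  assume "d > 0" "\<And>x0. has_weak_divergence (\<lambda>x. A x *v (x - x0)) (dA x0)" "\<And>x0 x. \<bar>dA x0 x\<bar> \<le> d * (1 + norm (x - x0))"
  thus ?thesis by (intro exI[of _ d] exI[of _ dA]) simp
qed

section \<open>The steady state and the wavefront\<close>

locale kpp_front = periodic_medium L A \<gamma>
  for L :: "real ^ 'n" and A :: "real ^ 'n \<Rightarrow> real ^ 'n ^ 'n" and \<gamma> :: real +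
  fixes f :: "real ^ 'n \<Rightarrow> real \<Rightarrow> real" and p :: "real ^ 'n \<Rightarrow> real" and k :: 'n
    and w :: "real ^ 'n \<Rightarrow> real \<Rightarrow> real" and c \<mu>\<^sub>1 :: real
  assumes f: "reaction_term L \<gamma> f"
    and dec: "\<forall>x. strict_antimono_on {0<..} (\<lambda>s. f x s / s)"
    and mu1: "principal_eigenvalue L A (\<lambda>x. f_u f x 0) \<mu>\<^sub>1"
    and p: "steady_state L \<gamma> A f p"
    and w: "traveling_wavefront L A f k p c w"
begin

abbreviation q :: "real ^ 'n \<Rightarrow> real" where "q x \<equiv> f_u f x 0"

definition W :: "real \<Rightarrow> real ^ 'n \<Rightarrow> real" where "W t x = w x (x $ k + c * t)"

lemma f_zero: "f x 0 = 0"
  using f by (simp add: reaction_term_def)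

text \<open>Continuity of f_u(x, 0) in x is not assumed directly. It is read off from the eigenvalue
  equation for \<mu>1, which writes q as a quotient of continuous functions; periodicity then gives
  the bound.\<close>

lemma q_bound: obtains Q where "Q \<ge> 0" "\<And>x. \<bar>q x\<bar> \<le> Q"
proof -
  obtain \<phi> D where \<phi>: "C1 \<phi>" "\<And>x. \<phi> x > 0" "has_weak_divergence (\<lambda>x. A x *v grad \<phi> x) D" "\<And>x. D x + q x * \<phi> x = \<mu>\<^sub>1 * \<phi> x"
    using mu1 unfolding principal_eigenvalue_def by blast
  have "q = (\<lambda>x. (\<mu>\<^sub>1 * \<phi> x - D x) / \<phi> x)"
  proof
    fix x show "q x = (\<mu>\<^sub>1 * \<phi> x - D x) / \<phi> x" using \<phi>(2)[of x] \<phi>(4)[of x] by (simp add: field_simps)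
  qed
  moreover have "continuous_on UNIV (\<lambda>x. (\<mu>\<^sub>1 * \<phi> x - D x) / \<phi> x)"
    using \<phi>(3) by (intro continuous_intros C1_continuous[OF \<phi>(1)])
      (use \<phi>(2) in \<open>auto simp: has_weak_divergence_def less_imp_neq[symmetric]\<close>)
  ultimately have "continuous_on UNIV q" by (rule ssubst[where P = "continuous_on UNIV"])
  moreover have "periodic L q" using f by (simp add: reaction_term_def periodic_def f_u_def)
  ultimately show ?thesis using periodic_bounded[OF L_pos, of q] that by (metis less_imp_le real_norm_def)
qed

lemma p_facts: "C1 p" "periodic L p" "p x > 0" "weak_sol A p (\<lambda>x. - f x (p x))"
proof -
  have 2: "C2 p" using p by (simp add: steady_state_def C2_holder_def)
  thus "C1 p" by (simp add: C2_def)
  show "periodic L p" "p x > 0" using p by (auto simp: steady_state_def)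
  have "div_A_grad A p x = - f x (p x)" for x
  proof -
    have "div_A_grad A p x + f x (p x) = 0" using p by (simp add: steady_state_def)
    thus ?thesis by simp
  qed
  hence "div_A_grad A p = (\<lambda>x. - f x (p x))" by auto
  thus "weak_sol A p (\<lambda>x. - f x (p x))" using weak_sol_C2[OF 2] by simp
qed

lemma p_bounds: obtains p0 p1 where "p0 > 0" "\<And>x. p0 \<le> p x" "\<And>x. p x \<le> p1"
proof -
  obtain p0 where "p0 > 0" "\<And>x. p0 \<le> p x"
    using periodic_positive[OF L_pos p_facts(2) C1_continuous[OF p_facts(1)] p_facts(3)] by blast
  moreover obtain p1 where "\<And>x. norm (p x) \<le> p1"
    using periodic_bounded[OF L_pos p_facts(2) C1_continuous[OF p_facts(1)]] by blast
  ultimately show ?thesis using that by (metis abs_le_D1 real_norm_def)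
qed

lemma W_parabolic: "parabolic A W (\<lambda>t x. deriv (\<lambda>s. W s x) t) (\<lambda>t. div_A_grad A (W t))"
  "t > 0 \<Longrightarrow> deriv (\<lambda>s. W s x) t = div_A_grad A (W t) x + f x (W t x)"
proof -
  have "solves_equation A f UNIV W" using w by (simp add: traveling_wavefront_def W_def[abs_def])
  from parabolic_solution[OF this] show "parabolic A W (\<lambda>t x. deriv (\<lambda>s. W s x) t) (\<lambda>t. div_A_grad A (W t))"
    "t > 0 \<Longrightarrow> deriv (\<lambda>s. W s x) t = div_A_grad A (W t) x + f x (W t x)" by auto
qed

lemma W_nonneg: "0 \<le> W t x" using w by (simp add: traveling_wavefront_def W_def)

lemma W_bounded: obtains B where "B \<ge> 0" "\<And>t x. 0 \<le> t \<Longrightarrow> t \<le> T \<Longrightarrow> W t x \<le> B"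
  using wave_bounded[OF w p_facts(2) C1_continuous[OF p_facts(1)], of T] unfolding W_def by metis

lemma W_limit: "((\<lambda>t. W t x) \<longlongrightarrow> W 0 x) (at_right 0)"
proof -
  have "continuous_on (UNIV \<times> UNIV) (\<lambda>(t, x). W t x)"
    using w by (simp add: traveling_wavefront_def solves_equation_def W_def[abs_def])
  moreover have "continuous_on UNIV (\<lambda>t :: real. (t, x))" by (intro continuous_intros)
  ultimately have "continuous_on UNIV (\<lambda>t. W t x)" using continuous_on_compose2[of "UNIV \<times> UNIV" "\<lambda>(t, x). W t x" UNIV "\<lambda>t. (t, x)"] by auto
  hence "isCont (\<lambda>t. W t x) 0" by (simp add: continuous_on_eq_continuous_at)
  thus ?thesis unfolding isCont_def by (rule tendsto_mono[rotated]) (simp add: at_le)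
qed

end

section \<open>The Cauchy problem and the perturbation of the wavefront\<close>

locale kpp_cauchy = kpp_front L A \<gamma> f p k w c \<mu>\<^sub>1
  for L :: "real ^ 'n" and A \<gamma> f p k w c \<mu>\<^sub>1 +
  fixes u\<^sub>0 :: "real ^ 'n \<Rightarrow> real" and u :: "real \<Rightarrow> real ^ 'n \<Rightarrow> real"
  assumes disc: "finite {x. \<not> isCont u\<^sub>0 x}" and u0: "\<And>x. 0 \<le> u\<^sub>0 x" "\<And>x. u\<^sub>0 x \<le> p x"
    and u: "solves_ivp A f u\<^sub>0 u"
begin

lemma u_parabolic: "parabolic A u (\<lambda>t x. deriv (\<lambda>s. u s x) t) (\<lambda>t. div_A_grad A (u t))"
  "t > 0 \<Longrightarrow> deriv (\<lambda>s. u s x) t = div_A_grad A (u t) x + f x (u t x)"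
proof -
  have "solves_equation A f {0<..} u" using u by (simp add: solves_ivp_def)
  from parabolic_solution[OF this] show "parabolic A u (\<lambda>t x. deriv (\<lambda>s. u s x) t) (\<lambda>t. div_A_grad A (u t))"
    "t > 0 \<Longrightarrow> deriv (\<lambda>s. u s x) t = div_A_grad A (u t) x + f x (u t x)" by auto
qed

text \<open>Continuity up to time 0 is known at the continuity points of \<open>u\<^sub>0\<close>;
  the finitely many other points form a null set.\<close>

lemma u_limit: "AE x in lborel. ((\<lambda>t. u t x) \<longlongrightarrow> u\<^sub>0 x) (at_right 0)"
proof (rule AE_I')
  show "{x. \<not> isCont u\<^sub>0 x} \<in> null_sets lborel" by (rule finite_imp_null_set_lborel[OF disc])
  have "((\<lambda>t. u t x) \<longlongrightarrow> u\<^sub>0 x) (at_right 0)" if "isCont u\<^sub>0 x" for x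
  proof -
    have "continuous (at (0, x) within {0..} \<times> UNIV) (\<lambda>(t, y). u t y)" "u 0 x = u\<^sub>0 x"
      using u that by (auto simp: solves_ivp_def)
    hence "((\<lambda>(t, y). u t y) \<longlongrightarrow> u\<^sub>0 x) (at (0, x) within {0..} \<times> UNIV)" by (simp add: continuous_within)
    moreover have "filterlim (\<lambda>t :: real. (t, x)) (at (0, x) within {0..} \<times> UNIV) (at_right 0)"
      unfolding filterlim_at
    proof
      show "\<forall>\<^sub>F t in at_right (0 :: real). (t, x) \<in> {0..} \<times> UNIV \<and> (t, x) \<noteq> (0, x)"
        unfolding eventually_at_right_field by (intro exI[of _ 1]) auto
      show "((\<lambda>t. (t, x)) \<longlongrightarrow> (0 :: real, x)) (at_right 0)" by (intro tendsto_intros)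
    qed
    ultimately show ?thesis using filterlim_compose[of "\<lambda>(t, y). u t y" "nhds (u\<^sub>0 x)" _ "\<lambda>t. (t, x)" "at_right 0"] by simp
  qed
  thus "{x \<in> space lborel. \<not> ((\<lambda>t. u t x) \<longlongrightarrow> u\<^sub>0 x) (at_right 0)} \<subseteq> {x. \<not> isCont u\<^sub>0 x}" by auto
qed

lemma max_limit:
  assumes "((\<lambda>t. g t :: real) \<longlongrightarrow> l) F" "l \<le> 0"
  shows "((\<lambda>t. max 0 (g t)) \<longlongrightarrow> 0) F"
  using tendsto_max[OF tendsto_const[of 0] assms(1)] assms(2) by (simp add: max_absorb1)

lemma u_bounded: obtains B where "B \<ge> 0" "\<And>t x. 0 \<le> t \<Longrightarrow> \<bar>u t x\<bar> \<le> B"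
proof -
  obtain B where B: "\<And>t x. 0 \<le> t \<Longrightarrow> \<bar>u t x\<bar> \<le> B" using u unfolding solves_ivp_def by blast
  moreover have "0 \<le> B" using B[of 0 undefined] by (simp add: order_trans[OF abs_ge_zero])
  ultimately show ?thesis using that by blast
qed

text \<open>Where u < 0, the mean value theorem and f(x, 0) = 0 bound -f(x, u) by K (-u), with K a
  bound of \<open>f_u\<close> on the range of u; thus -u satisfies the inequality of
  \<open>global_comparison\<close>.\<close>

lemma u_nonneg:
  assumes T: "T > 0"
  shows "0 \<le> u T x"
proof -
  obtain B where B: "B \<ge> 0" "\<And>t x. 0 \<le> t \<Longrightarrow> \<bar>u t x\<bar> \<le> B" using u_bounded by blast
  obtain Q where Q: "Q \<ge> 0" "\<And>x. \<bar>q x\<bar> \<le> Q" using q_bound by blast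
  obtain K where K: "K \<ge> 0" "\<And>s x. \<bar>s\<bar> \<le> B \<Longrightarrow> \<bar>f_u f x s\<bar> \<le> K" using f_u_bounded[OF f Q(2)] by blast
  have "parabolic A (\<lambda>t x. -1 * u t x) (\<lambda>t x. 0 * u t x + -1 * deriv (\<lambda>s. u s x) t) (\<lambda>t x. -1 * div_A_grad A (u t) x)"
    by (rule parabolic_scale[OF u_parabolic(1)]) auto
  hence P: "parabolic A (\<lambda>t x. - u t x) (\<lambda>t x. - deriv (\<lambda>s. u s x) t) (\<lambda>t x. - div_A_grad A (u t) x)" by simp
  have "- u T x \<le> 0"
  proof (rule global_comparison[OF P K(1) _ _ _ T])
    fix t x assume t: "t > 0" "- u t x > 0"
    obtain \<theta> where \<theta>: "u t x < \<theta>" "\<theta> < 0" "f x 0 - f x (u t x) = f_u f x \<theta> * (0 - u t x)"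
      using f_mean_value[OF f, of "u t x" 0 x] t(2) by auto
    have "\<bar>\<theta>\<bar> \<le> B" using \<theta> B(2)[of t x] t by linarith
    hence "f_u f x \<theta> \<le> K" using K(2) abs_le_D1 by blast
    hence "f_u f x \<theta> * (- u t x) \<le> K * (- u t x)" using t(2) by (intro mult_right_mono) auto
    thus "- deriv (\<lambda>s. u s x) t \<le> - div_A_grad A (u t) x + K * - u t x"
      using \<theta>(3) u_parabolic(2)[OF t(1), of x] by (simp add: f_zero)
  next
    show "\<exists>B. \<forall>t x. 0 < t \<longrightarrow> t \<le> T \<longrightarrow> - u t x \<le> B" for T
      using B(2) by (intro exI[of _ B]) (metis abs_le_D2 less_imp_le)
    show "AE x in lborel. ((\<lambda>t. max 0 (- u t x)) \<longlongrightarrow> 0) (at_right 0)"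
      using u_limit
    proof eventually_elim
      case (elim x)
      show ?case by (rule max_limit[OF tendsto_minus[OF elim]]) (use u0 in simp)
    qed
  qed
  thus ?thesis by simp
qed

lemma u_le_p:
  assumes T: "T > 0"
  shows "u T x \<le> p x"
proof -
  obtain B where B: "B \<ge> 0" "\<And>t x. 0 \<le> t \<Longrightarrow> \<bar>u t x\<bar> \<le> B" using u_bounded by blast
  obtain Q where Q: "Q \<ge> 0" "\<And>x. \<bar>q x\<bar> \<le> Q" using q_bound by blast
  note P = parabolic_diff[OF u_parabolic(1) parabolic_const[OF p_facts(4)]]
  have "u T x - p x \<le> 0"
  proof (rule global_comparison[OF P Q(1) _ _ _ T])
    fix t x assume t: "t > 0" "u t x - p x > 0"
    have "f x (u t x) - f x (p x) \<le> f x (p x) / p x * (u t x - p x)"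
      by (rule kpp_diff_le[OF f dec]) (use t p_facts(3)[of x] in auto)
    also have "\<dots> \<le> Q * (u t x - p x)"
    proof (rule mult_right_mono)
      show "f x (p x) / p x \<le> Q" using kpp_ratio_le[OF f dec p_facts(3)[of x], of x] Q(2)[of x] by linarith
    qed (use t in simp)
    finally show "deriv (\<lambda>s. u s x) t - 0 \<le> div_A_grad A (u t) x - - f x (p x) + Q * (u t x - p x)"
      using u_parabolic(2)[OF t(1), of x] by simp
  next
    have "u t x - p x \<le> B" if "0 < t" for t x using B(2)[of t x] p_facts(3)[of x] that by simp
    thus "\<exists>B. \<forall>t x. 0 < t \<longrightarrow> t \<le> T \<longrightarrow> u t x - p x \<le> B" for T by blast
    show "AE x in lborel. ((\<lambda>t. max 0 (u t x - p x)) \<longlongrightarrow> 0) (at_right 0)"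
      using u_limit
    proof eventually_elim
      case (elim x)
      show ?case by (rule max_limit[OF tendsto_diff[OF elim tendsto_const]]) (use u0 in simp)
    qed
  qed
  thus ?thesis by simp
qed

definition v :: "real \<Rightarrow> real ^ 'n \<Rightarrow> real" where "v t x = u t x - W t x"
definition v\<^sub>0 :: "real ^ 'n \<Rightarrow> real" where "v\<^sub>0 x = u\<^sub>0 x - W 0 x"

definition v' :: "real \<Rightarrow> real ^ 'n \<Rightarrow> real" where "v' t x = deriv (\<lambda>s. u s x) t - deriv (\<lambda>s. W s x) t"
definition Dv :: "real \<Rightarrow> real ^ 'n \<Rightarrow> real" where "Dv t x = div_A_grad A (u t) x - div_A_grad A (W t) x"

lemma v_parabolic: "parabolic A v v' Dv"
  using parabolic_diff[OF u_parabolic(1) W_parabolic(1)] unfolding v_def[abs_def] v'_def[abs_def] Dv_def[abs_def] .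

lemma v_equation: "t > 0 \<Longrightarrow> v' t x - Dv t x = f x (u t x) - f x (W t x)"
  using u_parabolic(2)[of t x] W_parabolic(2)[of t x] by (simp add: v'_def Dv_def)

lemma v_limit: "AE x in lborel. ((\<lambda>t. v t x) \<longlongrightarrow> v\<^sub>0 x) (at_right 0)"
  using u_limit
proof eventually_elim
  case (elim x)
  show ?case unfolding v_def v\<^sub>0_def by (rule tendsto_diff[OF elim W_limit])
qed

lemma v_bounded: obtains B where "B \<ge> 0" "\<And>t x. 0 \<le> t \<Longrightarrow> t \<le> T \<Longrightarrow> \<bar>v t x\<bar> \<le> B"
proof -
  obtain B1 where B1: "B1 \<ge> 0" "\<And>t x. 0 \<le> t \<Longrightarrow> \<bar>u t x\<bar> \<le> B1" using u_bounded by blast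
  obtain B2 where B2: "B2 \<ge> 0" "\<And>t x. 0 \<le> t \<Longrightarrow> t \<le> T \<Longrightarrow> W t x \<le> B2" using W_bounded by blast
  have "\<bar>v t x\<bar> \<le> B1 + B2" if "0 \<le> t" "t \<le> T" for t x
    using B1(2)[OF that(1), of x] B2(2)[OF that, of x] W_nonneg[of t x] unfolding v_def by linarith
  thus ?thesis using that[of "B1 + B2"] B1(1) B2(1) by simp
qed

lemma decay_estimate:
  assumes \<alpha>: "\<alpha> > 0" "\<And>x y. \<alpha> * (norm y)\<^sup>2 \<le> (A x *v y) \<bullet> y"
    and \<Phi>: "weak_sol A \<Phi> D\<^sub>\<Phi>" "\<And>x. \<Phi> x > 0" "\<And>x. D\<^sub>\<Phi> x \<le> (\<kappa> - q x) * \<Phi> x"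
    and \<Psi>: "weak_sol A \<Psi> D\<^sub>\<Psi>" "\<And>x. \<Psi> x > 0" "\<And>x. D\<^sub>\<Psi> x \<le> (\<kappa> - q x) * \<Psi> x"
    and m: "0 < m0" "\<And>x. m0 \<le> \<Phi> x * \<Psi> x" "\<And>x. \<Phi> x * \<Psi> x \<le> m1"
    and b: "\<And>x. norm (drift A \<Phi> \<Psi> x) \<le> b"
    and a: "c0 > 0" "\<And>x. c0 * exp (- a * norm x) \<le> \<Phi> x"
    and Y: "has_weak_divergence (\<lambda>x. (\<Phi> x * \<Psi> x) *\<^sub>R (A x *v x)) dY" "\<And>x. \<bar>dY x\<bar> \<le> d * (1 + norm x)"
    and M: "integrable lborel (\<lambda>x. \<Psi> x * \<bar>v\<^sub>0 x\<bar>)" and v0: "v\<^sub>0 \<in> borel_measurable borel"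
    and n: "n = real CARD('n) / 2" and C0: "C0 = 2 * m1 / m0\<^sup>2 * (8 * n\<^sup>2 * m1 / (\<alpha> * m0)) powr n"
    and T: "T > 0"
  shows "\<bar>v T x\<bar> \<le> C0 * 2 powr n * (LINT x|lborel. \<Psi> x * \<bar>v\<^sub>0 x\<bar>) * T powr (- n) * exp (\<kappa> * T) * \<Phi> x"
proof -
  obtain \<Lambda> where \<Lambda>: "\<Lambda> > 0" "\<And>x y. norm (A x *v y) \<le> \<Lambda> * norm y" using A_bound by blast
  define s where "s = (\<lambda>t. exp (- \<kappa> * t))"
  have sd: "(s has_real_derivative - \<kappa> * s t) (at t)" for t unfolding s_def by (auto intro!: derivative_eq_intros)
  have s: "s t > 0" for t by (simp add: s_def)
  have cs: "continuous_on {0<..} (\<lambda>t. - \<kappa> * s t)" unfolding s_def by (intro continuous_intros)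
  interpret F: weighted_flow A \<Phi> \<Psi> "\<lambda>x. q x - \<kappa>" D\<^sub>\<Phi> D\<^sub>\<Psi> "\<lambda>t x. s t * v t x"
    "\<lambda>t x. - \<kappa> * s t * v t x + s t * v' t x" "\<lambda>t x. s t * Dv t x" \<alpha> \<Lambda> m0 m1 b
    by unfold_locales (use sym \<alpha> \<Lambda> \<Phi> \<Psi> m b parabolic_scale[OF v_parabolic sd cs] in auto)
  have "\<bar>s T * v T x / \<Phi> x\<bar> \<le> C0 * 2 powr n * (LINT x|lborel. \<Psi> x * \<bar>v\<^sub>0 x\<bar>) * T powr (- n)"
  proof (rule F.kernel_bound[OF _ _ Y _ _ _ _ n C0 T])
    fix t x assume t: "t > (0::real)"
    have "v t x * (v' t x - Dv t x - q x * v t x) \<le> 0"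
      unfolding v_equation[OF t] unfolding v_def by (rule kpp_upper[OF f dec u_nonneg[OF t] W_nonneg])
    from mult_nonneg_nonpos[OF _ this, of "s t * s t"] s[of t]
    have "(s t * s t) * (v t x * (v' t x - Dv t x - q x * v t x)) \<le> 0" by simp
    thus "s t * v t x * (- \<kappa> * s t * v t x + s t * v' t x - s t * Dv t x - (q x - \<kappa>) * (s t * v t x)) \<le> 0"
      by (simp add: algebra_simps)
  next
    fix T :: real
    obtain B where B: "B \<ge> 0" "\<And>t x. 0 \<le> t \<Longrightarrow> t \<le> T \<Longrightarrow> \<bar>v t x\<bar> \<le> B" using v_bounded by blast
    have "\<bar>s t * v t x / \<Phi> x\<bar> \<le> exp (\<bar>\<kappa>\<bar> * \<bar>T\<bar>) * B / c0 * exp (a * norm x)" if t: "0 < t" "t \<le> T" for t x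
    proof -
      have "- \<kappa> * t \<le> \<bar>\<kappa>\<bar> * \<bar>T\<bar>"
      proof -
        have "- \<kappa> * t \<le> \<bar>\<kappa>\<bar> * t" using t by (intro mult_right_mono) auto
        also have "\<dots> \<le> \<bar>\<kappa>\<bar> * \<bar>T\<bar>" using t by (intro mult_left_mono) auto
        finally show ?thesis .
      qed
      hence 1: "s t \<le> exp (\<bar>\<kappa>\<bar> * \<bar>T\<bar>)" by (simp add: s_def)
      have "\<bar>s t * v t x\<bar> \<le> exp (\<bar>\<kappa>\<bar> * \<bar>T\<bar>) * B"
        unfolding abs_mult using 1 s[of t] B(2)[of t x] t by (intro mult_mono) auto
      hence "\<bar>s t * v t x / \<Phi> x\<bar> \<le> exp (\<bar>\<kappa>\<bar> * \<bar>T\<bar>) * B / (c0 * exp (- a * norm x))"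
        unfolding abs_divide using a \<Phi>(2)[of x] B(1) by (intro frac_le) auto
      thus ?thesis by (simp add: exp_minus field_simps)
    qed
    thus "\<exists>Z\<ge>0. \<forall>t x. 0 < t \<longrightarrow> t \<le> T \<longrightarrow> \<bar>s t * v t x / \<Phi> x\<bar> \<le> Z * exp (a * norm x)"
      using B(1) a(1) by (intro exI[of _ "exp (\<bar>\<kappa>\<bar> * \<bar>T\<bar>) * B / c0"]) auto
  next
    show "AE x in lborel. ((\<lambda>t. s t * v t x / \<Phi> x) \<longlongrightarrow> v\<^sub>0 x / \<Phi> x) (at_right 0)"
      using v_limit
    proof eventually_elim
      case (elim x)
      have "(s \<longlongrightarrow> s 0) (at_right 0)" unfolding s_def by (intro tendsto_intros)
      from tendsto_divide[OF tendsto_mult[OF this elim] tendsto_const[of "\<Phi> x"]] \<Phi>(2)[of x]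
      show ?case by (simp add: s_def)
    qed
    have "\<Phi> \<in> borel_measurable borel" using \<Phi>(1) by (intro borel_measurable_continuous_onI C1_continuous) (simp add: weak_sol_def)
    thus "(\<lambda>x. v\<^sub>0 x / \<Phi> x) \<in> borel_measurable borel" using v0 by measurable
    have e: "\<Phi> x * \<Psi> x * \<bar>v\<^sub>0 x / \<Phi> x\<bar> = \<Psi> x * \<bar>v\<^sub>0 x\<bar>" for x using \<Phi>(2)[of x] by (simp add: abs_divide)
    show "integrable lborel (\<lambda>x. \<Phi> x * \<Psi> x * \<bar>v\<^sub>0 x / \<Phi> x\<bar>)" unfolding e by (rule M)
    show "(LINT x|lborel. \<Phi> x * \<Psi> x * \<bar>v\<^sub>0 x / \<Phi> x\<bar>) \<le> (LINT x|lborel. \<Psi> x * \<bar>v\<^sub>0 x\<bar>)" unfolding e by simp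
  qed
  hence "s T * \<bar>v T x\<bar> \<le> C0 * 2 powr n * (LINT x|lborel. \<Psi> x * \<bar>v\<^sub>0 x\<bar>) * T powr (- n) * \<Phi> x"
    using \<Phi>(2)[of x] s[of T] by (simp add: abs_mult abs_divide field_simps)
  hence "exp (\<kappa> * T) * (s T * \<bar>v T x\<bar>) \<le> exp (\<kappa> * T) * (C0 * 2 powr n * (LINT x|lborel. \<Psi> x * \<bar>v\<^sub>0 x\<bar>) * T powr (- n) * \<Phi> x)"
    by (intro mult_left_mono) auto
  moreover have e: "exp (\<kappa> * T) * (s T * \<bar>v T x\<bar>) = \<bar>v T x\<bar>" by (simp add: s_def mult.assoc[symmetric] exp_add[symmetric])
  ultimately have "\<bar>v T x\<bar> \<le> exp (\<kappa> * T) * (C0 * 2 powr n * (LINT x|lborel. \<Psi> x * \<bar>v\<^sub>0 x\<bar>) * T powr (- n) * \<Phi> x)" unfolding e by simp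
  thus ?thesis by (simp only: mult_ac)
qed

text \<open>The exponentials in \<open>\<Phi>\<close> and \<open>\<Psi>\<close> cancel in the
  product and in the drift, so all constants come from periodic functions. As exp(-l x_k) is at most
  a multiple of the weight, the weighted L^1 hypothesis bounds the initial mass.\<close>

lemma decay_left:
  assumes mu: "\<forall>c l. principal_eigenvalue_L L A f k c l (\<mu> c l)" and l: "l > 0"
    and v0: "integrable lborel (\<lambda>x. weight l \<xi>\<^sub>0 (x $ k) * v\<^sub>0 x)" "v\<^sub>0 \<in> borel_measurable borel"
  obtains C where "C \<ge> 0" "\<And>t x. t > 0 \<Longrightarrow> \<bar>v t x\<bar> \<le> C * t powr (- (real CARD('n) / 2)) * exp (- \<mu> c l * t) * exp (l * (x $ k + c * t))"
proof -
  obtain \<alpha> where \<alpha>: "\<alpha> > 0" "\<And>x y. \<alpha> * (norm y)\<^sup>2 \<le> (A x *v y) \<bullet> y" using ellipticity by blast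
  obtain \<Lambda> where \<Lambda>: "\<Lambda> > 0" "\<And>x y. norm (A x *v y) \<le> \<Lambda> * norm y" using A_bound by blast
  obtain d dA where dA: "d > 0" "\<And>x0. has_weak_divergence (\<lambda>x. A x *v (x - x0)) (dA x0)" "\<And>x0 x. \<bar>dA x0 x\<bar> \<le> d * (1 + norm (x - x0))"
    using radial_field_ex by blast
  define e :: "real ^ 'n" where "e = axis k 1"
  have ne: "norm e = 1" by (simp add: e_def norm_eq_1 inner_axis_axis)
  obtain \<psi> where \<psi>: "C1 \<psi>" "periodic L \<psi>" "\<And>x. \<psi> x > 0"
    "weak_sol A (\<lambda>x. exp (l * x $ k) * \<psi> x) (\<lambda>x. (l * c - \<mu> c l - q x) * (exp (l * x $ k) * \<psi> x))"
    "\<And>x. flux A (\<lambda>x. exp (l * x $ k) * \<psi> x) x = exp (l * x $ k) *\<^sub>R (flux A \<psi> x + (l * \<psi> x) *\<^sub>R (A x *v e))"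
    unfolding e_def by (rule exp_eigenfunction[OF mu[rule_format, of c l]]) blast
  obtain \<psi>' where \<psi>': "C1 \<psi>'" "periodic L \<psi>'" "\<And>x. \<psi>' x > 0"
    "weak_sol A (\<lambda>x. exp ((-l) * x $ k) * \<psi>' x) (\<lambda>x. ((-l) * c - \<mu> c (-l) - q x) * (exp ((-l) * x $ k) * \<psi>' x))"
    "\<And>x. flux A (\<lambda>x. exp ((-l) * x $ k) * \<psi>' x) x = exp ((-l) * x $ k) *\<^sub>R (flux A \<psi>' x + ((-l) * \<psi>' x) *\<^sub>R (A x *v e))"
    unfolding e_def by (rule exp_eigenfunction[OF mu[rule_format, of c "-l"]]) blast
  define \<Phi> \<Psi> where "\<Phi> = (\<lambda>x. exp (l * x $ k) * \<psi> x)" and "\<Psi> = (\<lambda>x. exp ((-l) * x $ k) * \<psi>' x)"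
  have pos: "\<Phi> x > 0" "\<Psi> x > 0" for x using \<psi>(3) \<psi>'(3) by (auto simp: \<Phi>_def \<Psi>_def)
  have m: "\<Phi> x * \<Psi> x = \<psi> x * \<psi>' x" for x
  proof -
    have "exp (l * x $ k) * exp ((-l) * x $ k) = 1" by (simp add: exp_add[symmetric])
    moreover have "\<Phi> x * \<Psi> x = (exp (l * x $ k) * exp ((-l) * x $ k)) * (\<psi> x * \<psi>' x)" by (simp add: \<Phi>_def \<Psi>_def)
    ultimately show ?thesis by simp
  qed
  obtain s0 where s0: "s0 > 0" "\<And>x. s0 \<le> \<psi> x" using periodic_positive[OF L_pos \<psi>(2) C1_continuous[OF \<psi>(1)] \<psi>(3)] by blast
  obtain s0' where s0': "s0' > 0" "\<And>x. s0' \<le> \<psi>' x" using periodic_positive[OF L_pos \<psi>'(2) C1_continuous[OF \<psi>'(1)] \<psi>'(3)] by blast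
  obtain s1 where s1: "s1 > 0" "\<And>x. norm (\<psi> x) \<le> s1" using periodic_bounded[OF L_pos \<psi>(2) C1_continuous[OF \<psi>(1)]] by blast
  obtain s1' where s1': "s1' > 0" "\<And>x. norm (\<psi>' x) \<le> s1'" using periodic_bounded[OF L_pos \<psi>'(2) C1_continuous[OF \<psi>'(1)]] by blast
  obtain g where g: "g > 0" "\<And>x. norm (grad \<psi> x) \<le> g" using periodic_bounded[OF L_pos periodic_grad[OF \<psi>(2,1)] C1_continuous_grad[OF \<psi>(1)]] by blast
  obtain g' where g': "g' > 0" "\<And>x. norm (grad \<psi>' x) \<le> g'" using periodic_bounded[OF L_pos periodic_grad[OF \<psi>'(2,1)] C1_continuous_grad[OF \<psi>'(1)]] by blast
  have ub: "\<psi> x \<le> s1" "\<psi>' x \<le> s1'" for x using s1(2)[of x] s1'(2)[of x] by (auto dest: abs_le_D1)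
  have mb: "s0 * s0' \<le> \<Phi> x * \<Psi> x" "\<Phi> x * \<Psi> x \<le> s1 * s1'" for x
  proof -
    show "s0 * s0' \<le> \<Phi> x * \<Psi> x" unfolding m
      by (rule mult_mono[OF s0(2) s0'(2) less_imp_le[OF \<psi>(3)] less_imp_le[OF s0'(1)]])
    show "\<Phi> x * \<Psi> x \<le> s1 * s1'" unfolding m
      by (rule mult_mono[OF ub less_imp_le[OF s1(1)] less_imp_le[OF \<psi>'(3)]])
  qed
  have Ae: "norm (A x *v e) \<le> \<Lambda>" for x using \<Lambda>(2)[of x e] ne by simp
  have fb: "norm (flux A \<psi> x) \<le> \<Lambda> * g" "norm (flux A \<psi>' x) \<le> \<Lambda> * g'" for x
    using \<Lambda>(2)[of x "grad \<psi> x"] \<Lambda>(2)[of x "grad \<psi>' x"] mult_left_mono[OF g(2)[of x], of \<Lambda>] mult_left_mono[OF g'(2)[of x], of \<Lambda>] \<Lambda>(1)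
    unfolding flux_def by linarith+
  define b where "b = s1' * (\<Lambda> * g) + s1 * (\<Lambda> * g') + 2 * l * (s1 * s1') * \<Lambda>"
  have drb: "norm (drift A \<Phi> \<Psi> x) \<le> b" for x
  proof -
    have alg: "(r' * y') *\<^sub>R (r *\<^sub>R (F + (l * y) *\<^sub>R G)) - (r * y) *\<^sub>R (r' *\<^sub>R (F' + ((-l) * y') *\<^sub>R G))
       = (r * r') *\<^sub>R (y' *\<^sub>R F - y *\<^sub>R F' + (2 * l * (y * y')) *\<^sub>R G)" for r r' y y' :: real and F F' G :: "real ^ 'n"
      by (simp add: vec_eq_iff algebra_simps)
    have "drift A \<Phi> \<Psi> x = (exp (l * x $ k) * exp ((-l) * x $ k)) *\<^sub>R (\<psi>' x *\<^sub>R flux A \<psi> x - \<psi> x *\<^sub>R flux A \<psi>' x + (2 * l * (\<psi> x * \<psi>' x)) *\<^sub>R (A x *v e))"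
      unfolding drift_def \<Phi>_def \<Psi>_def \<psi>(5) \<psi>'(5) by (rule alg)
    also have "exp (l * x $ k) * exp ((-l) * x $ k) = 1" by (simp add: exp_add[symmetric])
    finally have "drift A \<Phi> \<Psi> x = \<psi>' x *\<^sub>R flux A \<psi> x - \<psi> x *\<^sub>R flux A \<psi>' x + (2 * l * (\<psi> x * \<psi>' x)) *\<^sub>R (A x *v e)"
      by simp
    hence "norm (drift A \<Phi> \<Psi> x) \<le> norm (\<psi>' x *\<^sub>R flux A \<psi> x) + norm (\<psi> x *\<^sub>R flux A \<psi>' x) + norm ((2 * l * (\<psi> x * \<psi>' x)) *\<^sub>R (A x *v e))"
      using norm_triangle_ineq[of "\<psi>' x *\<^sub>R flux A \<psi> x - \<psi> x *\<^sub>R flux A \<psi>' x" "(2 * l * (\<psi> x * \<psi>' x)) *\<^sub>R (A x *v e)"]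
        norm_triangle_ineq4[of "\<psi>' x *\<^sub>R flux A \<psi> x" "\<psi> x *\<^sub>R flux A \<psi>' x"] by (simp only:)
    also have "\<dots> \<le> b"
    proof -
      have "\<psi>' x * norm (flux A \<psi> x) \<le> s1' * (\<Lambda> * g)" "\<psi> x * norm (flux A \<psi>' x) \<le> s1 * (\<Lambda> * g')"
        using ub fb s1 s1' by (auto intro!: mult_mono)
      moreover have "2 * l * (\<psi> x * \<psi>' x) * norm (A x *v e) \<le> 2 * l * (s1 * s1') * \<Lambda>"
        using ub[of x] Ae[of x] s1 s1' l \<psi>(3)[of x] \<psi>'(3)[of x] by (intro mult_mono) auto
      moreover have "0 < 2 * l * (\<psi> x * \<psi>' x)" using \<psi>(3)[of x] \<psi>'(3)[of x] l by simp
      ultimately show ?thesis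
        unfolding b_def norm_scaleR abs_of_pos[OF \<psi>(3)] abs_of_pos[OF \<psi>'(3)] by (simp only: abs_of_pos add_mono)
    qed
    finally show ?thesis .
  qed
  define \<kappa> where "\<kappa> = l * c - \<mu> c l"
  have ws: "weak_sol A \<Phi> (\<lambda>x. (\<kappa> - q x) * \<Phi> x)" "weak_sol A \<Psi> (\<lambda>x. ((-l) * c - \<mu> c (-l) - q x) * \<Psi> x)"
    using \<psi>(4) \<psi>'(4) by (auto simp: \<Phi>_def \<Psi>_def \<kappa>_def)
  have m0: "0 < s0 * s0'" using s0 s0' by simp
  \<comment> \<open>This makes \<open>\<Psi>\<close> a supersolution for the rate
    \<open>\<kappa>\<close> that belongs to \<open>\<Phi>\<close>.\<close>
  have kk: "(-l) * c - \<mu> c (-l) \<le> \<kappa>" by (rule adjoint_eigenvalue_le[OF ws m0 mb(1) drb])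
  have le: "((-l) * c - \<mu> c (-l) - q x) * \<Psi> x \<le> (\<kappa> - q x) * \<Psi> x" for x
    using kk pos(2)[of x] by (intro mult_right_mono) auto
  have lx: "s0 * exp (- l * norm x) \<le> \<Phi> x" for x
  proof -
    have "l * - norm x \<le> l * x $ k"
      using component_le_norm_cart[of x k] l by (intro mult_left_mono) auto
    hence "exp (- l * norm x) \<le> exp (l * x $ k)" by simp
    thus ?thesis unfolding \<Phi>_def using s0 by (subst mult.commute, intro mult_mono) auto
  qed
  have Cm: "C1 (\<lambda>x. \<psi> x * \<psi>' x)" "grad (\<lambda>x. \<psi> x * \<psi>' x) x = \<psi> x *\<^sub>R grad \<psi>' x + \<psi>' x *\<^sub>R grad \<psi> x" for x
    by (rule C1_mult[OF \<psi>(1) \<psi>'(1)])+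
  define dY where "dY x = \<psi> x * \<psi>' x * dA 0 x + (A x *v x) \<bullet> grad (\<lambda>x. \<psi> x * \<psi>' x) x" for x
  have Y: "has_weak_divergence (\<lambda>x. (\<Phi> x * \<Psi> x) *\<^sub>R (A x *v x)) dY"
    unfolding m dY_def[abs_def] using weak_div_mult[OF dA(2)[of 0] Cm(1)] by simp
  define d2 where "d2 = s1 * s1' * d + \<Lambda> * (s1 * g' + s1' * g)"
  have Yb: "\<bar>dY x\<bar> \<le> d2 * (1 + norm x)" for x
  proof -
    have 1: "\<bar>\<psi> x * \<psi>' x * dA 0 x\<bar> \<le> (s1 * s1') * (d * (1 + norm x))"
      unfolding abs_mult using s1 s1' dA(3)[of 0 x] by (intro mult_mono) auto
    have "norm (grad (\<lambda>x. \<psi> x * \<psi>' x) x) \<le> norm (\<psi> x *\<^sub>R grad \<psi>' x) + norm (\<psi>' x *\<^sub>R grad \<psi> x)"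
      unfolding Cm(2) by (rule norm_triangle_ineq)
    also have "\<dots> \<le> s1 * g' + s1' * g"
      unfolding norm_scaleR using s1 s1' g g' by (intro add_mono mult_mono) auto
    finally have 2: "norm (grad (\<lambda>x. \<psi> x * \<psi>' x) x) \<le> s1 * g' + s1' * g" .
    have "\<bar>(A x *v x) \<bullet> grad (\<lambda>x. \<psi> x * \<psi>' x) x\<bar> \<le> norm (A x *v x) * norm (grad (\<lambda>x. \<psi> x * \<psi>' x) x)" by (rule Cauchy_Schwarz_ineq2)
    also have "\<dots> \<le> (\<Lambda> * norm x) * (s1 * g' + s1' * g)" using \<Lambda> 2 by (intro mult_mono) auto
    also have "\<dots> \<le> \<Lambda> * (s1 * g' + s1' * g) * (1 + norm x)"
    proof -
      have "0 \<le> \<Lambda> * (s1 * g' + s1' * g)" using \<Lambda>(1) s1(1) s1'(1) g(1) g'(1) by simp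
      thus ?thesis by (simp add: algebra_simps)
    qed
    finally have "\<bar>(A x *v x) \<bullet> grad (\<lambda>x. \<psi> x * \<psi>' x) x\<bar> \<le> \<Lambda> * (s1 * g' + s1' * g) * (1 + norm x)" .
    moreover have "d2 * (1 + norm x) = (s1 * s1') * (d * (1 + norm x)) + \<Lambda> * (s1 * g' + s1' * g) * (1 + norm x)"
      unfolding d2_def by (simp add: algebra_simps)
    ultimately show ?thesis using 1 unfolding dY_def by linarith
  qed
  have mPsi: "\<Psi> \<in> borel_measurable borel" using ws(2) by (intro borel_measurable_continuous_onI C1_continuous) (simp add: weak_sol_def)
  have M: "integrable lborel (\<lambda>x. \<Psi> x * \<bar>v\<^sub>0 x\<bar>)"
  proof (rule Bochner_Integration.integrable_bound)
    show "integrable lborel (\<lambda>x. s1' * exp (- l * \<xi>\<^sub>0) * (weight l \<xi>\<^sub>0 (x $ k) * v\<^sub>0 x))" using v0(1) by simp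
    show "(\<lambda>x. \<Psi> x * \<bar>v\<^sub>0 x\<bar>) \<in> borel_measurable lborel" using mPsi v0(2) by measurable
    show "AE x in lborel. norm (\<Psi> x * \<bar>v\<^sub>0 x\<bar>) \<le> norm (s1' * exp (- l * \<xi>\<^sub>0) * (weight l \<xi>\<^sub>0 (x $ k) * v\<^sub>0 x))"
    proof (rule AE_I2)
      fix x
      \<comment> \<open>For x_k \<le> \<xi>0 this is an equality; beyond \<xi>0 the exponential is
        below its value at \<xi>0, since l > 0.\<close>
      have w: "exp ((-l) * x $ k) \<le> exp (- l * \<xi>\<^sub>0) * weight l \<xi>\<^sub>0 (x $ k)" "0 < weight l \<xi>\<^sub>0 (x $ k)"
        using l by (auto simp: weight_def exp_add[symmetric] algebra_simps mult_left_mono)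
      have "\<Psi> x \<le> (exp (- l * \<xi>\<^sub>0) * weight l \<xi>\<^sub>0 (x $ k)) * s1'"
        unfolding \<Psi>_def using w ub(2)[of x] \<psi>'(3)[of x] by (intro mult_mono) auto
      hence "\<Psi> x * \<bar>v\<^sub>0 x\<bar> \<le> (exp (- l * \<xi>\<^sub>0) * weight l \<xi>\<^sub>0 (x $ k)) * s1' * \<bar>v\<^sub>0 x\<bar>" by (intro mult_right_mono) auto
      thus "norm (\<Psi> x * \<bar>v\<^sub>0 x\<bar>) \<le> norm (s1' * exp (- l * \<xi>\<^sub>0) * (weight l \<xi>\<^sub>0 (x $ k) * v\<^sub>0 x))"
        using pos(2)[of x] w(2) s1'(1) by (simp add: abs_mult mult_ac)
    qed
  qed
  define n where "n = real CARD('n) / 2"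
  define C0 where "C0 = 2 * (s1 * s1') / (s0 * s0')\<^sup>2 * (8 * n\<^sup>2 * (s1 * s1') / (\<alpha> * (s0 * s0'))) powr n"
  have C0: "0 \<le> C0" using s1 s1' by (simp add: C0_def)
  define M0 where "M0 = (LINT x|lborel. \<Psi> x * \<bar>v\<^sub>0 x\<bar>)"
  have M0: "0 \<le> M0" unfolding M0_def using pos(2) by (intro Bochner_Integration.integral_nonneg) (simp add: less_imp_le)
  show ?thesis
  proof (rule that[of "C0 * 2 powr n * M0 * s1"])
    show "0 \<le> C0 * 2 powr n * M0 * s1" using C0 M0 s1 by simp
    fix t x assume t: "t > (0 :: real)"
    have "\<bar>v t x\<bar> \<le> C0 * 2 powr n * M0 * t powr (- n) * exp (\<kappa> * t) * \<Phi> x"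
      unfolding M0_def
      by (rule decay_estimate[OF \<alpha> ws(1) pos(1) order_refl ws(2) pos(2) le m0 mb drb s0(1) lx Y Yb M v0(2) n_def C0_def t])
    also have "\<dots> \<le> C0 * 2 powr n * M0 * t powr (- n) * exp (\<kappa> * t) * (exp (l * x $ k) * s1)"
      unfolding \<Phi>_def using C0 M0 ub(1) by (intro mult_left_mono) auto
    also have "\<dots> = C0 * 2 powr n * M0 * s1 * t powr (- n) * (exp (\<kappa> * t) * exp (l * x $ k))" by simp
    \<comment> \<open>As \<kappa> = l c - \<mu>, the growth l c t is exactly what the moving
      coordinate x_k + c t absorbs.\<close>
    also have "exp (\<kappa> * t) * exp (l * x $ k) = exp (- \<mu> c l * t) * exp (l * (x $ k + c * t))"
      unfolding \<kappa>_def exp_add[symmetric] by (simp add: algebra_simps)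
    finally show "\<bar>v t x\<bar> \<le> C0 * 2 powr n * M0 * s1 * t powr (- (real CARD('n) / 2)) * exp (- \<mu> c l * t) * exp (l * (x $ k + c * t))"
      by (simp add: n_def)
  qed
qed

end

lemma (in periodic_medium) weak_sol_const: "weak_sol A (\<lambda>x. a) (\<lambda>x. 0)"
proof -
  have "has_weak_divergence (\<lambda>x. 0 :: real ^ 'n) (divergence (\<lambda>x. 0))" by (rule weak_div_C1) (simp add: C1_const)
  moreover have "divergence (\<lambda>x :: real ^ 'n. 0) = (\<lambda>x. 0)" by (simp add: divergence_def grad_const fun_eq_iff)
  moreover have "flux A (\<lambda>x. a) = (\<lambda>x. 0)" by (simp add: flux_def grad_const fun_eq_iff)
  ultimately show ?thesis by (simp add: weak_sol_def C1_const)
qed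

text \<open>Prepares the penalty term that moves with the front in
  \<open>growing_lower_bound\<close>; \<open>t0\<close> is the time at which the comparison
  starts.\<close>

lemma (in periodic_medium) plane_wave:
  assumes g: "\<And>s. (g has_real_derivative g' s) (at s)" "\<And>s. (g' has_real_derivative g'' s) (at s)" "continuous_on UNIV g''"
  shows "parabolic A (\<lambda>t x. g (x $ k + c * (t0 + t))) (\<lambda>t x. c * g' (x $ k + c * (t0 + t)))
    (\<lambda>t x. g' (x $ k + c * (t0 + t)) * divergence (\<lambda>y. A y *v axis k 1) x + (A x *v axis k 1) \<bullet> (g'' (x $ k + c * (t0 + t)) *\<^sub>R axis k 1))"
proof -
  have cg: "continuous_on UNIV g" "continuous_on UNIV g'" using g(1,2) DERIV_continuous_on by (metis has_field_derivative_at_within)+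
  have c2: "continuous_on ({0<..} \<times> UNIV) (\<lambda>p :: real \<times> (real ^ 'n). h (snd p $ k + c * (t0 + fst p)))" if "continuous_on UNIV h" for h :: "real \<Rightarrow> real"
    by (rule continuous_on_compose2[OF that]) (auto intro!: continuous_intros)
  have "C1 (\<lambda>x. (A x *v axis k 1) $ i)" for i
    unfolding matrix_vector_mult_def using C1_sum(1)[of UNIV "\<lambda>j x. A x $ i $ j * axis k 1 $ j"] C1_mult(1)[OF C1_entry C1_const] by auto
  from weak_div_C1[OF this] have wA: "has_weak_divergence (\<lambda>x. A x *v axis k 1) (divergence (\<lambda>y. A y *v axis k 1))" .
  have ws: "weak_sol A (\<lambda>x. g (x $ k + r)) (\<lambda>x. g' (x $ k + r) * divergence (\<lambda>y. A y *v axis k 1) x + (A x *v axis k 1) \<bullet> (g'' (x $ k + r) *\<^sub>R axis k 1))" for r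
  proof -
    have sh: "((\<lambda>s. h (s + r)) has_real_derivative h' (s + r)) (at s)" if "\<And>s. (h has_real_derivative h' s) (at s)" for h h' :: "real \<Rightarrow> real" and s
    proof -
      have "((\<lambda>s. s + r) has_real_derivative 1) (at s)" by (auto intro!: derivative_eq_intros)
      from DERIV_chain2[OF that this] show ?thesis by simp
    qed
    have cs: "continuous_on UNIV (\<lambda>s. h (s + r))" if "continuous_on UNIV h" for h :: "real \<Rightarrow> real"
      by (rule continuous_on_compose2[OF that]) (auto intro!: continuous_intros)
    note Cg = C1_compose[OF C1_nth[of k] sh[OF g(1)] cs[OF cg(2)]]
    note Cg' = C1_compose[OF C1_nth[of k] sh[OF g(2)] cs[OF g(3)]]
    have fl: "flux A (\<lambda>x. g (x $ k + r)) x = g' (x $ k + r) *\<^sub>R (A x *v axis k 1)" for x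
      unfolding flux_def Cg(2) grad_nth by (simp add: matrix_vector_mult_scaleR)
    have "has_weak_divergence (flux A (\<lambda>x. g (x $ k + r))) (\<lambda>x. g' (x $ k + r) * divergence (\<lambda>y. A y *v axis k 1) x + (A x *v axis k 1) \<bullet> (g'' (x $ k + r) *\<^sub>R axis k 1))"
      by (rule weak_div_cong[OF weak_div_mult[OF wA Cg'(1)]]) (simp_all add: fl Cg'(2) grad_nth)
    thus ?thesis using Cg(1) by (simp add: weak_sol_def)
  qed
  have dt: "((\<lambda>s. g (x $ k + c * (t0 + s))) has_real_derivative c * g' (x $ k + c * (t0 + t))) (at t)" for t x
  proof -
    have "((\<lambda>s. x $ k + c * (t0 + s)) has_real_derivative c) (at t)" by (auto intro!: derivative_eq_intros)
    from DERIV_chain2[OF g(1) this] show ?thesis by (simp add: mult.commute)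
  qed
  show ?thesis unfolding parabolic_def split_beta
  proof (intro conjI allI impI)
    show "weak_sol A (\<lambda>x. g (x $ k + c * (t0 + t))) (\<lambda>x. g' (x $ k + c * (t0 + t)) * divergence (\<lambda>y. A y *v axis k 1) x + (A x *v axis k 1) \<bullet> (g'' (x $ k + c * (t0 + t)) *\<^sub>R axis k 1))" for t
      by (rule ws)
    show "continuous_on ({0<..} \<times> UNIV) (\<lambda>p. g (snd p $ k + c * (t0 + fst p)))" by (rule c2[OF cg(1)])
    show "continuous_on ({0<..} \<times> UNIV) (\<lambda>p. c * g' (snd p $ k + c * (t0 + fst p)))" by (intro continuous_intros c2[OF cg(2)])
  qed (rule dt)
qed

section \<open>Smallness far out, and positivity of the solution\<close>

context kpp_cauchy
begin

text \<open>Here \<open>\<Phi> x = 1 + \<bar>x - x0\<bar>\<^sup>2\<close> and \<open>\<Psi> = 1 / \<Phi>\<close>, with constants independent of \<open>x0\<close>. Since \<open>\<Phi> x0 = 1\<close>, this bounds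
  \<open>v T x0\<close> by the integral of \<open>\<bar>v\<^sub>0 x\<bar> / (1 + \<bar>x - x0\<bar>\<^sup>2)\<close>, which tends to \<open>0\<close> as \<open>x0\<close> goes to infinity.\<close>

lemma decay_far:
  assumes v0: "integrable lborel v\<^sub>0" and T: "T > 0" and \<epsilon>: "\<epsilon> > 0"
  obtains \<rho> where "\<And>x. norm x \<ge> \<rho> \<Longrightarrow> \<bar>v T x\<bar> \<le> \<epsilon>"
proof -
  obtain \<alpha> where \<alpha>: "\<alpha> > 0" "\<And>x y. \<alpha> * (norm y)\<^sup>2 \<le> (A x *v y) \<bullet> y" using ellipticity by blast
  obtain \<Lambda> where \<Lambda>: "\<Lambda> > 0" "\<And>x y. norm (A x *v y) \<le> \<Lambda> * norm y" using A_bound by blast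
  obtain Q where Q: "Q \<ge> 0" "\<And>x. \<bar>q x\<bar> \<le> Q" using q_bound by blast
  obtain d dA where dA: "d > 0" "\<And>x0. has_weak_divergence (\<lambda>x. A x *v (x - x0)) (dA x0)" "\<And>x0 x. \<bar>dA x0 x\<bar> \<le> d * (1 + norm (x - x0))"
    using radial_field_ex by blast
  define \<Phi> where "\<Phi> = (\<lambda>x0 x :: real ^ 'n. 1 + (x - x0) \<bullet> (x - x0))"
  define \<Psi> where "\<Psi> = (\<lambda>x0 x. inverse (\<Phi> x0 x))"
  \<comment> \<open>The summand 4 d serves both functions, 8 \<Lambda> pays for the second
    derivatives of \<open>\<Psi>\<close>, and \<open>Q\<close> compensates for
    \<open>q\<close>.\<close>
  define \<kappa> where "\<kappa> = 4 * d + 8 * \<Lambda> + Q"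
  define n where "n = real CARD('n) / 2"
  define C0 where "C0 = 2 * 1 / 1\<^sup>2 * (8 * n\<^sup>2 * 1 / (\<alpha> * 1)) powr n"
  have mv: "v\<^sub>0 \<in> borel_measurable borel" using v0 by (simp add: integrable_iff_bounded)
  have Y2: "(x - x0) \<bullet> (x - x0) = (norm (x - x0))\<^sup>2" for x x0 :: "real ^ 'n" by (simp add: power2_norm_eq_inner)
  have \<Phi>1: "\<Phi> x0 x = 1 + (norm (x - x0))\<^sup>2" for x0 x by (simp add: \<Phi>_def Y2)
  have \<Phi>p: "\<Phi> x0 x > 0" "\<Phi> x0 x \<ge> 1" "\<Phi> x0 x \<noteq> 0" for x0 x
    using zero_le_power2[of "norm (x - x0)"] unfolding \<Phi>1 by linarith+
  have Ip: "0 < \<Psi> x0 x" "\<Psi> x0 x \<le> 1" "\<Phi> x0 x * \<Psi> x0 x = 1" for x0 x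
    using \<Phi>p[of x0 x] by (auto simp: \<Psi>_def intro: le_imp_inverse_le[of 1, simplified])
  have Yb: "1 + Y \<le> 2 * (1 + Y\<^sup>2)" "Y \<le> 1 + Y\<^sup>2" for Y :: real
  proof -
    have "(Y - 1 / 2)\<^sup>2 = Y\<^sup>2 - Y + 1 / 4" by (simp add: power2_eq_square algebra_simps)
    hence "Y \<le> Y\<^sup>2 + 1 / 4" using zero_le_power2[of "Y - 1 / 2"] by linarith
    have "(Y - 1 / 4)\<^sup>2 = Y\<^sup>2 - Y / 2 + 1 / 16" by (simp add: power2_eq_square algebra_simps)
    thus "1 + Y \<le> 2 * (1 + Y\<^sup>2)" using zero_le_power2[of "Y - 1 / 4"] unfolding distrib_left by linarith
    show "Y \<le> 1 + Y\<^sup>2" using \<open>Y \<le> Y\<^sup>2 + 1 / 4\<close> by linarith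
  qed
  have IY: "\<Psi> x0 x * (1 + norm (x - x0)) \<le> 2" "\<Psi> x0 x * norm (x - x0) \<le> 1" "\<Psi> x0 x * (norm (x - x0))\<^sup>2 \<le> 1" for x0 x
  proof -
    have "\<Psi> x0 x * (1 + norm (x - x0)) \<le> \<Psi> x0 x * (2 * \<Phi> x0 x)" unfolding \<Phi>1 using Ip(1)[of x0 x] Yb by (intro mult_left_mono) auto
    thus "\<Psi> x0 x * (1 + norm (x - x0)) \<le> 2" using Ip(3)[of x0 x] by (simp add: mult_ac)
    have "\<Psi> x0 x * norm (x - x0) \<le> \<Psi> x0 x * \<Phi> x0 x" unfolding \<Phi>1 using Ip(1)[of x0 x] Yb by (intro mult_left_mono) auto
    thus "\<Psi> x0 x * norm (x - x0) \<le> 1" using Ip(3)[of x0 x] by (simp add: mult_ac)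
    have "\<Psi> x0 x * (norm (x - x0))\<^sup>2 \<le> \<Psi> x0 x * \<Phi> x0 x" unfolding \<Phi>1 using Ip(1)[of x0 x] by (intro mult_left_mono) auto
    thus "\<Psi> x0 x * (norm (x - x0))\<^sup>2 \<le> 1" using Ip(3)[of x0 x] by (simp add: mult_ac)
  qed
  have C\<Phi>: "C1 (\<Phi> x0)" "grad (\<Phi> x0) x = 2 *\<^sub>R (x - x0)" for x0 x
    unfolding \<Phi>_def using C1_add[OF C1_const C1_sqnorm[of x0], of 1] by (auto simp: grad_const grad_sqnorm)
  have C\<Psi>: "C1 (\<Psi> x0)" "grad (\<Psi> x0) x = - ((\<Psi> x0 x)\<^sup>2 *\<^sub>R (2 *\<^sub>R (x - x0)))" for x0 x
    unfolding \<Psi>_def using C1_inverse[OF C\<Phi>(1) \<Phi>p(3), of x0] by (auto simp: C\<Phi>(2))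
  have f\<Phi>: "flux A (\<Phi> x0) x = 2 *\<^sub>R (A x *v (x - x0))" for x0 x
    unfolding flux_def C\<Phi>(2) by (simp add: matrix_vector_mult_scaleR)
  have f\<Psi>: "flux A (\<Psi> x0) x = (-2 * (\<Psi> x0 x * \<Psi> x0 x)) *\<^sub>R (A x *v (x - x0))" for x0 x
  proof -
    have "grad (\<Psi> x0) x = (-2 * (\<Psi> x0 x * \<Psi> x0 x)) *\<^sub>R (x - x0)" unfolding C\<Psi>(2) by (simp add: power2_eq_square)
    thus ?thesis unfolding flux_def by (simp only: matrix_vector_mult_scaleR)
  qed
  have w\<Phi>: "weak_sol A (\<Phi> x0) (\<lambda>x. 2 * dA x0 x)" for x0
    unfolding weak_sol_def using C\<Phi>(1) weak_div_cong[OF weak_div_cmult[OF dA(2)[of x0], of 2], of "flux A (\<Phi> x0)"] f\<Phi> by simp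
  define h where "h = (\<lambda>x0 x. -2 * (\<Psi> x0 x * \<Psi> x0 x))"
  have Ch: "C1 (h x0)" for x0 unfolding h_def by (intro C1_cmult C1_mult C\<Psi>)
  have gh: "grad (h x0) x = (8 * (\<Psi> x0 x * \<Psi> x0 x * \<Psi> x0 x)) *\<^sub>R (x - x0)" for x0 x
    unfolding h_def C1_cmult(2)[OF C1_mult(1)[OF C\<Psi>(1) C\<Psi>(1)]] C1_mult(2)[OF C\<Psi>(1) C\<Psi>(1)] C\<Psi>(2)
    by (simp add: vec_eq_iff power2_eq_square algebra_simps)
  define D\<Psi> where "D\<Psi> = (\<lambda>x0 x. h x0 x * dA x0 x + (A x *v (x - x0)) \<bullet> grad (h x0) x)"
  have w\<Psi>: "weak_sol A (\<Psi> x0) (D\<Psi> x0)" for x0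
    unfolding weak_sol_def D\<Psi>_def using C\<Psi>(1) weak_div_cong[OF weak_div_mult[OF dA(2)[of x0] Ch[of x0]], of "flux A (\<Psi> x0)"] f\<Psi> by (simp add: h_def)
  have le\<Phi>: "2 * dA x0 x \<le> (\<kappa> - q x) * \<Phi> x0 x" for x0 x
  proof -
    have "2 * dA x0 x \<le> 2 * (d * (1 + norm (x - x0)))" using dA(3)[of x0 x] by linarith
    also have "\<dots> \<le> 2 * (d * (2 * \<Phi> x0 x))" unfolding \<Phi>1 using Yb(1)[of "norm (x - x0)"] dA(1) by (intro mult_left_mono) auto
    also have "\<dots> = (4 * d) * \<Phi> x0 x" by simp
    also have "\<dots> \<le> (\<kappa> - q x) * \<Phi> x0 x"
      using \<Phi>p(1)[of x0 x] Q(2)[of x] \<Lambda>(1) unfolding \<kappa>_def by (intro mult_right_mono) auto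
    finally show ?thesis .
  qed
  have le\<Psi>: "D\<Psi> x0 x \<le> (\<kappa> - q x) * \<Psi> x0 x" for x0 x
  proof -
    define i Y where "i = \<Psi> x0 x" and "Y = norm (x - x0)"
    have i: "0 < i" "i * (1 + Y) \<le> 2" "i * Y\<^sup>2 \<le> 1" "i \<le> 1" using Ip[of x0 x] IY[of x0 x] by (auto simp: i_def Y_def)
    have AY: "(A x *v (x - x0)) \<bullet> (x - x0) \<le> \<Lambda> * Y\<^sup>2"
    proof -
      have "(A x *v (x - x0)) \<bullet> (x - x0) \<le> norm (A x *v (x - x0)) * Y" unfolding Y_def by (rule norm_cauchy_schwarz)
      also have "\<dots> \<le> \<Lambda> * Y * Y" unfolding Y_def using \<Lambda> by (intro mult_right_mono) auto
      finally show ?thesis by (simp add: power2_eq_square mult.assoc)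
    qed
    have "D\<Psi> x0 x = i * (2 * i * (- dA x0 x) + 8 * i * (i * ((A x *v (x - x0)) \<bullet> (x - x0))))"
      unfolding D\<Psi>_def gh unfolding h_def i_def[symmetric] inner_scaleR_right distrib_left by (simp add: mult_ac)
    also have "\<dots> \<le> i * (4 * d + 8 * \<Lambda>)"
    proof (rule mult_left_mono[OF add_mono less_imp_le[OF i(1)]])
      have "2 * i * (- dA x0 x) \<le> 2 * i * (d * (1 + Y))" using dA(3)[of x0 x] i(1) unfolding Y_def by (intro mult_left_mono) linarith+
      also have "\<dots> = 2 * d * (i * (1 + Y))" by simp
      also have "\<dots> \<le> 2 * d * 2" using i dA(1) by (intro mult_left_mono) auto
      finally show "2 * i * (- dA x0 x) \<le> 4 * d" by simp
      have "8 * i * (i * ((A x *v (x - x0)) \<bullet> (x - x0))) \<le> 8 * i * (i * (\<Lambda> * Y\<^sup>2))" using AY i(1) by (intro mult_left_mono) auto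
      also have "\<dots> = 8 * \<Lambda> * (i * (i * Y\<^sup>2))" by simp
      also have "\<dots> \<le> 8 * \<Lambda> * (1 * 1)" using i \<Lambda>(1) by (intro mult_left_mono mult_mono) auto
      finally show "8 * i * (i * ((A x *v (x - x0)) \<bullet> (x - x0))) \<le> 8 * \<Lambda>" by simp
    qed
    also have "\<dots> \<le> i * (\<kappa> - q x)" using i(1) Q(2)[of x] unfolding \<kappa>_def by (intro mult_left_mono) auto
    finally show ?thesis by (simp add: i_def mult.commute)
  qed
  have dr: "norm (drift A (\<Phi> x0) (\<Psi> x0) x) \<le> 4 * \<Lambda>" for x0 x
  proof -
    have "drift A (\<Phi> x0) (\<Psi> x0) x = (2 * \<Psi> x0 x + 2 * (\<Phi> x0 x * \<Psi> x0 x) * \<Psi> x0 x) *\<^sub>R (A x *v (x - x0))"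
      unfolding drift_def f\<Phi> f\<Psi> by (simp add: vec_eq_iff algebra_simps)
    hence "drift A (\<Phi> x0) (\<Psi> x0) x = (4 * \<Psi> x0 x) *\<^sub>R (A x *v (x - x0))" unfolding Ip(3) by simp
    hence "norm (drift A (\<Phi> x0) (\<Psi> x0) x) = 4 * \<Psi> x0 x * norm (A x *v (x - x0))" using Ip(1)[of x0 x] by simp
    also have "\<dots> \<le> 4 * \<Psi> x0 x * (\<Lambda> * norm (x - x0))" using Ip(1)[of x0 x] \<Lambda>(2) by (intro mult_left_mono) auto
    also have "\<dots> = 4 * \<Lambda> * (\<Psi> x0 x * norm (x - x0))" by simp
    also have "\<dots> \<le> 4 * \<Lambda> * 1" using IY(2) \<Lambda>(1) by (intro mult_left_mono) auto
    finally show ?thesis by simp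
  qed
  have m\<Psi>[measurable]: "\<Psi> x0 \<in> borel_measurable borel" for x0 by (intro borel_measurable_continuous_onI C1_continuous C\<Psi>)
  have M: "integrable lborel (\<lambda>x. \<Psi> x0 x * \<bar>v\<^sub>0 x\<bar>)" for x0
  proof (rule Bochner_Integration.integrable_bound[OF v0])
    show "(\<lambda>x. \<Psi> x0 x * \<bar>v\<^sub>0 x\<bar>) \<in> borel_measurable lborel" using mv by measurable
    show "AE x in lborel. norm (\<Psi> x0 x * \<bar>v\<^sub>0 x\<bar>) \<le> norm (v\<^sub>0 x)"
      using Ip less_imp_le[OF Ip(1)] by (intro AE_I2) (auto simp: abs_mult intro!: mult_left_le_one_le)
  qed
  have Y: "has_weak_divergence (\<lambda>x. (\<Phi> x0 x * \<Psi> x0 x) *\<^sub>R (A x *v x)) (dA 0)" "\<bar>dA 0 x\<bar> \<le> d * (1 + norm x)" for x0 x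
    using dA(2)[of 0] dA(3)[of 0 x] by (auto simp: Ip(3))
  have key: "\<bar>v T x0\<bar> \<le> C0 * 2 powr n * (LINT x|lborel. \<Psi> x0 x * \<bar>v\<^sub>0 x\<bar>) * T powr (- n) * exp (\<kappa> * T)" for x0
  proof -
    have "\<bar>v T x0\<bar> \<le> C0 * 2 powr n * (LINT x|lborel. \<Psi> x0 x * \<bar>v\<^sub>0 x\<bar>) * T powr (- n) * exp (\<kappa> * T) * \<Phi> x0 x0"
    proof (rule decay_estimate[OF \<alpha> w\<Phi> \<Phi>p(1) le\<Phi> w\<Psi> Ip(1) le\<Psi> _ _ _ dr _ _ Y M mv n_def C0_def T])
      show "1 * exp (- 0 * norm x) \<le> \<Phi> x0 x" for x using \<Phi>p(2)[of x0 x] by simp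
    qed (auto simp: Ip(3))
    thus ?thesis by (simp add: \<Phi>_def)
  qed
  define B where "B = C0 * 2 powr n * T powr (- n) * exp (\<kappa> * T)"
  have key': "\<bar>v T x0\<bar> \<le> B * (LINT x|lborel. \<Psi> x0 x * \<bar>v\<^sub>0 x\<bar>)" for x0 using key[of x0] by (simp add: B_def mult_ac)
  have "\<exists>\<rho>. \<forall>x. norm x \<ge> \<rho> \<longrightarrow> \<bar>v T x\<bar> \<le> \<epsilon>"
  proof (rule ccontr)
    assume "\<not> ?thesis"
    hence "\<forall>j :: nat. \<exists>x. norm x \<ge> real j \<and> \<epsilon> < \<bar>v T x\<bar>" by (metis not_le)
    then obtain X where X: "\<And>j :: nat. norm (X j) \<ge> real j" "\<And>j. \<epsilon> < \<bar>v T (X j)\<bar>" by metis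
    have "(\<lambda>j. LINT x|lborel. \<Psi> (X j) x * \<bar>v\<^sub>0 x\<bar>) \<longlonglongrightarrow> (LINT x|(lborel :: (real ^ 'n) measure). 0)"
    proof (rule integral_dominated_convergence[where w = "\<lambda>x. \<bar>v\<^sub>0 x\<bar>"])
      show "(\<lambda>x. \<Psi> (X j) x * \<bar>v\<^sub>0 x\<bar>) \<in> borel_measurable lborel" for j using mv by measurable
      show "integrable lborel (\<lambda>x. \<bar>v\<^sub>0 x\<bar>)" using v0 by simp
      show "AE x in lborel. norm (\<Psi> (X j) x * \<bar>v\<^sub>0 x\<bar>) \<le> \<bar>v\<^sub>0 x\<bar>" for j
        using Ip less_imp_le[OF Ip(1)] by (intro AE_I2) (auto simp: abs_mult intro!: mult_left_le_one_le)
      show "AE x in lborel. (\<lambda>j. \<Psi> (X j) x * \<bar>v\<^sub>0 x\<bar>) \<longlonglongrightarrow> 0"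
      proof (rule AE_I2)
        fix x
        have "filterlim (\<lambda>j. \<Phi> (X j) x) at_top sequentially"
        proof (rule filterlim_at_top_mono)
          show "filterlim (\<lambda>j. real j - norm x) at_top sequentially" by real_asymp
          show "\<forall>\<^sub>F j in sequentially. real j - norm x \<le> \<Phi> (X j) x"
          proof (intro always_eventually allI)
            fix j
            have "norm (X j) \<le> norm x + norm (x - X j)" by (metis norm_minus_commute norm_triangle_sub)
            thus "real j - norm x \<le> \<Phi> (X j) x" using X(1)[of j] Yb(2)[of "norm (x - X j)"] unfolding \<Phi>1 by linarith
          qed
        qed
        hence "(\<lambda>j. \<Psi> (X j) x) \<longlonglongrightarrow> 0" unfolding \<Psi>_def by (rule tendsto_inverse_0_at_top)
        thus "(\<lambda>j. \<Psi> (X j) x * \<bar>v\<^sub>0 x\<bar>) \<longlonglongrightarrow> 0" by (rule tendsto_mult_left_zero)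
      qed
    qed simp
    hence "(\<lambda>j. LINT x|lborel. \<Psi> (X j) x * \<bar>v\<^sub>0 x\<bar>) \<longlonglongrightarrow> 0" by simp
    from tendsto_mult_right_zero[OF this, of B]
    have "\<epsilon> \<le> 0"
      by (rule LIMSEQ_le_const) (use key' X(2) in \<open>meson less_le_trans less_imp_le\<close>)
    thus False using \<epsilon> by simp
  qed
  thus ?thesis using that by blast
qed

text \<open>Otherwise u0 vanishes almost everywhere and |u0 - w| \<ge> p0 / 2 almost everywhere on a
  half space x_k \<ge> K. Balls of every radius fit into it, against integrability.\<close>

lemma positive_continuity_point:
  assumes v0: "integrable lborel v\<^sub>0"
  obtains x0 where "isCont u\<^sub>0 x0" "u\<^sub>0 x0 > 0"
proof -
  obtain p0 p1 where p01: "p0 > 0" "\<And>x. p0 \<le> p x" "\<And>x. p x \<le> p1" using p_bounds by blast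
  have "uniform_limit UNIV (\<lambda>\<xi> x. w x \<xi>) p at_top" using w by (simp add: traveling_wavefront_def)
  hence "\<forall>\<^sub>F \<xi> in at_top. \<forall>x\<in>UNIV. dist (w x \<xi>) (p x) < p0 / 2" using p01(1) by (intro uniform_limitD) auto
  then obtain K where K: "\<And>\<xi> x. \<xi> \<ge> K \<Longrightarrow> dist (w x \<xi>) (p x) < p0 / 2" unfolding eventually_at_top_linorder by (metis UNIV_I)
  have "\<exists>x0. isCont u\<^sub>0 x0 \<and> u\<^sub>0 x0 > 0"
  proof (rule ccontr)
    assume "\<not> ?thesis"
    hence z: "u\<^sub>0 x = 0" if "isCont u\<^sub>0 x" for x using u0(1)[of x] that by force
    have "AE x in lborel. x \<notin> {x. \<not> isCont u\<^sub>0 x}" by (rule AE_not_in[OF finite_imp_null_set_lborel[OF disc]])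
    hence ae: "AE x in lborel. x $ k \<ge> K \<longrightarrow> p0 / 2 \<le> \<bar>v\<^sub>0 x\<bar>"
    proof eventually_elim
      case (elim x)
      hence "v\<^sub>0 x = - w x (x $ k)" using z by (simp add: v\<^sub>0_def W_def)
      show ?case
      proof
        assume "x $ k \<ge> K"
        from K[OF this, of x] have "\<bar>w x (x $ k) - p x\<bar> < p0 / 2" by (simp add: dist_real_def)
        thus "p0 / 2 \<le> \<bar>v\<^sub>0 x\<bar>" using p01(2)[of x] \<open>v\<^sub>0 x = - w x (x $ k)\<close> by linarith
      qed
    qed
    define I where "I = (LINT x|lborel. \<bar>v\<^sub>0 x\<bar>)"
    define V where "V = unit_ball_vol (real DIM(real ^ 'n))"
    have V: "V > 0" by (simp add: V_def)
    have le: "p0 / 2 * (V * R ^ DIM(real ^ 'n)) \<le> I" if R: "R \<ge> 0" for R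
    proof -
      define y :: "real ^ 'n" where "y = axis k (K + R)"
      have "(LINT x|lborel. p0 / 2 * indicator (cball y R) x) \<le> I" unfolding I_def
      proof (rule integral_mono_AE)
        show "integrable lborel (\<lambda>x. p0 / 2 * indicator (cball y R) x)"
          using emeasure_lborel_cball_finite[of y R] by (intro integrable_mult_right integrable_real_indicator) auto
        show "AE x in lborel. p0 / 2 * indicator (cball y R) x \<le> \<bar>v\<^sub>0 x\<bar>"
          using ae
        proof eventually_elim
          case (elim x)
          have "x $ k \<ge> K" if "x \<in> cball y R"
          proof -
            have "\<bar>(y - x) $ k\<bar> \<le> R" using component_le_norm_cart[of "y - x" k] that by (simp add: dist_norm)
            thus ?thesis by (simp add: y_def)
          qed
          thus ?case using elim by (auto simp: indicator_def)
        qed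
      qed (use v0 in simp)
      thus ?thesis using content_cball[OF R, of y] by (simp add: V_def)
    qed
    define R where "R = 1 + \<bar>I\<bar> / (p0 / 2 * V)"
    have pV: "p0 / 2 * V > 0" using p01 V by simp
    have R: "R \<ge> 1" using pV by (simp add: R_def)
    have "R ^ 1 \<le> R ^ DIM(real ^ 'n)" by (rule power_increasing[OF _ R]) (simp add: Suc_leI)
    hence "p0 / 2 * V * R \<le> p0 / 2 * V * R ^ DIM(real ^ 'n)" using pV by (intro mult_left_mono) auto
    also have "\<dots> \<le> I" using le[of R] R by (simp add: mult.assoc)
    also have "p0 / 2 * V * R = p0 / 2 * V + \<bar>I\<bar>" unfolding R_def using pV p01 V by (simp add: field_simps)
    finally show False using pV by linarith
  qed
  thus ?thesis using that by blast
qed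

text \<open>The barrier is \<open>\<delta> (\<Gamma> - c0)\<close> with a Gaussian \<open>\<Gamma>\<close> of initial width \<open>a\<close> around \<open>x0\<close>; \<open>c0\<close> bounds \<open>\<Gamma>\<close> initially
  outside the ball where \<open>u\<^sub>0\<close> is positive, and is below \<open>\<Gamma> T x\<close> if \<open>a\<close> is small.\<close>

lemma u_positive:
  assumes x0: "isCont u\<^sub>0 x0" "u\<^sub>0 x0 > 0" and T: "T > 0"
  shows "u T x > 0"
proof -
  obtain \<alpha> where \<alpha>: "\<alpha> > 0" "\<And>x y. \<alpha> * (norm y)\<^sup>2 \<le> (A x *v y) \<bullet> y" using ellipticity by blast
  obtain Q where Q: "Q \<ge> 0" "\<And>x. \<bar>q x\<bar> \<le> Q" using q_bound by blast
  obtain p0 p1 where p01: "p0 > 0" "\<And>x. p0 \<le> p x" "\<And>x. p x \<le> p1" using p_bounds by blast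
  obtain K where K: "K \<ge> 0" "\<And>s x. \<bar>s\<bar> \<le> p1 \<Longrightarrow> \<bar>f_u f x s\<bar> \<le> K" using f_u_bounded[OF f Q(2)] by blast
  obtain d dA where dA: "d > 0" "\<And>x0. has_weak_divergence (\<lambda>x. A x *v (x - x0)) (dA x0)" "\<And>x0 x. \<bar>dA x0 x\<bar> \<le> d * (1 + norm (x - x0))"
    using radial_field_ex by blast
  \<comment> \<open>Dictated by the inequality \<open>sub\<close>. As 2 g \<alpha> = 1, the
    diffusion yields at least 2 g (Y / s)^2: one half pays for the time derivative, the other, by
    completing a square, for the part of \<open>dA\<close> linear in Y. The constant part of
    \<open>dA\<close> is taken by \<open>\<kappa>\<close>; \<open>K3\<close> takes the remainder g
    d^2 of the square and the reaction bound K.\<close>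
  define g \<kappa> K3 where "g = 1 / (2 * \<alpha>)" and "\<kappa> = 2 * g * d" and "K3 = g * d\<^sup>2 + K"
  have g: "g > 0" "2 * (g * \<alpha>) = 1" using \<alpha> by (auto simp: g_def)
  have \<kappa>p: "\<kappa> > 0" using g dA by (simp add: \<kappa>_def)
  have \<kappa>0: "\<kappa> \<ge> 0" using \<kappa>p by simp
  define r where "r y = (y - x0) \<bullet> (y - x0)" for y
  have r: "r y = (norm (y - x0))\<^sup>2" for y by (simp add: r_def power2_norm_eq_inner)
  have "u\<^sub>0 x0 / 2 > 0" using x0 by simp
  from x0(1)[unfolded continuous_at_eps_delta, rule_format, OF this]
  obtain s0 where s0: "s0 > 0" "\<And>y. dist y x0 < s0 \<Longrightarrow> dist (u\<^sub>0 y) (u\<^sub>0 x0) < u\<^sub>0 x0 / 2" by blast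
  \<comment> \<open>A lower bound for \<open>\<Gamma> T x\<close> valid for every width a in (0, 1];
    it is fixed before a is chosen.\<close>
  define \<beta>1 where "\<beta>1 = exp (- K3 * T - \<kappa> * ln (T + 1) - g / T * r x)"
  have Gs: "g * s0\<^sup>2 > 0" using g s0 by simp
  have lim: "((\<lambda>a. exp (- \<kappa> * ln a - G / a)) \<longlongrightarrow> 0) (at_right 0)" if "G > 0" for G :: real
    using that \<kappa>p by real_asymp
  have "((\<lambda>a. exp (- \<kappa> * ln a - g * s0\<^sup>2 / a)) \<longlongrightarrow> 0) (at_right 0)" by (rule lim[OF Gs])
  hence "\<forall>\<^sub>F a in at_right 0. exp (- \<kappa> * ln a - g * s0\<^sup>2 / a) < \<beta>1" by (rule order_tendstoD) (simp add: \<beta>1_def)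
  then obtain a1 where a1: "a1 > 0" "\<And>a. 0 < a \<Longrightarrow> a < a1 \<Longrightarrow> exp (- \<kappa> * ln a - g * s0\<^sup>2 / a) < \<beta>1"
    unfolding eventually_at_right_field by auto
  define a where "a = min 1 (a1 / 2)"
  have a: "0 < a" "a \<le> 1" "exp (- \<kappa> * ln a - g * s0\<^sup>2 / a) < \<beta>1" using a1 by (auto simp: a_def)
  define c0 where "c0 = exp (- \<kappa> * ln a - g * s0\<^sup>2 / a)"
  \<comment> \<open>At time 0 the Gaussian is at most exp(-\<kappa> ln a), so
    \<open>\<delta>\<close> times it stays below u0(x0) / 2, hence below u0 near x0.\<close>
  define \<delta> where "\<delta> = u\<^sub>0 x0 / 2 * exp (\<kappa> * ln a)"
  have \<delta>: "\<delta> > 0" using x0 by (simp add: \<delta>_def)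
  define \<Gamma> where "\<Gamma> = (\<lambda>t y. exp (- K3 * t - \<kappa> * ln (t + a) - g / (t + a) * r y))"
  define \<Gamma>' where "\<Gamma>' = (\<lambda>t y. \<Gamma> t y * (- K3 - \<kappa> / (t + a) + g / (t + a)\<^sup>2 * r y))"
  define h where "h = (\<lambda>t y. - (2 * g / (t + a)) * \<Gamma> t y)"
  define D\<Gamma> where "D\<Gamma> = (\<lambda>t y. h t y * dA x0 y + (A y *v (y - x0)) \<bullet> grad (h t) y)"
  have C\<Gamma>: "C1 (\<Gamma> t)" "grad (\<Gamma> t) y = (- (2 * g / (t + a)) * \<Gamma> t y) *\<^sub>R (y - x0)" for t y
  proof -
    have d: "((\<lambda>s. exp (- K3 * t - \<kappa> * ln (t + a) - g / (t + a) * s)) has_real_derivative exp (- K3 * t - \<kappa> * ln (t + a) - g / (t + a) * s) * - (g / (t + a))) (at s)" for s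
    proof -
      have "((\<lambda>s. B - G * s) has_real_derivative - G) (at s)" for B G :: real by (auto intro!: derivative_eq_intros)
      from DERIV_chain2[OF DERIV_exp this] show ?thesis .
    qed
    have cc: "continuous_on UNIV (\<lambda>s. exp (- K3 * t - \<kappa> * ln (t + a) - g / (t + a) * s) * - (g / (t + a)))" by (intro continuous_intros)
    note * = C1_compose[OF C1_sqnorm[of x0] d cc]
    show "C1 (\<Gamma> t)" unfolding \<Gamma>_def r_def by (rule *(1))
    show "grad (\<Gamma> t) y = (- (2 * g / (t + a)) * \<Gamma> t y) *\<^sub>R (y - x0)" unfolding \<Gamma>_def r_def *(2) grad_sqnorm by simp
  qed
  have Ch: "C1 (h t)" "grad (h t) y = ((2 * g / (t + a))\<^sup>2 * \<Gamma> t y) *\<^sub>R (y - x0)" for t y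
    unfolding h_def using C1_cmult[OF C\<Gamma>(1), of "- (2 * g / (t + a))" t] by (auto simp: C\<Gamma>(2) power2_eq_square)
  have w\<Gamma>: "weak_sol A (\<Gamma> t) (D\<Gamma> t)" for t
  proof -
    have "flux A (\<Gamma> t) y = h t y *\<^sub>R (A y *v (y - x0))" for y unfolding flux_def C\<Gamma>(2) h_def by (simp only: matrix_vector_mult_scaleR)
    thus ?thesis unfolding weak_sol_def D\<Gamma>_def using C\<Gamma>(1) weak_div_cong[OF weak_div_mult[OF dA(2)[of x0] Ch(1)[of t]], of "flux A (\<Gamma> t)"] by simp
  qed
  have P\<Gamma>: "parabolic A \<Gamma> \<Gamma>' D\<Gamma>"
    unfolding parabolic_def split_beta
  proof (intro conjI allI impI)
    fix t :: real and y assume t: "t > 0"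
    have ta: "t + a > 0" using t a by simp
    have "((\<lambda>s. - K3 * s - \<kappa> * ln (s + a) - g / (s + a) * r y) has_real_derivative (- K3 - \<kappa> / (t + a) + g / (t + a)\<^sup>2 * r y)) (at t)"
      using ta by (auto intro!: derivative_eq_intros simp: power2_eq_square)
    from DERIV_chain2[OF DERIV_exp this] show "((\<lambda>s. \<Gamma> s y) has_real_derivative \<Gamma>' t y) (at t)" unfolding \<Gamma>_def \<Gamma>'_def .
  next
    have ne: "t + a \<noteq> 0" "t + a > 0" if "t > 0" for t using that a by auto
    show "continuous_on ({0<..} \<times> UNIV) (\<lambda>p. \<Gamma> (fst p) (snd p))" unfolding \<Gamma>_def r_def by (intro continuous_intros) (auto dest: ne)
    thus "continuous_on ({0<..} \<times> UNIV) (\<lambda>p. \<Gamma>' (fst p) (snd p))" unfolding \<Gamma>'_def r_def by (intro continuous_intros) (auto dest: ne)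
  qed (rule w\<Gamma>)
  have sub: "\<Gamma>' t y \<le> D\<Gamma> t y - K * \<Gamma> t y" if t: "t > 0" for t y
  proof -
    define s Y where "s = t + a" and "Y = norm (y - x0)"
    have s: "s > 0" using t a by (simp add: s_def)
    have Gp: "\<Gamma> t y > 0" by (simp add: \<Gamma>_def)
    have ab: "\<alpha> * Y\<^sup>2 \<le> (A y *v (y - x0)) \<bullet> (y - x0)" unfolding Y_def by (rule \<alpha>(2))
    have da: "dA x0 y \<le> d * (1 + Y)" using dA(3)[of x0 y] unfolding Y_def by linarith
    have 1: "(2 * g / s) * dA x0 y \<le> (2 * g / s) * (d * (1 + Y))" using da g s by (intro mult_left_mono) auto
    have 2: "(2 * g / s)\<^sup>2 * (\<alpha> * Y\<^sup>2) \<le> (2 * g / s)\<^sup>2 * ((A y *v (y - x0)) \<bullet> (y - x0))" using ab by (intro mult_left_mono) auto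
    have 3: "(2 * g / s)\<^sup>2 * (\<alpha> * Y\<^sup>2) = 2 * (g * (Y / s)\<^sup>2)"
    proof -
      have "(2 * g / s)\<^sup>2 * (\<alpha> * Y\<^sup>2) = 2 * (2 * (g * \<alpha>)) * (g * (Y / s)\<^sup>2)" by (simp add: power2_eq_square)
      thus ?thesis unfolding g(2) by simp
    qed
    have 4: "0 \<le> g * (d - Y / s)\<^sup>2" using g by simp
    have 5: "g * (d - Y / s)\<^sup>2 = g * d\<^sup>2 - (2 * g / s) * (d * Y) + g * (Y / s)\<^sup>2" by (simp add: power2_eq_square algebra_simps)
    have 6: "(2 * g / s) * (d * (1 + Y)) = \<kappa> / s + (2 * g / s) * (d * Y)" by (simp add: \<kappa>_def algebra_simps add_divide_distrib)
    have 7: "g / s\<^sup>2 * r y = g * (Y / s)\<^sup>2" by (simp add: r Y_def power_divide)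
    have "- K3 - \<kappa> / s + g / s\<^sup>2 * r y \<le> - (2 * g / s) * dA x0 y + (2 * g / s)\<^sup>2 * ((A y *v (y - x0)) \<bullet> (y - x0)) - K"
      using 1 2 3 4 5 6 7 unfolding K3_def by linarith
    from mult_left_mono[OF this less_imp_le[OF Gp]]
    have "\<Gamma> t y * (- K3 - \<kappa> / s + g / s\<^sup>2 * r y) \<le> \<Gamma> t y * (- (2 * g / s) * dA x0 y + (2 * g / s)\<^sup>2 * ((A y *v (y - x0)) \<bullet> (y - x0)) - K)" .
    moreover have "D\<Gamma> t y = \<Gamma> t y * (- (2 * g / s) * dA x0 y + (2 * g / s)\<^sup>2 * ((A y *v (y - x0)) \<bullet> (y - x0)))"
      unfolding D\<Gamma>_def Ch(2) s_def[symmetric] unfolding h_def s_def[symmetric] inner_scaleR_right distrib_left by (simp only: mult_ac)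
    ultimately show ?thesis unfolding \<Gamma>'_def s_def[symmetric] right_diff_distrib by (simp add: mult.commute[of K])
  qed
  have cst: "((\<lambda>t :: real. \<delta>) has_real_derivative 0) (at t)" for t by simp
  note PV0 = parabolic_diff[OF parabolic_diff[OF parabolic_scale[OF P\<Gamma> cst] parabolic_const[OF weak_sol_const[of "\<delta> * c0"]]] u_parabolic(1)]
  have PV: "parabolic A (\<lambda>t y. \<delta> * \<Gamma> t y - \<delta> * c0 - u t y) (\<lambda>t y. (0 * \<Gamma> t y + \<delta> * \<Gamma>' t y - 0) - deriv (\<lambda>s. u s y) t)
     (\<lambda>t y. (\<delta> * D\<Gamma> t y - 0) - div_A_grad A (u t) y)" by (rule PV0) (intro continuous_intros)
  have "\<delta> * \<Gamma> T x - \<delta> * c0 - u T x \<le> 0"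
  proof (rule global_comparison[OF PV order_refl _ _ _ T])
    fix t y assume t: "t > 0" "\<delta> * \<Gamma> t y - \<delta> * c0 - u t y > 0"
    have un: "0 \<le> u t y" "u t y \<le> p1" using u_nonneg[OF t(1)] u_le_p[OF t(1), of y] p01(3)[of y] by auto
    have fl: "- f y (u t y) \<le> K * u t y"
    proof (cases "u t y = 0")
      case False
      hence "0 < u t y" using un by simp
      then obtain \<theta> where \<theta>: "0 < \<theta>" "\<theta> < u t y" "f y (u t y) - f y 0 = f_u f y \<theta> * (u t y - 0)"
        using f_mean_value[OF f, of 0 "u t y" y] by auto
      have "- f_u f y \<theta> \<le> K" using K(2)[of \<theta> y] \<theta> un by (auto simp: abs_le_iff)
      from mult_right_mono[OF this un(1)] \<theta>(3) show ?thesis by (simp add: f_zero)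
    qed (simp add: f_zero)
    have "c0 > 0" by (simp add: c0_def)
    hence "u t y \<le> \<delta> * \<Gamma> t y" using t(2) \<delta> by (smt (verit) mult_pos_pos)
    hence "K * u t y \<le> K * (\<delta> * \<Gamma> t y)" using K(1) by (rule mult_left_mono)
    moreover have "\<delta> * \<Gamma>' t y \<le> \<delta> * (D\<Gamma> t y - K * \<Gamma> t y)" using sub[OF t(1)] \<delta> by (intro mult_left_mono) auto
    ultimately show "0 * \<Gamma> t y + \<delta> * \<Gamma>' t y - 0 - deriv (\<lambda>s. u s y) t \<le> \<delta> * D\<Gamma> t y - 0 - div_A_grad A (u t) y + 0 * (\<delta> * \<Gamma> t y - \<delta> * c0 - u t y)"
      unfolding u_parabolic(2)[OF t(1), of y] using fl by (simp add: algebra_simps)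
  next
    fix T' :: real
    have gl: "\<Gamma> t y \<le> exp (- \<kappa> * ln a)" if "0 < t" for t y
    proof -
      have "K3 \<ge> 0" using g K by (simp add: K3_def)
      hence "- K3 * t \<le> 0" using that by simp
      moreover have "\<kappa> * ln a \<le> \<kappa> * ln (t + a)" using \<kappa>0 a that by (intro mult_left_mono) auto
      moreover have "0 \<le> g / (t + a) * r y" using g a that by (simp add: r)
      ultimately show ?thesis unfolding \<Gamma>_def by simp
    qed
    have "\<delta> * \<Gamma> t y - \<delta> * c0 - u t y \<le> \<delta> * exp (- \<kappa> * ln a)" if "0 < t" for t y
    proof -
      have "\<delta> * \<Gamma> t y \<le> \<delta> * exp (- \<kappa> * ln a)" using gl[OF that] \<delta> by (intro mult_left_mono) auto
      moreover have "0 \<le> \<delta> * c0" using \<delta> by (simp add: c0_def)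
      ultimately show ?thesis using u_nonneg[OF that, of y] by linarith
    qed
    thus "\<exists>B. \<forall>t y. 0 < t \<longrightarrow> t \<le> T' \<longrightarrow> \<delta> * \<Gamma> t y - \<delta> * c0 - u t y \<le> B" by blast
  next
    show "AE y in lborel. ((\<lambda>t. max 0 (\<delta> * \<Gamma> t y - \<delta> * c0 - u t y)) \<longlongrightarrow> 0) (at_right 0)"
      using u_limit
    proof eventually_elim
      case (elim y)
      have G0: "((\<lambda>t. \<Gamma> t y) \<longlongrightarrow> \<Gamma> 0 y) (at_right 0)" unfolding \<Gamma>_def using a by (intro tendsto_intros) auto
      have "\<delta> * \<Gamma> 0 y - \<delta> * c0 - u\<^sub>0 y \<le> 0"
      proof (cases "dist y x0 < s0")
        case True
        have "\<Gamma> 0 y \<le> exp (- \<kappa> * ln a)" unfolding \<Gamma>_def using g a by (simp add: r)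
        hence "\<delta> * \<Gamma> 0 y \<le> \<delta> * exp (- \<kappa> * ln a)" using \<delta> by (intro mult_left_mono) auto
        also have "\<dots> = u\<^sub>0 x0 / 2" by (simp add: \<delta>_def exp_minus)
        also have "\<dots> \<le> u\<^sub>0 y" using s0(2)[OF True] unfolding dist_real_def by linarith
        finally have "\<delta> * \<Gamma> 0 y \<le> u\<^sub>0 y" .
        moreover have "0 \<le> \<delta> * c0" using \<delta> by (simp add: c0_def)
        ultimately show ?thesis by linarith
      next
        case False
        hence "s0\<^sup>2 \<le> r y" unfolding r using s0(1) by (intro power_mono) (auto simp: dist_norm)
        hence "g / a * s0\<^sup>2 \<le> g / a * r y" using g a by (intro mult_left_mono) auto
        hence "\<Gamma> 0 y \<le> c0" unfolding \<Gamma>_def c0_def by simp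
        hence "\<delta> * \<Gamma> 0 y \<le> \<delta> * c0" using \<delta> by (intro mult_left_mono) auto
        thus ?thesis using u0(1)[of y] by linarith
      qed
      thus ?case by (rule max_limit[OF tendsto_diff[OF tendsto_diff[OF tendsto_mult[OF tendsto_const G0] tendsto_const] elim]])
    qed
  qed
  moreover have "c0 < \<Gamma> T x"
  proof -
    have "\<kappa> * ln (T + a) \<le> \<kappa> * ln (T + 1)" using \<kappa>0 a T by (intro mult_left_mono) auto
    moreover have "g / (T + a) * r x \<le> g / T * r x"
      using g a T by (intro mult_right_mono divide_left_mono) (auto simp: r)
    ultimately have "\<beta>1 \<le> \<Gamma> T x" unfolding \<beta>1_def \<Gamma>_def by simp
    thus ?thesis using a(3) by (simp add: c0_def)
  qed
  hence "\<delta> * c0 < \<delta> * \<Gamma> T x" using \<delta> by simp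
  ultimately show ?thesis by linarith
qed

end

section \<open>Convergence behind the front\<close>

context kpp_cauchy
begin

lemma u_C1: "t > 0 \<Longrightarrow> C1 (u t)"
  using u_parabolic(1) by (simp add: parabolic_def weak_sol_def)

lemma u_isCont: "t > 0 \<Longrightarrow> isCont (\<lambda>s. u s x) t"
  using u_parabolic(1) by (auto simp: parabolic_def intro: DERIV_isCont)

text \<open>Far out |v| \<le> p0 / 4 and W is within p0 / 4 of p, so u \<ge> p / 2. On the remaining
  ball the positive minimum of u, divided by the upper bound of p, gives \<theta>.\<close>

lemma initial_lower_bound:
  assumes v0: "integrable lborel v\<^sub>0" and T: "T > 0"
    and p0: "p0 > 0" "\<And>x. p0 \<le> p x" and close: "\<And>\<xi> x. \<xi> \<ge> \<xi>\<^sub>0 \<Longrightarrow> \<bar>w x \<xi> - p x\<bar> \<le> p0 / 4"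
  obtains \<theta> where "0 < \<theta>" "\<theta> \<le> 1 / 2" "\<And>x. x $ k + c * T \<ge> \<xi>\<^sub>0 \<Longrightarrow> \<theta> * p x \<le> u T x"
proof -
  obtain p0' p1 where "p0' > 0" "\<And>x. p0' \<le> p x" and p1: "\<And>x. p x \<le> p1" using p_bounds by blast
  have p1p: "p1 > 0" using p0(1) p0(2)[of 0] p1[of 0] by linarith
  obtain \<rho> where \<rho>: "\<And>x. norm x \<ge> \<rho> \<Longrightarrow> \<bar>v T x\<bar> \<le> p0 / 4" using decay_far[OF v0 T, of "p0 / 4"] p0 by auto
  obtain x0 where x0: "isCont u\<^sub>0 x0" "u\<^sub>0 x0 > 0" using positive_continuity_point[OF v0] by blast
  have "\<exists>y\<in>cball 0 (max 0 \<rho>). \<forall>x\<in>cball 0 (max 0 \<rho>). u T y \<le> u T x"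
    by (rule continuous_attains_inf) (auto intro: continuous_on_subset[OF C1_continuous[OF u_C1[OF T]]])
  then obtain y where "\<forall>x\<in>cball 0 (max 0 \<rho>). u T y \<le> u T x" by blast
  hence y: "\<And>x. norm x \<le> max 0 \<rho> \<Longrightarrow> u T y \<le> u T x" by (simp only: mem_cball_0)
  have uy: "u T y > 0" by (rule u_positive[OF x0 T])
  define \<theta> where "\<theta> = min (1 / 2) (u T y / p1)"
  have \<theta>: "0 < \<theta>" "\<theta> \<le> 1 / 2" "\<theta> \<le> u T y / p1"
  proof -
    show "0 < \<theta>" using uy p1p by (simp add: \<theta>_def)
    show "\<theta> \<le> 1 / 2" unfolding \<theta>_def by (rule min.cobounded1)
    show "\<theta> \<le> u T y / p1" unfolding \<theta>_def by (rule min.cobounded2)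
  qed
  have "\<theta> * p x \<le> u T x" if x: "x $ k + c * T \<ge> \<xi>\<^sub>0" for x
  proof (cases "norm x \<ge> \<rho>")
    case True
    have "\<theta> * p x \<le> 1 / 2 * p x" using \<theta>(2) p_facts(3)[of x] by (intro mult_right_mono) auto
    thus ?thesis using \<rho>[OF True] close[OF x, of x] p0(2)[of x] unfolding v_def W_def by linarith
  next
    case False
    have "\<theta> * p x \<le> u T y / p1 * p1" using \<theta> p1[of x] p_facts(3)[of x] uy p1p by (intro mult_mono) auto
    also have "\<dots> = u T y" using p1p by simp
    also have "\<dots> \<le> u T x" using False by (intro y) auto
    finally show ?thesis .
  qed
  with \<theta> show ?thesis using that by blast
qed

text \<open>Since \<open>f(x,s)/s\<close> decreases strictly in \<open>s\<close>, multiples \<open>\<theta>p\<close> with \<open>\<theta> < 1\<close> are strict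
  subsolutions by a uniform margin, so \<open>\<theta>\<close> may grow in time. The cubic term penalises the region
  behind \<open>\<xi>\<^sub>0\<close>, where \<open>u\<close> is not known to exceed \<open>\<theta>p\<close>.\<close>

lemma growing_lower_bound:
  assumes T: "T > 0" and e: "0 < e" "e \<le> 1 / 4" and \<theta>\<^sub>0: "0 < \<theta>\<^sub>0" "\<theta>\<^sub>0 \<le> 1 / 2"
    and init: "\<And>x. x $ k + c * T \<ge> \<xi>\<^sub>0 \<Longrightarrow> \<theta>\<^sub>0 * p x \<le> u T x"
    and band: "\<And>t x. t \<ge> T \<Longrightarrow> x $ k + c * t \<ge> \<xi>\<^sub>0 \<Longrightarrow> x $ k + c * t \<le> \<xi>\<^sub>0 + 1 \<Longrightarrow> (1 - e) * p x \<le> u t x"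
  obtains a where "a > 0" "\<And>t x. t > 0 \<Longrightarrow> x $ k + c * (T + t) \<ge> \<xi>\<^sub>0 + 1 \<Longrightarrow> (1 - e - exp (- a * t)) * p x \<le> u (T + t) x"
proof -
  obtain p0 p1 where p01: "p0 > 0" "\<And>x. p0 \<le> p x" "\<And>x. p x \<le> p1" using p_bounds by blast
  have p1p: "p1 > 0" using p01(1) p01(2)[of 0] p01(3)[of 0] by linarith
  obtain Q where Q: "Q \<ge> 0" "\<And>x. \<bar>q x\<bar> \<le> Q" using q_bound by blast
  \<comment> \<open>The relative margin by which (1 - e) p is a strict subsolution. It is periodic,
    continuous and positive, hence at least some \<open>\<delta>\<close> > 0; for smaller multiples
    of p the margin only grows.\<close>
  define h where "h x = f x ((1 - e) * p x) / ((1 - e) * p x) - f x (p x) / p x" for x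
  have e1: "1 - e > 0" "1 - e < 1" using e by auto
  have fc: "continuous_on UNIV (\<lambda>x. f x (g x))" if "continuous_on UNIV g" for g
  proof -
    have "continuous_on UNIV (\<lambda>(x, s). f x s)" using f by (simp add: reaction_term_def)
    moreover have "continuous_on UNIV (\<lambda>x. (x, g x))" by (intro continuous_on_Pair continuous_on_id that)
    ultimately show ?thesis using continuous_on_compose2[of UNIV "\<lambda>(x, s). f x s" UNIV "\<lambda>x. (x, g x)"] by auto
  qed
  have cp: "continuous_on UNIV p" by (rule C1_continuous[OF p_facts(1)])
  have pne: "p x \<noteq> 0" for x using p_facts(3)[of x] by simp
  have "continuous_on UNIV h" unfolding h_def using e1 pne by (intro continuous_intros fc cp) auto
  moreover have "periodic L h" using f p_facts(2) by (simp add: reaction_term_def periodic_def h_def)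
  moreover have "h x > 0" for x
  proof -
    have "(1 - e) * p x < p x" using e1 p_facts(3)[of x] by simp
    from monotone_onD[OF dec[rule_format, of x] _ _ this] show ?thesis using e1 p_facts(3)[of x] by (simp add: h_def)
  qed
  ultimately obtain \<delta> where \<delta>: "\<delta> > 0" "\<And>x. \<delta> \<le> h x" using periodic_positive[OF L_pos, of h] by blast
  \<comment> \<open>The growth rate that the margin affords: \<theta>' \<le> \<theta>0 \<delta>
    \<le> \<theta> \<delta>.\<close>
  define a where "a = \<theta>\<^sub>0 * \<delta>"
  have a: "a > 0" using \<theta>\<^sub>0 \<delta> by (simp add: a_def)
  define \<theta> \<theta>' where "\<theta> t = (1 - e) - (1 - e - \<theta>\<^sub>0) * exp (- a * t)" and "\<theta>' t = a * ((1 - e - \<theta>\<^sub>0) * exp (- a * t))" for t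
  have b: "0 \<le> 1 - e - \<theta>\<^sub>0" "1 - e - \<theta>\<^sub>0 \<le> 1" using e \<theta>\<^sub>0 by auto
  have \<theta>d: "(\<theta> has_real_derivative \<theta>' t) (at t)" for t
    unfolding \<theta>_def[abs_def] \<theta>'_def by (auto intro!: derivative_eq_intros)
  have \<theta>c: "continuous_on {0<..} \<theta>'" unfolding \<theta>'_def[abs_def] by (intro continuous_intros)
  have \<theta>b: "\<theta>\<^sub>0 \<le> \<theta> t" "\<theta> t \<le> 1 - e" "\<theta>' t \<le> a" if "t \<ge> 0" for t
  proof -
    have x: "exp (- a * t) \<le> 1" "0 < exp (- a * t)" using a that by auto
    have 1: "(1 - e - \<theta>\<^sub>0) * exp (- a * t) \<le> (1 - e - \<theta>\<^sub>0) * 1" by (rule mult_left_mono[OF x(1) b(1)])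
    show "\<theta>\<^sub>0 \<le> \<theta> t" using 1 by (simp add: \<theta>_def)
    show "\<theta> t \<le> 1 - e" using b(1) by (simp add: \<theta>_def)
    have "a * ((1 - e - \<theta>\<^sub>0) * exp (- a * t)) \<le> a * 1" using 1 b a by (intro mult_left_mono) auto
    thus "\<theta>' t \<le> a" by (simp add: \<theta>'_def)
  qed
  \<comment> \<open>The third power is twice continuously differentiable. It is at least p1, hence
    at least \<theta> p, for s \<le> \<xi>0, and vanishes for s \<ge> \<xi>0 + 1, so its derivatives
    never enter the inequality to be checked.\<close>
  define g g' g'' where "g s = p1 * max 0 (\<xi>\<^sub>0 + 1 - s) ^ 3" and "g' s = - p1 * (3 * max 0 (\<xi>\<^sub>0 + 1 - s) ^ 2)"
    and "g'' s = p1 * (3 * (2 * max 0 (\<xi>\<^sub>0 + 1 - s)))" for s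
  have sd: "((\<lambda>s. \<xi>\<^sub>0 + 1 - s) has_real_derivative - 1) (at s)" for s by (auto intro!: derivative_eq_intros)
  have gd: "(g has_real_derivative g' s) (at s)" for s
  proof -
    have "((\<lambda>s. p1 * max 0 (\<xi>\<^sub>0 + 1 - s) ^ 3) has_real_derivative p1 * (real (1 + 2) * max 0 (\<xi>\<^sub>0 + 1 - s) ^ Suc 1 * - 1)) (at s)"
      using DERIV_cmult[OF DERIV_chain2[OF DERIV_pos_part_power[of 1] sd], of p1 s] by (simp add: numeral_3_eq_3)
    thus ?thesis unfolding g_def[abs_def] g'_def by (simp add: power2_eq_square)
  qed
  have gd': "(g' has_real_derivative g'' s) (at s)" for s
  proof -
    have "((\<lambda>s. - p1 * (3 * max 0 (\<xi>\<^sub>0 + 1 - s) ^ 2)) has_real_derivative - p1 * (3 * (real (0 + 2) * max 0 (\<xi>\<^sub>0 + 1 - s) ^ Suc 0 * - 1))) (at s)"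
      using DERIV_cmult[OF DERIV_cmult[OF DERIV_chain2[OF DERIV_pos_part_power[of 0] sd], of 3], of "- p1" s] by (simp add: numeral_2_eq_2)
    thus ?thesis unfolding g'_def[abs_def] g''_def by simp
  qed
  have gc: "continuous_on UNIV g''" unfolding g''_def[abs_def] by (intro continuous_intros)
  have g0: "g s = 0" "g' s = 0" "g'' s = 0" if "s \<ge> \<xi>\<^sub>0 + 1" for s using that by (auto simp: g_def g'_def g''_def)
  have gn: "0 \<le> g s" for s using p1p by (simp add: g_def)
  have g1: "p1 \<le> g s" if "s \<le> \<xi>\<^sub>0" for s
  proof -
    have "1 \<le> max 0 (\<xi>\<^sub>0 + 1 - s) ^ 3" using that by (intro one_le_power) auto
    from mult_left_mono[OF this, of p1] p1p show ?thesis by (simp add: g_def)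
  qed
  note PV = parabolic_diff[OF parabolic_diff[OF parabolic_scale[OF parabolic_const[OF p_facts(4)] \<theta>d \<theta>c] parabolic_shift[OF u_parabolic(1) less_imp_le[OF T]]]
      plane_wave[OF gd gd' gc, where c = c and ?t0.0 = T]]
  have tp: "\<theta> t * p x \<le> p1" if "t \<ge> 0" for t x
  proof -
    have "\<theta> t * p x \<le> 1 * p1" using \<theta>b[OF that] e p01(3)[of x] p_facts(3)[of x] by (intro mult_mono) auto
    thus ?thesis by simp
  qed
  have key: "\<theta> S * p x - u (T + S) x - g (x $ k + c * (T + S)) \<le> 0" if S: "S > 0" for S x
  proof (rule global_comparison[OF PV Q(1) _ _ _ S])
    fix t x assume t: "t > 0" and V: "\<theta> t * p x - u (T + t) x - g (x $ k + c * (T + t)) > 0"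
    have Tt: "T + t > 0" using T t by simp
    have un: "0 \<le> u (T + t) x" by (rule u_nonneg[OF Tt])
    \<comment> \<open>Up to \<xi>0 the penalty makes the comparison function nonpositive, and in the
      band of width 1 already u \<ge> (1 - e) p \<ge> \<theta> p; positivity therefore forces the
      point beyond the band.\<close>
    have \<xi>: "x $ k + c * (T + t) \<ge> \<xi>\<^sub>0 + 1"
    proof (rule ccontr)
      assume n: "\<not> ?thesis"
      show False
      proof (cases "x $ k + c * (T + t) \<le> \<xi>\<^sub>0")
        case True
        show ?thesis using g1[OF True] tp[of t x] t un V by linarith
      next
        case False
        have "\<theta> t * p x \<le> (1 - e) * p x" using \<theta>b(2)[of t] t p_facts(3)[of x] by (intro mult_right_mono) auto
        thus ?thesis using band[of "T + t" x] n False t V gn[of "x $ k + c * (T + t)"] by linarith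
      qed
    qed
    have V': "\<theta> t * p x - u (T + t) x > 0" using V g0[OF \<xi>] by simp
    have \<theta>p: "\<theta> t > 0" using \<theta>b(1)[of t] t \<theta>\<^sub>0 by linarith
    have tpp: "\<theta> t * p x > 0" using \<theta>p p_facts(3)[of x] by simp
    have "(\<theta> t * p x - u (T + t) x) * (f x (\<theta> t * p x) - f x (u (T + t) x) - q x * (\<theta> t * p x - u (T + t) x)) \<le> 0"
      by (rule kpp_upper[OF f dec less_imp_le[OF tpp] un])
    hence 1: "f x (\<theta> t * p x) - f x (u (T + t) x) - q x * (\<theta> t * p x - u (T + t) x) \<le> 0"
      using V' by (simp add: mult_le_0_iff)
    have 2: "q x * (\<theta> t * p x - u (T + t) x) \<le> Q * (\<theta> t * p x - u (T + t) x)"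
      using Q(2)[of x] V' by (intro mult_right_mono) auto
    have "f x ((1 - e) * p x) / ((1 - e) * p x) \<le> f x (\<theta> t * p x) / (\<theta> t * p x)"
    proof (cases "\<theta> t = 1 - e")
      case False
      hence "\<theta> t * p x < (1 - e) * p x" using \<theta>b(2)[of t] t p_facts(3)[of x] by auto
      from monotone_onD[OF dec[rule_format, of x] _ _ this] show ?thesis using e1 tpp p_facts(3)[of x] by simp
    qed simp
    hence "f x (p x) / p x + \<delta> \<le> f x (\<theta> t * p x) / (\<theta> t * p x)" using \<delta>(2)[of x] unfolding h_def by linarith
    from mult_left_mono[OF this less_imp_le[OF tpp]]
    moreover have "\<theta> t * p x * (f x (p x) / p x + \<delta>) = \<theta> t * f x (p x) + \<theta> t * \<delta> * p x" using pne[of x] by (simp add: distrib_left)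
    moreover have "\<theta> t * p x * (f x (\<theta> t * p x) / (\<theta> t * p x)) = f x (\<theta> t * p x)" using pne[of x] \<theta>p by (simp add: f_zero)
    ultimately have 3: "\<theta> t * f x (p x) + \<theta> t * \<delta> * p x \<le> f x (\<theta> t * p x)" by simp
    have "\<theta>' t \<le> \<theta>\<^sub>0 * \<delta>" using \<theta>b(3)[of t] t by (simp add: a_def)
    also have "\<dots> \<le> \<theta> t * \<delta>" using \<theta>b(1)[of t] t \<delta>(1) by (intro mult_right_mono) auto
    finally have 4: "\<theta>' t * p x \<le> \<theta> t * \<delta> * p x" using p_facts(3)[of x] by (intro mult_right_mono) auto
    show "\<theta>' t * p x + \<theta> t * 0 - deriv (\<lambda>s. u s x) (T + t) - c * g' (x $ k + c * (T + t))
        \<le> \<theta> t * - f x (p x) - div_A_grad A (u (T + t)) x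
          - (g' (x $ k + c * (T + t)) * divergence (\<lambda>y. A y *v axis k 1) x + (A x *v axis k 1) \<bullet> (g'' (x $ k + c * (T + t)) *\<^sub>R axis k 1))
          + Q * (\<theta> t * p x - u (T + t) x - g (x $ k + c * (T + t)))"
      unfolding u_parabolic(2)[OF Tt, of x] g0[OF \<xi>] using 1 2 3 4 by simp
  next
    fix T' :: real
    have "\<theta> t * p x - u (T + t) x - g (x $ k + c * (T + t)) \<le> p1" if "t > 0" for t x
      using tp[of t x] that u_nonneg[of "T + t" x] T gn[of "x $ k + c * (T + t)"] by linarith
    thus "\<exists>B. \<forall>t x. 0 < t \<longrightarrow> t \<le> T' \<longrightarrow> \<theta> t * p x - u (T + t) x - g (x $ k + c * (T + t)) \<le> B" by blast
  next
    show "AE x in lborel. ((\<lambda>t. max 0 (\<theta> t * p x - u (T + t) x - g (x $ k + c * (T + t)))) \<longlongrightarrow> 0) (at_right 0)"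
    proof (rule AE_I2, rule max_limit)
      fix x
      have T0: "((\<lambda>t. T + t) \<longlongrightarrow> T) (at_right 0)" by (rule tendsto_eq_intros refl | simp)+
      have X0: "((\<lambda>t. x $ k + c * (T + t)) \<longlongrightarrow> x $ k + c * T) (at_right 0)" by (intro tendsto_intros T0)
      have "((\<lambda>t. u (T + t) x) \<longlongrightarrow> u T x) (at_right 0)" by (rule isCont_tendsto_compose[OF u_isCont[OF T] T0])
      moreover have "((\<lambda>t. g (x $ k + c * (T + t))) \<longlongrightarrow> g (x $ k + c * T)) (at_right 0)"
        by (rule isCont_tendsto_compose[OF DERIV_isCont[OF gd] X0])
      moreover have "(\<theta> \<longlongrightarrow> \<theta> 0) (at_right 0)"
        using DERIV_isCont[OF \<theta>d, of 0] unfolding isCont_def by (rule tendsto_mono[rotated]) (simp add: at_le)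
      hence "(\<theta> \<longlongrightarrow> \<theta>\<^sub>0) (at_right 0)" by (simp add: \<theta>_def)
      ultimately show "((\<lambda>t. \<theta> t * p x - u (T + t) x - g (x $ k + c * (T + t))) \<longlongrightarrow> \<theta>\<^sub>0 * p x - u T x - g (x $ k + c * T)) (at_right 0)"
        by (intro tendsto_intros)
      show "\<theta>\<^sub>0 * p x - u T x - g (x $ k + c * T) \<le> 0"
      proof (cases "x $ k + c * T \<ge> \<xi>\<^sub>0")
        case True
        show ?thesis using init[OF True] gn[of "x $ k + c * T"] by linarith
      next
        case False
        have "\<theta>\<^sub>0 * p x \<le> 1 * p1" using \<theta>\<^sub>0 p01(3)[of x] p_facts(3)[of x] by (intro mult_mono) auto
        thus ?thesis using g1[of "x $ k + c * T"] False u_nonneg[OF T, of x] by linarith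
      qed
    qed
  qed
  have "(1 - e - exp (- a * t)) * p x \<le> u (T + t) x" if t: "t > 0" and x: "x $ k + c * (T + t) \<ge> \<xi>\<^sub>0 + 1" for t x
  proof -
    have "(1 - e - \<theta>\<^sub>0) * exp (- a * t) \<le> 1 * exp (- a * t)" using b by (intro mult_right_mono) auto
    hence "(1 - e - exp (- a * t)) * p x \<le> \<theta> t * p x" unfolding \<theta>_def using p_facts(3)[of x] by (intro mult_right_mono) auto
    thus ?thesis using key[OF t, of x] g0(1)[OF x] by linarith
  qed
  with a show ?thesis using that by blast
qed

text \<open>On the band between \<xi>0 and \<xi>0 + 1 the exponential in \<open>decay_left\<close>
  is still bounded; as \<mu> may be 0, smallness comes from the factor t^(-n) alone. The band plays
  the part of a lateral boundary for \<open>growing_lower_bound\<close>.\<close>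

lemma eventually_close:
  assumes mu: "\<forall>c l. principal_eigenvalue_L L A f k c l (\<mu> c l)" and l: "l > 0" "\<mu> c l \<ge> 0"
    and v0w: "integrable lborel (\<lambda>x. weight l \<xi>\<^sub>0 (x $ k) * v\<^sub>0 x)" "v\<^sub>0 \<in> borel_measurable borel" and v0: "integrable lborel v\<^sub>0"
    and e: "0 < e" "e \<le> 1 / 4" and p0: "p0 > 0" "\<And>x. p0 \<le> p x"
    and close: "\<And>\<xi> x. \<xi> \<ge> \<xi>\<^sub>0 \<Longrightarrow> \<bar>w x \<xi> - p x\<bar> \<le> e * p0 / 2"
  obtains T where "T > 0" "\<And>t x. t \<ge> T \<Longrightarrow> x $ k + c * t \<ge> \<xi>\<^sub>0 \<Longrightarrow> (1 - 2 * e) * p x \<le> u t x"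
proof -
  define n where "n = real CARD('n) / 2"
  have n: "- n < 0" by (simp add: n_def)
  obtain C where C: "C \<ge> 0" "\<And>t x. t > 0 \<Longrightarrow> \<bar>v t x\<bar> \<le> C * t powr (- n) * exp (- \<mu> c l * t) * exp (l * (x $ k + c * t))"
    using decay_left[OF mu l(1) v0w] unfolding n_def by blast
  define E where "E = exp (l * (\<xi>\<^sub>0 + 1))"
  have "((\<lambda>t. C * E * t powr (- n)) \<longlongrightarrow> C * E * 0) at_top"
    by (intro tendsto_intros tendsto_neg_powr n filterlim_ident)
  hence "\<forall>\<^sub>F t in at_top. C * E * t powr (- n) < e * p0 / 2" using e p0 by (intro order_tendstoD) auto
  then obtain N where N: "\<And>t. t \<ge> N \<Longrightarrow> C * E * t powr (- n) < e * p0 / 2" by (auto simp: eventually_at_top_linorder)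
  define T where "T = max 1 N"
  have T: "T > 0" by (simp add: T_def)
  have ep: "e * p0 \<le> e * p x" for x using e p0(2)[of x] by (intro mult_left_mono) auto
  have band: "(1 - e) * p x \<le> u t x" if t: "t \<ge> T" and x: "x $ k + c * t \<ge> \<xi>\<^sub>0" "x $ k + c * t \<le> \<xi>\<^sub>0 + 1" for t x
  proof -
    have t0: "t > 0" "t \<ge> N" using t by (auto simp: T_def)
    have "\<bar>v t x\<bar> \<le> C * t powr (- n) * exp (- \<mu> c l * t) * exp (l * (x $ k + c * t))" by (rule C(2)[OF t0(1)])
    also have "\<dots> \<le> C * t powr (- n) * 1 * E"
      unfolding E_def using C(1) l t0 x(2) by (intro mult_mono) auto
    also have "\<dots> = C * E * t powr (- n)" by simp
    also have "\<dots> \<le> e * p0 / 2" using N[OF t0(2)] by simp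
    finally have "\<bar>v t x\<bar> \<le> e * p0 / 2" .
    moreover have "(1 - e) * p x = p x - e * p x" by (simp add: left_diff_distrib)
    ultimately show ?thesis using close[OF x(1), of x] ep[of x] unfolding v_def W_def by linarith
  qed
  have "e * p0 / 2 \<le> p0 / 4"
  proof -
    have "e * p0 \<le> 1 / 4 * p0" using e p0 by (intro mult_right_mono) auto
    thus ?thesis using p0(1) by linarith
  qed
  hence "\<And>\<xi> x. \<xi> \<ge> \<xi>\<^sub>0 \<Longrightarrow> \<bar>w x \<xi> - p x\<bar> \<le> p0 / 4" using close by (meson order_trans)
  from initial_lower_bound[OF v0 T p0 this] obtain \<theta> where \<theta>: "0 < \<theta>" "\<theta> \<le> 1 / 2" "\<And>x. x $ k + c * T \<ge> \<xi>\<^sub>0 \<Longrightarrow> \<theta> * p x \<le> u T x"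
    by blast
  obtain a where a: "a > 0" "\<And>t x. t > 0 \<Longrightarrow> x $ k + c * (T + t) \<ge> \<xi>\<^sub>0 + 1 \<Longrightarrow> (1 - e - exp (- a * t)) * p x \<le> u (T + t) x"
    using growing_lower_bound[OF T e \<theta> band] by blast
  \<comment> \<open>After this time exp(-a s) \<le> e, which accounts for the second e in 1 - 2
    e.\<close>
  define s where "s = max 1 (- ln e / a)"
  have s: "s > 0" "- ln e / a \<le> s" by (auto simp: s_def)
  have "(1 - 2 * e) * p x \<le> u t x" if t: "t \<ge> T + s" and x: "x $ k + c * t \<ge> \<xi>\<^sub>0" for t x
  proof (cases "x $ k + c * t \<le> \<xi>\<^sub>0 + 1")
    case True
    have "(1 - 2 * e) * p x \<le> (1 - e) * p x" using e p_facts(3)[of x] by (intro mult_right_mono) auto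
    thus ?thesis using band[OF _ x True] t s by linarith
  next
    case False
    have "- ln e \<le> a * s" using s(2) a(1) by (simp add: field_simps)
    also have "\<dots> \<le> a * (t - T)" using t a by (intro mult_left_mono) auto
    finally have "exp (- a * (t - T)) \<le> exp (ln e)" by simp
    hence "1 - 2 * e \<le> 1 - e - exp (- a * (t - T))" using e by simp
    hence "(1 - 2 * e) * p x \<le> (1 - e - exp (- a * (t - T))) * p x" using p_facts(3)[of x] by (intro mult_right_mono) auto
    thus ?thesis using a(2)[of "t - T" x] False t s by simp
  qed
  thus ?thesis using that[of "T + s"] T s by simp
qed

end

section \<open>Decay in time on both sides of the front position\<close>

context kpp_cauchy
begin

text \<open>The comparison with C3 (1 + t)^(-n) exp(-m t) \<phi> starts at a time T after which,
  beyond \<xi>0, both u and W lie in the neighbourhood of p where \<open>\<delta>\<close> controls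
  \<open>f_u\<close>. Behind \<xi>0 the estimate of \<open>decay_left\<close> is already below the
  barrier, so the comparison runs on the whole space. Times up to T are covered by enlarging the
  constant.\<close>

lemma front_stability:
  assumes mu: "\<forall>c l. principal_eigenvalue_L L A f k c l (\<mu> c l)" and l: "l > 0" "\<mu> c l \<ge> 0"
    and v0w: "integrable lborel (\<lambda>x. weight l \<xi>\<^sub>0 (x $ k) * v\<^sub>0 x)" "v\<^sub>0 \<in> borel_measurable borel" and v0: "integrable lborel v\<^sub>0"
    and e: "0 < e" "e \<le> 1 / 4" and p01: "p0 > 0" "\<And>x. p0 \<le> p x" "\<And>x. p x \<le> p1"
    and \<phi>: "weak_sol A \<phi> (\<lambda>x. (\<mu>' - f_u f x (p x)) * \<phi> x)" "\<phi>0 > 0" "\<And>x. \<phi>0 \<le> \<phi> x" "\<And>x. \<phi> x \<le> \<phi>1" and \<mu>': "\<mu>' < 0"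
    and \<delta>: "2 * e * p1 < \<delta>" "\<And>x s. \<bar>s - p x\<bar> < \<delta> \<Longrightarrow> f_u f x s \<le> f_u f x (p x) - \<mu>' / 4"
    and close: "\<And>\<xi> x. \<xi> \<ge> \<xi>\<^sub>0 \<Longrightarrow> \<bar>w x \<xi> - p x\<bar> \<le> e * p0 / 2" "\<And>\<xi> x. \<xi> \<ge> \<xi>\<^sub>0 \<Longrightarrow> \<bar>w x \<xi> - p x\<bar> < \<delta>"
  shows "\<exists>C>0. \<forall>t\<ge>0. \<forall>x.
     (x $ k + c * t \<le> \<xi>\<^sub>0 \<longrightarrow> \<bar>v t x\<bar> < C * (1 + t) powr (- (real CARD('n) / 2)) * exp (- \<mu> c l * t)) \<and>
     (x $ k + c * t \<ge> \<xi>\<^sub>0 \<longrightarrow> \<bar>v t x\<bar> < C * (1 + t) powr (- (real CARD('n) / 2)) * exp (- min (\<mu> c l) (- \<mu>' / 2) * t))"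
proof -
  define n where "n = real CARD('n) / 2"
  have n: "n > 0" by (simp add: n_def)
  define m where "m = min (\<mu> c l) (- \<mu>' / 2)"
  have m: "0 \<le> m" "m \<le> \<mu> c l" "m \<le> - \<mu>' / 2" using l \<mu>' by (auto simp: m_def)
  define H where "H r t = (1 + t) powr (- n) * exp (- r * t)" for r t :: real
  have Hp: "H r t > 0" if "t \<ge> 0" for r t using that by (simp add: H_def)
  have Hm: "H (\<mu> c l) t \<le> H m t" if "t \<ge> 0" for t
    unfolding H_def using m(2) that by (intro mult_left_mono) (auto intro: mult_right_mono)
  have Ha: "H (\<mu> c l) T \<le> H (\<mu> c l) t" if "0 \<le> t" "t \<le> T" for t T
    unfolding H_def using that l n by (intro mult_mono powr_mono2') (auto intro: mult_left_mono)
  obtain C1 where C1: "C1 \<ge> 0" "\<And>t x. t > 0 \<Longrightarrow> \<bar>v t x\<bar> \<le> C1 * t powr (- n) * exp (- \<mu> c l * t) * exp (l * (x $ k + c * t))"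
    using decay_left[OF mu l(1) v0w] unfolding n_def by blast
  define C2 where "C2 = C1 * 2 powr n * exp (l * \<xi>\<^sub>0)"
  have C2: "C2 \<ge> 0" using C1 by (simp add: C2_def)
  have left: "\<bar>v t x\<bar> \<le> C2 * H (\<mu> c l) t" if t: "t \<ge> 1" and x: "x $ k + c * t \<le> \<xi>\<^sub>0" for t x
  proof -
    have "t powr (- n) \<le> ((1 + t) / 2) powr (- n)" using t n by (intro powr_mono2') auto
    also have "\<dots> = 2 powr n * (1 + t) powr (- n)" using t by (simp add: powr_divide powr_minus divide_simps)
    finally have 1: "t powr (- n) \<le> 2 powr n * (1 + t) powr (- n)" .
    have "\<bar>v t x\<bar> \<le> C1 * t powr (- n) * exp (- \<mu> c l * t) * exp (l * (x $ k + c * t))" using C1(2)[of t x] t by simp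
    also have "\<dots> \<le> C1 * (2 powr n * (1 + t) powr (- n)) * exp (- \<mu> c l * t) * exp (l * \<xi>\<^sub>0)"
      using 1 C1(1) l x by (intro mult_mono) auto
    finally show ?thesis by (simp add: C2_def H_def mult_ac)
  qed
  obtain T0 where T0: "T0 > 0" "\<And>t x. t \<ge> T0 \<Longrightarrow> x $ k + c * t \<ge> \<xi>\<^sub>0 \<Longrightarrow> (1 - 2 * e) * p x \<le> u t x"
    using eventually_close[OF mu l v0w v0 e p01(1,2) close(1)] by blast
  \<comment> \<open>Late enough for \<open>eventually_close\<close>, for the left estimate, and for
    n / (1 + t) \<le> - \<mu>' / 4.\<close>
  define T where "T = max T0 (max 1 (4 * n / - \<mu>'))"
  have T: "T \<ge> T0" "T \<ge> 1" "T \<ge> 4 * n / - \<mu>'" by (auto simp: T_def)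
  have T': "T > 0" using T(2) by simp
  have nT: "n / (1 + t) \<le> - \<mu>' / 4" if "t \<ge> T" for t
  proof -
    have "4 * n / - \<mu>' \<le> 1 + t" using T(3) that by linarith
    hence "4 * n \<le> (1 + t) * - \<mu>'" using \<mu>' by (simp only: pos_divide_le_eq neg_0_less_iff_less)
    moreover have "- \<mu>' / 4 * (1 + t) = (1 + t) * - \<mu>' / 4" by simp
    ultimately have "n \<le> - \<mu>' / 4 * (1 + t)" by linarith
    thus ?thesis using that T(2) by (simp only: pos_divide_le_eq)
  qed
  obtain Q where Q: "Q \<ge> 0" "\<And>x. \<bar>q x\<bar> \<le> Q" using q_bound by blast
  obtain K1 where K1: "K1 \<ge> 0" "\<And>s x. \<bar>s\<bar> \<le> p1 \<Longrightarrow> \<bar>f_u f x s\<bar> \<le> K1" using f_u_bounded[OF f Q(2), of p1] by blast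
  define K where "K = K1 - \<mu>' / 4"
  have K: "K \<ge> 0" using K1 \<mu>' by (simp add: K_def)
  have Kq: "f_u f x (p x) - \<mu>' / 4 \<le> K" for x
    using K1(2)[of "p x" x] p01(3)[of x] p_facts(3)[of x] unfolding K_def by (auto simp: abs_le_iff)
  obtain B where B: "B \<ge> 0" "\<And>t x. 0 \<le> t \<Longrightarrow> t \<le> T \<Longrightarrow> \<bar>v t x\<bar> \<le> B" using v_bounded by blast
  \<comment> \<open>The first summand puts the barrier above the left estimate, the second above the
    bound \<open>B\<close> of |v| at the starting time T.\<close>
  define C3 where "C3 = C2 / \<phi>0 + B / (H m T * \<phi>0)"
  have HT: "H m T > 0" using Hp T' by simp
  have C3: "C3 \<ge> 0" using C2 B HT \<phi>(2) by (simp add: C3_def)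
  have C3l: "C2 * H m t \<le> C3 * H m t * \<phi> x" if "t \<ge> 0" for t x
  proof -
    have "C2 \<le> C3 * \<phi>0" using B(1) HT \<phi>(2) by (simp add: C3_def field_simps)
    also have "\<dots> \<le> C3 * \<phi> x" using C3 \<phi>(3) by (intro mult_left_mono)
    finally have "C2 * H m t \<le> (C3 * \<phi> x) * H m t" using Hp[OF that, of m] by (intro mult_right_mono) auto
    thus ?thesis by (simp add: mult_ac)
  qed
  have C3T: "B \<le> C3 * H m T * \<phi> x" for x
  proof -
    have "B \<le> C3 * H m T * \<phi>0" using C2 HT \<phi>(2) by (simp add: C3_def field_simps)
    also have "\<dots> \<le> C3 * H m T * \<phi> x" using C3 HT \<phi>(3) by (intro mult_left_mono) auto
    finally show ?thesis .
  qed
  define H' where "H' t = H m t * (- n / (1 + t) - m)" for t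
  have Hd: "(H m has_real_derivative H' t) (at t)" if "t \<ge> 0" for t
  proof -
    have t: "1 + t > 0" using that by simp
    have "((\<lambda>t. (1 + t) powr (- n) * exp (- m * t)) has_real_derivative
        - n * (1 + t) powr (- n - 1) * exp (- m * t) + (1 + t) powr (- n) * (- m * exp (- m * t))) (at t)"
      using t by (auto intro!: derivative_eq_intros)
    moreover have "(1 + t) powr (- n - 1) = (1 + t) powr (- n) / (1 + t)" using t by (simp add: powr_diff)
    hence "- n * (1 + t) powr (- n - 1) * exp (- m * t) + (1 + t) powr (- n) * (- m * exp (- m * t)) = H' t"
      unfolding H_def H'_def by (simp add: algebra_simps)
    ultimately show ?thesis unfolding H_def[abs_def] by (simp only:)
  qed
  define S where "S s = C3 * H m (T + s)" for s
  have Sd: "(S has_real_derivative C3 * H' (T + s)) (at s)" if "s > 0" for s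
  proof -
    have "((\<lambda>s. T + s) has_real_derivative 1) (at s)" by (auto intro!: derivative_eq_intros)
    from DERIV_chain2[OF Hd this] that T' have "((\<lambda>s. H m (T + s)) has_real_derivative H' (T + s)) (at s)" by simp
    from DERIV_cmult[OF this] show ?thesis by (simp add: S_def[abs_def])
  qed
  have Sc: "continuous_on {0<..} (\<lambda>s. C3 * H' (T + s))" unfolding H'_def H_def
    using T' by (intro continuous_intros) auto
  \<comment> \<open>The sign \<open>\<sigma>\<close> treats u - W and W - u at once.\<close>
  have right: "\<sigma> * v (T + \<tau>) x - S \<tau> * \<phi> x \<le> 0" if \<tau>: "\<tau> > 0" and \<sigma>: "\<sigma> = 1 \<or> \<sigma> = -1" for \<tau> \<sigma> x
  proof -
    have s1: "((\<lambda>s :: real. \<sigma>) has_real_derivative 0) (at t)" for t by simp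
    have s2: "continuous_on {0<..} (\<lambda>s :: real. 0 :: real)" by (rule continuous_on_const)
    note PV = parabolic_diff[OF parabolic_scale[OF parabolic_shift[OF v_parabolic less_imp_le[OF T']] s1 s2] parabolic_scale[OF parabolic_const[OF \<phi>(1)] Sd Sc]]
    show ?thesis
    proof (rule global_comparison[OF PV K _ _ _ \<tau>])
      fix s x assume s: "s > 0" and V: "\<sigma> * v (T + s) x - S s * \<phi> x > 0"
      define t where "t = T + s"
      have t: "t > 0" "t \<ge> T" "t \<ge> T0" "t \<ge> 1" using s T' T by (auto simp: t_def)
      have va: "\<sigma> * v t x \<le> \<bar>v t x\<bar>" using \<sigma> by auto
      have \<xi>: "x $ k + c * t \<ge> \<xi>\<^sub>0"
      proof (rule ccontr)
        assume "\<not> ?thesis"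
        hence "\<bar>v t x\<bar> \<le> C2 * H (\<mu> c l) t" using left t by simp
        also have "\<dots> \<le> C2 * H m t" using Hm[of t] t C2 by (intro mult_left_mono) auto
        also have "\<dots> \<le> C3 * H m t * \<phi> x" using C3l t by simp
        finally show False using V va by (simp add: S_def t_def)
      qed
      have pb: "p x - \<delta> < u t x" "u t x \<le> p x"
      proof -
        have "2 * e * p x \<le> 2 * e * p1" using e p01(3)[of x] by (intro mult_left_mono) auto
        moreover have "(1 - 2 * e) * p x = p x - 2 * e * p x" by (simp add: left_diff_distrib)
        ultimately show "p x - \<delta> < u t x" using T0(2)[OF t(3) \<xi>] \<delta>(1) by linarith
        show "u t x \<le> p x" by (rule u_le_p[OF t(1)])
      qed
      have wb: "\<bar>W t x - p x\<bar> < \<delta>" using close(2)[OF \<xi>] by (simp add: W_def)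
      have Sp: "S s * \<phi> x \<ge> 0" using C3 Hp[of t m] t \<phi>(2) \<phi>(3)[of x] by (simp add: S_def t_def)
      have sv: "\<sigma> * v t x > 0" using V Sp by (simp add: t_def)
      define a where "a = f_u f x (p x) - \<mu>' / 4"
      have mv: "\<sigma> * (f x (u t x) - f x (W t x)) \<le> a * (\<sigma> * v t x)"
      proof (cases "\<sigma> = 1")
        case True
        hence lt: "W t x < u t x" using sv by (simp add: v_def)
        obtain z where z: "W t x < z" "z < u t x" "f x (u t x) - f x (W t x) = f_u f x z * (u t x - W t x)"
          using f_mean_value[OF f lt, of x] by blast
        have "f_u f x z \<le> a" unfolding a_def by (rule \<delta>(2)) (use z wb pb in linarith)
        from mult_right_mono[OF this, of "u t x - W t x"] lt z(3) True show ?thesis by (simp add: v_def)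
      next
        case False
        hence \<sigma>1: "\<sigma> = -1" using \<sigma> by simp
        hence lt: "u t x < W t x" using sv by (simp add: v_def)
        obtain z where z: "u t x < z" "z < W t x" "f x (W t x) - f x (u t x) = f_u f x z * (W t x - u t x)"
          using f_mean_value[OF f lt, of x] by blast
        have "f_u f x z \<le> a" unfolding a_def by (rule \<delta>(2)) (use z wb pb in linarith)
        from mult_right_mono[OF this, of "W t x - u t x"] lt z(3) \<sigma>1 show ?thesis by (simp add: v_def)
      qed
      define V where "V = \<sigma> * v t x - S s * \<phi> x"
      have aV: "a * V \<le> K * V" using Kq[of x] V unfolding a_def V_def t_def by (intro mult_right_mono) auto
      have "a * (\<sigma> * v t x) = a * V + S s * \<phi> x * a" by (simp add: V_def algebra_simps)
      \<comment> \<open>The budget of the rate: -\<mu>'/4 inside \<open>a\<close>, at most -\<mu>'/4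
        for n / (1 + t) and at most -\<mu>'/2 for \<open>m\<close> add up to at most
        -\<mu>'.\<close>
      moreover have "S s * \<phi> x * (a + (n / (1 + t) + m)) \<le> S s * \<phi> x * (f_u f x (p x) - \<mu>')"
        using nT[OF t(2)] m(3) Sp unfolding a_def by (intro mult_left_mono) linarith+
      moreover have "C3 * H' t * \<phi> x = - (S s * \<phi> x * (n / (1 + t) + m))"
        by (simp add: H'_def S_def t_def algebra_simps)
      moreover have "S s * ((\<mu>' - f_u f x (p x)) * \<phi> x) = - (S s * \<phi> x * (f_u f x (p x) - \<mu>'))" by (simp add: algebra_simps)
      ultimately have "\<sigma> * (f x (u t x) - f x (W t x)) - C3 * H' t * \<phi> x \<le> K * V - S s * ((\<mu>' - f_u f x (p x)) * \<phi> x)"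
        using mv aV unfolding distrib_left by simp
      moreover have "\<sigma> * v' t x = \<sigma> * Dv t x + \<sigma> * (f x (u t x) - f x (W t x))"
        unfolding v_equation[OF t(1), symmetric] by (simp add: right_diff_distrib)
      ultimately show "0 * v (T + s) x + \<sigma> * v' (T + s) x - (C3 * H' (T + s) * \<phi> x + S s * 0)
          \<le> \<sigma> * Dv (T + s) x - S s * ((\<mu>' - f_u f x (p x)) * \<phi> x) + K * (\<sigma> * v (T + s) x - S s * \<phi> x)"
        unfolding t_def[symmetric] V_def by simp
    next
      fix T2 :: real
      obtain B2 where B2: "B2 \<ge> 0" "\<And>t x. 0 \<le> t \<Longrightarrow> t \<le> T + T2 \<Longrightarrow> \<bar>v t x\<bar> \<le> B2" using v_bounded by blast
      have "\<sigma> * v (T + s) x - S s * \<phi> x \<le> B2" if "0 < s" "s \<le> T2" for s x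
      proof -
        have "0 \<le> S s * \<phi> x" using C3 Hp[of "T + s" m] T' that \<phi>(2) \<phi>(3)[of x] by (simp add: S_def)
        moreover have "\<sigma> * v (T + s) x \<le> \<bar>v (T + s) x\<bar>" using \<sigma> by auto
        ultimately show ?thesis using B2(2)[of "T + s" x] that T' by linarith
      qed
      thus "\<exists>B. \<forall>s x. 0 < s \<longrightarrow> s \<le> T2 \<longrightarrow> \<sigma> * v (T + s) x - S s * \<phi> x \<le> B" by blast
    next
      show "AE x in lborel. ((\<lambda>s. max 0 (\<sigma> * v (T + s) x - S s * \<phi> x)) \<longlongrightarrow> 0) (at_right 0)"
      proof (rule AE_I2, rule max_limit)
        fix x
        have Ts: "((\<lambda>s. T + s) \<longlongrightarrow> T) (at_right 0)" by (rule tendsto_eq_intros refl | simp)+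
        have "isCont (\<lambda>s. v s x) T" using v_parabolic T' by (auto simp: parabolic_def intro: DERIV_isCont)
        from isCont_tendsto_compose[OF this Ts] have "((\<lambda>s. v (T + s) x) \<longlongrightarrow> v T x) (at_right 0)" .
        moreover have "((\<lambda>s. H m (T + s)) \<longlongrightarrow> H m T) (at_right 0)" using Hd[of T] T' by (intro isCont_tendsto_compose[OF DERIV_isCont Ts]) auto
        ultimately show "((\<lambda>s. \<sigma> * v (T + s) x - S s * \<phi> x) \<longlongrightarrow> \<sigma> * v T x - C3 * H m T * \<phi> x) (at_right 0)"
          unfolding S_def by (intro tendsto_intros)
        have "\<sigma> * v T x \<le> \<bar>v T x\<bar>" using \<sigma> by auto
        thus "\<sigma> * v T x - C3 * H m T * \<phi> x \<le> 0" using B(2)[of T x] T' C3T[of x] by linarith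
      qed
    qed
  qed
  have right': "\<bar>v t x\<bar> \<le> C3 * \<phi>1 * H m t" if t: "t > T" for t x
  proof -
    have "\<bar>v t x\<bar> \<le> C3 * H m t * \<phi> x"
      using right[of "t - T" 1 x] right[of "t - T" "-1" x] t by (simp add: S_def)
    also have "\<dots> \<le> C3 * H m t * \<phi>1" using C3 Hp[of t m] t T' \<phi>(4) by (intro mult_left_mono) auto
    finally show ?thesis by (simp add: mult_ac)
  qed
  \<comment> \<open>The third summand covers times up to T, as \<open>H (\<mu> c l)\<close> is
    nonincreasing; the final 1 makes all inequalities strict.\<close>
  define C where "C = C2 + C3 * \<phi>1 + B / H (\<mu> c l) T + 1"
  have HT': "H (\<mu> c l) T > 0" using Hp T' by simp
  have \<phi>1: "\<phi>1 > 0" using \<phi>(2) \<phi>(3,4)[of 0] by linarith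
  have parts: "0 \<le> C3 * \<phi>1" "0 \<le> B / H (\<mu> c l) T" using C3 \<phi>1 B HT' by auto
  have C: "C > 0" "C2 < C" "C3 * \<phi>1 < C" "B / H (\<mu> c l) T < C" using C2 parts by (auto simp: C_def)
  have small: "\<bar>v t x\<bar> < C * H (\<mu> c l) t" if "0 \<le> t" "t \<le> T" for t x
  proof -
    have "\<bar>v t x\<bar> \<le> B / H (\<mu> c l) T * H (\<mu> c l) T" using B(2)[OF that, of x] HT' by simp
    also have "\<dots> \<le> B / H (\<mu> c l) T * H (\<mu> c l) t" using Ha[OF that] parts by (intro mult_left_mono) auto
    also have "\<dots> < C * H (\<mu> c l) t" using C(4) Hp[OF that(1)] by (intro mult_strict_right_mono) auto
    finally show ?thesis .
  qed
  have "(x $ k + c * t \<le> \<xi>\<^sub>0 \<longrightarrow> \<bar>v t x\<bar> < C * H (\<mu> c l) t) \<and> (x $ k + c * t \<ge> \<xi>\<^sub>0 \<longrightarrow> \<bar>v t x\<bar> < C * H m t)" if t: "t \<ge> 0" for t x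
  proof (cases "t \<le> T")
    case True
    have "C * H (\<mu> c l) t \<le> C * H m t" using Hm[OF t] C by (intro mult_left_mono) auto
    thus ?thesis using small[OF t True, of x] by linarith
  next
    case False
    hence "\<bar>v t x\<bar> \<le> C3 * \<phi>1 * H m t" using right' by simp
    also have "\<dots> < C * H m t" using C(3) Hp[OF t] by (intro mult_strict_right_mono) auto
    finally have r: "\<bar>v t x\<bar> < C * H m t" .
    have "C2 * H (\<mu> c l) t < C * H (\<mu> c l) t" using C(2) Hp[OF t] by (intro mult_strict_right_mono) auto
    thus ?thesis using r left[of t x] False T(2) by auto
  qed
  thus ?thesis using C(1) unfolding H_def m_def n_def mult.assoc by blast
qed

end

theorem theorem2p1:
  fixes L :: "real ^ 'n" and k :: 'n
    and A :: "real ^ 'n \<Rightarrow> real ^ 'n ^ 'n"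
    and f :: "real ^ 'n \<Rightarrow> real \<Rightarrow> real"
    and p :: "real ^ 'n \<Rightarrow> real"
    and w :: "real ^ 'n \<Rightarrow> real \<Rightarrow> real"
    and \<mu> :: "real \<Rightarrow> real \<Rightarrow> real"
    and \<alpha> \<mu>\<^sub>1 \<mu>bar\<^sub>1 cstar c l\<^sub>1 l\<^sub>2 l :: real
  assumes L_pos: "\<forall>i. L $ i > 0"
    and alpha: "0 < \<alpha>" "\<alpha> < 1"
    and A: "diffusion_matrix L \<alpha> A"
    and f: "reaction_term L \<alpha> f"
    and f_decreasing: "\<forall>x. strict_antimono_on {0<..} (\<lambda>s. f x s / s)"
    and f_nonpos: "\<exists>M>0. \<forall>x. \<forall>s\<ge>M. f x s \<le> 0"
    and mu1: "principal_eigenvalue L A (\<lambda>x. f_u f x 0) \<mu>\<^sub>1" "\<mu>\<^sub>1 > 0"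
    and p: "steady_state L \<alpha> A f p"
    and mubar1: "principal_eigenvalue L A (\<lambda>x. f_u f x (p x)) \<mu>bar\<^sub>1" "\<mu>bar\<^sub>1 < 0"
    and mu: "\<forall>c l. principal_eigenvalue_L L A f k c l (\<mu> c l)"
    and cstar: "minimal_speed \<mu> cstar"
    and c: "cstar \<le> c"
    and w: "traveling_wavefront L A f k p c w"
    and rates: "decay_rates \<mu> cstar c l\<^sub>1 l\<^sub>2"
    and l: "l \<in> {l\<^sub>1..l\<^sub>2}"
  shows "\<exists>\<epsilon>\<^sub>0>0. \<forall>\<epsilon>\<in>{0<..<\<epsilon>\<^sub>0}. \<forall>\<xi>\<^sub>0. (\<forall>\<xi>\<ge>\<xi>\<^sub>0. \<forall>x. \<bar>w x \<xi> - p x\<bar> < \<epsilon>) \<longrightarrow>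
    (\<forall>u\<^sub>0 u. finite {x. \<not> isCont u\<^sub>0 x} \<and> (\<forall>x. 0 \<le> u\<^sub>0 x \<and> u\<^sub>0 x \<le> p x) \<and>
       integrable lborel (\<lambda>x. weight l \<xi>\<^sub>0 (x $ k) * (u\<^sub>0 x - w x (x $ k))) \<and>
       solves_ivp A f u\<^sub>0 u \<longrightarrow>
       (\<exists>C>0. \<forall>t\<ge>0. \<forall>x.
          (x $ k + c * t \<le> \<xi>\<^sub>0 \<longrightarrow>
             \<bar>u t x - w x (x $ k + c * t)\<bar>
               < C * (1 + t) powr (- (real CARD('n) / 2)) * exp (- \<mu> c l * t)) \<and>
          (x $ k + c * t \<ge> \<xi>\<^sub>0 \<longrightarrow>
             \<bar>u t x - w x (x $ k + c * t)\<bar>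
               < C * (1 + t) powr (- (real CARD('n) / 2)) * exp (- min (\<mu> c l) (- \<mu>bar\<^sub>1 / 2) * t))))"
proof -
  interpret kpp_front L A \<alpha> f p k w c \<mu>\<^sub>1
    by unfold_locales (use L_pos A f f_decreasing mu1 p w in auto)
  have l0: "l > 0" "\<mu> c l \<ge> 0"
  proof -
    show "l > 0" using rates l by (auto simp: decay_rates_def)
    show "\<mu> c l \<ge> 0"
    \<comment> \<open>At the end points \<mu> is 0; strictly between them, which is possible only
      for c > cstar, it is positive.\<close>
    proof (cases "l = l\<^sub>1 \<or> l = l\<^sub>2")
      case False
      thus ?thesis using rates l by (auto simp: decay_rates_def less_le split: if_splits)
    qed (use rates in \<open>auto simp: decay_rates_def\<close>)
  qed
  obtain p0 p1 where p01: "p0 > 0" "\<And>x. p0 \<le> p x" "\<And>x. p x \<le> p1" using p_bounds by blast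
  have p1: "p1 > 0" using p01(1) p01(2)[of 0] p01(3)[of 0] by linarith
  obtain \<phi> D where \<phi>: "C1 \<phi>" "periodic L \<phi>" "\<And>x. \<phi> x > 0" "has_weak_divergence (\<lambda>x. A x *v grad \<phi> x) D"
      "\<And>x. D x + f_u f x (p x) * \<phi> x = \<mu>bar\<^sub>1 * \<phi> x"
    using mubar1(1) unfolding principal_eigenvalue_def by blast
  have "D = (\<lambda>x. (\<mu>bar\<^sub>1 - f_u f x (p x)) * \<phi> x)"
  proof
    show "D x = (\<mu>bar\<^sub>1 - f_u f x (p x)) * \<phi> x" for x using \<phi>(5)[of x] unfolding left_diff_distrib by linarith
  qed
  hence ws: "weak_sol A \<phi> (\<lambda>x. (\<mu>bar\<^sub>1 - f_u f x (p x)) * \<phi> x)" using \<phi>(1,4) by (simp add: weak_sol_def flux_def[abs_def])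
  obtain \<phi>0 where \<phi>0: "\<phi>0 > 0" "\<And>x. \<phi>0 \<le> \<phi> x" using periodic_positive[OF L_pos \<phi>(2) C1_continuous[OF \<phi>(1)] \<phi>(3)] by blast
  obtain \<phi>1 where "\<phi>1 > 0" "\<And>x. norm (\<phi> x) \<le> \<phi>1" using periodic_bounded[OF L_pos \<phi>(2) C1_continuous[OF \<phi>(1)]] by blast
  hence \<phi>1: "\<phi> x \<le> \<phi>1" for x by (auto intro: abs_le_D1)
  have "- \<mu>bar\<^sub>1 / 4 > 0" using mubar1(2) by simp
  then obtain \<delta> where \<delta>: "\<delta> > 0" "\<And>r s x. \<bar>s\<bar> \<le> p1 \<Longrightarrow> \<bar>r - s\<bar> < \<delta> \<Longrightarrow> \<bar>f_u f x r - f_u f x s\<bar> < - \<mu>bar\<^sub>1 / 4"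
    using f_u_uniform[OF f, of "- \<mu>bar\<^sub>1 / 4" p1] by blast
  have \<delta>': "f_u f x s \<le> f_u f x (p x) - \<mu>bar\<^sub>1 / 4" if "\<bar>s - p x\<bar> < \<delta>" for x s
    using \<delta>(2)[of "p x" s x] that p01(3)[of x] p_facts(3)[of x] by (auto simp: abs_less_iff)
  \<comment> \<open>Measures how close to p the solution must eventually be from below: u \<ge> (1 -
    2 e) p together with u \<le> p keeps u within \<delta> of p, because 2 e p1 < \<delta>.\<close>
  define e where "e = min (1 / 4) (\<delta> / (4 * p1))"
  have e: "0 < e" "e \<le> 1 / 4" "e \<le> \<delta> / (4 * p1)"
  proof -
    show "0 < e" using \<delta> p1 by (simp add: e_def)
    show "e \<le> 1 / 4" unfolding e_def by (rule min.cobounded1)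
    show "e \<le> \<delta> / (4 * p1)" unfolding e_def by (rule min.cobounded2)
  qed
  have e\<delta>: "2 * e * p1 < \<delta>" using e(3) p1 \<delta>(1) by (simp add: field_simps)
  \<comment> \<open>The first bound is what \<open>eventually_close\<close> demands of the front,
    the second keeps W where \<open>\<delta>'\<close> applies.\<close>
  define \<epsilon>\<^sub>0 where "\<epsilon>\<^sub>0 = min (e * p0 / 2) \<delta>"
  have \<epsilon>\<^sub>0: "\<epsilon>\<^sub>0 > 0" using e p01 \<delta> by (simp add: \<epsilon>\<^sub>0_def)
  show ?thesis
  proof (rule exI[of _ \<epsilon>\<^sub>0], intro conjI \<epsilon>\<^sub>0 ballI allI impI)
    fix \<epsilon> \<xi>\<^sub>0 u\<^sub>0 u
    assume \<epsilon>: "\<epsilon> \<in> {0<..<\<epsilon>\<^sub>0}" and near: "\<forall>\<xi>\<ge>\<xi>\<^sub>0. \<forall>x. \<bar>w x \<xi> - p x\<bar> < \<epsilon>"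
      and as: "finite {x. \<not> isCont u\<^sub>0 x} \<and> (\<forall>x. 0 \<le> u\<^sub>0 x \<and> u\<^sub>0 x \<le> p x) \<and>
       integrable lborel (\<lambda>x. weight l \<xi>\<^sub>0 (x $ k) * (u\<^sub>0 x - w x (x $ k))) \<and> solves_ivp A f u\<^sub>0 u"
    interpret kpp_cauchy L A \<alpha> f p k w c \<mu>\<^sub>1 u\<^sub>0 u by unfold_locales (use as in auto)
    have close: "\<bar>w x \<xi> - p x\<bar> \<le> e * p0 / 2" "\<bar>w x \<xi> - p x\<bar> < \<delta>" if "\<xi> \<ge> \<xi>\<^sub>0" for \<xi> x
    proof -
      have "\<bar>w x \<xi> - p x\<bar> < \<epsilon>" using near that by blast
      hence "\<bar>w x \<xi> - p x\<bar> < \<epsilon>\<^sub>0" using \<epsilon> by simp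
      thus "\<bar>w x \<xi> - p x\<bar> \<le> e * p0 / 2" "\<bar>w x \<xi> - p x\<bar> < \<delta>" by (auto simp: \<epsilon>\<^sub>0_def)
    qed
    have W0: "u\<^sub>0 x - w x (x $ k) = v\<^sub>0 x" for x by (simp add: v\<^sub>0_def W_def)
    have vw: "integrable lborel (\<lambda>x. weight l \<xi>\<^sub>0 (x $ k) * v\<^sub>0 x)" using as by (simp only: W0)
    \<comment> \<open>A weight of at least 1 makes u0 - w itself integrable, as
      \<open>decay_far\<close> and \<open>positive_continuity_point\<close> require; the weighted
      integral feeds \<open>decay_left\<close>.\<close>
    have w1: "weight l \<xi>\<^sub>0 s \<ge> 1" for s
    proof -
      have "0 \<le> - l * (s - \<xi>\<^sub>0)" if "s \<le> \<xi>\<^sub>0" using that l0(1) by (intro mult_nonpos_nonpos) auto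
      thus ?thesis unfolding weight_def by simp
    qed
    have [measurable]: "(\<lambda>x :: real ^ 'n. x $ k) \<in> borel_measurable borel" by (intro borel_measurable_continuous_onI continuous_intros)
    have mw: "(\<lambda>x :: real ^ 'n. weight l \<xi>\<^sub>0 (x $ k)) \<in> borel_measurable borel" unfolding weight_def by measurable
    have "(\<lambda>x. (weight l \<xi>\<^sub>0 (x $ k) * v\<^sub>0 x) / weight l \<xi>\<^sub>0 (x $ k)) \<in> borel_measurable borel"
      using borel_measurable_integrable[OF vw] mw by (intro borel_measurable_divide) auto
    moreover have "(weight l \<xi>\<^sub>0 (x $ k) * v\<^sub>0 x) / weight l \<xi>\<^sub>0 (x $ k) = v\<^sub>0 x" for x using w1[of "x $ k"] by simp
    ultimately have m0: "v\<^sub>0 \<in> borel_measurable borel" by simp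
    have "norm (v\<^sub>0 x) \<le> norm (weight l \<xi>\<^sub>0 (x $ k) * v\<^sub>0 x)" for x
    proof -
      have "1 * \<bar>v\<^sub>0 x\<bar> \<le> weight l \<xi>\<^sub>0 (x $ k) * \<bar>v\<^sub>0 x\<bar>" using w1[of "x $ k"] by (intro mult_right_mono) auto
      thus ?thesis using w1[of "x $ k"] by (simp add: abs_mult)
    qed
    hence v0: "integrable lborel v\<^sub>0" using m0 by (intro Bochner_Integration.integrable_bound[OF vw]) auto
    from front_stability[OF mu l0 vw m0 v0 e(1,2) p01 ws \<phi>0 \<phi>1 mubar1(2) e\<delta> \<delta>' close]
    show "\<exists>C>0. \<forall>t\<ge>0. \<forall>x.
          (x $ k + c * t \<le> \<xi>\<^sub>0 \<longrightarrow>
             \<bar>u t x - w x (x $ k + c * t)\<bar>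
               < C * (1 + t) powr (- (real CARD('n) / 2)) * exp (- \<mu> c l * t)) \<and>
          (x $ k + c * t \<ge> \<xi>\<^sub>0 \<longrightarrow>
             \<bar>u t x - w x (x $ k + c * t)\<bar>
               < C * (1 + t) powr (- (real CARD('n) / 2)) * exp (- min (\<mu> c l) (- \<mu>bar\<^sub>1 / 2) * t))"
      unfolding v_def W_def by blast
  qed
qed

end
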